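(* Let $0\le\beta<d-1$, $\delta\in(0,\underline\delta_0)$, and let $q,\lambda,\rho$ be as in the context. Suppose that $u\in\mathfrak W^{\beta,2}[\delta;q](\Omega)$ satisfies $$\mathcal B_\delta(u,v)=\int_\Omega G_\delta[u](x)\,v(x)\,dx\qquad\forall v\in C_c^\infty(\Omega),$$ with a given $G_\delta[u]=G_\delta[u](x)\in W^{1,2}_{loc}(\Omega)$. Then $\mathcal L_\delta u(x)=G_\delta[u](x)$ almost everywhere in $\Omega$, i.e. $$u(x)=J_{\delta,\beta}u(x)+\frac{G_\delta[u](x)}{P_{\delta,\beta}(x)}\quad\text{for almost every }x\in\Omega,$$ and there exists a constant $C$ depending only on $d,\beta,\rho,p,\lambda,q,\kappa_1$ (with $p=2$) such that $$\|\nabla u\|_{L^2(\Omega)}\le C\Big([u]_{\mathfrak W^{\beta,2}[\delta;q](\Omega)}+\|\eta_\delta G_\delta[u]\|_{L^2(\Omega)}+\|\eta_\delta^2\nabla G_\delta[u]\|_{L^2(\Omega)}\Big).$$ Consequently, $u\in W^{1,2}(\Omega)$ whenever the right-hand side of this estimate is finite.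
   Context: Setting. $\Omega\subset\mathbb R^d$ is a bounded connected open set with Lipschitz boundary; $\boldsymbol\nu$ outward unit normal, $\sigma$ surface measure, $\mathcal H^{d-1}$ Hausdorff measure. $q:[0,\infty)\to[0,\infty)$ is $C^k$ for some $k\ge2$ (possibly $\infty$), $q(0)=0$, $0<q(r)\le r$ for $r>0$; $0\le q'\le1$, $q'>0$ on $(0,c_q]$ for some $c_q>0$; $q(2r)\le C_qq(r)$ for all $r>0$ with some $C_q\ge1$; and there is $N\in\{1,\dots,k-1\}$ with $q^{(j)}(0)=0$ for $0\le j\le N-1$, $q^{(N)}(0)>0$, $0\le q^{(N)}\le1$, $q^{(N)}\in C^1_b([0,\infty))$. $\lambda:\overline\Omega\to[0,\infty)$ satisfies $\kappa_0^{-1}\mathrm{dist}(x,\partial\Omega)\le\lambda(x)\le\kappa_0\mathrm{dist}(x,\partial\Omega)$ ($\kappa_0\ge1$), $|\lambda(x)-\lambda(y)|\le\kappa_1|x-y|$, $\lambda\in C^0(\overline\Omega)\cap C^{k}(\Omega)$ for some $k\in\mathbb N_0\cup\{\infty\}$, $|D^\alpha\lambda(x)|\le\kappa_\alpha\mathrm{dist}(x,\partial\Omega)^{1-|\alpha|}$ for $|\alpha|\le k$; and there is $N_0\subset\partial\Omega$ with $\mathcal H^{d-1}(N_0)=0$ such that for $x\in\partial\Omega\setminus N_0$ and $z$ with $\boldsymbol\nu(x)\cdot z<0$: $\lim_{t\to0^+}\lambda(x+tz)/t=-\boldsymbol\nu(x)\cdot z$. Put $\eta=q(\lambda)$, $\eta_\delta=\delta\eta$;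 assume $\eta\in W^{2,\infty}(\Omega)$. $\underline\delta_0=\frac1{3\max\{1,\kappa_1,C_q\kappa_0^{\log_2C_q}\}}$. $\rho:\mathbb R\to[0,\infty)$ is even, $C^1$, $[-c_\rho,c_\rho]\subset\operatorname{supp}\rho\Subset(-1,1)$ for some $c_\rho>0$, $\int_{B(0,1)}|z|^{2-\beta}\rho(|z|)dz=\overline C_{d,2}$, $\overline C_{d,2}=\frac{\sqrt\pi\,\Gamma((d+2)/2)}{\Gamma(3/2)\Gamma(d/2)}=d$. $\mathfrak W^{\beta,2}[\delta;q](\Omega)$: all $u\in L^2(\Omega)$ with $[u]^2_{\mathfrak W^{\beta,2}[\delta;q](\Omega)}=\int_\Omega\int_\Omega\mathbf 1_{\{|y-x|<\delta q(\mathrm{dist}(x,\partial\Omega))\}}\frac{C_{d,\beta,2}|u(x)-u(y)|^2}{|x-y|^\beta(\delta q(\mathrm{dist}(x,\partial\Omega)))^{d+2-\beta}}dy\,dx<\infty$, $C_{d,\beta,2}=\overline C_{d,2}\frac{d+2-\beta}{\sigma(\mathbb S^{d-1})}$. $\mathcal B_\delta(u,v)=\int_\Omega\int_\Omega\frac{\rho(|y-x|/\eta_\delta(x))}{\eta_\delta(x)^{d+2-\beta}}\frac{(u(x)-u(y))(v(x)-v(y))}{|x-y|^\beta}dy\,dx$. Put $\rho_{\delta,\beta}(x,y)=\frac1{\eta_\delta(x)^d}\rho\big(\frac{|y-x|}{\eta_\delta(x)}\big)\big(\frac{|y-x|}{\eta_\delta(x)}\big)^{-\beta}$ and $k(x,y)=\frac{\rho_{\delta,\beta}(x,y)}{\eta_\delta(x)^2}+\frac{\rho_{\delta,\beta}(y,x)}{\eta_\delta(y)^2}$.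 Then $\mathcal L_\delta u(x)=\int_\Omega k(x,y)(u(x)-u(y))dy$ (absolutely convergent), $P_{\delta,\beta}(x)=\int_\Omega k(x,y)dy$, $J_{\delta,\beta}u(x)=\frac1{P_{\delta,\beta}(x)}\int_\Omega k(x,y)u(y)dy$. *)

theory Defs
  imports "HOL-Analysis.Analysis" "HOL-Library.Extended_Nat"
begin

section \<open>Hausdorff measure\<close>

text \<open>The factor is the one of the volume of the \<open>s\<close>-dimensional ball, so that for
  \<open>s = d - 1\<close> the measure is the surface measure on Lipschitz hypersurfaces.
  Boundedness of the covering sets is required because \<^const>\<open>diameter\<close> is only
  meaningful for bounded sets.\<close>

definition hausdorff_measure :: "real \<Rightarrow> 'a::metric_space set \<Rightarrow> ennreal" where
  "hausdorff_measure s A =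
    (SUP r\<in>{0::real<..}.
      INF E\<in>{E :: nat \<Rightarrow> 'a set. A \<subseteq> (\<Union>i. E i) \<and> (\<forall>i. bounded (E i) \<and> diameter (E i) \<le> r)}.
        (\<Sum>i. ennreal (unit_ball_vol s * (diameter (E i) / 2) powr s)))"

text \<open>\<open>\<sigma>(S\<^sup>d\<^sup>-\<^sup>1)\<close>, with \<open>d\<close> the dimension of \<^typ>\<open>'a\<close>.\<close>

definition sphere_area :: "'a::euclidean_space itself \<Rightarrow> real" where
  "sphere_area _ = enn2real (hausdorff_measure (real DIM('a) - 1) (sphere (0::'a) 1))"


section \<open>Lipschitz domains\<close>

text \<open>Inside the ball around \<open>x\<close> the set \<open>\<Omega>\<close> is the strict epigraph, in direction \<open>e\<close>, of a
  Lipschitz function \<open>\<phi>\<close> on the hyperplane orthogonal to \<open>e\<close>.\<close>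

definition lipschitz_graph_at ::
  "'a::euclidean_space set \<Rightarrow> 'a \<Rightarrow> real \<Rightarrow> 'a \<Rightarrow> ('a \<Rightarrow> real) \<Rightarrow> bool" where
  "lipschitz_graph_at \<Omega> x r e \<phi> \<longleftrightarrow>
     0 < r \<and> norm e = 1 \<and> (\<exists>L. L-lipschitz_on {y. y \<bullet> e = 0} \<phi>) \<and>
     (\<forall>y\<in>ball x r. y \<in> \<Omega> \<longleftrightarrow> \<phi> (y - (y \<bullet> e) *\<^sub>R e) < y \<bullet> e)"

definition lipschitz_domain :: "'a::euclidean_space set \<Rightarrow> bool" where
  "lipschitz_domain \<Omega> \<longleftrightarrow> open \<Omega> \<and> connected \<Omega> \<and> bounded \<Omega> \<and>
     (\<forall>x\<in>frontier \<Omega>. \<exists>r e \<phi>. lipschitz_graph_at \<Omega> x r e \<phi>)"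

text \<open>\<open>n\<close> is the outward unit normal at the boundary point \<open>x\<close>: near \<open>x\<close> the set \<open>\<Omega>\<close> is
  \<open>{y. \<Phi> y < 0}\<close> with \<open>\<Phi> y = \<phi> (y - (y \<bullet> e) e) - y \<bullet> e\<close>, and \<open>n = \<nabla>\<Phi>(x) / |\<nabla>\<Phi>(x)|\<close>.
  It exists only where the local graph is differentiable.  The gradient \<open>g\<close> is never zero,
  because \<open>g \<bullet> e = -1\<close>.\<close>

definition outward_unit_normal :: "'a::euclidean_space set \<Rightarrow> 'a \<Rightarrow> 'a \<Rightarrow> bool" where
  "outward_unit_normal \<Omega> x n \<longleftrightarrow> x \<in> frontier \<Omega> \<and>
     (\<exists>r e \<phi> g. lipschitz_graph_at \<Omega> x r e \<phi> \<and>
        ((\<lambda>y. \<phi> (y - (y \<bullet> e) *\<^sub>R e) - y \<bullet> e) has_derivative (\<lambda>h. g \<bullet> h)) (at x) \<and>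
        n = g /\<^sub>R norm g)"


section \<open>Classical derivatives\<close>

text \<open>A multi-index is represented by a list \<open>bs\<close> of basis vectors, and \<open>|\<alpha>|\<close> is its length.\<close>

primrec iter_partial :: "'a::euclidean_space list \<Rightarrow> ('a \<Rightarrow> real) \<Rightarrow> 'a \<Rightarrow> real" where
  "iter_partial [] f = f"
| "iter_partial (b # bs) f = (\<lambda>x. frechet_derivative (iter_partial bs f) (at x) b)"

definition Ck_on :: "enat \<Rightarrow> 'a::euclidean_space set \<Rightarrow> ('a \<Rightarrow> real) \<Rightarrow> bool" where
  "Ck_on k S f \<longleftrightarrow> open S \<and> (\<forall>bs\<in>lists Basis.
     (enat (length bs) \<le> k \<longrightarrow> continuous_on S (iter_partial bs f)) \<and>
     (enat (length bs) < k \<longrightarrow> iter_partial bs f differentiable_on S))"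

text \<open>Functions in \<open>C\<^sub>c\<^sup>\<infinity>(\<Omega>)\<close>, extended by zero to the whole space.\<close>

definition test_fun :: "'a::euclidean_space set \<Rightarrow> ('a \<Rightarrow> real) \<Rightarrow> bool" where
  "test_fun \<Omega> v \<longleftrightarrow> Ck_on \<infinity> UNIV v \<and> compact (closure {x. v x \<noteq> 0}) \<and> closure {x. v x \<noteq> 0} \<subseteq> \<Omega>"

text \<open>\<open>q \<in> C\<^sup>k([0,\<infinity>))\<close> with derivatives \<open>D j = q\<^sup>(\<^sup>j\<^sup>)\<close>, one-sided at \<open>0\<close>.  The values at negative
  arguments are irrelevant.\<close>

definition Ck_halfline :: "enat \<Rightarrow> (real \<Rightarrow> real) \<Rightarrow> (nat \<Rightarrow> real \<Rightarrow> real) \<Rightarrow> bool" where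
  "Ck_halfline k q D \<longleftrightarrow>
     (\<forall>r\<ge>0. D 0 r = q r) \<and>
     (\<forall>j. enat j \<le> k \<longrightarrow> continuous_on {0..} (D j)) \<and>
     (\<forall>j. enat j < k \<longrightarrow> (\<forall>r\<ge>0. (D j has_real_derivative D (Suc j) r) (at r within {0..})))"


section \<open>Lebesgue and Sobolev spaces\<close>

definition ennsqrt :: "ennreal \<Rightarrow> ennreal" where
  "ennsqrt a = (if a = \<infinity> then \<infinity> else ennreal (sqrt (enn2real a)))"

definition L2_norm :: "'a::euclidean_space set \<Rightarrow> ('a \<Rightarrow> 'b::euclidean_space) \<Rightarrow> ennreal" where
  "L2_norm \<Omega> f = ennsqrt (\<integral>\<^sup>+x. ennreal ((norm (f x))\<^sup>2) \<partial>(lebesgue_on \<Omega>))"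

definition L2_on :: "'a::euclidean_space set \<Rightarrow> ('a \<Rightarrow> 'b::euclidean_space) \<Rightarrow> bool" where
  "L2_on \<Omega> f \<longleftrightarrow> f \<in> borel_measurable (lebesgue_on \<Omega>) \<and> L2_norm \<Omega> f < \<infinity>"

definition L2_loc :: "'a::euclidean_space set \<Rightarrow> ('a \<Rightarrow> 'b::euclidean_space) \<Rightarrow> bool" where
  "L2_loc \<Omega> f \<longleftrightarrow> (\<forall>K. compact K \<and> K \<subseteq> \<Omega> \<longrightarrow> L2_on K f)"

definition L1_loc :: "'a::euclidean_space set \<Rightarrow> ('a \<Rightarrow> 'b::euclidean_space) \<Rightarrow> bool" where
  "L1_loc \<Omega> f \<longleftrightarrow> (\<forall>K. compact K \<and> K \<subseteq> \<Omega> \<longrightarrow> integrable (lebesgue_on K) f)"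

definition Linf_on :: "'a::euclidean_space set \<Rightarrow> ('a \<Rightarrow> real) \<Rightarrow> bool" where
  "Linf_on \<Omega> f \<longleftrightarrow> f \<in> borel_measurable (lebesgue_on \<Omega>) \<and>
     (\<exists>M. AE x in lebesgue_on \<Omega>. \<bar>f x\<bar> \<le> M)"

definition weak_partial ::
  "'a::euclidean_space set \<Rightarrow> 'a list \<Rightarrow> ('a \<Rightarrow> real) \<Rightarrow> ('a \<Rightarrow> real) \<Rightarrow> bool" where
  "weak_partial \<Omega> bs f g \<longleftrightarrow> L1_loc \<Omega> f \<and> L1_loc \<Omega> g \<and>
     (\<forall>v. test_fun \<Omega> v \<longrightarrow>
        (\<integral>x. f x * iter_partial bs v x \<partial>(lebesgue_on \<Omega>)) =
        (-1) ^ length bs * (\<integral>x. g x * v x \<partial>(lebesgue_on \<Omega>)))"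

definition is_weak_grad :: "'a::euclidean_space set \<Rightarrow> ('a \<Rightarrow> real) \<Rightarrow> ('a \<Rightarrow> 'a) \<Rightarrow> bool" where
  "is_weak_grad \<Omega> f g \<longleftrightarrow> (\<forall>b\<in>Basis. weak_partial \<Omega> [b] f (\<lambda>x. g x \<bullet> b))"

definition weak_grad :: "'a::euclidean_space set \<Rightarrow> ('a \<Rightarrow> real) \<Rightarrow> 'a \<Rightarrow> 'a" where
  "weak_grad \<Omega> f = (SOME g. is_weak_grad \<Omega> f g)"

text \<open>\<open>\<parallel>w \<nabla>f\<parallel>\<close> in \<open>L\<^sup>2(\<Omega>)\<close> for a weight \<open>w\<close>.  It is infinite if the distributional gradient of
  \<open>f\<close> is not a locally integrable function.\<close>

definition L2_norm_grad :: "'a::euclidean_space set \<Rightarrow> ('a \<Rightarrow> real) \<Rightarrow> ('a \<Rightarrow> real) \<Rightarrow> ennreal" where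
  "L2_norm_grad \<Omega> w f =
     (if \<exists>g. is_weak_grad \<Omega> f g then L2_norm \<Omega> (\<lambda>x. w x *\<^sub>R weak_grad \<Omega> f x) else \<infinity>)"

definition W12 :: "'a::euclidean_space set \<Rightarrow> ('a \<Rightarrow> real) \<Rightarrow> bool" where
  "W12 \<Omega> f \<longleftrightarrow> L2_on \<Omega> f \<and> (\<exists>g. is_weak_grad \<Omega> f g \<and> L2_on \<Omega> g)"

definition W12_loc :: "'a::euclidean_space set \<Rightarrow> ('a \<Rightarrow> real) \<Rightarrow> bool" where
  "W12_loc \<Omega> f \<longleftrightarrow> L2_loc \<Omega> f \<and> (\<exists>g. is_weak_grad \<Omega> f g \<and> L2_loc \<Omega> g)"

definition W2inf :: "'a::euclidean_space set \<Rightarrow> ('a \<Rightarrow> real) \<Rightarrow> bool" where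
  "W2inf \<Omega> f \<longleftrightarrow> Linf_on \<Omega> f \<and>
     (\<forall>bs\<in>lists Basis. length bs \<le> 2 \<longrightarrow> (\<exists>g. weak_partial \<Omega> bs f g \<and> Linf_on \<Omega> g))"


section \<open>The functions \<open>q\<close>, \<open>\<lambda>\<close> and \<open>\<rho>\<close>\<close>

definition admissible_q :: "enat \<Rightarrow> real \<Rightarrow> real \<Rightarrow> nat \<Rightarrow> (real \<Rightarrow> real) \<Rightarrow> bool" where
  "admissible_q k cq Cq N q \<longleftrightarrow>
     2 \<le> k \<and> 0 < cq \<and> 1 \<le> Cq \<and> 1 \<le> N \<and> enat N < k \<and>
     q 0 = 0 \<and> (\<forall>r>0. 0 < q r \<and> q r \<le> r) \<and> (\<forall>r>0. q (2 * r) \<le> Cq * q r) \<and>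
     (\<exists>D. Ck_halfline k q D \<and>
        (\<forall>r\<ge>0. 0 \<le> D 1 r \<and> D 1 r \<le> 1) \<and> (\<forall>r\<in>{0<..cq}. 0 < D 1 r) \<and>
        (\<forall>j<N. D j 0 = 0) \<and> 0 < D N 0 \<and>
        (\<forall>r\<ge>0. 0 \<le> D N r \<and> D N r \<le> 1) \<and>
        bounded (D (Suc N) ` {0..}))"

text \<open>Only the values of \<open>lam\<close> on the closure of \<open>\<Omega>\<close> matter.\<close>

definition generalized_distance ::
  "'a::euclidean_space set \<Rightarrow> enat \<Rightarrow> real \<Rightarrow> real \<Rightarrow> ('a \<Rightarrow> real) \<Rightarrow> bool" where
  "generalized_distance \<Omega> k \<kappa>0 \<kappa>1 lam \<longleftrightarrow>
     1 \<le> \<kappa>0 \<and>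
     (\<forall>x\<in>closure \<Omega>. 0 \<le> lam x \<and>
        infdist x (frontier \<Omega>) / \<kappa>0 \<le> lam x \<and> lam x \<le> \<kappa>0 * infdist x (frontier \<Omega>)) \<and>
     \<kappa>1-lipschitz_on (closure \<Omega>) lam \<and>
     continuous_on (closure \<Omega>) lam \<and> Ck_on k \<Omega> lam \<and>
     (\<forall>bs\<in>lists Basis. enat (length bs) \<le> k \<longrightarrow>
        (\<exists>\<kappa>. \<forall>x\<in>\<Omega>. \<bar>iter_partial bs lam x\<bar> \<le>
           \<kappa> * infdist x (frontier \<Omega>) powr (1 - real (length bs)))) \<and>
     (\<exists>N0\<subseteq>frontier \<Omega>. hausdorff_measure (real DIM('a) - 1) N0 = 0 \<and>
        (\<forall>x\<in>frontier \<Omega> - N0. \<exists>\<nu>. outward_unit_normal \<Omega> x \<nu> \<and>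
           (\<forall>z. \<nu> \<bullet> z < 0 \<longrightarrow> ((\<lambda>t. lam (x + t *\<^sub>R z) / t) \<longlongrightarrow> - (\<nu> \<bullet> z)) (at_right 0))))"

definition delta0 :: "real \<Rightarrow> real \<Rightarrow> real \<Rightarrow> real" where
  "delta0 \<kappa>0 \<kappa>1 Cq = 1 / (3 * max 1 (max \<kappa>1 (Cq * \<kappa>0 powr log 2 Cq)))"

definition Cbar :: "real \<Rightarrow> real" where
  "Cbar d = sqrt pi * Gamma ((d + 2) / 2) / (Gamma (3 / 2) * Gamma (d / 2))"

definition admissible_rho :: "'a::euclidean_space itself \<Rightarrow> real \<Rightarrow> (real \<Rightarrow> real) \<Rightarrow> bool" where
  "admissible_rho _ \<beta> \<rho> \<longleftrightarrow>
     (\<forall>r. 0 \<le> \<rho> r) \<and> (\<forall>r. \<rho> (- r) = \<rho> r) \<and> \<rho> C1_differentiable_on UNIV \<and>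
     (\<exists>c>0. {-c..c} \<subseteq> closure {r. \<rho> r \<noteq> 0}) \<and> closure {r. \<rho> r \<noteq> 0} \<subseteq> {-1<..<1} \<and>
     (\<integral>z. norm z powr (2 - \<beta>) * \<rho> (norm z) \<partial>(lebesgue_on (ball (0::'a) 1))) = Cbar (real DIM('a))"


section \<open>The nonlocal space, form and operators\<close>

definition nl_seminorm ::
  "real \<Rightarrow> real \<Rightarrow> (real \<Rightarrow> real) \<Rightarrow> 'a::euclidean_space set \<Rightarrow> ('a \<Rightarrow> real) \<Rightarrow> ennreal" where
  "nl_seminorm \<beta> \<delta> q \<Omega> u =
     (let d = real DIM('a);
          C = Cbar d * (d + 2 - \<beta>) / sphere_area TYPE('a);
          h = (\<lambda>x. \<delta> * q (infdist x (frontier \<Omega>)))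
      in ennsqrt (\<integral>\<^sup>+x. (\<integral>\<^sup>+y.
           ennreal (if norm (y - x) < h x
             then C * \<bar>u x - u y\<bar>\<^sup>2 / (norm (x - y) powr \<beta> * h x powr (d + 2 - \<beta>)) else 0)
         \<partial>(lebesgue_on \<Omega>)) \<partial>(lebesgue_on \<Omega>)))"

definition nl_space ::
  "real \<Rightarrow> real \<Rightarrow> (real \<Rightarrow> real) \<Rightarrow> 'a::euclidean_space set \<Rightarrow> ('a \<Rightarrow> real) \<Rightarrow> bool" where
  "nl_space \<beta> \<delta> q \<Omega> u \<longleftrightarrow> L2_on \<Omega> u \<and> nl_seminorm \<beta> \<delta> q \<Omega> u < \<infinity>"

text \<open>Below, \<open>h\<close> is the horizon function \<open>\<eta>\<^sub>\<delta>\<close>.\<close>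

definition nl_form ::
  "real \<Rightarrow> (real \<Rightarrow> real) \<Rightarrow> 'a::euclidean_space set \<Rightarrow> ('a \<Rightarrow> real) \<Rightarrow> ('a \<Rightarrow> real) \<Rightarrow> ('a \<Rightarrow> real) \<Rightarrow> real" where
  "nl_form \<beta> \<rho> \<Omega> h u v =
     (\<integral>x. (\<integral>y. \<rho> (norm (y - x) / h x) / h x powr (real DIM('a) + 2 - \<beta>) *
        ((u x - u y) * (v x - v y) / norm (x - y) powr \<beta>) \<partial>(lebesgue_on \<Omega>)) \<partial>(lebesgue_on \<Omega>))"

definition rho_ker ::
  "real \<Rightarrow> (real \<Rightarrow> real) \<Rightarrow> ('a::euclidean_space \<Rightarrow> real) \<Rightarrow> 'a \<Rightarrow> 'a \<Rightarrow> real" where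
  "rho_ker \<beta> \<rho> h x y =
     1 / h x ^ DIM('a) * \<rho> (norm (y - x) / h x) * (norm (y - x) / h x) powr (- \<beta>)"

definition sym_ker ::
  "real \<Rightarrow> (real \<Rightarrow> real) \<Rightarrow> ('a::euclidean_space \<Rightarrow> real) \<Rightarrow> 'a \<Rightarrow> 'a \<Rightarrow> real" where
  "sym_ker \<beta> \<rho> h x y = rho_ker \<beta> \<rho> h x y / (h x)\<^sup>2 + rho_ker \<beta> \<rho> h y x / (h y)\<^sup>2"

definition nl_op ::
  "real \<Rightarrow> (real \<Rightarrow> real) \<Rightarrow> 'a::euclidean_space set \<Rightarrow> ('a \<Rightarrow> real) \<Rightarrow> ('a \<Rightarrow> real) \<Rightarrow> 'a \<Rightarrow> real" where
  "nl_op \<beta> \<rho> \<Omega> h u x = (\<integral>y. sym_ker \<beta> \<rho> h x y * (u x - u y) \<partial>(lebesgue_on \<Omega>))"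

definition nl_P ::
  "real \<Rightarrow> (real \<Rightarrow> real) \<Rightarrow> 'a::euclidean_space set \<Rightarrow> ('a \<Rightarrow> real) \<Rightarrow> 'a \<Rightarrow> real" where
  "nl_P \<beta> \<rho> \<Omega> h x = (\<integral>y. sym_ker \<beta> \<rho> h x y \<partial>(lebesgue_on \<Omega>))"

definition nl_J ::
  "real \<Rightarrow> (real \<Rightarrow> real) \<Rightarrow> 'a::euclidean_space set \<Rightarrow> ('a \<Rightarrow> real) \<Rightarrow> ('a \<Rightarrow> real) \<Rightarrow> 'a \<Rightarrow> real" where
  "nl_J \<beta> \<rho> \<Omega> h u x =
     1 / nl_P \<beta> \<rho> \<Omega> h x * (\<integral>y. sym_ker \<beta> \<rho> h x y * u y \<partial>(lebesgue_on \<Omega>))"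

end

theory Submission
  imports Defs
begin

text \<open>The horizon \<open>h = \<delta> q(\<lambda>)\<close> is \<open>C\<^sup>1\<close> in \<open>\<Omega>\<close> with Lipschitz constant at most \<open>1/3\<close>, and the balls of
  radius \<open>3 h(x)\<close> around \<open>x\<close> stay inside \<open>\<Omega>\<close>.  By the symmetry of the kernel \<open>k\<close> and the fundamental
  lemma, the weak equation says \<open>P u = G + \<integral>k(x, y) u(y) dy\<close> almost everywhere, where \<open>P\<close> is \<open>C\<^sup>1\<close>
  and \<open>P \<ge> c h\<^sup>-\<^sup>2\<close>.  Differentiating in \<open>x\<close>, in the weak sense, gives
  \<open>P \<nabla>u = \<nabla>G + \<integral>\<nabla>\<^sub>xk(x, y) (u(y) - u(x)) dy\<close>.  The singularity of \<open>\<nabla>\<^sub>xk\<close> is of order \<open>\<beta> + 1 < d\<close>, so the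
  Cauchy-Schwarz inequality bounds \<open>\<parallel>\<nabla>u\<parallel>\<^sup>2\<close> by \<open>\<parallel>h\<^sup>2 \<nabla>G\<parallel>\<^sup>2\<close> and the nonlocal energy of \<open>u\<close> whose weight
  has this singularity.  Passing from \<open>x\<close> to \<open>y\<close> through points near the midpoint bounds that energy by
  the one without singularity and with a smaller horizon.  The same step, iterated, changes the
  horizon by a constant factor, and hence replaces \<open>q(\<lambda>)\<close> by \<open>q(dist(x, \<partial>\<Omega>))\<close>.  The constants see the
  horizon only through its Lipschitz constant.\<close>

section \<open>Smooth test functions\<close>

text \<open>The constant is free of \<delta> because all powers of the horizon cancel. The gradient
  of k is at most C S / h, where the symmetric weight S has the singularity \<beta> + 1 and an
  integral over y of at most C / h^2. Cauchy-Schwarz then yields C / h^4, and the division by P,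
  squared, yields h^4 / c^2; what remains is the energy with the weight S. The increment u(y) - u(x)
  appears because \<nabla>P is the integral of \<nabla>k in y, so that the term u \<nabla>P is
  absorbed. The obstacle is regularity. Since u is only square integrable, every derivative has to
  fall on k, on P or on a test function. The smoothness order of \<lambda> may be 0, so
  differentiability of h has to be extracted from the bounded weak second derivatives of
  q(\<lambda>). The test function v / P is then merely C^1, while weak derivatives are defined by
  smooth test functions; mollification closes this gap. Finally k is singular on the diagonal, and
  integrating it by parts requires a regularisation whose gradient is still bounded by an integrable
  kernel of order \<beta> + 1.\<close>

lemma has_derivative_integral:
  fixes f D :: "'a::euclidean_space \<Rightarrow> 'b \<Rightarrow> _"
  assumes r: "0 < r"
    and der: "\<And>x y. x \<in> ball x0 r \<Longrightarrow> y \<in> space N \<Longrightarrow>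
      ((\<lambda>x. f x y) has_derivative (\<lambda>h. D x y \<bullet> h)) (at x)"
    and int: "\<And>x. x \<in> ball x0 r \<Longrightarrow> integrable N (f x)"
    and meas: "D x0 \<in> borel_measurable N"
    and bound: "\<And>x y. x \<in> ball x0 r \<Longrightarrow> y \<in> space N \<Longrightarrow> norm (D x y) \<le> g y"
    and g: "integrable N g"
  shows "((\<lambda>x. \<integral>y. f x y \<partial>N) has_derivative (\<lambda>h. (\<integral>y. D x0 y \<partial>N) \<bullet> h)) (at x0)"
    and "integrable N (D x0)"
proof -
  have x0: "x0 \<in> ball x0 r" using r by simp
  show iD: "integrable N (D x0)"
    by (rule Bochner_Integration.integrable_bound[OF g meas])
      (use bound[OF x0] in \<open>auto intro!: AE_I2 intro: order_trans[OF _ abs_ge_self]\<close>)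
  have lip: "\<bar>f x y - f x0 y\<bar> \<le> g y * norm (x - x0)" if "x \<in> ball x0 r" "y \<in> space N" for x y
  proof -
    have "norm (f x y - f x0 y) \<le> g y * norm (x - x0)"
    proof (rule differentiable_bound[where S="ball x0 r" and f="\<lambda>x. f x y" and f'="\<lambda>x h. D x y \<bullet> h"])
      fix z assume z: "z \<in> ball x0 r"
      show "((\<lambda>x. f x y) has_derivative (\<bullet>) (D z y)) (at z within ball x0 r)"
        using der[OF z that(2)] by (rule has_derivative_at_withinI)
      show "onorm ((\<bullet>) (D z y)) \<le> g y"
      proof (rule onorm_le)
        fix h
        have "norm (D z y \<bullet> h) \<le> norm (D z y) * norm h" by (simp add: Cauchy_Schwarz_ineq2)
        also have "\<dots> \<le> g y * norm h"
          using bound[OF z that(2)] by (intro mult_right_mono) auto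
        finally show "norm (D z y \<bullet> h) \<le> g y * norm h" .
      qed
    qed (use that r in auto)
    then show ?thesis by simp
  qed
  have "((\<lambda>x. (1 / norm (x - x0)) *\<^sub>R ((\<integral>y. f x y \<partial>N) - ((\<integral>y. f x0 y \<partial>N) + (\<integral>y. D x0 y \<partial>N) \<bullet> (x - x0))))
        \<longlongrightarrow> 0) (at x0)"
    unfolding tendsto_at_iff_sequentially
  proof (intro allI impI)
    fix X assume X: "\<forall>i. X i \<in> UNIV - {x0}" and lim: "X \<longlonglongrightarrow> x0"
    have "\<forall>\<^sub>F i in sequentially. X i \<in> ball x0 r"
      by (rule topological_tendstoD[OF lim open_ball x0])
    then obtain n where n: "\<And>i. i \<ge> n \<Longrightarrow> X i \<in> ball x0 r"
      by (auto simp: eventually_sequentially)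
    \<comment> \<open>The normalised first-order remainder along the sequence, shifted by
      \<open>n\<close> so that all points lie in the ball. The mean value bound \<open>lip\<close>
      and the bound on \<open>D\<close> dominate it by \<open>2 * g y\<close>, and dominated
      convergence is a statement about sequences.\<close>
    define s where "s i y = (f (X (i + n)) y - (f x0 y + D x0 y \<bullet> (X (i + n) - x0))) / norm (X (i + n) - x0)" for i y
    have Xn: "X (i + n) \<in> ball x0 r" for i using n by simp
    have ne: "norm (X (i + n) - x0) > 0" for i using X by auto
    have "(\<lambda>i. \<integral>y. s i y \<partial>N) \<longlonglongrightarrow> (\<integral>y. 0 \<partial>N)"
    proof (rule integral_dominated_convergence[where w="\<lambda>y. 2 * g y"])
      show "s i \<in> borel_measurable N" for i
        unfolding s_def using int[OF Xn] int[OF x0] meas by measurable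
      show "integrable N (\<lambda>y. 2 * g y)" using g by simp
      show "AE y in N. (\<lambda>i. s i y) \<longlonglongrightarrow> 0"
      proof (rule AE_I2)
        fix y assume y: "y \<in> space N"
        have "((\<lambda>x. (1 / norm (x - x0)) *\<^sub>R (f x y - (f x0 y + D x0 y \<bullet> (x - x0)))) \<longlongrightarrow> 0) (at x0)"
          using der[OF x0 y] unfolding has_derivative_within by simp
        then have "(\<lambda>i. (1 / norm (X i - x0)) *\<^sub>R (f (X i) y - (f x0 y + D x0 y \<bullet> (X i - x0)))) \<longlonglongrightarrow> 0"
          unfolding tendsto_at_iff_sequentially using X lim by (force simp: o_def)
        from LIMSEQ_ignore_initial_segment[OF this, of n] show "(\<lambda>i. s i y) \<longlonglongrightarrow> 0"
          by (simp add: s_def)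
      qed
      show "AE y in N. norm (s i y) \<le> 2 * g y" for i
      proof (rule AE_I2)
        fix y assume y: "y \<in> space N"
        have "\<bar>D x0 y \<bullet> (X (i + n) - x0)\<bar> \<le> g y * norm (X (i + n) - x0)"
          using Cauchy_Schwarz_ineq2 bound[OF x0 y] by (meson mult_right_mono norm_ge_zero order_trans)
        then have "\<bar>f (X (i + n)) y - (f x0 y + D x0 y \<bullet> (X (i + n) - x0))\<bar> \<le> 2 * g y * norm (X (i + n) - x0)"
          using lip[OF Xn y, of i] by linarith
        then show "norm (s i y) \<le> 2 * g y"
          using ne[of i] by (simp add: s_def field_simps)
      qed
    qed simp
    moreover have "(\<integral>y. s i y \<partial>N) = (1 / norm (X (i + n) - x0)) *\<^sub>R ((\<integral>y. f (X (i + n)) y \<partial>N) - ((\<integral>y. f x0 y \<partial>N) + (\<integral>y. D x0 y \<partial>N) \<bullet> (X (i + n) - x0)))" for i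
      unfolding s_def using int[OF Xn] int[OF x0] iD by simp
    ultimately have "(\<lambda>i. (1 / norm (X (i + n) - x0)) *\<^sub>R ((\<integral>y. f (X (i + n)) y \<partial>N) - ((\<integral>y. f x0 y \<partial>N) + (\<integral>y. D x0 y \<partial>N) \<bullet> (X (i + n) - x0)))) \<longlonglongrightarrow> 0"
      by simp
    from LIMSEQ_offset[where k=n and f="\<lambda>i. (1 / norm (X i - x0)) *\<^sub>R ((\<integral>y. f (X i) y \<partial>N) - ((\<integral>y. f x0 y \<partial>N) + (\<integral>y. D x0 y \<partial>N) \<bullet> (X i - x0)))", OF this]
    show "((\<lambda>x. (1 / norm (x - x0)) *\<^sub>R ((\<integral>y. f x y \<partial>N) - ((\<integral>y. f x0 y \<partial>N) + (\<integral>y. D x0 y \<partial>N) \<bullet> (x - x0)))) \<circ> X) \<longlonglongrightarrow> 0"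
      by (simp add: o_def)
  qed
  then show "((\<lambda>x. \<integral>y. f x y \<partial>N) has_derivative (\<lambda>h. (\<integral>y. D x0 y \<partial>N) \<bullet> h)) (at x0)"
    unfolding has_derivative_within by (simp add: bounded_linear_inner_right)
qed

lemma frechet_derivative_inner:
  assumes "(f has_derivative (\<lambda>h. D \<bullet> h)) (at x)"
  shows "frechet_derivative f (at x) b = D \<bullet> b"
  using frechet_derivative_at[OF assms] by metis

lemma has_derivative_gradient:
  fixes f :: "'a::euclidean_space \<Rightarrow> real"
  assumes "f differentiable (at x)"
  shows "(f has_derivative (\<lambda>h. (\<Sum>b\<in>Basis. frechet_derivative f (at x) b *\<^sub>R b) \<bullet> h)) (at x)"
proof -
  let ?F = "frechet_derivative f (at x)"
  have d: "(f has_derivative ?F) (at x)" using assms by (simp add: frechet_derivative_works)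
  then interpret bounded_linear ?F by (rule has_derivative_bounded_linear)
  have "?F h = (\<Sum>b\<in>Basis. ?F b *\<^sub>R b) \<bullet> h" for h
  proof -
    have "?F h = ?F (\<Sum>b\<in>Basis. (h \<bullet> b) *\<^sub>R b)" by (simp add: euclidean_representation)
    also have "\<dots> = (\<Sum>b\<in>Basis. (h \<bullet> b) * ?F b)" by (simp add: sum scaleR)
    also have "\<dots> = (\<Sum>b\<in>Basis. ?F b *\<^sub>R b) \<bullet> h"
      by (simp add: inner_sum_left mult.commute inner_commute[of h])
    finally show ?thesis .
  qed
  with d show ?thesis by (metis (no_types, lifting) ext)
qed

text \<open>Smoothness by coinduction: if a class of differentiable functions is closed under
  partial derivatives, it contains every iterated partial derivative of its members, and no formula
  for higher derivatives has to be found.\<close>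

lemma Ck_on_infinity_coinduct:
  assumes f: "f \<in> S"
    and diff: "\<And>g. g \<in> S \<Longrightarrow> g differentiable_on UNIV"
    and step: "\<And>g b. g \<in> S \<Longrightarrow> b \<in> Basis \<Longrightarrow> (\<lambda>x. frechet_derivative g (at x) b) \<in> S"
  shows "Ck_on \<infinity> UNIV f"
proof -
  have "iter_partial bs f \<in> S" if "bs \<in> lists Basis" for bs
    using that by (induction bs) (auto simp: f intro: step)
  with diff show ?thesis
    unfolding Ck_on_def by (auto intro: differentiable_imp_continuous_on)
qed

text \<open>The classical smooth function exp(-1/t), with the powers of 1/t that differentiation
  produces as additional factors; the family is thus closed under derivatives up to linear
  combinations.\<close>

definition flat :: "nat \<Rightarrow> real \<Rightarrow> real" where
  "flat n t = (if 0 < t then exp (- (1 / t)) / t ^ n else 0)"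

lemma flat_nonneg: "0 \<le> flat n t"
  by (simp add: flat_def)

lemma flat_0_le_1: "flat 0 t \<le> 1"
  by (simp add: flat_def)

text \<open>A single term of the series of exp(1/t), the one of index n + k, beats the pole of order
  n and leaves t^k. The case k = 2 makes the difference quotient at the origin tend to 0.\<close>

lemma flat_bound:
  assumes t: "0 < t"
  shows "flat n t \<le> fact (n + k) * t ^ k"
proof -
  have "(\<lambda>i. (1 / t) ^ i / fact i) sums exp (1 / t)"
    using exp_converges[of "1 / t"] by (simp add: divide_inverse mult.commute)
  then have "(\<Sum>i\<in>{n + k}. (1 / t) ^ i / fact i) \<le> exp (1 / t)"
    using t sum_le_suminf[of "\<lambda>i. (1 / t) ^ i / fact i" "{n + k}"] by (simp add: sums_iff)
  then have "1 / (fact (n + k) * t ^ (n + k)) \<le> exp (1 / t)"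
    by (simp add: power_divide mult.commute)
  then have "exp (- (1 / t)) \<le> fact (n + k) * t ^ (n + k)"
    using t by (simp add: exp_minus field_simps)
  then show ?thesis
    using t by (simp add: flat_def power_add field_simps)
qed

lemma flat_has_derivative:
  "(flat n has_real_derivative flat (n + 2) t - real n * flat (n + 1) t) (at t)"
proof -
  consider "t > 0" | "t < 0" | "t = 0" by linarith
  then show ?thesis
  proof cases
    case 1
    have "((\<lambda>t. exp (- (1 / t)) / t ^ n) has_real_derivative flat (n + 2) t - real n * flat (n + 1) t) (at t)"
      using 1 by (cases n) (auto intro!: derivative_eq_intros simp: flat_def field_simps power2_eq_square, metis One_nat_def power_eq_if)
    then show ?thesis
      by (rule has_field_derivative_transform_within_open[where S="{0<..}"]) (use 1 in \<open>auto simp: flat_def\<close>)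
  next
    case 2
    have "((\<lambda>t. 0) has_real_derivative flat (n + 2) t - real n * flat (n + 1) t) (at t)"
      using 2 by (simp add: flat_def)
    then show ?thesis
      by (rule has_field_derivative_transform_within_open[where S="{..<0}"]) (use 2 in \<open>auto simp: flat_def\<close>)
  next
    case 3
    have "((\<lambda>s. (flat n s - flat n 0) / (s - 0)) \<longlongrightarrow> 0) (at 0)"
    proof (rule Lim_null_comparison)
      show "\<forall>\<^sub>F s in at 0. norm ((flat n s - flat n 0) / (s - 0)) \<le> fact (n + 2) * \<bar>s\<bar>"
      proof (rule always_eventually, rule allI)
        fix s :: real
        show "norm ((flat n s - flat n 0) / (s - 0)) \<le> fact (n + 2) * \<bar>s\<bar>"
        proof (cases "s > 0")
          case True
          then show ?thesis using flat_bound[OF True, of n 2] flat_nonneg[of n s]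
            by (simp add: flat_def[of n 0] divide_simps power2_eq_square mult.assoc)
        next
          case False
          then have "norm ((flat n s - flat n 0) / (s - 0)) = 0" by (simp add: flat_def)
          also have "0 \<le> fact (n + 2) * \<bar>s\<bar>" by (intro mult_nonneg_nonneg) auto
          finally show ?thesis .
        qed
      qed
      show "((\<lambda>s. fact (n + 2) * \<bar>s\<bar>) \<longlongrightarrow> (0::real)) (at 0)"
        by (auto intro!: tendsto_eq_intros)
    qed
    then show ?thesis using 3 by (simp add: has_field_derivative_iff flat_def)
  qed
qed

text \<open>A syntactic class in which smoothness is read off the construction: derivatives stay in
  the class by induction on the expression, and coinduction does the rest. Bumps and mollifiers are
  members.\<close>

inductive_set smooth_expr :: "('a::euclidean_space \<Rightarrow> real) set" where
  const: "(\<lambda>x. c) \<in> smooth_expr"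
| coord: "(\<lambda>x. x \<bullet> v) \<in> smooth_expr"
| add: "f \<in> smooth_expr \<Longrightarrow> g \<in> smooth_expr \<Longrightarrow> (\<lambda>x. f x + g x) \<in> smooth_expr"
| mult: "f \<in> smooth_expr \<Longrightarrow> g \<in> smooth_expr \<Longrightarrow> (\<lambda>x. f x * g x) \<in> smooth_expr"
| flat: "f \<in> smooth_expr \<Longrightarrow> (\<lambda>x. flat n (f x)) \<in> smooth_expr"

lemma smooth_expr_diff: "f \<in> smooth_expr \<Longrightarrow> g \<in> smooth_expr \<Longrightarrow> (\<lambda>x. f x - g x) \<in> smooth_expr"
  using smooth_expr.add[OF _ smooth_expr.mult[OF smooth_expr.const[of "-1"]], of f g] by simp

lemma smooth_expr_prod:
  assumes "\<And>i. i \<in> A \<Longrightarrow> f i \<in> smooth_expr"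
  shows "(\<lambda>x. \<Prod>i\<in>A. f i x) \<in> smooth_expr"
  using assms by (induction A rule: infinite_finite_induct) (auto intro: smooth_expr.intros)

lemma smooth_expr_sum:
  assumes "\<And>i. i \<in> A \<Longrightarrow> f i \<in> smooth_expr"
  shows "(\<lambda>x. \<Sum>i\<in>A. f i x) \<in> smooth_expr"
  using assms by (induction A rule: infinite_finite_induct) (auto intro: smooth_expr.intros)

lemma smooth_expr_derivative:
  assumes "f \<in> smooth_expr"
  shows "\<exists>D. (\<forall>x. (f has_derivative D x) (at x)) \<and> (\<forall>b. (\<lambda>x. D x b) \<in> smooth_expr)"
  using assms
proof induction
  case (const c)
  show ?case by (rule exI[of _ "\<lambda>x h. 0"]) (auto intro: smooth_expr.intros)
next
  case (coord v)
  show ?case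
    by (rule exI[of _ "\<lambda>x h. h \<bullet> v"]) (auto intro!: smooth_expr.intros derivative_eq_intros)
next
  case (add f g)
  then obtain D E where "\<forall>x. (f has_derivative D x) (at x)" "\<forall>b. (\<lambda>x. D x b) \<in> smooth_expr"
    "\<forall>x. (g has_derivative E x) (at x)" "\<forall>b. (\<lambda>x. E x b) \<in> smooth_expr" by blast
  then show ?case
    by (intro exI[of _ "\<lambda>x h. D x h + E x h"]) (auto intro!: smooth_expr.intros derivative_eq_intros)
next
  case (mult f g)
  then obtain D E where "\<forall>x. (f has_derivative D x) (at x)" "\<forall>b. (\<lambda>x. D x b) \<in> smooth_expr"
    "\<forall>x. (g has_derivative E x) (at x)" "\<forall>b. (\<lambda>x. E x b) \<in> smooth_expr" by blast
  with mult show ?case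
    by (intro exI[of _ "\<lambda>x h. f x * E x h + D x h * g x"])
      (auto intro!: smooth_expr.intros has_derivative_mult)
next
  case (flat f n)
  then obtain D where D: "\<forall>x. (f has_derivative D x) (at x)" "\<forall>b. (\<lambda>x. D x b) \<in> smooth_expr" by blast
  have "((\<lambda>x. flat n (f x)) has_derivative (\<lambda>h. (flat (n + 2) (f x) - real n * flat (n + 1) (f x)) * D x h)) (at x)" for x
    using has_derivative_compose[OF D(1)[rule_format, of x] flat_has_derivative[of n "f x", unfolded has_field_derivative_def]]
    by (simp add: o_def)
  with flat D show ?case
    by (intro exI[of _ "\<lambda>x h. (flat (n + 2) (f x) - real n * flat (n + 1) (f x)) * D x h"])
      (auto intro!: smooth_expr.intros smooth_expr_diff)
qed

lemma Ck_on_smooth_expr: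
  assumes "f \<in> smooth_expr" shows "Ck_on \<infinity> UNIV f"
proof (rule Ck_on_infinity_coinduct[OF assms])
  fix g :: "'a \<Rightarrow> real" and b assume "g \<in> smooth_expr"
  then obtain D where D: "\<forall>x. (g has_derivative D x) (at x)" "\<forall>b. (\<lambda>x. D x b) \<in> smooth_expr"
    using smooth_expr_derivative by blast
  then show "g differentiable_on UNIV" by (auto simp: differentiable_on_def differentiable_def)
  have "frechet_derivative g (at x) = D x" for x using frechet_derivative_at D by metis
  then show "(\<lambda>x. frechet_derivative g (at x) b) \<in> smooth_expr" using D by simp
qed

text \<open>A smooth substitute for the indicator of a box. The number \<open>k\<close> is a
  steepness: the bump vanishes off the open box for every positive \<open>k\<close> and tends to 1
  inside it as \<open>k\<close> grows.\<close>

definition box_bump :: "'a::euclidean_space \<Rightarrow> 'a \<Rightarrow> real \<Rightarrow> 'a \<Rightarrow> real" where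
  "box_bump a b k x = (\<Prod>i\<in>Basis. flat 0 (k * (x \<bullet> i - a \<bullet> i)) * flat 0 (k * (b \<bullet> i - x \<bullet> i)))"

lemma box_bump_eq_0:
  assumes "x \<notin> box a b" "0 < k" shows "box_bump a b k x = 0"
proof -
  obtain i where "i \<in> Basis" "x \<bullet> i \<le> a \<bullet> i \<or> b \<bullet> i \<le> x \<bullet> i"
    using assms(1) by (auto simp: mem_box not_less)
  with assms(2) show ?thesis
    unfolding box_bump_def by (intro prod_zero) (auto simp: flat_def zero_less_mult_iff intro!: bexI[of _ i])
qed

lemma box_bump_le_1: "box_bump a b k x \<le> 1"
  unfolding box_bump_def by (intro prod_le_1) (auto simp: flat_nonneg flat_0_le_1 mult_le_one)

lemma box_bump_nonneg: "0 \<le> box_bump a b k x"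
  unfolding box_bump_def by (intro prod_nonneg) (auto simp: flat_nonneg)

lemma box_bump_smooth: "box_bump a b k \<in> smooth_expr"
  unfolding box_bump_def by (intro smooth_expr_prod smooth_expr.intros smooth_expr_diff)

lemma box_bump_LIMSEQ:
  assumes "x \<in> box a b"
  shows "(\<lambda>n. box_bump a b (real (Suc n)) x) \<longlonglongrightarrow> 1"
proof -
  have fl: "(\<lambda>n. flat 0 (real (Suc n) * s)) \<longlonglongrightarrow> 1" if "s > 0" for s
  proof -
    have "(\<lambda>n. - (1 / s) * inverse (real (Suc n))) \<longlonglongrightarrow> - (1 / s) * 0"
      by (intro tendsto_intros LIMSEQ_inverse_real_of_nat)
    then have "(\<lambda>n. exp (- (1 / s) * inverse (real (Suc n)))) \<longlonglongrightarrow> exp 0"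
      by (intro tendsto_exp) simp
    moreover have "flat 0 (real (Suc n) * s) = exp (- (1 / s) * inverse (real (Suc n)))" for n
      using that by (simp add: flat_def field_simps del: of_nat_Suc)
    ultimately show ?thesis by simp
  qed
  have "(\<lambda>n. box_bump a b (real (Suc n)) x) \<longlonglongrightarrow> (\<Prod>i\<in>(Basis::'a set). 1 * 1)"
    unfolding box_bump_def
    by (intro tendsto_prod tendsto_mult fl) (use assms in \<open>auto simp: mem_box\<close>)
  then show ?thesis by simp
qed

lemma test_fun_box_bump:
  assumes "0 < k" "cbox a b \<subseteq> \<Omega>"
  shows "test_fun \<Omega> (box_bump a b k)"
proof -
  have "{x. box_bump a b k x \<noteq> 0} \<subseteq> cbox a b"
    using box_bump_eq_0[OF _ assms(1)] box_subset_cbox by blast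
  then have "closure {x. box_bump a b k x \<noteq> 0} \<subseteq> cbox a b"
    by (intro closure_minimal) auto
  moreover from this have "compact (closure {x. box_bump a b k x \<noteq> 0})"
    by (meson bounded_cbox bounded_subset closed_closure compact_eq_bounded_closed)
  ultimately show ?thesis
    unfolding test_fun_def using assms Ck_on_smooth_expr[OF box_bump_smooth] by auto
qed

section \<open>Local integrability and the fundamental lemma of the calculus of variations\<close>

lemma integrable_on_mult_bounded:
  fixes f g :: "'b \<Rightarrow> real"
  assumes "integrable M f" "g \<in> borel_measurable M" "\<And>x. x \<in> space M \<Longrightarrow> \<bar>g x\<bar> \<le> B"
  shows "integrable M (\<lambda>x. f x * g x)"
proof (rule Bochner_Integration.integrable_bound[of _ "\<lambda>x. B * f x"])
  show "AE x in M. norm (f x * g x) \<le> norm (B * f x)"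
    using assms(3) by (intro AE_I2) (auto simp: abs_mult mult.commute[of "\<bar>f _\<bar>"] intro!: mult_right_mono intro: order_trans[OF _ abs_ge_self])
qed (use assms in auto)

lemma smooth_expr_continuous: "f \<in> smooth_expr \<Longrightarrow> continuous_on UNIV f"
  using smooth_expr_derivative has_derivative_continuous_on by (metis has_derivative_at_withinI)

lemma measurable_lebesgue_on_borel: "f \<in> borel_measurable borel \<Longrightarrow> f \<in> borel_measurable (lebesgue_on S)"
  by (rule measurable_restrict_space1) (simp add: measurable_completion)

lemma integrable_lebesgue_on_iff:
  fixes f :: "'a::euclidean_space \<Rightarrow> 'b::{banach, second_countable_topology}"
  assumes "K \<in> sets lebesgue" "S \<in> sets lebesgue" "K \<subseteq> S"
  shows "integrable (lebesgue_on K) f \<longleftrightarrow> integrable (lebesgue_on S) (\<lambda>x. indicator K x *\<^sub>R f x)"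
    and "(\<integral>x. f x \<partial>lebesgue_on K) = (\<integral>x. indicator K x *\<^sub>R f x \<partial>lebesgue_on S)"
proof -
  have *: "indicator S x *\<^sub>R indicator K x *\<^sub>R f x = indicator K x *\<^sub>R f x" for x
    using assms by (auto simp: indicator_def)
  show "integrable (lebesgue_on K) f \<longleftrightarrow> integrable (lebesgue_on S) (\<lambda>x. indicator K x *\<^sub>R f x)"
    "(\<integral>x. f x \<partial>lebesgue_on K) = (\<integral>x. indicator K x *\<^sub>R f x \<partial>lebesgue_on S)"
    using assms by (simp_all add: integrable_restrict_space integral_restrict_space * del: scaleR_scaleR)
qed

lemma L1_loc_integrable_mult:
  fixes f v :: "'a::euclidean_space \<Rightarrow> real"
  assumes "L1_loc \<Omega> f" "\<Omega> \<in> sets lebesgue" "compact K" "K \<subseteq> \<Omega>"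
    and "v \<in> borel_measurable borel" "\<And>x. \<bar>v x\<bar> \<le> B" "\<And>x. x \<notin> K \<Longrightarrow> v x = 0"
  shows "integrable (lebesgue_on \<Omega>) (\<lambda>x. f x * v x)"
proof -
  have "integrable (lebesgue_on K) (\<lambda>x. f x * v x)"
    using assms by (intro integrable_on_mult_bounded[where B=B]) (auto simp: L1_loc_def intro: measurable_lebesgue_on_borel)
  moreover have "(\<lambda>x. indicator K x *\<^sub>R (f x * v x)) = (\<lambda>x. f x * v x)" using assms(7) by (auto simp: indicator_def fun_eq_iff)
  moreover have "K \<in> sets lebesgue" using assms(3) by (simp add: lmeasurable_compact fmeasurableD)
  ultimately show ?thesis using integrable_lebesgue_on_iff(1)[of K \<Omega> "\<lambda>x. f x * v x"] assms by simp
qed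

text \<open>Box bumps approximate indicators, so the integral of \<open>f\<close> vanishes over
  every closed box in \<Omega>. Lebesgue differentiation along shrinking cubes then gives f = 0
  almost everywhere in a box, and countably many boxes exhaust \<Omega>.\<close>

lemma fundamental_lemma:
  fixes f :: "'a::euclidean_space \<Rightarrow> real"
  assumes \<Omega>: "open \<Omega>" and f: "L1_loc \<Omega> f"
    and zero: "\<And>v. test_fun \<Omega> v \<Longrightarrow> (\<integral>x. f x * v x \<partial>lebesgue_on \<Omega>) = 0"
  shows "AE x in lebesgue_on \<Omega>. f x = 0"
proof -
  have \<Omega>m: "\<Omega> \<in> sets lebesgue" using \<Omega> by simp
  have box0: "integral (cbox a b) f = 0" if ab: "cbox a b \<subseteq> \<Omega>" for a b
  proof -
    have int: "integrable (lebesgue_on (cbox a b)) f" using f ab by (auto simp: L1_loc_def)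
    have "(\<lambda>n. \<integral>x. f x * box_bump a b (real (Suc n)) x \<partial>lebesgue_on \<Omega>) \<longlonglongrightarrow>
        (\<integral>x. f x * indicator (box a b) x \<partial>lebesgue_on \<Omega>)"
    proof (rule integral_dominated_convergence[where w="\<lambda>x. indicator (cbox a b) x *\<^sub>R \<bar>f x\<bar>"])
      have *: "integrable (lebesgue_on \<Omega>) (\<lambda>x. f x * indicator (box a b) x)"
        by (rule L1_loc_integrable_mult[OF f \<Omega>m compact_cbox ab, where B=1])
          (use box_subset_cbox[of a b] in \<open>auto simp: indicator_def\<close>)
      show "(\<lambda>x. f x * indicator (box a b) x) \<in> borel_measurable (lebesgue_on \<Omega>)"
        using * by simp
      show "(\<lambda>x. f x * box_bump a b (real (Suc n)) x) \<in> borel_measurable (lebesgue_on \<Omega>)" for n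
      proof (rule borel_measurable_integrable, rule L1_loc_integrable_mult[OF f \<Omega>m compact_cbox ab, where B=1])
        show "box_bump a b (real (Suc n)) \<in> borel_measurable borel"
          by (rule borel_measurable_continuous_onI[OF smooth_expr_continuous[OF box_bump_smooth]])
        show "\<bar>box_bump a b (real (Suc n)) x\<bar> \<le> 1" for x
          unfolding abs_of_nonneg[OF box_bump_nonneg] by (rule box_bump_le_1)
        show "box_bump a b (real (Suc n)) x = 0" if "x \<notin> cbox a b" for x
          using box_bump_eq_0[of x a b "real (Suc n)"] that box_subset_cbox[of a b] by auto
      qed
      show "integrable (lebesgue_on \<Omega>) (\<lambda>x. indicator (cbox a b) x *\<^sub>R \<bar>f x\<bar>)"
        using int ab \<Omega>m by (subst integrable_lebesgue_on_iff(1)[symmetric]) auto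
      show "AE x in lebesgue_on \<Omega>. (\<lambda>n. f x * box_bump a b (real (Suc n)) x) \<longlonglongrightarrow> f x * indicator (box a b) x"
      proof (rule AE_I2)
        fix x
        show "(\<lambda>n. f x * box_bump a b (real (Suc n)) x) \<longlonglongrightarrow> f x * indicator (box a b) x"
          using tendsto_mult[OF tendsto_const[of "f x"] box_bump_LIMSEQ[of x a b]]
          by (cases "x \<in> box a b") (simp_all add: box_bump_eq_0)
      qed
      show "AE x in lebesgue_on \<Omega>. norm (f x * box_bump a b (real (Suc n)) x) \<le> indicator (cbox a b) x *\<^sub>R \<bar>f x\<bar>" for n
      proof (rule AE_I2)
        fix x
        show "norm (f x * box_bump a b (real (Suc n)) x) \<le> indicator (cbox a b) x *\<^sub>R \<bar>f x\<bar>"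
          using box_bump_le_1[of a b "Suc n" x] box_bump_nonneg[of a b "Suc n" x] box_subset_cbox[of a b]
          by (cases "x \<in> box a b") (auto simp: abs_mult box_bump_eq_0 mult_left_le)
      qed
    qed
    moreover have "(\<integral>x. f x * box_bump a b (real (Suc n)) x \<partial>lebesgue_on \<Omega>) = 0" for n
      by (rule zero, rule test_fun_box_bump) (use ab in auto)
    ultimately have "(\<integral>x. f x * indicator (box a b) x \<partial>lebesgue_on \<Omega>) = 0"
      using LIMSEQ_unique[OF _ tendsto_const] by auto
    moreover have "(\<integral>x. f x * indicator (box a b) x \<partial>lebesgue_on \<Omega>) = (\<integral>x. f x \<partial>lebesgue_on (box a b))"
      using ab box_subset_cbox[of a b] \<Omega>m
      by (subst integrable_lebesgue_on_iff(2)[of "box a b" \<Omega>]) (auto simp: mult.commute)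
    moreover have "integrable (lebesgue_on (box a b)) f"
      using L1_loc_integrable_mult[OF f \<Omega>m compact_cbox ab, where B=1 and v="indicator (box a b)"] ab box_subset_cbox[of a b] \<Omega>m
      by (subst integrable_lebesgue_on_iff(1)[of "box a b" \<Omega>]) (auto simp: mult.commute indicator_def)
    ultimately have "(f has_integral 0) (box a b)"
      using has_integral_integral_lebesgue_on[of "box a b" f] by simp
    then show ?thesis by (simp add: integral_open_interval[symmetric] integral_unique)
  qed
  have local: "negligible {x \<in> cbox a b. f x \<noteq> 0}" if ab: "cbox a b \<subseteq> \<Omega>" for a b
  proof -
    \<comment> \<open>Extension by zero off the box, because the differentiation theorem asks for
      integrability on every box of the space.\<close>
    define F where "F x = (if x \<in> cbox a b then f x else 0)" for x
    have int: "f integrable_on cbox a b"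
      using f ab by (intro integrable_on_lebesgue_on) (auto simp: L1_loc_def)
    have Fint: "F integrable_on cbox c d" for c d
    proof -
      have "f integrable_on cbox c d \<inter> cbox a b"
        unfolding Int_interval by (rule integrable_on_subcbox[OF int]) (auto simp flip: Int_interval)
      then show ?thesis unfolding F_def by (subst integrable_restrict_Int) (simp only: Int_commute)
    qed
    obtain N where N: "negligible N" and lim: "\<And>x e. x \<notin> N \<Longrightarrow> 0 < e \<Longrightarrow>
       \<exists>d>0. \<forall>h. 0 < h \<and> h < d \<longrightarrow> norm(integral (cbox x (x + h *\<^sub>R One)) F /\<^sub>R h ^ DIM('a) - F x) < e"
      using integrable_ccontinuous_explicit[OF Fint] by metis
    have "f x = 0" if x: "x \<in> box a b" "x \<notin> N" for x
    proof (rule ccontr)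
      assume ne: "f x \<noteq> 0"
      then obtain d where d: "d > 0" "\<And>h. 0 < h \<Longrightarrow> h < d \<Longrightarrow>
         norm(integral (cbox x (x + h *\<^sub>R One)) F /\<^sub>R h ^ DIM('a) - F x) < \<bar>f x\<bar>"
        using lim[OF x(2), of "\<bar>f x\<bar>"] by auto
      obtain e where e: "e > 0" "ball x e \<subseteq> box a b" using x(1) open_box open_contains_ball by metis
      \<comment> \<open>The cube with lower corner \<open>x\<close> and side \<open>h\<close> has
        the diagonal \<open>h * norm One\<close>, which is below \<open>e\<close>; the cube
        therefore stays in the box, where the integrals are already known to vanish.\<close>
      define h where "h = min (d/2) (e / (2 * norm (One::'a)))"
      have One: "norm (One::'a) > 0" by simp
      have h: "0 < h" "h < d" using d e One by (auto simp: h_def)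
      have "h \<le> e / (2 * norm (One::'a))" by (simp add: h_def)
      then have "norm (h *\<^sub>R (One::'a)) < e" using One e h by (simp add: field_simps)
      then have "x + h *\<^sub>R One \<in> box a b" using e by (auto simp: dist_norm subset_iff)
      then have sub: "cbox x (x + h *\<^sub>R One) \<subseteq> cbox a b"
        using x(1) by (auto simp: mem_box) (meson less_imp_le order_trans)+
      have "integral (cbox x (x + h *\<^sub>R One)) F = integral (cbox x (x + h *\<^sub>R One)) f"
        by (rule integral_cong) (use sub in \<open>auto simp: F_def\<close>)
      also have "\<dots> = 0" by (rule box0) (use sub ab in auto)
      finally show False using d(2)[OF h] x(1) box_subset_cbox[of a b] by (auto simp: F_def)
    qed
    then have "{x \<in> cbox a b. f x \<noteq> 0} \<subseteq> N \<union> (cbox a b - box a b)" by auto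
    moreover have "negligible (N \<union> (cbox a b - box a b))"
      using N negligible_frontier_interval by (rule negligible_Un)
    ultimately show ?thesis by (rule negligible_subset[rotated])
  qed
  obtain \<D> where D: "countable \<D>" "\<D> \<subseteq> Pow \<Omega>" "\<And>X. X \<in> \<D> \<Longrightarrow> \<exists>a b. X = cbox a b"  "\<Union>\<D> = \<Omega>" 
    using open_countable_Union_open_cbox[OF \<Omega>] by blast
  have "{x \<in> \<Omega>. f x \<noteq> 0} = (\<Union>X\<in>\<D>. {x \<in> X. f x \<noteq> 0})" using D(4) by auto
  moreover have "negligible (\<Union>X\<in>\<D>. {x \<in> X. f x \<noteq> 0})"
  proof (rule negligible_countable_Union)
    show "countable ((\<lambda>X. {x \<in> X. f x \<noteq> 0}) ` \<D>)" using D(1) by simp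
    fix S assume "S \<in> (\<lambda>X. {x \<in> X. f x \<noteq> 0}) ` \<D>"
    then obtain X where X: "X \<in> \<D>" "S = {x \<in> X. f x \<noteq> 0}" by auto
    obtain a b where "X = cbox a b" using D(3)[OF X(1)] by blast
    with X D(2) local[of a b] show "negligible S" by auto
  qed
  ultimately have "{x \<in> \<Omega>. f x \<noteq> 0} \<in> null_sets lebesgue" by (simp add: negligible_iff_null_sets)
  then have "AE x in lebesgue. x \<notin> {x \<in> \<Omega>. f x \<noteq> 0}" by (rule AE_not_in)
  then show ?thesis using \<Omega>m by (subst AE_restrict_space_iff) auto
qed


section \<open>Convolution with test functions\<close>

lemma integral_lborel_diff:
  fixes f :: "'a::euclidean_space \<Rightarrow> 'b::{banach, second_countable_topology}"
  assumes [measurable]: "f \<in> borel_measurable borel"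
  shows "(\<integral>y. f (x - y) \<partial>lborel) = (\<integral>y. f y \<partial>lborel)"
proof -
  have "lborel = distr lborel borel (\<lambda>y. x - y)"
    by (subst lborel_affine[of "-1" x]) (simp_all add: density_1)
  then have "(\<integral>y. f y \<partial>lborel) = (\<integral>y. f y \<partial>distr lborel borel (\<lambda>y. x - y))" by simp
  also have "\<dots> = (\<integral>y. f (x - y) \<partial>lborel)"
    by (simp add: integral_distr)
  finally show ?thesis ..
qed

lemma test_fun_bounded_derivatives:
  assumes v: "test_fun UNIV v" and bs: "bs \<in> lists Basis"
  shows "continuous_on UNIV (iter_partial bs v)" "test_fun UNIV (iter_partial bs v)" "\<exists>B. \<forall>x. \<bar>iter_partial bs v x\<bar> \<le> B"
    "\<And>x. x \<notin> closure {x. v x \<noteq> 0} \<Longrightarrow> iter_partial bs v x = 0"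
proof -
  have ck: "Ck_on \<infinity> UNIV v" and comp: "compact (closure {x. v x \<noteq> 0})"
    using v by (auto simp: test_fun_def)
  show cont: "continuous_on UNIV (iter_partial bs v)"
    using ck bs by (auto simp: Ck_on_def)
  have app: "iter_partial cs (iter_partial bs v) = iter_partial (cs @ bs) v" for cs
    by (induction cs) auto
  have ck': "Ck_on \<infinity> UNIV (iter_partial bs v)"
    using ck bs unfolding Ck_on_def by (auto simp: app)
  show zero: "iter_partial bs v x = 0" if "x \<notin> closure {x. v x \<noteq> 0}" for x
    using that
  proof (induction bs arbitrary: x)
    case Nil
    then show ?case using closure_subset[of "{x. v x \<noteq> 0}"] by auto
  next
    case (Cons b bs)
    have "(iter_partial bs v has_derivative (\<lambda>h. 0)) (at x)"
      by (rule has_derivative_transform_within_open[where f="\<lambda>x. 0" and s="- closure {x. v x \<noteq> 0}"])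
        (use Cons in auto)
    from frechet_derivative_at[OF this] show ?case by (simp add: fun_eq_iff)
  qed
  have sub: "closure {x. iter_partial bs v x \<noteq> 0} \<subseteq> closure {x. v x \<noteq> 0}"
    using zero by (intro closure_minimal) auto
  show "test_fun UNIV (iter_partial bs v)"
    unfolding test_fun_def using ck' sub comp by (auto intro: bounded_subset compact_imp_bounded simp: compact_eq_bounded_closed)
  obtain B where "\<And>x. x \<in> closure {x. v x \<noteq> 0} \<Longrightarrow> \<bar>iter_partial bs v x\<bar> \<le> B"
    using compact_imp_bounded[OF compact_continuous_image[OF continuous_on_subset[OF cont subset_UNIV] comp]]
    by (auto simp: bounded_iff)
  then have "\<bar>iter_partial bs v x\<bar> \<le> max B 0" for x
    by (cases "x \<in> closure {x. v x \<noteq> 0}") (auto simp: zero le_max_iff_disj)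
  then show "\<exists>B. \<forall>x. \<bar>iter_partial bs v x\<bar> \<le> B" by blast
qed

lemma test_fun_has_derivative:
  assumes v: "test_fun UNIV v"
  obtains D where "\<And>x. (v has_derivative (\<lambda>h. D x \<bullet> h)) (at x)"
    "\<And>x b. b \<in> Basis \<Longrightarrow> D x \<bullet> b = iter_partial [b] v x"
    "continuous_on UNIV D" "\<And>x. x \<notin> closure {x. v x \<noteq> 0} \<Longrightarrow> D x = 0"
proof -
  define D where "D x = (\<Sum>b\<in>Basis. frechet_derivative v (at x) b *\<^sub>R b)" for x
  have diff: "v differentiable (at x)" for x
    using v by (auto simp: test_fun_def Ck_on_def differentiable_on_def dest!: bspec[of _ _ "[]"])
  show ?thesis
  proof
    show "(v has_derivative (\<lambda>h. D x \<bullet> h)) (at x)" for x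
      unfolding D_def by (rule has_derivative_gradient[OF diff])
    show "D x \<bullet> b = iter_partial [b] v x" if "b \<in> Basis" for x b
      using that by (simp add: D_def inner_sum_left inner_Basis if_distrib cong: if_cong)
    have "continuous_on UNIV (\<lambda>x. frechet_derivative v (at x) b)" if "b \<in> Basis" for b
      using test_fun_bounded_derivatives(1)[OF v, of "[b]"] that by simp
    then show "continuous_on UNIV D"
      unfolding D_def by (intro continuous_intros) auto
    show "D x = 0" if "x \<notin> closure {x. v x \<noteq> 0}" for x
      using test_fun_bounded_derivatives(4)[OF v, of "[b]" x for b] that
      by (auto simp: D_def intro!: sum.neutral)
  qed
qed

lemma convolution_has_derivative:
  fixes v :: "'a::euclidean_space \<Rightarrow> real"
  assumes f: "integrable N f" and id: "(\<lambda>y. y) \<in> measurable N borel" and v: "test_fun UNIV v"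
  shows "\<exists>D. ((\<lambda>x. \<integral>y. f y * v (x - y) \<partial>N) has_derivative (\<lambda>h. D \<bullet> h)) (at x) \<and>
    (\<forall>b\<in>Basis. D \<bullet> b = (\<integral>y. f y * iter_partial [b] v (x - y) \<partial>N))"
proof -
  obtain D where D: "\<And>x. (v has_derivative (\<lambda>h. D x \<bullet> h)) (at x)"
    "\<And>x b. b \<in> Basis \<Longrightarrow> D x \<bullet> b = iter_partial [b] v x" "continuous_on UNIV D"
    "\<And>x. x \<notin> closure {x. v x \<noteq> 0} \<Longrightarrow> D x = 0"
    using test_fun_has_derivative[OF v] by metis
  have comp: "compact (closure {x. v x \<noteq> 0})" using v by (auto simp: test_fun_def)
  obtain B where B: "\<And>x. x \<in> closure {x. v x \<noteq> 0} \<Longrightarrow> norm (D x) \<le> B"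
    using compact_imp_bounded[OF compact_continuous_image[OF continuous_on_subset[OF D(3) subset_UNIV] comp]]
    by (auto simp: bounded_iff)
  have B': "norm (D x) \<le> max B 0" for x
    using B[of x] by (cases "x \<in> closure {x. v x \<noteq> 0}") (auto simp: D(4))
  obtain B0 where B0: "\<And>x. \<bar>v x\<bar> \<le> B0" using test_fun_bounded_derivatives(3)[OF v, of "[]"] by auto
  have mv: "v \<in> borel_measurable borel" 
    using test_fun_bounded_derivatives(1)[OF v, of "[]"] by (auto intro: borel_measurable_continuous_onI)
  have mD: "D \<in> borel_measurable borel" using D(3) by (rule borel_measurable_continuous_onI)
  have mm: "(\<lambda>y. z - y) \<in> measurable N borel" for z using id by measurable
  note leibniz = has_derivative_integral[of 1 x N, where g="\<lambda>y. \<bar>f y\<bar> * max B 0"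
      and f="\<lambda>x y. f y * v (x - y)" and D="\<lambda>x y. f y *\<^sub>R D (x - y)"]
  have 1: "((\<lambda>x. f y * v (x - y)) has_derivative (\<lambda>h. (f y *\<^sub>R D (z - y)) \<bullet> h)) (at z)" for y z
  proof -
    have "((\<lambda>x. v (x - y)) has_derivative (\<lambda>h. D (z - y) \<bullet> h)) (at z)"
      by (rule has_derivative_compose[OF _ D(1), of "\<lambda>x. x - y" "\<lambda>h. h"]) (auto intro!: derivative_eq_intros)
    from has_derivative_mult_right[OF this, of "f y"] show ?thesis by simp
  qed
  have 2: "integrable N (\<lambda>y. f y * v (z - y))" for z
    by (rule integrable_on_mult_bounded[OF f measurable_compose[OF mm mv] B0])
  have 3: "(\<lambda>y. f y *\<^sub>R D (x - y)) \<in> borel_measurable N"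
    using f measurable_compose[OF mm mD] by measurable
  have 4: "norm (f y *\<^sub>R D (z - y)) \<le> \<bar>f y\<bar> * max B 0" for y z
    using B'[of "z - y"] by (auto intro: mult_left_mono)
  have 5: "integrable N (\<lambda>y. \<bar>f y\<bar> * max B 0)" using f by simp
  note der = leibniz(1)[OF zero_less_one 1 2 3 4 5] and int = leibniz(2)[OF zero_less_one 1 2 3 4 5]
  show ?thesis
    using der int D(2) by (intro exI[of _ "\<integral>y. f y *\<^sub>R D (x - y) \<partial>N"]) (auto simp flip: integral_inner_left)
qed

text \<open>Derivatives fall on the test function, so the convolutions of one fixed \<open>f\<close>
  with all test functions form a class closed under partial derivatives.\<close>

lemma Ck_on_convolution:
  fixes v :: "'a::euclidean_space \<Rightarrow> real"
  assumes f: "integrable N f" and id: "(\<lambda>y. y) \<in> measurable N borel" and v: "test_fun UNIV v"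
  shows "Ck_on \<infinity> UNIV (\<lambda>x. \<integral>y. f y * v (x - y) \<partial>N)"
proof (rule Ck_on_infinity_coinduct[where S="{(\<lambda>x. \<integral>y. f y * v (x - y) \<partial>N)|v. test_fun UNIV v}"])
  fix g assume "g \<in> {(\<lambda>x. \<integral>y. f y * v (x - y) \<partial>N)|v. test_fun UNIV v}"
  then obtain w where w: "g = (\<lambda>x. \<integral>y. f y * w (x - y) \<partial>N)" "test_fun UNIV w" by auto
  note D = convolution_has_derivative[OF f id w(2)]
  show "g differentiable_on UNIV" unfolding w differentiable_on_def differentiable_def using D by blast
  fix b :: 'a assume b: "b \<in> Basis"
  have "frechet_derivative g (at x) b = (\<integral>y. f y * iter_partial [b] w (x - y) \<partial>N)" for x
    using D[of x] b frechet_derivative_inner unfolding w by metis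
  moreover have "test_fun UNIV (iter_partial [b] w)" using test_fun_bounded_derivatives(2)[OF w(2), of "[b]"] b by simp
  ultimately show "(\<lambda>x. frechet_derivative g (at x) b) \<in> {(\<lambda>x. \<integral>y. f y * v (x - y) \<partial>N)|v. test_fun UNIV v}"
    by blast
qed (use v in auto)

section \<open>Mollification\<close>

text \<open>The squared norm is written as a sum over coordinates so that the unnormalised function
  is visibly a \<open>smooth_expr\<close>. The support radius is 1 / (n + 1).\<close>

definition mollifier :: "nat \<Rightarrow> 'a::euclidean_space \<Rightarrow> real" where
  "mollifier n x = (let \<psi> = (\<lambda>x::'a. flat 0 ((inverse (real (Suc n)))\<^sup>2 - (\<Sum>i\<in>Basis. (x \<bullet> i) * (x \<bullet> i)))) in \<psi> x / (\<integral>x. \<psi> x \<partial>lborel))"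

lemma mollifier:
  fixes x :: "'a::euclidean_space"
  shows "0 \<le> mollifier n x" "x \<notin> ball 0 (inverse (real (Suc n))) \<Longrightarrow> mollifier n x = 0"
    "test_fun UNIV (mollifier n :: 'a \<Rightarrow> real)"
    "integrable lborel (mollifier n :: 'a \<Rightarrow> real)" "(\<integral>x. mollifier n (x::'a) \<partial>lborel) = 1"
proof -
  define r where "r = inverse (real (Suc n))"
  have r: "r > 0" by (simp add: r_def)
  define \<psi> where "\<psi> x = flat 0 (r\<^sup>2 - (\<Sum>i\<in>Basis. (x \<bullet> i) * (x \<bullet> i)))" for x :: 'a
  have sq: "(\<Sum>i\<in>Basis. (x \<bullet> i) * (x \<bullet> i)) = (norm x)\<^sup>2" for x :: 'a
    by (metis euclidean_inner power2_norm_eq_inner)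
  have eq: "mollifier n x = \<psi> x / (\<integral>x. \<psi> x \<partial>lborel)" for x :: 'a
    by (simp add: mollifier_def Let_def \<psi>_def r_def)
  have se: "\<psi> \<in> smooth_expr" unfolding \<psi>_def by (intro smooth_expr_sum smooth_expr.intros smooth_expr_diff)
  have out: "\<psi> x = 0" if "x \<notin> ball 0 r" for x
  proof -
    have "r\<^sup>2 \<le> (norm x)\<^sup>2" using that r by (intro power_mono) auto
    then show ?thesis unfolding \<psi>_def sq by (simp add: flat_def)
  qed
  have pos: "\<psi> x > 0" if "x \<in> ball 0 r" for x
  proof -
    have "(norm x)\<^sup>2 < r\<^sup>2" using that r by (intro power_strict_mono) auto
    then show ?thesis unfolding \<psi>_def sq by (simp add: flat_def)
  qed
  have nonneg: "\<psi> x \<ge> 0" for x by (simp add: \<psi>_def flat_nonneg)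
  have m: "\<psi> \<in> borel_measurable borel" using smooth_expr_continuous[OF se] by (rule borel_measurable_continuous_onI)
  have "integrable lborel (indicator (ball (0::'a) r) :: 'a \<Rightarrow> real)"
    by (intro integrable_real_indicator) (auto simp flip: infinity_ennreal_def intro: emeasure_bounded_finite)
  then have int: "integrable lborel \<psi>"
  proof (rule Bochner_Integration.integrable_bound)
    show "AE x in lborel. norm (\<psi> x) \<le> norm (indicator (ball (0::'a) r) x :: real)"
    proof (rule AE_I2)
      fix x
      have "\<psi> x \<le> 1" unfolding \<psi>_def by (rule flat_0_le_1)
      with nonneg[of x] out[of x] show "norm (\<psi> x) \<le> norm (indicator (ball (0::'a) r) x :: real)"
        by (cases "x \<in> ball 0 r") simp_all
    qed
  qed (use m in simp)
  have ipos: "(\<integral>x. \<psi> x \<partial>lborel) > 0"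
  proof -
    have "(\<integral>x. \<psi> x \<partial>lborel) \<noteq> 0"
    proof
      assume "(\<integral>x. \<psi> x \<partial>lborel) = 0"
      then have "AE x in lborel. \<psi> x = 0" using integral_nonneg_eq_0_iff_AE[OF int] nonneg by auto
      then have "AE x in lborel. x \<notin> ball (0::'a) r" by (rule eventually_mono) (metis pos less_irrefl)
      then have "ball (0::'a) r \<in> null_sets lborel" using AE_iff_null_sets[of "ball (0::'a) r" lborel] by (metis open_ball borel_open sets_lborel)
      then have "emeasure lborel (ball (0::'a) r) = 0" by (rule null_setsD1)
      then show False using r unit_ball_vol_pos[of "real DIM('a)"] by (simp add: emeasure_ball[OF less_imp_le[OF r]] del: unit_ball_vol_pos)
    qed
    moreover have "0 \<le> (\<integral>x. \<psi> x \<partial>lborel)" using nonneg by (rule Bochner_Integration.integral_nonneg)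
    ultimately show ?thesis by linarith
  qed
  show "0 \<le> mollifier n x" unfolding eq using nonneg ipos by simp
  have z: "mollifier n x = 0" if "x \<notin> ball 0 r" for x :: 'a
    unfolding eq out[OF that] by simp
  then show "x \<notin> ball 0 (inverse (real (Suc n))) \<Longrightarrow> mollifier n x = 0"
    unfolding r_def .
  have se': "(mollifier n :: 'a \<Rightarrow> real) \<in> smooth_expr"
    unfolding eq[abs_def] divide_inverse by (intro smooth_expr.mult se smooth_expr.const)
  have "closure {x::'a. mollifier n x \<noteq> 0} \<subseteq> cball 0 r"
    using z ball_subset_cball[of 0 r] by (intro closure_minimal closed_cball) blast
  then have "compact (closure {x::'a. mollifier n x \<noteq> 0})"
    by (meson bounded_cball bounded_subset closed_closure compact_eq_bounded_closed)
  then show "test_fun UNIV (mollifier n :: 'a \<Rightarrow> real)"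
    unfolding test_fun_def using Ck_on_smooth_expr[OF se'] by simp
  show "integrable lborel (mollifier n :: 'a \<Rightarrow> real)" unfolding eq[abs_def] using int by simp
  show "(\<integral>x. mollifier n (x::'a) \<partial>lborel) = 1" unfolding eq using ipos by simp
qed


text \<open>The threshold \<open>m\<close> allows for a measure living on a compact set: there the
  mollifier centred at \<open>x\<close> has total mass one only after its support has shrunk into
  that set. Continuity is asked for at the single point \<open>x\<close>.\<close>

lemma convolution_LIMSEQ:
  fixes \<phi> :: "'a::euclidean_space \<Rightarrow> real"
  assumes id: "(\<lambda>y. y) \<in> measurable N borel" and \<phi>: "integrable N \<phi>"
    and one: "\<And>n. n \<ge> m \<Longrightarrow> integrable N (\<lambda>y. mollifier n (x - y))" "\<And>n. n \<ge> m \<Longrightarrow> (\<integral>y. mollifier n (x - y) \<partial>N) = 1"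
    and cont: "\<And>e. 0 < e \<Longrightarrow> \<exists>d>0. \<forall>y\<in>space N. dist y x < d \<longrightarrow> \<bar>\<phi> y - \<phi> x\<bar> \<le> e"
  shows "(\<lambda>n. \<integral>y. \<phi> y * mollifier n (x - y) \<partial>N) \<longlonglongrightarrow> \<phi> x"
proof (rule LIMSEQ_I)
  fix e :: real assume e: "0 < e"
  then obtain d where d: "d > 0" "\<And>y. y \<in> space N \<Longrightarrow> dist y x < d \<Longrightarrow> \<bar>\<phi> y - \<phi> x\<bar> \<le> e / 2"
    using cont[of "e / 2"] by auto
  obtain n1 where n1: "inverse (real (Suc n1)) < d" using reals_Archimedean[OF d(1)] by blast
  have "norm ((\<integral>y. \<phi> y * mollifier n (x - y) \<partial>N) - \<phi> x) < e" if n: "n \<ge> max m n1" for n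
  proof -
    have i1: "integrable N (\<lambda>y. mollifier n (x - y))" and i2: "(\<integral>y. mollifier n (x - y) \<partial>N) = 1"
      using one n by auto
    obtain B where B: "\<And>z::'a. \<bar>mollifier n z\<bar> \<le> B"
      using test_fun_bounded_derivatives(3)[OF mollifier(3), of "[]"] by auto
    have mm: "(\<lambda>y. mollifier n (x - y)) \<in> borel_measurable N" using i1 by simp
    have i3: "integrable N (\<lambda>y. \<phi> y * mollifier n (x - y))"
      by (rule integrable_on_mult_bounded[OF \<phi> mm B])
    have "inverse (real (Suc n)) \<le> inverse (real (Suc n1))" using n by (simp add: divide_simps)
    then have r: "inverse (real (Suc n)) < d" using n1 by linarith
    have "norm ((\<integral>y. \<phi> y * mollifier n (x - y) \<partial>N) - \<phi> x) = norm (\<integral>y. (\<phi> y - \<phi> x) * mollifier n (x - y) \<partial>N)"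
      using i1 i2 i3 by (simp add: left_diff_distrib)
    also have "\<dots> \<le> (\<integral>y. e / 2 * mollifier n (x - y) \<partial>N)"
    proof (rule Bochner_Integration.integral_norm_bound_integral)
      show "integrable N (\<lambda>y. (\<phi> y - \<phi> x) * mollifier n (x - y))" using i1 i3 by (simp add: left_diff_distrib)
      show "integrable N (\<lambda>y. e / 2 * mollifier n (x - y))" using i1 by simp
      fix y assume y: "y \<in> space N"
      show "norm ((\<phi> y - \<phi> x) * mollifier n (x - y)) \<le> e / 2 * mollifier n (x - y)"
      proof (cases "x - y \<in> ball 0 (inverse (real (Suc n)))")
        case True
        then have "dist y x < d" using r by (simp add: dist_norm norm_minus_commute)
        then show ?thesis using mult_right_mono[OF d(2)[OF y] mollifier(1)[of n "x - y"]] mollifier(1)[of n "x - y"] by (simp add: abs_mult)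
      next
        case False
        then show ?thesis unfolding mollifier(2)[OF False] by simp
      qed
    qed
    also have "\<dots> = e / 2" using i2 by simp
    finally show ?thesis using e by simp
  qed
  then show "\<exists>no. \<forall>n\<ge>no. norm ((\<integral>y. \<phi> y * mollifier n (x - y) \<partial>N) - \<phi> x) < e" by blast
qed

section \<open>Weak derivatives tested with C^1 functions\<close>

lemma integrable_lborel_diff:
  fixes f :: "'a::euclidean_space \<Rightarrow> 'b::{banach, second_countable_topology}"
  assumes f: "integrable lborel f"
  shows "integrable lborel (\<lambda>y. f (x - y))"
proof -
  have eq: "lborel = distr lborel borel (\<lambda>y. x - y)"
    by (subst lborel_affine[of "-1" x]) (simp_all add: density_1)
  have "integrable (distr lborel borel (\<lambda>y. x - y)) f" using f eq by simp
  then show ?thesis using f by (subst (asm) integrable_distr_eq) auto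
qed

lemma compact_thicken:
  fixes K :: "'a::euclidean_space set"
  assumes "compact K" "open \<Omega>" "K \<subseteq> \<Omega>"
  obtains e K' where "0 < e" "compact K'" "K' \<subseteq> \<Omega>" "\<And>x y. x \<in> K \<Longrightarrow> dist x y \<le> e \<Longrightarrow> y \<in> K'"
proof -
  obtain e where e: "e > 0" "(\<Union>x\<in>K. cball x e) \<subseteq> \<Omega>"
    using compact_subset_open_imp_cball_epsilon_subset assms by metis
  show thesis
  proof
    show "compact {x + y |x y. x \<in> K \<and> y \<in> cball 0 e}" by (intro compact_sums assms compact_cball)
    show "{x + y |x y. x \<in> K \<and> y \<in> cball 0 e} \<subseteq> \<Omega>"
      using e by (force simp: dist_norm)
    show "y \<in> {x + y |x y. x \<in> K \<and> y \<in> cball 0 e}" if "x \<in> K" "dist x y \<le> e" for x y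
      using that by (intro CollectI exI[of _ x] exI[of _ "y - x"]) (simp add: dist_norm norm_minus_commute)
  qed (rule e)
qed

lemma continuous_compact_support:
  fixes f :: "'a::euclidean_space \<Rightarrow> 'b::euclidean_space"
  assumes c: "continuous_on UNIV f" and K: "compact K" "\<And>x. x \<notin> K \<Longrightarrow> f x = 0"
  shows "\<exists>B\<ge>0. \<forall>x. norm (f x) \<le> B" "integrable lborel f"
proof -
  obtain B where "\<And>x. x \<in> K \<Longrightarrow> norm (f x) \<le> B"
    using compact_imp_bounded[OF compact_continuous_image[OF continuous_on_subset[OF c subset_UNIV] K(1)]]
    by (auto simp: bounded_iff)
  then have "norm (f x) \<le> max B 0" for x
    by (cases "x \<in> K") (auto simp: K(2) le_max_iff_disj)
  then show "\<exists>B\<ge>0. \<forall>x. norm (f x) \<le> B" by (intro exI[of _ "max B 0"]) auto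
  have "(\<lambda>x. indicator K x *\<^sub>R f x) = f" using K(2) by (auto simp: indicator_def fun_eq_iff)
  then show "integrable lborel f"
    using borel_integrable_compact[OF K(1) continuous_on_subset[OF c subset_UNIV]] by (simp add: set_integrable_def)
qed

text \<open>Weak derivatives are defined by smooth test functions, whereas the function v / P needed
  for the gradient formula is only C^1. The mollifications \<open>W n\<close> of \<open>w\<close>
  are admissible, their partial derivatives are the mollifications \<open>V n\<close> of
  \<open>D\<close>, and uniform bounds together with supports in one compact set \<open>K'\<close>
  let both sides pass to the limit.\<close>

lemma weak_partial_C1_test:
  fixes f g w :: "'a::euclidean_space \<Rightarrow> real"
  assumes \<Omega>: "open \<Omega>" and b: "b \<in> Basis" and wp: "weak_partial \<Omega> [b] f g"
    and w: "\<And>x. (w has_derivative (\<lambda>h. D x \<bullet> h)) (at x)" and D: "continuous_on UNIV D"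
    and K: "compact K" "K \<subseteq> \<Omega>" "\<And>x. x \<notin> K \<Longrightarrow> w x = 0"
  shows "(\<integral>x. f x * (D x \<bullet> b) \<partial>lebesgue_on \<Omega>) = - (\<integral>x. g x * w x \<partial>lebesgue_on \<Omega>)"
proof -
  have \<Omega>m: "\<Omega> \<in> sets lebesgue" using \<Omega> by simp
  have D0: "D x = 0" if "x \<notin> K" for x
  proof -
    have "(w has_derivative (\<lambda>h. 0)) (at x)"
      by (rule has_derivative_transform_within_open[where f="\<lambda>x. 0" and s="- K"])
        (use K that in \<open>auto simp: compact_imp_closed\<close>)
    then have "(\<bullet>) (D x) = (\<lambda>h. 0)" using has_derivative_unique[OF w[of x]] by blast
    then show ?thesis by (metis inner_eq_zero_iff)
  qed
  have wc: "continuous_on UNIV w" by (rule has_derivative_continuous_on, rule has_derivative_at_withinI, rule w)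
  have Dbc: "continuous_on UNIV (\<lambda>x. D x \<bullet> b)" using D by (intro continuous_intros)
  obtain B0 where B0: "0 \<le> B0" "\<And>x. norm (w x) \<le> B0"
    using continuous_compact_support(1)[OF wc K(1,3)] by blast
  obtain B1 where B1: "0 \<le> B1" "\<And>x. norm (D x) \<le> B1"
    using continuous_compact_support(1)[OF D K(1) D0] by blast
  have wi: "integrable lborel w" using continuous_compact_support(2)[OF wc K(1,3)] .
  have Di: "integrable lborel (\<lambda>x. D x \<bullet> b)" by (rule continuous_compact_support(2)[OF Dbc K(1)]) (simp add: D0)
  obtain e K' where e: "0 < e" and K': "compact K'" "K' \<subseteq> \<Omega>" "\<And>x y. x \<in> K \<Longrightarrow> dist x y \<le> e \<Longrightarrow> y \<in> K'"
    using compact_thicken[OF K(1) \<Omega> K(2)] by metis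
  obtain n0 where n0: "inverse (real (Suc n0)) < e" using reals_Archimedean[OF e] by blast
  define W where "W n x = (\<integral>y. w y * mollifier n (x - y) \<partial>lborel)" for n x
  define V where "V n x = (\<integral>y. (D y \<bullet> b) * mollifier n (x - y) \<partial>lborel)" for n x
  have moll_int: "integrable lborel (\<lambda>y. mollifier n (x - y))" for n and x :: 'a
    by (rule integrable_lborel_diff[OF mollifier(4)])
  have moll_cont: "continuous_on UNIV (mollifier n :: 'a \<Rightarrow> real)" for n
    using test_fun_bounded_derivatives(1)[OF mollifier(3), of "[]"] by simp
  have moll_m: "(mollifier n :: 'a \<Rightarrow> real) \<in> borel_measurable borel" for n
    by (rule borel_measurable_continuous_onI[OF moll_cont])
  have moll_one: "(\<integral>y. mollifier n (x - y) \<partial>lborel) = 1" for n and x :: 'a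
    using integral_lborel_diff[OF moll_m] mollifier(5) by simp
  have outside: "h y * mollifier n (x - y) = 0"
    if n: "n \<ge> n0" and x: "x \<notin> K'" and h: "\<And>y. y \<notin> K \<Longrightarrow> h y = 0" for n x y and h :: "'a \<Rightarrow> real"
  proof (cases "y \<in> K")
    case True
    have "inverse (real (Suc n)) \<le> inverse (real (Suc n0))" using n by (simp add: divide_simps)
    then have "inverse (real (Suc n)) < e" using n0 by linarith
    moreover have "dist y x > e" using K'(3)[OF True, of x] x by force
    ultimately have "x - y \<notin> ball 0 (inverse (real (Suc n)))" by (simp add: dist_norm norm_minus_commute)
    then show ?thesis using mollifier(2)[of "x - y" n] by simp
  qed (simp add: h)
  have W0: "W n x = 0" if "n \<ge> n0" "x \<notin> K'" for n x
  proof -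
    have "w y * mollifier n (x - y) = 0" for y by (rule outside[OF that K(3)])
    then show ?thesis unfolding W_def by (simp only: Bochner_Integration.integral_zero)
  qed
  have V0: "V n x = 0" if "n \<ge> n0" "x \<notin> K'" for n x
  proof -
    have "(D y \<bullet> b) * mollifier n (x - y) = 0" for y
      by (rule outside[where h="\<lambda>y. D y \<bullet> b", OF that]) (simp add: D0)
    then show ?thesis unfolding V_def by (simp only: Bochner_Integration.integral_zero)
  qed
  have bound: "\<bar>\<integral>y. h y * mollifier n (x - y) \<partial>lborel\<bar> \<le> B"
    if h: "\<And>y. \<bar>h y\<bar> \<le> B" "integrable lborel h" for h B n and x :: 'a
  proof -
    have "norm (\<integral>y. h y * mollifier n (x - y) \<partial>lborel) \<le> (\<integral>y. B * mollifier n (x - y) \<partial>lborel)"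
    proof (rule Bochner_Integration.integral_norm_bound_integral)
      have "integrable lborel (\<lambda>y. mollifier n (x - y) * h y)"
        by (rule integrable_on_mult_bounded[OF moll_int _ h(1)]) (use h in simp)
      then show "integrable lborel (\<lambda>y. h y * mollifier n (x - y))" by (simp add: mult.commute)
      show "norm (h y * mollifier n (x - y)) \<le> B * mollifier n (x - y)" for y
        using mult_right_mono[OF h(1) mollifier(1)] mollifier(1)[of n "x - y"] by (simp add: abs_mult)
    qed (use moll_int in simp)
    then show ?thesis using moll_one by simp
  qed
  have WB: "\<bar>W n x\<bar> \<le> B0" for n x unfolding W_def using B0(2) wi by (intro bound) auto
  have VB: "\<bar>V n x\<bar> \<le> B1" for n x unfolding V_def 
  proof (rule bound[OF _ Di])
    show "\<bar>D y \<bullet> b\<bar> \<le> B1" for y using Cauchy_Schwarz_ineq2[of "D y" b] B1(2)[of y] b by simp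
  qed
  have Wder: "(W n has_derivative (\<lambda>h. (\<integral>z. mollifier n z *\<^sub>R D (x - z) \<partial>lborel) \<bullet> h)) (at x)"
    and Wint: "integrable lborel (\<lambda>z. mollifier n z *\<^sub>R D (x - z))" for n x
  proof -
    \<comment> \<open>The substitution carries \<open>x\<close> from the mollifier over to
      \<open>w\<close>. The derivative then falls on \<open>w\<close> and produces the mollified
      gradient instead of a derivative of the mollifier.\<close>
    have W': "W n x = (\<integral>z. mollifier n z * w (x - z) \<partial>lborel)" for x
    proof -
      have "(\<lambda>y. w y * mollifier n (x - y)) \<in> borel_measurable borel"
        using borel_measurable_continuous_onI[OF wc] moll_m[of n] by measurable
      from integral_lborel_diff[OF this, of x] show ?thesis by (simp add: W_def mult.commute)
    qed
    note leibniz = has_derivative_integral[of 1 x lborel, where f="\<lambda>x z. mollifier n z * w (x - z)" and D="\<lambda>x z. mollifier n z *\<^sub>R D (x - z)"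
      and g="\<lambda>z. mollifier n z * B1"]
    have 1: "((\<lambda>x. mollifier n z * w (x - z)) has_derivative (\<lambda>h. (mollifier n z *\<^sub>R D (u - z)) \<bullet> h)) (at u)" for z u
    proof -
      have "((\<lambda>x. w (x - z)) has_derivative (\<lambda>h. D (u - z) \<bullet> h)) (at u)"
        by (rule has_derivative_compose[OF _ w, of "\<lambda>x. x - z" "\<lambda>h. h"]) (auto intro!: derivative_eq_intros)
      from has_derivative_mult_right[OF this, of "mollifier n z"] show ?thesis by simp
    qed
    have 2: "integrable lborel (\<lambda>z. mollifier n z * w (u - z))" for u
      by (rule integrable_on_mult_bounded[OF mollifier(4), where B=B0])
        (use borel_measurable_continuous_onI[OF wc] B0(2) in auto)
    have 3: "(\<lambda>z. mollifier n z *\<^sub>R D (x - z)) \<in> borel_measurable lborel"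
      using borel_measurable_continuous_onI[OF D] moll_m[of n] by measurable
    have 4: "norm (mollifier n z *\<^sub>R D (u - z)) \<le> mollifier n z * B1" for u z
      using B1(2)[of "u - z"] mollifier(1)[of n z] by (auto intro: mult_left_mono)
    have 5: "integrable lborel (\<lambda>z. mollifier n (z::'a) * B1)" by (intro integrable_mult_left mollifier(4))
    show "(W n has_derivative (\<lambda>h. (\<integral>z. mollifier n z *\<^sub>R D (x - z) \<partial>lborel) \<bullet> h)) (at x)"
      unfolding W'[abs_def] by (rule leibniz(1)[OF zero_less_one 1 2 3 4 5])
    show "integrable lborel (\<lambda>z. mollifier n z *\<^sub>R D (x - z))" by (rule leibniz(2)[OF zero_less_one 1 2 3 4 5])
  qed
  have part: "iter_partial [b] (W n) x = V n x" for n x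
  proof -
    have "iter_partial [b] (W n) x = (\<integral>z. mollifier n z *\<^sub>R D (x - z) \<partial>lborel) \<bullet> b"
      using frechet_derivative_inner[OF Wder] by simp
    also have "\<dots> = (\<integral>z. mollifier n z * (D (x - z) \<bullet> b) \<partial>lborel)"
      using Wint[of n x] by (simp flip: integral_inner_left)
    also have "\<dots> = V n x"
    proof -
      have "(\<lambda>y. (D y \<bullet> b) * mollifier n (x - y)) \<in> borel_measurable borel"
        using borel_measurable_continuous_onI[OF Dbc] moll_m[of n] by measurable
      from integral_lborel_diff[OF this, of x] show ?thesis by (simp add: V_def mult.commute)
    qed
    finally show ?thesis .
  qed
  have test: "test_fun \<Omega> (W n)" if n: "n \<ge> n0" for n
  proof -
    have "Ck_on \<infinity> UNIV (W n)"
      unfolding W_def[abs_def] by (rule Ck_on_convolution[OF wi _ mollifier(3)]) simp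
    moreover have "closure {x. W n x \<noteq> 0} \<subseteq> K'"
      using W0[OF n] K'(1) by (intro closure_minimal) (auto simp: compact_imp_closed)
    moreover from this have "compact (closure {x. W n x \<noteq> 0})"
      by (meson K'(1) bounded_subset closed_closure compact_eq_bounded_closed)
    ultimately show ?thesis unfolding test_fun_def using K'(2) by auto
  qed
  have Wm: "W n \<in> borel_measurable borel" for n
    by (rule borel_measurable_continuous_onI, rule has_derivative_continuous_on, rule has_derivative_at_withinI, rule Wder)
  have Vm: "V n \<in> borel_measurable borel" if "n \<ge> n0" for n
  proof -
    have "continuous_on UNIV (iter_partial [b] (W n))"
      using test[OF that] b unfolding test_fun_def Ck_on_def by (auto dest: bspec[where x="[b]"] simp del: iter_partial.simps)
    moreover have "iter_partial [b] (W n) = V n" using part by (rule ext)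
    ultimately show ?thesis by (intro borel_measurable_continuous_onI) (simp only:)
  qed
  have f: "L1_loc \<Omega> f" and g: "L1_loc \<Omega> g" using wp by (auto simp: weak_partial_def)
  have conv: "(\<lambda>n. \<integral>x. h x * Z (n + n0) x \<partial>lebesgue_on \<Omega>) \<longlonglongrightarrow> (\<integral>x. h x * z x \<partial>lebesgue_on \<Omega>)"
    if h: "L1_loc \<Omega> h" and Z: "\<And>n. n \<ge> n0 \<Longrightarrow> Z n \<in> borel_measurable borel" "\<And>n x. \<bar>Z n x\<bar> \<le> B" "0 \<le> B"
      "\<And>n x. n \<ge> n0 \<Longrightarrow> x \<notin> K' \<Longrightarrow> Z n x = 0" and z: "\<And>x. (\<lambda>n. Z n x) \<longlonglongrightarrow> z x" for h z :: "'a \<Rightarrow> real" and Z B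
  proof (rule integral_dominated_convergence[where w="\<lambda>x. B * \<bar>h x * indicator K' x\<bar>"])
    have hz: "integrable (lebesgue_on \<Omega>) (\<lambda>x. h x * Z (n + n0) x)" for n
      by (rule L1_loc_integrable_mult[OF h \<Omega>m K'(1,2) Z(1,2,4)]) auto
    show lim: "AE x in lebesgue_on \<Omega>. (\<lambda>n. h x * Z (n + n0) x) \<longlonglongrightarrow> h x * z x"
      by (intro AE_I2 tendsto_intros LIMSEQ_ignore_initial_segment[OF z])
    show "(\<lambda>x. h x * Z (n + n0) x) \<in> borel_measurable (lebesgue_on \<Omega>)" for n using hz by simp
    show "(\<lambda>x. h x * z x) \<in> borel_measurable (lebesgue_on \<Omega>)"
      by (rule borel_measurable_LIMSEQ_real[where u="\<lambda>n x. h x * Z (n + n0) x"])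
        (use hz in \<open>auto intro!: tendsto_intros LIMSEQ_ignore_initial_segment[OF z]\<close>)
    have "integrable (lebesgue_on \<Omega>) (\<lambda>x. h x * indicator K' x)"
    proof (rule L1_loc_integrable_mult[OF h \<Omega>m K'(1,2), where B=1])
      show "indicator K' \<in> borel_measurable borel"
        by (rule borel_measurable_indicator) (simp add: K'(1) compact_imp_closed)
    qed (auto simp: indicator_def)
    then show "integrable (lebesgue_on \<Omega>) (\<lambda>x. B * \<bar>h x * indicator K' x\<bar>)" by simp
    show "AE x in lebesgue_on \<Omega>. norm (h x * Z (n + n0) x) \<le> B * \<bar>h x * indicator K' x\<bar>" for n
    proof (rule AE_I2)
      fix x
      show "norm (h x * Z (n + n0) x) \<le> B * \<bar>h x * indicator K' x\<bar>"
        using Z(2)[of "n + n0" x] Z(4)[of "n + n0" x]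
        by (cases "x \<in> K'") (auto simp: abs_mult mult.commute[of "\<bar>h x\<bar>"] intro!: mult_right_mono)
    qed
  qed
  have pw: "(\<lambda>n. \<integral>y. h y * mollifier n (x - y) \<partial>lborel) \<longlonglongrightarrow> h x"
    if h: "continuous_on UNIV h" "integrable lborel h" for h and x :: 'a
  proof (rule convolution_LIMSEQ[where m=0])
    show "\<exists>d>0. \<forall>y\<in>space lborel. dist y x < d \<longrightarrow> \<bar>h y - h x\<bar> \<le> e" if "0 < e" for e
    proof -
      obtain d where "d > 0" "\<And>y. dist y x < d \<Longrightarrow> dist (h y) (h x) < e"
        using h(1) \<open>0 < e\<close> unfolding continuous_on_iff by (meson UNIV_I)
      then show ?thesis by (intro exI[of _ d]) (auto simp: dist_real_def intro: less_imp_le)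
    qed
  qed (use h moll_int moll_one in auto)
  have limV: "(\<lambda>n. \<integral>x. f x * V (n + n0) x \<partial>lebesgue_on \<Omega>) \<longlonglongrightarrow> (\<integral>x. f x * (D x \<bullet> b) \<partial>lebesgue_on \<Omega>)"
    by (rule conv[OF f Vm VB B1(1) V0]) (auto simp only: V_def intro!: pw Dbc Di)
  have limW: "(\<lambda>n. \<integral>x. g x * W (n + n0) x \<partial>lebesgue_on \<Omega>) \<longlonglongrightarrow> (\<integral>x. g x * w x \<partial>lebesgue_on \<Omega>)"
    by (rule conv[OF g Wm WB B0(1) W0]) (auto simp only: W_def intro!: pw wc wi)
  have "(\<integral>x. f x * V (n + n0) x \<partial>lebesgue_on \<Omega>) = - (\<integral>x. g x * W (n + n0) x \<partial>lebesgue_on \<Omega>)" for n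
  proof -
    have "(\<integral>x. f x * iter_partial [b] (W (n + n0)) x \<partial>lebesgue_on \<Omega>) = (-1) ^ length [b] * (\<integral>x. g x * W (n + n0) x \<partial>lebesgue_on \<Omega>)"
      using wp test[of "n + n0"] unfolding weak_partial_def by (metis le_add2)
    then show ?thesis unfolding part by simp
  qed
  with tendsto_minus[OF limW] have "(\<lambda>n. \<integral>x. f x * V (n + n0) x \<partial>lebesgue_on \<Omega>) \<longlonglongrightarrow> - (\<integral>x. g x * w x \<partial>lebesgue_on \<Omega>)"
    by simp
  with limV show ?thesis by (rule LIMSEQ_unique)
qed

text \<open>By translation invariance every difference quotient has integral zero. The bound on the
  derivative dominates the quotients on a ball of radius R + 1, the step being at most 1. This route
  works from a bounded derivative alone, which is what the regularised kernels below
  provide.\<close>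

lemma integral_partial_eq_0:
  fixes F :: "'a::euclidean_space \<Rightarrow> real"
  assumes F: "\<And>x. (F has_derivative D x) (at x)" and B: "\<And>x. \<bar>D x b\<bar> \<le> B"
    and R: "\<And>x. R < norm x \<Longrightarrow> F x = 0" and b: "norm b = 1"
  shows "(\<integral>x. D x b \<partial>lborel) = 0"
proof -
  define t where "t n = inverse (real (Suc n))" for n
  have t: "0 < t n" "t n \<le> 1" for n by (auto simp: t_def divide_simps)
  have Fc: "continuous_on UNIV F" by (rule has_derivative_continuous_on, rule has_derivative_at_withinI, rule F)
  have Fm: "F \<in> borel_measurable borel" by (rule borel_measurable_continuous_onI[OF Fc])
  have Fi: "integrable lborel F"
    by (rule continuous_compact_support(2)[OF Fc compact_cball[of 0 R]]) (use R in auto)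
  have shift: "integrable lborel (\<lambda>x. F (x + c))" "(\<integral>x. F (x + c) \<partial>lborel) = (\<integral>x. F x \<partial>lborel)" for c
  proof -
    have eq: "lborel = distr lborel borel ((+) c)" by (rule lborel_distr_plus[symmetric])
    have "integrable (distr lborel borel ((+) c)) F" using Fi eq by simp
    then show "integrable lborel (\<lambda>x. F (x + c))"
      using Fm by (subst (asm) integrable_distr_eq) (auto simp: add.commute)
    have "(\<integral>x. F x \<partial>lborel) = (\<integral>x. F x \<partial>distr lborel borel ((+) c))" using eq by simp
    also have "\<dots> = (\<integral>x. F (x + c) \<partial>lborel)" using Fm by (subst integral_distr) (auto simp: add.commute)
    finally show "(\<integral>x. F (x + c) \<partial>lborel) = (\<integral>x. F x \<partial>lborel)" ..
  qed
  have along: "((\<lambda>s. F (x + s *\<^sub>R b)) has_real_derivative D (x + s *\<^sub>R b) b) (at s)" for x s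
  proof -
    have "((\<lambda>s. F (x + s *\<^sub>R b)) has_derivative (\<lambda>h. D (x + s *\<^sub>R b) (h *\<^sub>R b))) (at s)"
      by (rule has_derivative_compose[OF _ F]) (auto intro!: derivative_eq_intros)
    moreover have "D y (h *\<^sub>R b) = h * D y b" for y h
      using linear_cmul[OF has_derivative_linear[OF F]] by simp
    ultimately show ?thesis by (simp add: has_field_derivative_def mult_commute_abs)
  qed
  have quot: "\<bar>(F (x + t n *\<^sub>R b) - F x) / t n\<bar> \<le> B" for x n
  proof -
    have "norm (F (x + t n *\<^sub>R b) - F (x + 0 *\<^sub>R b)) \<le> B * norm (t n - 0)"
      by (rule field_differentiable_bound[where S=UNIV]) (auto intro: along B)
    then show ?thesis using t(1)[of n] by (simp add: field_simps abs_divide)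
  qed
  have "(\<lambda>n. \<integral>x. (F (x + t n *\<^sub>R b) - F x) / t n \<partial>lborel) \<longlonglongrightarrow> (\<integral>x. D x b \<partial>lborel)"
  proof (rule integral_dominated_convergence[where w="\<lambda>x. B * indicator (cball 0 (R + 1)) x"])
    have lim: "(\<lambda>n. (F (x + t n *\<^sub>R b) - F x) / t n) \<longlonglongrightarrow> D x b" for x
    proof -
      have "((\<lambda>h. (F (x + h *\<^sub>R b) - F x) / h) \<longlongrightarrow> D x b) (at 0)"
        using along[of x 0] by (simp add: has_field_derivative_iff)
      moreover have "t \<longlonglongrightarrow> 0" unfolding t_def by (rule LIMSEQ_inverse_real_of_nat)
      moreover have "t n \<noteq> 0" for n using t(1)[of n] by simp
      ultimately show ?thesis unfolding tendsto_at_iff_sequentially by (auto simp: o_def)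
    qed
    then show "AE x in lborel. (\<lambda>n. (F (x + t n *\<^sub>R b) - F x) / t n) \<longlonglongrightarrow> D x b" by simp
    show mn: "(\<lambda>x. (F (x + t n *\<^sub>R b) - F x) / t n) \<in> borel_measurable lborel" for n
      using Fm by measurable
    show "(\<lambda>x. D x b) \<in> borel_measurable lborel"
      by (rule borel_measurable_LIMSEQ_real[OF lim mn])
    show "integrable lborel (\<lambda>x. B * indicator (cball (0::'a) (R + 1)) x)"
      by (intro integrable_mult_right integrable_real_indicator)
        (auto simp flip: infinity_ennreal_def intro: emeasure_bounded_finite)
    show "AE x in lborel. norm ((F (x + t n *\<^sub>R b) - F x) / t n) \<le> B * indicator (cball 0 (R + 1)) x" for n
    proof (rule AE_I2)
      fix x
      show "norm ((F (x + t n *\<^sub>R b) - F x) / t n) \<le> B * indicator (cball 0 (R + 1)) x"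
      proof (cases "norm x \<le> R + 1")
        case True
        then show ?thesis using quot[of x n] by simp
      next
        case False
        have "norm x \<le> norm (x + t n *\<^sub>R b) + norm (t n *\<^sub>R b)" by (metis add_diff_cancel norm_triangle_ineq4)
        then have "norm (x + t n *\<^sub>R b) > R" using False t[of n] b by simp
        then show ?thesis using False R[of "x + t n *\<^sub>R b"] R[of x] by simp
      qed
    qed
  qed
  moreover have "(\<lambda>n. \<integral>x. (F (x + t n *\<^sub>R b) - F x) / t n \<partial>lborel) = (\<lambda>n. 0)"
    using shift Fi by (simp add: fun_eq_iff)
  ultimately have "(\<lambda>n. 0 :: real) \<longlonglongrightarrow> (\<integral>x. D x b \<partial>lborel)" by (simp only:)
  from LIMSEQ_unique[OF this tendsto_const] show ?thesis .
qed

section \<open>Functions with bounded weak second derivatives\<close>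

lemma iter_partial_reflect:
  fixes v :: "'a::euclidean_space \<Rightarrow> real"
  assumes v: "test_fun UNIV v" and bs: "bs \<in> lists Basis"
  shows "iter_partial bs (\<lambda>y. v (x - y)) = (\<lambda>y. (-1) ^ length bs * iter_partial bs v (x - y))"
    and "(\<lambda>y. iter_partial bs v (x - y)) differentiable (at y)"
proof -
  have der: "\<exists>E. ((\<lambda>y. c * iter_partial bs v (x - y)) has_derivative (\<lambda>h. E \<bullet> h)) (at y) \<and>
      (\<forall>b\<in>Basis. E \<bullet> b = - c * iter_partial (b # bs) v (x - y))" if bs': "bs \<in> lists Basis" for bs c y
  proof -
    obtain D where D: "\<And>x::'a. (iter_partial bs v has_derivative (\<lambda>h. D x \<bullet> h)) (at x)"
      "\<And>x b. b \<in> Basis \<Longrightarrow> D x \<bullet> b = iter_partial [b] (iter_partial bs v) x"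
      using test_fun_has_derivative[OF test_fun_bounded_derivatives(2)[OF v bs']] by metis
    have "((\<lambda>y. iter_partial bs v (x - y)) has_derivative (\<lambda>h. D (x - y) \<bullet> (- h))) (at y)"
      by (rule has_derivative_compose[OF _ D(1), of "\<lambda>y. x - y"]) (auto intro!: derivative_eq_intros)
    from has_derivative_mult_right[OF this, of c] show ?thesis
      by (intro exI[of _ "- c *\<^sub>R D (x - y)"]) (simp add: D(2))
  qed
  show "iter_partial bs (\<lambda>y. v (x - y)) = (\<lambda>y. (-1) ^ length bs * iter_partial bs v (x - y))"
    using bs
  proof (induction bs)
    case (Cons b bs)
    show ?case
    proof
      fix y
      obtain E where E: "((\<lambda>y. (-1) ^ length bs * iter_partial bs v (x - y)) has_derivative (\<lambda>h. E \<bullet> h)) (at y)"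
        "\<forall>b\<in>Basis. E \<bullet> b = - ((-1) ^ length bs) * iter_partial (b # bs) v (x - y)"
        using der[of bs "(-1) ^ length bs" y] Cons by auto
      then show "iter_partial (b # bs) (\<lambda>y. v (x - y)) y = (-1) ^ length (b # bs) * iter_partial (b # bs) v (x - y)"
        using Cons frechet_derivative_inner[OF E(1), of b] by auto
    qed
  qed simp
  show "(\<lambda>y. iter_partial bs v (x - y)) differentiable (at y)"
    using der[OF bs, of 1 y] by (auto simp: differentiable_def)
qed

lemma test_fun_reflect:
  assumes v: "test_fun UNIV v" "\<And>z. z \<notin> cball 0 e \<Longrightarrow> v z = 0" and e: "cball x e \<subseteq> \<Omega>"
  shows "test_fun \<Omega> (\<lambda>y. v (x - y))"
proof -
  have diff: "iter_partial bs (\<lambda>y. v (x - y)) differentiable_on UNIV" if "bs \<in> lists Basis" for bs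
  proof -
    have "(\<lambda>y. (-1) ^ length bs * iter_partial bs v (x - y)) differentiable (at y)" for y
      using iter_partial_reflect(2)[OF v(1) that, of x y] by (intro differentiable_mult) auto
    then show ?thesis unfolding iter_partial_reflect(1)[OF v(1) that] differentiable_on_def by simp
  qed
  then have "Ck_on \<infinity> UNIV (\<lambda>y. v (x - y))"
    unfolding Ck_on_def by (auto intro: differentiable_imp_continuous_on)
  moreover have c: "closure {y. v (x - y) \<noteq> 0} \<subseteq> cball x e"
  proof (intro closure_minimal closed_cball subsetI)
    fix y assume "y \<in> {y. v (x - y) \<noteq> 0}"
    then have "x - y \<in> cball 0 e" using v(2) by blast
    then show "y \<in> cball x e" by (simp add: dist_norm norm_minus_commute)
  qed
  moreover have "compact (closure {y. v (x - y) \<noteq> 0})"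
    using c by (meson bounded_cball bounded_subset closed_closure compact_eq_bounded_closed)
  ultimately show ?thesis using e unfolding test_fun_def by auto
qed

text \<open>Move from \<open>y\<close> by the distance t = |x - y| in the direction of D x - D y.
  Comparing the expansions of f z about \<open>x\<close> and about \<open>y\<close>, and that of f y
  about \<open>x\<close>, leaves errors 4, 1 and 1 times L t^2, hence the 6. With both points in the
  ball of radius r / 3, the point z is still in the ball of radius r.\<close>

lemma gradient_lipschitz_of_taylor:
  fixes f :: "'a::euclidean_space \<Rightarrow> real"
  assumes tay: "\<And>x z. x \<in> ball c r \<Longrightarrow> z \<in> ball c r \<Longrightarrow> \<bar>f z - f x - D x \<bullet> (z - x)\<bar> \<le> L * (norm (z - x))\<^sup>2"
    and xy: "x \<in> ball c (r / 3)" "y \<in> ball c (r / 3)"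
  shows "norm (D x - D y) \<le> 6 * L * norm (x - y)"
proof (cases "x = y")
  case False
  define t where "t = norm (x - y)"
  \<comment> \<open>If the two gradients agree, \<open>e\<close> is 0 by the convention for
    division, and the claims about it below remain true.\<close>
  define e where "e = (D x - D y) /\<^sub>R norm (D x - D y)"
  have t: "t > 0" and e: "norm e \<le> 1" using False by (cases "D x = D y"; simp add: t_def e_def)+
  have ee: "(D x - D y) \<bullet> e = norm (D x - D y)"
    by (cases "D x = D y") (simp_all add: e_def dot_square_norm power2_eq_square)
  have "0 \<le> dist c x" "dist c x < r / 3" using xy(1) by auto
  then have r: "r > 0" by linarith
  have yc: "norm (y - c) < r / 3" and xc: "norm (x - c) < r / 3"
    using xy by (auto simp: dist_norm norm_minus_commute)
  have "t \<le> norm (x - c) + norm (y - c)" unfolding t_def by (metis norm_triangle_ineq4 diff_diff_eq2 diff_add_cancel add_diff_cancel_right' add_diff_eq diff_diff_add)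
  then have t2: "t < 2 * r / 3" using xc yc by simp
  define z where "z = y + t *\<^sub>R e"
  have "norm (z - c) \<le> norm (y - c) + norm (t *\<^sub>R e)"
    unfolding z_def by (metis add_diff_eq add.commute norm_triangle_ineq add_diff_cancel_left diff_add_eq)
  moreover have "norm (t *\<^sub>R e) \<le> t" using t e by simp
  ultimately have "norm (z - c) < r" using yc t2 by linarith
  then have z: "z \<in> ball c r" by (simp add: dist_norm norm_minus_commute)
  have x: "x \<in> ball c r" and y: "y \<in> ball c r" using xy r by auto
  have zy: "norm (z - y) \<le> t" using t e by (simp add: z_def)
  have yx: "norm (y - x) = t" by (simp add: t_def norm_minus_commute)
  have "norm (z - x) \<le> norm (z - y) + norm (y - x)" by (metis norm_triangle_ineq diff_add_cancel add_diff_eq)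
  then have zx: "norm (z - x) \<le> 2 * t" using zy yx by simp
  have L: "0 \<le> L"
  proof -
    have "0 \<le> L * t\<^sup>2" using tay[OF x y] yx by (metis abs_ge_zero order_trans)
    then show ?thesis using t by (simp add: zero_le_mult_iff)
  qed
  have "(norm (z - x))\<^sup>2 \<le> (2 * t)\<^sup>2" using zx by (intro power_mono) auto
  then have a1: "\<bar>f z - f x - D x \<bullet> (z - x)\<bar> \<le> L * (4 * t\<^sup>2)"
    using tay[OF x z] L by (smt (verit) mult_left_mono power_mult_distrib four_x_squared)
  have "(norm (z - y))\<^sup>2 \<le> t\<^sup>2" using zy by (intro power_mono) auto
  then have a2: "\<bar>f z - f y - D y \<bullet> (z - y)\<bar> \<le> L * t\<^sup>2"
    using tay[OF y z] L by (meson mult_left_mono order_trans)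
  have a3: "\<bar>f y - f x - D x \<bullet> (y - x)\<bar> \<le> L * t\<^sup>2" using tay[OF x y] yx by simp
  have "(D x - D y) \<bullet> (z - y) = t * norm (D x - D y)"
    using ee by (simp add: z_def)
  moreover have "(D x - D y) \<bullet> (z - y) = D x \<bullet> (z - x) - D x \<bullet> (y - x) - D y \<bullet> (z - y)"
    by (simp add: algebra_simps)
  ultimately have "t * norm (D x - D y) \<le> 6 * L * t\<^sup>2" using a1 a2 a3 by linarith
  then show ?thesis using t by (simp add: power2_eq_square t_def)
qed simp


text \<open>The reflected mollifier is an admissible test function, so a derivative on the mollifier
  is moved to the weak derivative \<open>g\<close>; the sign from the reflection cancels the one
  from the weak derivative. Since the mollifier has mass one, the bound M is independent of
  \<open>n\<close>. Multi-indices of length up to two control the mollified functions to second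
  order.\<close>

lemma mollifier_conv_bound:
  fixes f g :: "'a::euclidean_space \<Rightarrow> real"
  assumes \<Omega>: "open \<Omega>" and wp: "weak_partial \<Omega> bs f g" and bs: "bs \<in> lists Basis"
    and M: "AE y in lebesgue_on \<Omega>. \<bar>g y\<bar> \<le> M"
    and K: "compact K" "cball x r \<subseteq> K" "K \<subseteq> \<Omega>" and r: "inverse (real (Suc n)) \<le> r"
  shows "\<bar>\<integral>y. f y * iter_partial bs (mollifier n) (x - y) \<partial>lebesgue_on K\<bar> \<le> M"
    and "integrable (lebesgue_on K) (\<lambda>y. mollifier n (x - y))" and "(\<integral>y. mollifier n (x - y) \<partial>lebesgue_on K) = 1"
proof -
  have \<Omega>m: "\<Omega> \<in> sets lebesgue" and Km: "K \<in> sets lebesgue"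
    using \<Omega> K(1) by (auto simp: compact_imp_closed)
  note m = mollifier(3)[of n, where 'a='a]
  have sup: "mollifier n z = 0" if "z \<notin> cball 0 r" for z :: 'a
    using that r by (intro mollifier(2)) auto
  then have "closure {z::'a. mollifier n z \<noteq> 0} \<subseteq> cball 0 r" by (intro closure_minimal closed_cball) blast
  then have sup': "iter_partial bs (mollifier n) z = 0" if "z \<notin> cball 0 r" for z :: 'a
    using test_fun_bounded_derivatives(4)[OF m bs] that by blast
  have out: "x - y \<notin> cball 0 r" if "y \<notin> K" for y using that K(2) norm_minus_commute[of x y] by (auto simp: dist_norm subset_iff)
  have test: "test_fun \<Omega> (\<lambda>y. mollifier n (x - y))"
    by (rule test_fun_reflect[OF m sup]) (use K in auto)
  have all: "integrable (lebesgue_on S) (\<lambda>y. mollifier n (x - y)) \<and> (\<integral>y. mollifier n (x - y) \<partial>lebesgue_on S) = 1"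
    if S: "K \<subseteq> S" "S \<in> sets lebesgue" for S
  proof -
    have eq: "(\<lambda>y. indicator S y *\<^sub>R mollifier n (x - y)) = (\<lambda>y. mollifier n (x - y))"
      using sup[OF out] S by (fastforce simp: fun_eq_iff indicator_def)
    have i: "integrable lborel (\<lambda>y. mollifier n (x - y))" by (rule integrable_lborel_diff[OF mollifier(4)])
    have "(\<integral>y. mollifier n (x - y) \<partial>lborel) = 1"
      using integral_lborel_diff[of "mollifier n" x] borel_measurable_integrable[OF mollifier(4)[where 'a='a]] mollifier(5) by simp
    then show ?thesis using i S(2)
      by (subst integrable_restrict_space, simp, subst integral_restrict_space, simp)
        (simp only: eq integrable_completion[OF borel_measurable_integrable[OF i]] integral_completion[OF borel_measurable_integrable[OF i]])
  qed
  show "integrable (lebesgue_on K) (\<lambda>y. mollifier n (x - y))" "(\<integral>y. mollifier n (x - y) \<partial>lebesgue_on K) = 1"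
    using all[OF order_refl Km] by auto
  have "(\<integral>y. f y * iter_partial bs (mollifier n) (x - y) \<partial>lebesgue_on K)
      = (\<integral>y. f y * iter_partial bs (mollifier n) (x - y) \<partial>lebesgue_on \<Omega>)"
    unfolding integrable_lebesgue_on_iff(2)[OF Km \<Omega>m K(3)]
    by (rule Bochner_Integration.integral_cong) (use sup'[OF out] in \<open>auto simp: indicator_def\<close>)
  also have "\<dots> = (-1) ^ length bs * (\<integral>y. f y * iter_partial bs (\<lambda>y. mollifier n (x - y)) y \<partial>lebesgue_on \<Omega>)"
    unfolding iter_partial_reflect(1)[OF m bs]
    by (subst integral_mult_right_zero[symmetric]) (simp add: mult.left_commute flip: power_mult_distrib mult.assoc power_add)
  also have "\<dots> = (\<integral>y. g y * mollifier n (x - y) \<partial>lebesgue_on \<Omega>)"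
    using wp test unfolding weak_partial_def by (simp flip: power_mult_distrib mult.assoc)
  finally have eq: "(\<integral>y. f y * iter_partial bs (mollifier n) (x - y) \<partial>lebesgue_on K) = \<dots>" .
  have "norm (\<integral>y. g y * mollifier n (x - y) \<partial>lebesgue_on \<Omega>) \<le> (\<integral>y. M * mollifier n (x - y) \<partial>lebesgue_on \<Omega>)"
  proof (rule order_trans[OF integral_norm_bound], rule integral_mono_AE')
    show ae: "AE y in lebesgue_on \<Omega>. norm (g y * mollifier n (x - y)) \<le> M * mollifier n (x - y)"
      using M
    proof eventually_elim
      case (elim y)
      from mult_right_mono[OF this mollifier(1)[of n "x - y"]] mollifier(1)[of n "x - y"]
      show ?case by (simp add: abs_mult)
    qed
    then show "AE y in lebesgue_on \<Omega>. 0 \<le> M * mollifier n (x - y)"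
      by eventually_elim (rule order_trans[OF norm_ge_zero])
  qed (use all[OF K(3) \<Omega>m] in simp)
  also have "\<dots> = M" using all[OF K(3) \<Omega>m] by simp
  finally show "\<bar>\<integral>y. f y * iter_partial bs (mollifier n) (x - y) \<partial>lebesgue_on K\<bar> \<le> M"
    unfolding eq by simp
qed

text \<open>The mollifications have second derivatives bounded uniformly in n, hence quadratic
  Taylor estimates with a common constant. Letting n tend to infinity keeps the estimate for
  \<open>f\<close>, and such an estimate around every point makes \<open>f\<close> differentiable
  with a locally Lipschitz gradient. Continuity of \<open>f\<close> selects the right
  representative, so that convergence holds at every point.\<close>

lemma W2inf_C1:
  fixes f :: "'a::euclidean_space \<Rightarrow> real"
  assumes \<Omega>: "open \<Omega>" and W: "W2inf \<Omega> f" and cont: "continuous_on \<Omega> f"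
  obtains D where "\<And>x. x \<in> \<Omega> \<Longrightarrow> (f has_derivative (\<lambda>h. D x \<bullet> h)) (at x)" "continuous_on \<Omega> D"
proof -
  have "\<exists>g M. weak_partial \<Omega> bs f g \<and> (AE y in lebesgue_on \<Omega>. \<bar>g y\<bar> \<le> M)" if "bs \<in> lists Basis" "length bs \<le> 2" for bs
    using W that unfolding W2inf_def Linf_on_def by blast
  then obtain g M where gM: "\<And>bs. bs \<in> lists Basis \<Longrightarrow> length bs \<le> 2 \<Longrightarrow> weak_partial \<Omega> bs f (g bs) \<and> (AE y in lebesgue_on \<Omega>. \<bar>g bs y\<bar> \<le> M bs)"
    by metis
  \<comment> \<open>The inner sums bound the gradient of each mollified partial derivative in the
    l^1 norm; their total bounds the Lipschitz constant of the whole mollified gradient.\<close>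
  define L where "L = (\<Sum>b\<in>Basis. \<Sum>c\<in>Basis. M [c, b])"
  define B1 where "B1 = (\<Sum>b\<in>Basis. M [b])"
  have local: "\<exists>r>0. ball c r \<subseteq> \<Omega> \<and> (\<forall>x\<in>ball c r. \<exists>d. \<forall>z\<in>ball c r. \<bar>f z - f x - d \<bullet> (z - x)\<bar> \<le> L * (norm (z - x))\<^sup>2)"
    if c: "c \<in> \<Omega>" for c
  proof -
    obtain s where s: "s > 0" "cball c s \<subseteq> \<Omega>" using \<Omega> c open_contains_cball by metis
    define r where "r = s / 2"
    define K where "K = cball c s"
    have r: "r > 0" and K: "compact K" "K \<subseteq> \<Omega>" using s by (auto simp: r_def K_def)
    have xK: "cball x r \<subseteq> K" if "x \<in> ball c r" for x
    proof
      fix y assume "y \<in> cball x r"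
      then have "dist c y \<le> r + r" using that dist_triangle[of c y x] by (simp add: dist_commute)
      then show "y \<in> K" by (simp add: K_def r_def)
    qed
    obtain n0 where n0: "inverse (real (Suc n0)) < r" using reals_Archimedean[OF r] by blast
    have nr: "inverse (real (Suc n)) \<le> r" if "n \<ge> n0" for n
    proof -
      have "inverse (real (Suc n)) \<le> inverse (real (Suc n0))" using that by (simp add: divide_simps)
      then show ?thesis using n0 by linarith
    qed
    have fi: "integrable (lebesgue_on K) f" using gM[of "[]"] K by (auto simp: weak_partial_def L1_loc_def)
    have idK: "(\<lambda>y. y) \<in> measurable (lebesgue_on K) borel" by (rule measurable_lebesgue_on_borel[of "\<lambda>y. y"]) simp
    define F where "F n x = (\<integral>y. f y * mollifier n (x - y) \<partial>lebesgue_on K)" for n x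
    have cb: "\<bar>\<integral>y. f y * iter_partial bs (mollifier n) (x - y) \<partial>lebesgue_on K\<bar> \<le> M bs"
      if "bs \<in> lists Basis" "length bs \<le> 2" "x \<in> ball c r" "n \<ge> n0" for bs x n
      using gM[OF that(1,2)] by (intro mollifier_conv_bound(1)[OF \<Omega> _ that(1) _ K(1) xK[OF that(3)] K(2) nr[OF that(4)]]) auto
    have "\<forall>n. \<exists>D. \<forall>x. (F n has_derivative (\<lambda>h. D x \<bullet> h)) (at x) \<and>
      (\<forall>b\<in>Basis. D x \<bullet> b = (\<integral>y. f y * iter_partial [b] (mollifier n) (x - y) \<partial>lebesgue_on K))"
      unfolding F_def[abs_def] by (rule allI, intro choice allI convolution_has_derivative[OF fi idK mollifier(3)])
    from choice[OF this] obtain D where DD: "\<forall>n x. (F n has_derivative (\<lambda>h. D n x \<bullet> h)) (at x) \<and>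
      (\<forall>b\<in>Basis. D n x \<bullet> b = (\<integral>y. f y * iter_partial [b] (mollifier n) (x - y) \<partial>lebesgue_on K))"
      by (elim exE)
    have D: "\<And>n x. (F n has_derivative (\<lambda>h. D n x \<bullet> h)) (at x)"
      "\<And>n x b. b \<in> Basis \<Longrightarrow> D n x \<bullet> b = (\<integral>y. f y * iter_partial [b] (mollifier n) (x - y) \<partial>lebesgue_on K)"
      using DD by (simp_all only:) 
    have DB: "norm (D n x) \<le> B1" if "x \<in> ball c r" "n \<ge> n0" for n x
    proof -
      have "norm (D n x) \<le> (\<Sum>b\<in>Basis. \<bar>D n x \<bullet> b\<bar>)" by (rule norm_le_l1)
      also have "\<dots> \<le> B1" unfolding B1_def
        using cb[OF _ _ that, of "[b]" for b] D(2) by (intro sum_mono) (auto simp del: iter_partial.simps)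
      finally show ?thesis .
    qed
    have lipb: "\<bar>D n x \<bullet> b - D n z \<bullet> b\<bar> \<le> (\<Sum>c\<in>Basis. M [c, b]) * norm (x - z)"
      if x: "x \<in> ball c r" and z: "z \<in> ball c r" and n: "n \<ge> n0" and b: "b \<in> Basis" for n x z b
    proof -
      define H where "H x = (\<integral>y. f y * iter_partial [b] (mollifier n) (x - y) \<partial>lebesgue_on K)" for x
      have test: "test_fun UNIV (iter_partial [b] (mollifier n :: 'a \<Rightarrow> real))"
        using test_fun_bounded_derivatives(2)[OF mollifier(3), of "[b]"] b by simp
      have "\<exists>E. \<forall>x. (H has_derivative (\<lambda>h. E x \<bullet> h)) (at x) \<and>
        (\<forall>c\<in>Basis. E x \<bullet> c = (\<integral>y. f y * iter_partial [c] (iter_partial [b] (mollifier n)) (x - y) \<partial>lebesgue_on K))"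
        unfolding H_def[abs_def] by (intro choice allI convolution_has_derivative[OF fi idK test])
      then obtain E where EE: "\<forall>x. (H has_derivative (\<lambda>h. E x \<bullet> h)) (at x) \<and>
        (\<forall>c\<in>Basis. E x \<bullet> c = (\<integral>y. f y * iter_partial [c] (iter_partial [b] (mollifier n)) (x - y) \<partial>lebesgue_on K))"
        by (elim exE)
      have E: "\<And>x. (H has_derivative (\<lambda>h. E x \<bullet> h)) (at x)"
        "\<And>x c. c \<in> Basis \<Longrightarrow> E x \<bullet> c = (\<integral>y. f y * iter_partial [c] (iter_partial [b] (mollifier n)) (x - y) \<partial>lebesgue_on K)"
        using EE by (simp_all only:)
      have app: "iter_partial [c] (iter_partial [b] v) = iter_partial [c, b] v" for c and v :: "'a \<Rightarrow> real" by simp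
      have EB: "norm (E y) \<le> (\<Sum>c\<in>Basis. M [c, b])" if "y \<in> ball c r" for y
      proof -
        have "norm (E y) \<le> (\<Sum>c\<in>Basis. \<bar>E y \<bullet> c\<bar>)" by (rule norm_le_l1)
        also have "\<dots> \<le> (\<Sum>c\<in>Basis. M [c, b])"
        proof (rule sum_mono)
          fix k :: 'a assume k: "k \<in> Basis"
          show "\<bar>E y \<bullet> k\<bar> \<le> M [k, b]"
            unfolding E(2)[OF k] app by (rule cb[OF _ _ that n]) (use k b in auto)
        qed
        finally show ?thesis .
      qed
      have "norm (H x - H z) \<le> (\<Sum>c\<in>Basis. M [c, b]) * norm (x - z)"
      proof (rule differentiable_bound[OF convex_ball _ _ x z])
        fix y assume y: "y \<in> ball c r"
        show "(H has_derivative (\<bullet>) (E y)) (at y within ball c r)" using E(1) by (rule has_derivative_at_withinI)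
        show "onorm ((\<bullet>) (E y)) \<le> (\<Sum>c\<in>Basis. M [c, b])"
          using onorm_inner_right[OF bounded_linear_ident, of "E y"] EB[OF y] by (simp add: onorm_id)
      qed
      then show ?thesis using D(2)[OF b, of n] by (simp add: H_def del: iter_partial.simps)
    qed
    have lip: "norm (D n x - D n z) \<le> L * norm (x - z)" if "x \<in> ball c r" "z \<in> ball c r" "n \<ge> n0" for n x z
    proof -
      have "norm (D n x - D n z) \<le> (\<Sum>b\<in>Basis. \<bar>(D n x - D n z) \<bullet> b\<bar>)" by (rule norm_le_l1)
      also have "\<dots> \<le> (\<Sum>b\<in>Basis. (\<Sum>c\<in>Basis. M [c, b]) * norm (x - z))"
        using lipb[OF that] by (intro sum_mono) (simp add: inner_diff_left)
      also have "\<dots> = L * norm (x - z)" by (simp add: L_def sum_distrib_right)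
      finally show ?thesis .
    qed
    have L0: "0 \<le> L * norm (x - z)" if "x \<in> ball c r" "z \<in> ball c r" for x z
      using lip[OF that order_refl] norm_ge_zero order_trans by blast
    have taylor: "\<bar>F n z - F n x - D n x \<bullet> (z - x)\<bar> \<le> L * (norm (z - x))\<^sup>2"
      if x: "x \<in> ball c r" and z: "z \<in> ball c r" and n: "n \<ge> n0" for n x z
    proof -
      have sub: "closed_segment x z \<subseteq> ball c r" using x z by (simp add: closed_segment_subset)
      have "norm (F n z - F n x - D n x \<bullet> (z - x)) \<le> norm (z - x) * (L * norm (z - x))"
      proof (rule differentiable_bound_linearization[where S="closed_segment x z" and f'="\<lambda>y h. D n y \<bullet> h"])
        show "x + t *\<^sub>R (z - x) \<in> closed_segment x z" if "t \<in> {0..1}" for t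
          using that by (auto simp: in_segment algebra_simps intro!: exI[of _ t])
        show "(F n has_derivative (\<bullet>) (D n y)) (at y within closed_segment x z)" for y
          using D(1) by (rule has_derivative_at_withinI)
        fix y assume y: "y \<in> closed_segment x z"
        have "norm (y - x) \<le> norm (z - x)" using segment_bound(1)[OF y] by simp
        moreover have y': "y \<in> ball c r" using y sub by blast
        moreover have "norm (D n y - D n x) \<le> L * norm (y - x)" by (rule lip[OF y' x n])
        ultimately have "norm (D n y - D n x) \<le> L * norm (z - x)"
        proof (cases "y = x")
          case False
          then have "0 \<le> L" using L0[OF y' x] by (simp add: zero_le_mult_iff)
          then show ?thesis using \<open>norm (y - x) \<le> _\<close> \<open>norm (D n y - D n x) \<le> _\<close> by (meson mult_left_mono order_trans)
        qed (use L0[OF z x] in simp)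
        then have "onorm (\<lambda>h. (D n y - D n x) \<bullet> h) \<le> L * norm (z - x)"
          using onorm_inner_right[OF bounded_linear_ident, of "D n y - D n x"] by (simp add: onorm_id)
        then show "onorm ((\<bullet>) (D n y) - (\<bullet>) (D n x)) \<le> L * norm (z - x)"
          by (simp add: inner_diff_left fun_diff_def)
      qed simp
      then show ?thesis by (simp add: power2_eq_square mult.left_commute)
    qed
    have lim: "(\<lambda>n. F n x) \<longlonglongrightarrow> f x" if x: "x \<in> ball c r" for x
      unfolding F_def
    proof (rule convolution_LIMSEQ[OF idK fi, where m=n0])
      have wp: "weak_partial \<Omega> [] f (g [])" "AE y in lebesgue_on \<Omega>. \<bar>g [] y\<bar> \<le> M []" using gM[of "[]"] by auto
      show "integrable (lebesgue_on K) (\<lambda>y. mollifier n (x - y))" "(\<integral>y. mollifier n (x - y) \<partial>lebesgue_on K) = 1" if "n0 \<le> n" for n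
        using mollifier_conv_bound(2,3)[OF \<Omega> wp(1) _ wp(2) K(1) xK[OF x] K(2) nr[OF that]] by auto
      fix e :: real assume e: "0 < e"
      have "x \<in> cball x r" using r by simp
      then have "x \<in> \<Omega>" using xK[OF x] K(2) by blast
      then obtain d where d: "d > 0" "\<And>y. y \<in> \<Omega> \<Longrightarrow> dist y x < d \<Longrightarrow> dist (f y) (f x) < e"
        using cont e unfolding continuous_on_iff by meson
      then show "\<exists>d>0. \<forall>y\<in>space (lebesgue_on K). dist y x < d \<longrightarrow> \<bar>f y - f x\<bar> \<le> e"
        using K(2) by (intro exI[of _ d]) (auto simp: dist_real_def intro!: less_imp_le)
    qed
    have "\<exists>d. \<forall>z\<in>ball c r. \<bar>f z - f x - d \<bullet> (z - x)\<bar> \<le> L * (norm (z - x))\<^sup>2" if x: "x \<in> ball c r" for x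
    proof -
      \<comment> \<open>Only the gradients at the one point \<open>x\<close> have to converge, and
        along a subsequence: the functions converge everywhere in the ball, which is enough for the
        Taylor estimate to pass to the limit.\<close>
      have "bounded (range (\<lambda>n. D (n + n0) x))" using DB[OF x] by (auto simp: bounded_iff intro!: exI[of _ B1])
      then obtain d s where s: "strict_mono (s :: nat \<Rightarrow> nat)" "((\<lambda>n. D (n + n0) x) \<circ> s) \<longlonglongrightarrow> d"
        using bounded_imp_convergent_subsequence by metis
      have "\<bar>f z - f x - d \<bullet> (z - x)\<bar> \<le> L * (norm (z - x))\<^sup>2" if z: "z \<in> ball c r" for z
      proof (rule LIMSEQ_le_const2)
        have sub: "(\<lambda>k. F (s k + n0) y) \<longlonglongrightarrow> f y" if "y \<in> ball c r" for y
          using LIMSEQ_subseq_LIMSEQ[OF LIMSEQ_ignore_initial_segment[OF lim[OF that], of n0] s(1)] by (simp add: o_def)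
        show "(\<lambda>k. \<bar>F (s k + n0) z - F (s k + n0) x - D (s k + n0) x \<bullet> (z - x)\<bar>) \<longlonglongrightarrow> \<bar>f z - f x - d \<bullet> (z - x)\<bar>"
          using s(2) by (intro tendsto_intros sub x z) (simp add: o_def)
        show "\<exists>N. \<forall>k\<ge>N. \<bar>F (s k + n0) z - F (s k + n0) x - D (s k + n0) x \<bullet> (z - x)\<bar> \<le> L * (norm (z - x))\<^sup>2"
          using taylor[OF x z] by auto
      qed
      then show ?thesis by blast
    qed
    moreover have "ball c r \<subseteq> \<Omega>" using s(2) r by (force simp: r_def)
    ultimately show ?thesis using r by blast
  qed
  define G where "G x = (\<Sum>b\<in>Basis. frechet_derivative f (at x) b *\<^sub>R b)" for x
  have der: "(f has_derivative (\<lambda>h. d \<bullet> h)) (at x)"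
    if r: "r > 0" and x: "x \<in> ball c r" and d: "\<And>z. z \<in> ball c r \<Longrightarrow> \<bar>f z - f x - d \<bullet> (z - x)\<bar> \<le> L * (norm (z - x))\<^sup>2" for c r x d
    unfolding has_derivative_within_alt2
  proof (intro conjI allI impI bounded_linear_inner_right)
    fix e :: real assume e: "0 < e"
    have "\<forall>\<^sub>F y in at x. y \<in> ball c r" using x by (intro eventually_at_in_open') auto
    moreover have "\<forall>\<^sub>F y in at x. dist y x < e / (\<bar>L\<bar> + 1)"
      using e by (auto simp: eventually_at intro!: exI[of _ "e / (\<bar>L\<bar> + 1)"])
    ultimately show "\<forall>\<^sub>F y in at x. norm (f y - f x - d \<bullet> (y - x)) \<le> e * norm (y - x)"
    proof eventually_elim
      fix y assume y: "y \<in> ball c r" "dist y x < e / (\<bar>L\<bar> + 1)"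
      have "L * norm (y - x) \<le> (\<bar>L\<bar> + 1) * norm (y - x)" by (intro mult_right_mono) auto
      also have "\<dots> \<le> e" using y(2) by (simp add: dist_norm field_simps)
      finally have "L * norm (y - x) * norm (y - x) \<le> e * norm (y - x)" by (rule mult_right_mono) simp
      then show "norm (f y - f x - d \<bullet> (y - x)) \<le> e * norm (y - x)"
        using d[OF y(1)] by (simp add: power2_eq_square mult.assoc)
    qed
  qed
  have derG: "(f has_derivative (\<lambda>h. G x \<bullet> h)) (at x)" if "f differentiable (at x)" for x
    unfolding G_def by (rule has_derivative_gradient[OF that])
  show thesis
  proof
    fix x assume "x \<in> \<Omega>"
    then obtain r d where "r > 0" "\<forall>z\<in>ball x r. \<bar>f z - f x - d \<bullet> (z - x)\<bar> \<le> L * (norm (z - x))\<^sup>2"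
      using local[of x] by (meson centre_in_ball)
    then show "(f has_derivative (\<lambda>h. G x \<bullet> h)) (at x)"
      using der[of r x x d] by (intro derG) (auto simp: differentiable_def)
  next
    show "continuous_on \<Omega> G"
      unfolding continuous_on_iff
    proof (intro ballI allI impI)
      fix x and e :: real assume x: "x \<in> \<Omega>" and e: "0 < e"
      obtain r where r: "r > 0" and loc: "\<And>y. y \<in> ball x r \<Longrightarrow> \<exists>d. \<forall>z\<in>ball x r. \<bar>f z - f y - d \<bullet> (z - y)\<bar> \<le> L * (norm (z - y))\<^sup>2"
        using local[OF x] by metis
      have G: "\<bar>f z - f y - G y \<bullet> (z - y)\<bar> \<le> L * (norm (z - y))\<^sup>2" if y: "y \<in> ball x r" and z: "z \<in> ball x r" for y z
      proof -
        obtain d where d: "\<And>z. z \<in> ball x r \<Longrightarrow> \<bar>f z - f y - d \<bullet> (z - y)\<bar> \<le> L * (norm (z - y))\<^sup>2" using loc[OF y] by blast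
        have f1: "(f has_derivative (\<lambda>h. d \<bullet> h)) (at y)" by (rule der[OF r y d])
        then have "(\<bullet>) d = (\<bullet>) (G y)"
          by (intro has_derivative_unique[OF f1] derG) (auto simp: differentiable_def)
        then show ?thesis using d[OF z] by metis
      qed
      show "\<exists>d>0. \<forall>x'\<in>\<Omega>. dist x' x < d \<longrightarrow> dist (G x') (G x) < e"
      proof (intro exI[of _ "min (r / 3) (e / (6 * \<bar>L\<bar> + 1))"] conjI ballI impI)
        fix y assume "dist y x < min (r / 3) (e / (6 * \<bar>L\<bar> + 1))"
        then have y: "dist y x < r / 3" "dist y x < e / (6 * \<bar>L\<bar> + 1)" by auto
        have "norm (G y - G x) \<le> 6 * L * norm (y - x)"
          by (rule gradient_lipschitz_of_taylor[OF G]) (use y r in \<open>auto simp: dist_commute\<close>)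
        also have "\<dots> \<le> (6 * \<bar>L\<bar> + 1) * norm (y - x)" by (intro mult_right_mono) auto
        also have "\<dots> < e" using y(2) by (simp add: dist_norm field_simps)
        finally show "dist (G y) (G x) < e" by (simp add: dist_norm)
      qed (use r e in auto)
    qed
  qed
qed

section \<open>Riesz kernels and the area of the sphere\<close>

text \<open>Dyadic decomposition: at distance between R / 2^(n+1) and R / 2^n the kernel is at most
  its value at the inner radius. The masses form a geometric series of ratio 2^(\<gamma> - d), which
  converges because \<gamma> < d.\<close>

lemma riesz_kernel_nn_integral:
  fixes \<gamma> :: real
  assumes \<gamma>: "0 \<le> \<gamma>" "\<gamma> < real DIM('a::euclidean_space)"
  shows "\<exists>C>0. \<forall>(x::'a) R. 0 < R \<longrightarrow>
    (\<integral>\<^sup>+z. ennreal (norm (x - z) powr (- \<gamma>)) * indicator (ball x R) z \<partial>lborel) \<le> ennreal (C * R powr (real DIM('a) - \<gamma>))"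
proof -
  define d where "d = real DIM('a)"
  define a where "a = (2::real) powr (\<gamma> - d)"
  define V where "V = unit_ball_vol d"
  have V: "V > 0" by (simp add: V_def d_def)
  have a: "0 < a" "a < 1" using \<gamma> by (auto simp: a_def d_def powr_less_one)
  define C where "C = V * 2 powr \<gamma> / (1 - a)"
  have "(\<integral>\<^sup>+z. ennreal (norm (x - z) powr (- \<gamma>)) * indicator (ball x R) z \<partial>lborel) \<le> ennreal (C * R powr (d - \<gamma>))"
    if R: "0 < R" for x :: 'a and R
  proof -
    define s where "s n = R / 2 ^ n" for n :: nat
    have s: "s n > 0" for n using R by (simp add: s_def)
    have pw: "ennreal (norm (x - z) powr (- \<gamma>)) * indicator (ball x R) z
        \<le> (\<Sum>n. ennreal (s (Suc n) powr (- \<gamma>)) * indicator (ball x (s n)) z)" for z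
    proof (cases "z \<in> ball x R \<and> z \<noteq> x")
      case True
      then have p: "0 < norm (x - z)" "norm (x - z) < R" by (auto simp: dist_norm)
      define m where "m = (LEAST m. R / 2 ^ m \<le> norm (x - z))"
      have "\<exists>m. R / 2 ^ m \<le> norm (x - z)"
      proof -
        have "0 < norm (x - z) / R" using p R by simp
        then obtain m where "(1 / 2 :: real) ^ m < norm (x - z) / R"
          using real_arch_pow_inv[of "norm (x - z) / R" "1 / 2"] by auto
        then show ?thesis using R by (intro exI[of _ m]) (simp add: field_simps power_divide)
      qed
      then have m: "R / 2 ^ m \<le> norm (x - z)" unfolding m_def by (rule LeastI_ex)
      have "m \<noteq> 0" using m p by (intro notI) simp
      then obtain n where n: "m = Suc n" by (cases m) auto
      have "\<not> R / 2 ^ n \<le> norm (x - z)" unfolding n[symmetric] using n m_def not_less_Least[of n "\<lambda>m. R / 2 ^ m \<le> norm (x - z)"] by auto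
      then have zn: "z \<in> ball x (s n)" by (simp add: s_def dist_norm)
      have "norm (x - z) powr (- \<gamma>) \<le> s (Suc n) powr (- \<gamma>)"
        using m n s[of "Suc n"] \<gamma> by (intro powr_mono2') (auto simp: s_def)
      then have "ennreal (norm (x - z) powr (- \<gamma>)) * indicator (ball x R) z \<le> ennreal (s (Suc n) powr (- \<gamma>)) * indicator (ball x (s n)) z"
        using zn True by (simp add: ennreal_leI)
      also have "\<dots> \<le> (\<Sum>n. ennreal (s (Suc n) powr (- \<gamma>)) * indicator (ball x (s n)) z)"
      proof -
        have "f n \<le> (\<Sum>n. f n)" for f :: "nat \<Rightarrow> ennreal" using sum_le_suminf[of f "{n}"] by simp
        then show ?thesis .
      qed
      finally show ?thesis .
    qed auto
    have summand: "(\<integral>\<^sup>+z. ennreal (s (Suc n) powr (- \<gamma>)) * indicator (ball x (s n)) z \<partial>lborel) = ennreal (V * 2 powr \<gamma> * R powr (d - \<gamma>) * a ^ n)" for n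
    proof -
      have "(\<integral>\<^sup>+z. ennreal (s (Suc n) powr (- \<gamma>)) * indicator (ball x (s n)) z \<partial>lborel) = ennreal (s (Suc n) powr (- \<gamma>)) * emeasure lborel (ball x (s n))"
        by (simp add: nn_integral_cmult_indicator)
      also have "\<dots> = ennreal (s (Suc n) powr (- \<gamma>)) * ennreal (V * s n powr d)"
        using s[of n] by (simp add: emeasure_ball V_def d_def powr_realpow)
      also have "\<dots> = ennreal (V * (s (Suc n) powr (- \<gamma>) * s n powr d))"
        by (simp add: ennreal_mult'' [symmetric] ennreal_mult[symmetric] V less_imp_le mult.left_commute)
      also have "s (Suc n) powr (- \<gamma>) * s n powr d = 2 powr \<gamma> * R powr (d - \<gamma>) * a ^ n"
      proof -
        have e: "s n = R * 2 powr (- real n)" "s (Suc n) = R * 2 powr (- real n - 1)" 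
          by (simp_all add: s_def powr_minus powr_realpow powr_diff field_simps)
        have "a ^ n = 2 powr ((\<gamma> - d) * real n)" unfolding a_def by (simp add: powr_powr[symmetric] powr_realpow)
        then show ?thesis unfolding e using R
          by (simp add: powr_mult powr_powr powr_add[symmetric] mult.assoc mult.left_commute algebra_simps)
      qed
      finally show ?thesis by (simp add: mult.assoc)
    qed
    have "(\<integral>\<^sup>+z. ennreal (norm (x - z) powr (- \<gamma>)) * indicator (ball x R) z \<partial>lborel)
       \<le> (\<integral>\<^sup>+z. (\<Sum>n. ennreal (s (Suc n) powr (- \<gamma>)) * indicator (ball x (s n)) z) \<partial>lborel)"
      by (intro nn_integral_mono pw)
    also have "\<dots> = (\<Sum>n. (\<integral>\<^sup>+z. ennreal (s (Suc n) powr (- \<gamma>)) * indicator (ball x (s n)) z \<partial>lborel))"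
      by (rule nn_integral_suminf) (intro borel_measurable_times_ennreal borel_measurable_const borel_measurable_indicator, simp)
    also have "\<dots> = (\<Sum>n. ennreal (V * 2 powr \<gamma> * R powr (d - \<gamma>) * a ^ n))" by (simp only: summand)
    also have "\<dots> = ennreal (\<Sum>n. V * 2 powr \<gamma> * R powr (d - \<gamma>) * a ^ n)"
      using V a by (intro suminf_ennreal2) (auto intro!: summable_mult)
    also have "(\<Sum>n. V * 2 powr \<gamma> * R powr (d - \<gamma>) * a ^ n) = C * R powr (d - \<gamma>)"
      using a by (subst suminf_mult) (auto simp: suminf_geometric C_def)
    finally show ?thesis .
  qed
  moreover have "C > 0" using V a by (simp add: C_def)
  ultimately show ?thesis by (auto simp: d_def)
qed

lemma nn_integral_lebesgue_on_le_lborel: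
  assumes "S \<in> sets lebesgue"
  shows "(\<integral>\<^sup>+x. f x \<partial>lebesgue_on S) \<le> (\<integral>\<^sup>+x. f x \<partial>lborel)"
proof -
  have "(\<integral>\<^sup>+x. f x \<partial>lebesgue_on S) = (\<integral>\<^sup>+x. f x * indicator S x \<partial>lebesgue)"
    using assms by (simp add: nn_integral_restrict_space)
  also have "\<dots> \<le> (\<integral>\<^sup>+x. f x \<partial>lebesgue)" by (intro nn_integral_mono) (auto simp: indicator_def)
  finally show ?thesis by (simp add: nn_integral_completion)
qed

text \<open>The area of the sphere is a denominator in the nonlocal seminorm, so it must be neither
  zero nor infinite. Each covering set is replaced by a tube around a radial segment, whose volume
  is at most a constant times the (d - 1)-dimensional size of the set. The tubes cover a shell
  containing a ball, so the sizes cannot sum to an arbitrarily small number.\<close>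

lemma hausdorff_sphere_pos:
  assumes d2: "2 \<le> DIM('a::euclidean_space)"
  shows "0 < hausdorff_measure (real DIM('a) - 1) (sphere (0::'a) 1)"
proof -
  define s where "s = real DIM('a) - 1"
  define V where "V = unit_ball_vol (real DIM('a))"
  define W where "W = unit_ball_vol s"
  \<comment> \<open>A tube consists of m + 1 balls of radius 2 r with (m + 1) r \<le> 3; this gives
    the factor 3 and a power 2^d, generously replaced by 3^d. The remaining factors convert r^(d-1)
    into the normalised Hausdorff size.\<close>
  define c where "c = 3 * 3 ^ DIM('a) * V * 2 powr s / W"
  have s: "s \<ge> 1" using d2 by (simp add: s_def)
  have V: "V > 0" and W: "W > 0" using s by (auto simp: V_def W_def)
  have c: "c > 0" using V W by (simp add: c_def)
  obtain e :: 'a where e: "norm e = 1" using vector_choose_size[of 1] by auto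
  define B where "B = ball ((3/4) *\<^sub>R e) (1/8)"
  have Bpos: "emeasure lborel B > 0"
    unfolding B_def by (simp add: emeasure_ball)
  have low: "emeasure lborel B \<le> ennreal c * (\<Sum>i. ennreal (W * (diameter (E i) / 2) powr s))"
    if cov: "sphere (0::'a) 1 \<subseteq> (\<Union>i. E i)" and E: "\<And>i. bounded (E i) \<and> diameter (E i) \<le> 1" for E :: "nat \<Rightarrow> 'a set"
  proof -
    have "\<exists>U. U \<in> sets lborel \<and> (\<forall>x\<in>E i \<inter> sphere 0 1. \<forall>t\<in>{1/2..1}. t *\<^sub>R x \<in> U) \<and>
        emeasure lborel U \<le> ennreal c * ennreal (W * (diameter (E i) / 2) powr s)" for i
    proof (cases "E i \<inter> sphere 0 1 = {}")
      case False
      then obtain p where p: "p \<in> E i" "norm p = 1" by auto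
      define r where "r = diameter (E i)"
      have dist: "norm (x - p) \<le> r" if "x \<in> E i" for x
        using diameter_bounded_bound[of "E i" x p] E[of i] that p(1) by (simp add: r_def dist_norm)
      have r: "0 \<le> r" "r \<le> 1" using E[of i] diameter_ge_0[of "E i"] by (auto simp: r_def)
      show ?thesis
      proof (cases "r = 0")
        \<comment> \<open>A set of diameter 0 contributes nothing to the covering sum, so its tube
          must be null: the line through one point is, because d \<ge> 2.\<close>
        case True
        have "x = p" if "x \<in> E i" for x using dist[OF that] True by simp
        then have "t *\<^sub>R x \<in> span {p}" if "x \<in> E i" for x t using that by (auto intro: span_base span_mul)
        moreover have "negligible (span {p})"
        proof (rule negligible_lowdim)
          have "dim (span {p}) \<le> card {p}" by (metis dim_le_card' dim_span finite.emptyI finite_insert)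
          then show "dim (span {p}) < DIM('a)" using d2 by simp
        qed
        then have "emeasure lborel (span {p}) = 0"
          using negligible_iff_null_sets[of "span {p}"] by (auto simp: null_sets_def emeasure_completion closed_subspace borel_closed main_part_sets)
        ultimately show ?thesis
          by (intro exI[of _ "span {p}"]) (auto simp: closed_subspace borel_closed)
      next
        case False
        with r have r0: "0 < r" by simp
        \<comment> \<open>The centres (k / m) p are spaced at most r apart. A point t x with |x - p|
          \<le> r is then within r + r of the centre with k = floor(t m), hence the radius 2 r of
          the balls in \<open>U\<close>.\<close>
        define m where "m = nat \<lceil>1 / r\<rceil>"
        have m: "1 / r \<le> real m" "real m \<le> 1 / r + 1" 
        proof -
          have "real m = of_int \<lceil>1 / r\<rceil>" using r0 by (simp add: m_def)
          then show "1 / r \<le> real m" "real m \<le> 1 / r + 1" using ceiling_correct[of "1 / r"] by linarith+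
        qed
        then have m0: "0 < real m" using r0 by (metis divide_pos_pos order_less_le_trans zero_less_one)
        have mr: "1 / real m \<le> r" using m(1) m0 r0 by (simp add: field_simps)
        define U where "U = (\<Union>k\<in>{0..m}. cball ((real k / real m) *\<^sub>R p) (2 * r))"
        have "t *\<^sub>R x \<in> U" if x: "x \<in> E i" and t: "t \<in> {1/2..1}" for x t
        proof -
          define k where "k = nat \<lfloor>t * real m\<rfloor>"
          have k: "real k \<le> t * real m" "t * real m \<le> real k + 1" using t m0 unfolding k_def by (simp_all add: of_nat_nat le_floor_iff)
          have "t * real m \<le> 1 * real m" using t m0 by (intro mult_right_mono) auto
          then have "k \<le> m" using k(1) by linarith
          have tk: "\<bar>t - real k / real m\<bar> \<le> 1 / real m" 
          proof -
            have "t - real k / real m = (t * real m - real k) / real m" using m0 by (simp add: field_simps)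
            then have "\<bar>t - real k / real m\<bar> = \<bar>t * real m - real k\<bar> / real m" using m0 by (simp add: abs_divide)
            also have "\<dots> \<le> 1 / real m" using k m0 by (intro divide_right_mono) auto
            finally show ?thesis .
          qed
          have "norm (t *\<^sub>R x - (real k / real m) *\<^sub>R p) = norm (t *\<^sub>R (x - p) + (t - real k / real m) *\<^sub>R p)"
            by (simp add: algebra_simps)
          also have "\<dots> \<le> \<bar>t\<bar> * norm (x - p) + \<bar>t - real k / real m\<bar>"
            using norm_triangle_ineq[of "t *\<^sub>R (x - p)" "(t - real k / real m) *\<^sub>R p"] p(2) by simp
          also have "\<dots> \<le> 1 * r + r" using t dist[OF x] tk mr by (intro add_mono mult_mono) auto
          finally have "t *\<^sub>R x \<in> cball ((real k / real m) *\<^sub>R p) (2 * r)" by (simp add: dist_norm norm_minus_commute)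
          then show ?thesis unfolding U_def using \<open>k \<le> m\<close> by auto
        qed
        moreover have "emeasure lborel U \<le> ennreal c * ennreal (W * (r / 2) powr s)"
        proof -
          have "emeasure lborel U \<le> (\<Sum>k\<in>{0..m}. emeasure lborel (cball ((real k / real m) *\<^sub>R p) (2 * r)))"
            unfolding U_def by (rule emeasure_subadditive_finite) auto
          also have "\<dots> = ennreal ((real m + 1) * (V * (2 * r) ^ DIM('a)))"
          proof -
            have "(\<Sum>k\<in>{0..m}. emeasure lborel (cball ((real k / real m) *\<^sub>R p) (2 * r))) = (\<Sum>k\<in>{0..m}. ennreal (V * (2 * r) ^ DIM('a)))"
              using r0 by (simp add: emeasure_cball V_def)
            also have "\<dots> = ennreal (\<Sum>k\<in>{0..m}. V * (2 * r) ^ DIM('a))"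
              using r0 V by (intro sum_ennreal) simp
            finally show ?thesis by (simp add: add.commute)
          qed
          also have "\<dots> \<le> ennreal (c * (W * (r / 2) powr s))"
          proof (rule ennreal_leI)
            have "r ^ DIM('a) = r powr s * r" using r0 by (simp add: s_def powr_diff powr_realpow)
            moreover have "(real m + 1) * r \<le> 3"
            proof -
              have "(real m + 1) * r \<le> (1 / r + 2) * r" using m r0 by (intro mult_right_mono) auto
              also have "\<dots> = 1 + 2 * r" using r0 by (simp add: field_simps)
              finally show ?thesis using r by simp
            qed
            ultimately have "(real m + 1) * (V * (2 * r) ^ DIM('a)) \<le> 3 * (V * 2 ^ DIM('a) * r powr s)"
              using V mult_right_mono[of "(real m + 1) * r" 3 "V * 2 ^ DIM('a) * r powr s"] by (simp add: power_mult_distrib mult_ac)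
            also have "\<dots> \<le> 3 * (V * 3 ^ DIM('a) * r powr s)"
              using V by (intro mult_left_mono mult_right_mono power_mono) auto
            also have "\<dots> = c * (W * (r / 2) powr s)" using W r0 by (simp add: c_def powr_divide)
            finally show "(real m + 1) * (V * (2 * r) ^ DIM('a)) \<le> c * (W * (r / 2) powr s)" .
          qed
          also have "\<dots> = ennreal c * ennreal (W * (r / 2) powr s)" using c by (simp add: ennreal_mult')
          finally show ?thesis .
        qed
        moreover have "U \<in> sets lborel" unfolding U_def by auto
        ultimately show ?thesis unfolding r_def[symmetric] by blast
      qed
    qed (rule exI[of _ "{}"], auto)
    then obtain U where U: "\<And>i. U i \<in> sets lborel" "\<And>i x t. x \<in> E i \<Longrightarrow> norm x = 1 \<Longrightarrow> t \<in> {1/2..1} \<Longrightarrow> t *\<^sub>R x \<in> U i"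
      "\<And>i. emeasure lborel (U i) \<le> ennreal c * ennreal (W * (diameter (E i) / 2) powr s)"
    proof -
      assume *: "\<And>U. (\<And>i. U i \<in> sets lborel) \<Longrightarrow> (\<And>i x t. x \<in> E i \<Longrightarrow> norm x = 1 \<Longrightarrow> t \<in> {1/2..1} \<Longrightarrow> t *\<^sub>R x \<in> U i) \<Longrightarrow>
        (\<And>i. emeasure lborel (U i) \<le> ennreal c * ennreal (W * (diameter (E i) / 2) powr s)) \<Longrightarrow> thesis"
      assume "\<And>i. \<exists>U. U \<in> sets lborel \<and> (\<forall>x\<in>E i \<inter> sphere 0 1. \<forall>t\<in>{1/2..1}. t *\<^sub>R x \<in> U) \<and>
        emeasure lborel U \<le> ennreal c * ennreal (W * (diameter (E i) / 2) powr s)"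
      then obtain U where "\<forall>i. U i \<in> sets lborel \<and> (\<forall>x\<in>E i \<inter> sphere 0 1. \<forall>t\<in>{1/2..1}. t *\<^sub>R x \<in> U i) \<and>
        emeasure lborel (U i) \<le> ennreal c * ennreal (W * (diameter (E i) / 2) powr s)"
        using choice by (metis (no_types, lifting))
      then show thesis by (intro *[of U]) (auto simp: sphere_def)
    qed
    have "B \<subseteq> (\<Union>i. U i)"
    proof
      fix x assume "x \<in> B"
      then have x: "norm (x - (3/4) *\<^sub>R e) < 1/8" by (simp add: B_def dist_norm norm_minus_commute)
      have n: "norm ((3/4) *\<^sub>R e) = 3/4" using e by simp
      have nx: "norm x \<le> 1" "norm x \<ge> 1/2"
        using norm_triangle_ineq3[of x "(3/4) *\<^sub>R e"] x n by linarith+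
      then have nz: "x \<noteq> 0" by auto
      then have "x /\<^sub>R norm x \<in> sphere 0 1" by simp
      then obtain i where "x /\<^sub>R norm x \<in> E i" using cov by blast
      moreover have "norm (x /\<^sub>R norm x) = 1" using nz by simp
      ultimately have "norm x *\<^sub>R (x /\<^sub>R norm x) \<in> U i" by (rule U(2)) (use nx in simp)
      moreover have "norm x *\<^sub>R (x /\<^sub>R norm x) = x" using nz by simp
      ultimately have "x \<in> U i" by (simp only:)
      then show "x \<in> (\<Union>i. U i)" by blast
    qed
    then have "emeasure lborel B \<le> emeasure lborel (\<Union>i. U i)" using U(1) by (intro emeasure_mono) auto
    also have "\<dots> \<le> (\<Sum>i. emeasure lborel (U i))" using U(1) by (intro emeasure_subadditive_countably) auto
    also have "\<dots> \<le> (\<Sum>i. ennreal c * ennreal (W * (diameter (E i) / 2) powr s))" by (intro suminf_le U(3)) auto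
    also have "\<dots> = ennreal c * (\<Sum>i. ennreal (W * (diameter (E i) / 2) powr s))" by simp
    finally show ?thesis .
  qed
  have "emeasure lborel B / ennreal c \<le> hausdorff_measure s (sphere (0::'a) 1)"
    unfolding hausdorff_measure_def
  proof (rule SUP_upper2[of 1], simp, rule INF_greatest)
    fix E :: "nat \<Rightarrow> 'a set" assume "E \<in> {E. sphere 0 1 \<subseteq> (\<Union>i. E i) \<and> (\<forall>i. bounded (E i) \<and> diameter (E i) \<le> 1)}"
    then have "emeasure lborel B \<le> ennreal c * (\<Sum>i. ennreal (W * (diameter (E i) / 2) powr s))" by (intro low) auto
    then show "emeasure lborel B / ennreal c \<le> (\<Sum>i. ennreal (unit_ball_vol s * (diameter (E i) / 2) powr s))"
      using c unfolding W_def[symmetric] by (subst divide_le_posI_ennreal) (auto simp: mult.commute)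
  qed
  moreover have "emeasure lborel B / ennreal c > 0"
    using Bpos by (simp add: ennreal_zero_less_divide)
  ultimately show ?thesis unfolding s_def by (rule order_less_le_trans[rotated])
qed

text \<open>A maximal \<epsilon>-separated subset of the sphere is an \<epsilon>-net. The disjoint
  balls of radius \<epsilon> / 2 around its points lie in a shell of volume O(\<epsilon>), so there
  are O(\<epsilon>^(1-d)) of them, and the covering sums stay bounded as \<epsilon> tends to
  0.\<close>

lemma hausdorff_sphere_finite:
  assumes d2: "2 \<le> DIM('a::euclidean_space)"
  shows "hausdorff_measure (real DIM('a) - 1) (sphere (0::'a) 1) < \<infinity>"
proof -
  define d where "d = DIM('a)"
  define s where "s = real d - 1"
  define V where "V = unit_ball_vol (real d)"
  define W where "W = unit_ball_vol s"
  have s: "s \<ge> 1" using d2 by (simp add: s_def d_def)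
  have V: "V > 0" and W: "W > 0" using s by (auto simp: V_def W_def)
  define M where "M = real d * 2 ^ d * 2 ^ d * W"
  have "(INF E\<in>{E :: nat \<Rightarrow> 'a set. sphere 0 1 \<subseteq> (\<Union>i. E i) \<and> (\<forall>i. bounded (E i) \<and> diameter (E i) \<le> r)}.
        (\<Sum>i. ennreal (W * (diameter (E i) / 2) powr s))) \<le> ennreal M" if r: "0 < r" for r
  proof -
    \<comment> \<open>The covering balls have diameter at most 2 \<epsilon>, which must not exceed
      r; the bound by 1 serves the estimate of the shell.\<close>
    define \<epsilon> where "\<epsilon> = min (r / 2) 1"
    have \<epsilon>: "0 < \<epsilon>" "\<epsilon> \<le> 1" "2 * \<epsilon> \<le> r" using r by (auto simp: \<epsilon>_def)
    have emeasure_ball_finite: "emeasure lborel (ball (x::'a) t) \<noteq> top" for x t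
      using emeasure_bounded_finite[of "ball x t"] by simp
    define sep where "sep F \<longleftrightarrow> finite F \<and> F \<subseteq> sphere (0::'a) 1 \<and> (\<forall>x\<in>F. \<forall>y\<in>F. x \<noteq> y \<longrightarrow> \<epsilon> \<le> dist x y)" for F
    have count: "real (card F) * \<epsilon> powr s \<le> real d * 2 ^ d * 2 ^ d" if F: "sep F" for F
    proof -
      have "real (card F) * (V * (\<epsilon> / 2) ^ d) = (\<Sum>x\<in>F. measure lborel (ball x (\<epsilon> / 2)))"
        using \<epsilon> by (simp add: content_ball V_def d_def)
      also have "\<dots> = measure lborel (\<Union>x\<in>F. ball x (\<epsilon> / 2))"
      proof (rule measure_finite_Union[symmetric])
        show "disjoint_family_on (\<lambda>x. ball x (\<epsilon> / 2)) F"
          unfolding disjoint_family_on_def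
        proof (intro ballI impI)
          fix x y assume xy: "x \<in> F" "y \<in> F" "x \<noteq> y"
          then have "\<epsilon> \<le> dist x y" using F by (auto simp: sep_def)
          then show "ball x (\<epsilon> / 2) \<inter> ball y (\<epsilon> / 2) = {}"
            unfolding disjoint_iff
          proof (intro allI impI notI)
            fix z assume "z \<in> ball x (\<epsilon> / 2)" "z \<in> ball y (\<epsilon> / 2)"
            then have "dist x y < \<epsilon>" using dist_triangle2[of x y z] by simp
            with \<open>\<epsilon> \<le> dist x y\<close> show False by simp
          qed
        qed
      qed (use F in \<open>auto simp: sep_def emeasure_ball_finite\<close>)
      also have "\<dots> \<le> measure lborel (ball (0::'a) (1 + \<epsilon> / 2) - ball 0 (1 - \<epsilon> / 2))"
      proof (rule measure_mono_fmeasurable)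
        show "(\<Union>x\<in>F. ball x (\<epsilon> / 2)) \<subseteq> ball (0::'a) (1 + \<epsilon> / 2) - ball 0 (1 - \<epsilon> / 2)"
        proof
          fix y assume "y \<in> (\<Union>x\<in>F. ball x (\<epsilon> / 2))"
          then obtain x where x: "norm x = 1" "norm (x - y) < \<epsilon> / 2" using F by (auto simp: sep_def dist_norm subset_iff)
          then have "norm y < 1 + \<epsilon> / 2" "1 - \<epsilon> / 2 \<le> norm y"
            using norm_triangle_ineq3[of x y] by linarith+
          then show "y \<in> ball (0::'a) (1 + \<epsilon> / 2) - ball 0 (1 - \<epsilon> / 2)" by simp
        qed
        show "ball (0::'a) (1 + \<epsilon> / 2) - ball 0 (1 - \<epsilon> / 2) \<in> fmeasurable lborel"
          by (intro fmeasurable_Diff) (auto simp: fmeasurable_def emeasure_ball_finite less_top[symmetric])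
        show "(\<Union>x\<in>F. ball x (\<epsilon> / 2)) \<in> sets lborel" by (simp add: borel_open open_UN)
      qed
      also have "\<dots> = V * ((1 + \<epsilon> / 2) ^ d - (1 - \<epsilon> / 2) ^ d)"
        using \<epsilon> by (subst measure_Diff) (auto simp: content_ball V_def d_def right_diff_distrib emeasure_ball_finite less_top)
      also have "\<dots> \<le> V * (2 ^ d * (real d * (\<epsilon> / 2)))"
      proof (intro mult_left_mono less_imp_le[OF V])
        \<comment> \<open>The estimate for a difference of d-th powers is for bases of modulus at
          most 1, hence the division by 2 and the factor 2^d in the result.\<close>
        have "norm (((1 + \<epsilon> / 2) / 2) ^ d - ((1 - \<epsilon> / 2) / 2) ^ d) \<le> real d * norm ((1 + \<epsilon> / 2) / 2 - (1 - \<epsilon> / 2) / 2)"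
          by (rule norm_power_diff) (use \<epsilon> in auto)
        also have "(1 + \<epsilon> / 2) / 2 - (1 - \<epsilon> / 2) / 2 = \<epsilon> / 2" by (simp add: field_simps)
        finally have "((1 + \<epsilon> / 2) / 2) ^ d - ((1 - \<epsilon> / 2) / 2) ^ d \<le> real d * (\<epsilon> / 2)" using \<epsilon> unfolding real_norm_def by linarith
        then have "2 ^ d * (((1 + \<epsilon> / 2) / 2) ^ d - ((1 - \<epsilon> / 2) / 2) ^ d) \<le> 2 ^ d * (real d * (\<epsilon> / 2))"
          by (intro mult_left_mono) auto
        then show "(1 + \<epsilon> / 2) ^ d - (1 - \<epsilon> / 2) ^ d \<le> 2 ^ d * (real d * (\<epsilon> / 2))"
          by (simp add: right_diff_distrib power_divide)
      qed
      finally have "real (card F) * (\<epsilon> / 2) ^ d \<le> 2 ^ d * (real d * (\<epsilon> / 2))"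
        using V by (simp add: mult.left_commute)
      moreover have "(\<epsilon> / 2) ^ d = \<epsilon> powr s * \<epsilon> / 2 ^ d"
        using \<epsilon>(1) by (simp add: s_def powr_diff powr_realpow power_divide)
      ultimately have "real (card F) * \<epsilon> powr s * \<epsilon> \<le> (2 ^ d * 2 ^ d * real d / 2) * \<epsilon>" by (simp add: field_simps)
      then have "real (card F) * \<epsilon> powr s \<le> 2 ^ d * 2 ^ d * real d / 2" using \<epsilon>(1) by (simp only: mult_le_cancel_right_pos)
      also have "\<dots> \<le> real d * 2 ^ d * 2 ^ d" by simp
      finally show ?thesis .
    qed
    obtain K where K: "real d * 2 ^ d * 2 ^ d / \<epsilon> powr s < real K" using reals_Archimedean2 by blast
    have bound: "card F < K" if "sep F" for F
    proof -
      have "real (card F) \<le> real d * 2 ^ d * 2 ^ d / \<epsilon> powr s" using count[OF that] \<epsilon>(1) by (simp add: field_simps)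
      then show ?thesis using K by linarith
    qed
    have "sep {}" by (simp add: sep_def)
    then obtain F where F: "sep F" and max: "\<And>G. sep G \<Longrightarrow> card G \<le> card F"
      using ex_has_greatest_nat[of sep "{}" card K] bound by (metis less_imp_le)
    have finF: "finite F" using F by (simp add: sep_def)
    have cover: "\<exists>x\<in>F. dist x y \<le> \<epsilon>" if y: "y \<in> sphere 0 1" for y
    proof (rule ccontr)
      assume neg: "\<not> ?thesis"
      then have "y \<notin> F" using \<epsilon>(1) by force
      moreover have "sep (insert y F)" using F y neg unfolding sep_def by (auto simp: dist_commute not_le less_imp_le)
      ultimately show False using max[of "insert y F"] finF by simp
    qed
    obtain f where f: "bij_betw f {..<card F} F" using ex_bij_betw_nat_finite[OF finF] by (auto simp: atLeast0LessThan)
    define E where "E i = (if i < card F then cball (f i) \<epsilon> else {})" for i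
    have "sphere 0 1 \<subseteq> (\<Union>i. E i)"
    proof
      fix y :: 'a assume "y \<in> sphere 0 1"
      then obtain x where x: "x \<in> F" "dist x y \<le> \<epsilon>" using cover by blast
      then obtain i where "i < card F" "x = f i" using f by (auto simp: bij_betw_def)
      then show "y \<in> (\<Union>i. E i)" using x by (auto simp: E_def intro!: exI[of _ i])
    qed
    moreover have dE: "bounded (E i) \<and> diameter (E i) \<le> 2 * \<epsilon>" for i
      using \<epsilon>(1) diameter_cball[of "f i" \<epsilon>] by (auto simp: E_def)
    ultimately have "(INF E\<in>{E :: nat \<Rightarrow> 'a set. sphere 0 1 \<subseteq> (\<Union>i. E i) \<and> (\<forall>i. bounded (E i) \<and> diameter (E i) \<le> r)}.
        (\<Sum>i. ennreal (W * (diameter (E i) / 2) powr s))) \<le> (\<Sum>i. ennreal (W * (diameter (E i) / 2) powr s))"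
      using \<epsilon>(3) by (intro INF_lower) (auto intro: order_trans)
    also have "\<dots> = (\<Sum>i<card F. ennreal (W * (diameter (E i) / 2) powr s))"
      using s by (intro suminf_finite) (auto simp: E_def)
    also have "\<dots> \<le> (\<Sum>i<card F. ennreal (W * \<epsilon> powr s))"
    proof (intro sum_mono ennreal_leI mult_left_mono powr_mono2)
      show "0 \<le> diameter (E i) / 2" for i using diameter_ge_0[of "E i"] dE[of i] by simp
      show "diameter (E i) / 2 \<le> \<epsilon>" for i using dE[of i] by simp
    qed (use s W in auto)
    also have "\<dots> = ennreal (W * (real (card F) * \<epsilon> powr s))"
      by (simp add: ennreal_of_nat_eq_real_of_nat ennreal_mult'[symmetric] mult_ac)
    also have "\<dots> \<le> ennreal (W * (real d * 2 ^ d * 2 ^ d))"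
      using count[OF F] W by (intro ennreal_leI mult_left_mono) auto
    finally show ?thesis by (simp add: M_def mult_ac)
  qed
  then have "hausdorff_measure s (sphere (0::'a) 1) \<le> ennreal M"
    unfolding hausdorff_measure_def W_def by (intro SUP_least) auto
  then show ?thesis unfolding s_def d_def by (metis ennreal_less_top infinity_ennreal_def order_le_less_trans)
qed

lemma sphere_area_pos: "2 \<le> DIM('a::euclidean_space) \<Longrightarrow> 0 < sphere_area TYPE('a)"
  using hausdorff_sphere_pos hausdorff_sphere_finite by (auto simp: sphere_area_def enn2real_positive_iff)

section \<open>Comparison of nonlocal energies\<close>

text \<open>The power of \<open>h\<close> is chosen so that, for every \<gamma> < d, the weight
  integrated over y is at most a constant times h(x)^(-2). Energies with different singularities
  thus have the same scaling; \<gamma> = 0 is the one without singularity, and \<gamma> = \<beta> +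
  1 the one that bounds the gradient.\<close>

definition energy :: "'a::euclidean_space set \<Rightarrow> ('a \<Rightarrow> real) \<Rightarrow> real \<Rightarrow> real \<Rightarrow> ('a \<Rightarrow> real) \<Rightarrow> ennreal" where
  "energy \<Omega> h s \<gamma> u = (\<integral>\<^sup>+x. (\<integral>\<^sup>+y. ennreal (if norm (x - y) < s * h x
     then h x powr (\<gamma> - real DIM('a) - 2) * norm (x - y) powr (- \<gamma>) * (u x - u y)\<^sup>2 else 0)
     \<partial>lebesgue_on \<Omega>) \<partial>lebesgue_on \<Omega>)"

text \<open>Two horizons occur: the one built from \<lambda>, with L = 1/3, and the one built from
  the distance, with L = \<delta>. Factors s are used as long as L s \<le> 1/3; for these the
  horizons of two interacting points are comparable, and \<open>ball_sub\<close> keeps the balls of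
  radius s h(x) in \<Omega>.\<close>

locale horizon =
  fixes \<Omega> :: "'a::euclidean_space set" and h :: "'a \<Rightarrow> real" and L :: real
  assumes open_\<Omega>: "open \<Omega>" and bounded_\<Omega>: "bounded \<Omega>"
    and h_pos: "\<And>x. x \<in> \<Omega> \<Longrightarrow> 0 < h x"
    and h_lip: "\<And>x y. x \<in> \<Omega> \<Longrightarrow> y \<in> \<Omega> \<Longrightarrow> \<bar>h x - h y\<bar> \<le> L * norm (x - y)"
    and L_pos: "0 < L"
    and ball_sub: "\<And>x. x \<in> \<Omega> \<Longrightarrow> ball x (h x / (3 * L)) \<subseteq> \<Omega>"
begin

abbreviation M where "M \<equiv> lebesgue_on \<Omega>"

lemma \<Omega>_sets [simp]: "\<Omega> \<in> sets lebesgue" using open_\<Omega> by simp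

lemma finite_M: "finite_measure M"
  by (rule finite_measure_lebesgue_on, rule bounded_set_imp_lmeasurable) (auto simp: bounded_\<Omega>)

sublocale finite_measure M by (rule finite_M)

sublocale MM: pair_sigma_finite M M ..

lemma id_M [measurable]: "(\<lambda>x. x) \<in> measurable M borel"
  by (rule measurable_lebesgue_on_borel) simp

lemma fst_MM [measurable]: "(\<lambda>p. fst p) \<in> measurable (M \<Otimes>\<^sub>M M) borel"
  by (rule measurable_compose[OF measurable_fst id_M])

lemma snd_MM [measurable]: "(\<lambda>p. snd p) \<in> measurable (M \<Otimes>\<^sub>M M) borel"
  by (rule measurable_compose[OF measurable_snd id_M])

lemma continuous_h: "continuous_on \<Omega> h"
proof -
  have "L-lipschitz_on \<Omega> h"
    using h_lip L_pos by (intro lipschitz_onI) (auto simp: dist_norm)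
  then show ?thesis by (rule lipschitz_on_continuous_on)
qed

lemma h_M [measurable]: "h \<in> borel_measurable M"
  by (rule continuous_imp_measurable_on_sets_lebesgue[OF continuous_h]) simp

lemma comparable:
  assumes x: "x \<in> \<Omega>" and y: "y \<in> \<Omega>" and s: "L * s \<le> 1 / 3" "norm (x - y) < s * h x"
  shows "h x \<le> 3 / 2 * h y" "3 / 4 * h y \<le> h x"
proof -
  have "L * norm (x - y) \<le> L * (s * h x)" using s L_pos by (intro mult_left_mono) auto
  also have "\<dots> \<le> 1 / 3 * h x" using mult_right_mono[OF s(1), of "h x"] h_pos[OF x] by (simp add: mult.assoc)
  finally show "h x \<le> 3 / 2 * h y" "3 / 4 * h y \<le> h x" using h_lip[OF x y] by linarith+
qed

lemma energy_mono: "s \<le> s' \<Longrightarrow> energy \<Omega> h s \<gamma> u \<le> energy \<Omega> h s' \<gamma> u"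
  unfolding energy_def
proof (intro nn_integral_mono ennreal_leI)
  fix x y assume s: "s \<le> s'" and "x \<in> space M"
  then have "s * h x \<le> s' * h x" using h_pos[of x] by (intro mult_right_mono) auto
  then show "(if norm (x - y) < s * h x then h x powr (\<gamma> - real DIM('a) - 2) * norm (x - y) powr - \<gamma> * (u x - u y)\<^sup>2 else 0)
     \<le> (if norm (x - y) < s' * h x then h x powr (\<gamma> - real DIM('a) - 2) * norm (x - y) powr - \<gamma> * (u x - u y)\<^sup>2 else 0)"
    by auto
qed

definition local_osc :: "real \<Rightarrow> ('a \<Rightarrow> real) \<Rightarrow> 'a \<Rightarrow> ennreal" where
  "local_osc s u x = (\<integral>\<^sup>+z. ennreal (if norm (x - z) < s * h x then (u x - u z)\<^sup>2 else 0) \<partial>M)"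

lemma local_osc_measurable [measurable]:
  assumes [measurable]: "u \<in> borel_measurable M"
  shows "local_osc s u \<in> borel_measurable M"
proof -
  have "(\<lambda>p. ennreal (if norm (fst p - snd p) < s * h (fst p) then (u (fst p) - u (snd p))\<^sup>2 else 0)) \<in> borel_measurable (M \<Otimes>\<^sub>M M)"
    by measurable
  from borel_measurable_nn_integral_fst[OF this] show ?thesis unfolding local_osc_def[abs_def] by simp
qed

lemma energy_0: "energy \<Omega> h s 0 u = (\<integral>\<^sup>+x. ennreal (h x powr (- real DIM('a) - 2)) * local_osc s u x \<partial>M)"
  if [measurable]: "u \<in> borel_measurable M"
  unfolding energy_def
proof (rule nn_integral_cong)
  fix x assume x: "x \<in> space M"
  have [measurable]: "(\<lambda>z. ennreal (if norm (x - z) < s * h x then (u x - u z)\<^sup>2 else 0)) \<in> borel_measurable M"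
    by measurable
  have "(\<integral>\<^sup>+y. ennreal (if norm (x - y) < s * h x then h x powr (0 - real DIM('a) - 2) * norm (x - y) powr - 0 * (u x - u y)\<^sup>2 else 0) \<partial>M)
    = (\<integral>\<^sup>+y. ennreal (h x powr (- real DIM('a) - 2)) * ennreal (if norm (x - y) < s * h x then (u x - u y)\<^sup>2 else 0) \<partial>M)"
    by (intro nn_integral_cong) (auto simp: ennreal_mult)
  also have "\<dots> = ennreal (h x powr (- real DIM('a) - 2)) * local_osc s u x"
    unfolding local_osc_def by (rule nn_integral_cmult) measurable
  finally show "(\<integral>\<^sup>+y. ennreal (if norm (x - y) < s * h x then h x powr (0 - real DIM('a) - 2) * norm (x - y) powr - 0 * (u x - u y)\<^sup>2 else 0) \<partial>M)
    = ennreal (h x powr (- real DIM('a) - 2)) * local_osc s u x" .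
qed

text \<open>The increment over the pair \<open>x, y\<close> is averaged over intermediate points near the midpoint, each of which is
  within a fraction \<open>4/5\<close> of the horizon of both \<open>x\<close> and \<open>y\<close>.\<close>

lemma increment_le_local_osc:
  assumes u [measurable]: "u \<in> borel_measurable M" and x: "x \<in> \<Omega>" and y: "y \<in> \<Omega>"
    and s: "0 < s" "L * s \<le> 1 / 3" "norm (x - y) < s * h x"
  shows "ennreal ((u x - u y)\<^sup>2) \<le> ennreal (2 * (30 / (s * h x)) ^ DIM('a) / unit_ball_vol (real DIM('a))) * (local_osc (4 / 5 * s) u x + local_osc (4 / 5 * s) u y)"
proof -
  define m where "m = (1 / 2) *\<^sub>R (x + y)"
  \<comment> \<open>The midpoint is at distance below 15/30 of s h(x) from both ends, so points of
    the ball are within 16/30 of it. Passing from h(x) to h(y) costs the factor 3/2, and 16/30 times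
    3/2 is the fraction 4/5.\<close>
  define r where "r = s * h x / 30"
  define V where "V = unit_ball_vol (real DIM('a))"
  have V: "V > 0" by (simp add: V_def)
  have hx: "h x > 0" and hy: "h y > 0" using h_pos x y by auto
  have r: "r > 0" using s hx by (simp add: r_def)
  note cmp = comparable[OF x y s(2,3)]
  have near: "norm (x - z) < 4 / 5 * s * h x" "norm (y - z) < 4 / 5 * s * h y" "z \<in> \<Omega>" if z: "z \<in> ball m r" for z
  proof -
    have mz: "norm (m - z) < r" using z by (simp add: dist_norm)
    have xm: "norm (x - m) = norm (x - y) / 2" "norm (y - m) = norm (x - y) / 2"
    proof -
      have "x - m = (1 / 2) *\<^sub>R (x - y)" "y - m = (1 / 2) *\<^sub>R (y - x)"
        by (simp_all add: m_def algebra_simps) (simp_all flip: scaleR_left.add)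
      then show "norm (x - m) = norm (x - y) / 2" "norm (y - m) = norm (x - y) / 2" by (simp_all add: norm_minus_commute)
    qed
    have "norm (x - z) \<le> norm (x - m) + norm (m - z)" "norm (y - z) \<le> norm (y - m) + norm (m - z)"
      by (metis norm_triangle_ineq add.commute diff_add_cancel add_diff_eq)+
    then have b: "norm (x - z) < 16 / 30 * (s * h x)" "norm (y - z) < 16 / 30 * (s * h x)"
      using mz xm s(3) by (auto simp: r_def)
    have sh: "0 < s * h x" using s(1) hx by simp
    have "norm (x - z) < 4 / 5 * (s * h x)" using b(1) sh by linarith
    then show "norm (x - z) < 4 / 5 * s * h x" by simp
    have "s * h x \<le> 3 / 2 * (s * h y)" using mult_left_mono[OF cmp(1), of s] s(1) by simp
    then have "norm (y - z) < 4 / 5 * (s * h y)" using b(2) by linarith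
    then show "norm (y - z) < 4 / 5 * s * h y" by simp
    have "s * h x \<le> h x / (3 * L)" using mult_right_mono[OF s(2), of "h x"] hx L_pos by (simp add: field_simps)
    then have "norm (x - z) < h x / (3 * L)" using b(1) sh by linarith
    then show "z \<in> \<Omega>" using ball_sub[OF x] by (auto simp: dist_norm)
  qed
  have ball: "emeasure M (ball m r) = ennreal (V * r ^ DIM('a))"
  proof -
    have "ball m r \<subseteq> \<Omega>" using near(3) by blast
    then have "emeasure M (ball m r) = emeasure lebesgue (ball m r)"
      by (subst emeasure_restrict_space) auto
    then show ?thesis using r by (simp add: emeasure_ball V_def)
  qed
  let ?f = "\<lambda>x z. ennreal (if norm (x - z) < 4 / 5 * s * h x then (u x - u z)\<^sup>2 else 0)"
  have f [measurable]: "?f x \<in> borel_measurable M" for x by measurable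
  have "ennreal ((u x - u y)\<^sup>2) * ennreal (V * r ^ DIM('a)) = (\<integral>\<^sup>+z. ennreal ((u x - u y)\<^sup>2) * indicator (ball m r) z \<partial>M)"
    using near(3) by (subst nn_integral_cmult_indicator) (auto simp: ball sets_restrict_space_iff)
  also have "\<dots> \<le> (\<integral>\<^sup>+z. 2 * ?f x z + 2 * ?f y z \<partial>M)"
  proof (rule nn_integral_mono)
    fix z
    show "ennreal ((u x - u y)\<^sup>2) * indicator (ball m r) z \<le> 2 * ?f x z + 2 * ?f y z"
    proof (cases "z \<in> ball m r")
      case True
      have "(u x - u y)\<^sup>2 \<le> 2 * (u x - u z)\<^sup>2 + 2 * (u y - u z)\<^sup>2"
        using zero_le_power2[of "(u x - u z) + (u y - u z)"] by (simp add: power2_eq_square algebra_simps)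
      then have "ennreal ((u x - u y)\<^sup>2) \<le> ennreal (2 * (u x - u z)\<^sup>2 + 2 * (u y - u z)\<^sup>2)" by (rule ennreal_leI)
      then show ?thesis using near[OF True] True by (simp add: ennreal_mult' ennreal_plus)
    qed simp
  qed
  also have "\<dots> = 2 * local_osc (4 / 5 * s) u x + 2 * local_osc (4 / 5 * s) u y"
    unfolding local_osc_def by (simp add: nn_integral_add nn_integral_cmult)
  finally have *: "ennreal ((u x - u y)\<^sup>2) * ennreal (V * r ^ DIM('a)) \<le> 2 * (local_osc (4 / 5 * s) u x + local_osc (4 / 5 * s) u y)"
    by (simp add: distrib_left)
  have "ennreal ((u x - u y)\<^sup>2) = ennreal (1 / (V * r ^ DIM('a))) * (ennreal ((u x - u y)\<^sup>2) * ennreal (V * r ^ DIM('a)))"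
    using V r by (simp add: ennreal_mult'[symmetric] ennreal_mult''[symmetric])
  also have "\<dots> \<le> ennreal (1 / (V * r ^ DIM('a))) * (2 * (local_osc (4 / 5 * s) u x + local_osc (4 / 5 * s) u y))"
    by (rule mult_left_mono[OF *]) simp
  also have "\<dots> = ennreal (1 / (V * r ^ DIM('a)) * 2) * (local_osc (4 / 5 * s) u x + local_osc (4 / 5 * s) u y)"
    using V r by (subst ennreal_mult) (auto simp: mult.assoc)
  also have "1 / (V * r ^ DIM('a)) * 2 = 2 * (30 / (s * h x)) ^ DIM('a) / V"
    by (simp add: r_def power_divide mult.commute)
  finally show ?thesis unfolding V_def .
qed

lemma riesz_M:
  assumes C: "\<forall>(x::'a) R. 0 < R \<longrightarrow>
    (\<integral>\<^sup>+z. ennreal (norm (x - z) powr (- \<gamma>)) * indicator (ball x R) z \<partial>lborel) \<le> ennreal (C * R powr (real DIM('a) - \<gamma>))"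
    and R: "0 < R"
  shows "(\<integral>\<^sup>+z. ennreal (if norm (x - z) < R then norm (x - z) powr (- \<gamma>) else 0) \<partial>M) \<le> ennreal (C * R powr (real DIM('a) - \<gamma>))"
proof -
  have "(\<integral>\<^sup>+z. ennreal (if norm (x - z) < R then norm (x - z) powr (- \<gamma>) else 0) \<partial>M)
      \<le> (\<integral>\<^sup>+z. ennreal (if norm (x - z) < R then norm (x - z) powr (- \<gamma>) else 0) \<partial>lborel)"
    by (rule nn_integral_lebesgue_on_le_lborel) simp
  also have "\<dots> = (\<integral>\<^sup>+z. ennreal (norm (x - z) powr (- \<gamma>)) * indicator (ball x R) z \<partial>lborel)"
    by (intro nn_integral_cong) (auto simp: dist_norm indicator_def)
  also have "\<dots> \<le> ennreal (C * R powr (real DIM('a) - \<gamma>))" using C R by blast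
  finally show ?thesis .
qed

text \<open>Once the increment is replaced by local oscillations at \<open>x\<close> and at
  \<open>y\<close>, the singular weight can be integrated out in the other variable, where it is an
  integrable Riesz kernel. The singularity is then gone and the horizon has shrunk to 4/5. For the
  oscillation at \<open>y\<close> the order of integration is exchanged first.\<close>

lemma energy_chain_step:
  assumes C0: "0 < C0" "\<forall>(x::'a) R. 0 < R \<longrightarrow>
    (\<integral>\<^sup>+z. ennreal (norm (x - z) powr (- \<gamma>)) * indicator (ball x R) z \<partial>lborel) \<le> ennreal (C0 * R powr (real DIM('a) - \<gamma>))"
    and \<gamma>: "0 \<le> \<gamma>" "\<gamma> < real DIM('a)"
    and u [measurable]: "u \<in> borel_measurable M" and s: "0 < s" "L * s \<le> 1 / 3"
  shows "energy \<Omega> h s \<gamma> u \<le> ennreal (2 * 30 ^ DIM('a) / unit_ball_vol (real DIM('a)) * C0 *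
     (1 + (4 / 3) powr (2 * real DIM('a) + 2 - \<gamma>) * (3 / 2) powr (real DIM('a) - \<gamma>)) * s powr (- \<gamma>)) * energy \<Omega> h (4 / 5 * s) 0 u"
proof -
  define d where "d = real DIM('a)"
  define c1 where "c1 = 2 * 30 ^ DIM('a) / unit_ball_vol (real DIM('a))"
  have c1: "c1 > 0" by (simp add: c1_def)
  define \<Phi> where "\<Phi> = local_osc (4 / 5 * s) u"
  have \<Phi>m [measurable]: "\<Phi> \<in> borel_measurable M" unfolding \<Phi>_def by measurable
  define k where "k x y = (if norm (x - y) < s * h x then c1 * s powr (- d) * h x powr (\<gamma> - 2 * d - 2) * norm (x - y) powr (- \<gamma>) else 0)" for x y
  have km [measurable]: "(\<lambda>p. k (fst p) (snd p)) \<in> borel_measurable (M \<Otimes>\<^sub>M M)" unfolding k_def by measurable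
  have km': "(\<lambda>p. k (snd p) (fst p)) \<in> borel_measurable (M \<Otimes>\<^sub>M M)" unfolding k_def by measurable
  have km1 [measurable]: "(\<lambda>y. k x y) \<in> borel_measurable M" "(\<lambda>x. k x y) \<in> borel_measurable M" for x y unfolding k_def by measurable
  have "energy \<Omega> h s \<gamma> u \<le> (\<integral>\<^sup>+x. \<integral>\<^sup>+y. ennreal (k x y) * \<Phi> x + ennreal (k x y) * \<Phi> y \<partial>M \<partial>M)"
    unfolding energy_def
  proof (intro nn_integral_mono)
    fix x y assume "x \<in> space M" "y \<in> space M"
    then have x: "x \<in> \<Omega>" and y: "y \<in> \<Omega>" by auto
    note hx = h_pos[OF x]
    show "ennreal (if norm (x - y) < s * h x then h x powr (\<gamma> - real DIM('a) - 2) * norm (x - y) powr - \<gamma> * (u x - u y)\<^sup>2 else 0)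
       \<le> ennreal (k x y) * \<Phi> x + ennreal (k x y) * \<Phi> y"
    proof (cases "norm (x - y) < s * h x")
      case True
      let ?a = "h x powr (\<gamma> - d - 2) * norm (x - y) powr - \<gamma>"
      have "ennreal (?a * (u x - u y)\<^sup>2) = ennreal ?a * ennreal ((u x - u y)\<^sup>2)" by (simp add: ennreal_mult)
      also have "\<dots> \<le> ennreal ?a * (ennreal (2 * (30 / (s * h x)) ^ DIM('a) / unit_ball_vol (real DIM('a))) * (\<Phi> x + \<Phi> y))"
        unfolding \<Phi>_def by (rule mult_left_mono[OF increment_le_local_osc[OF u x y s True]]) simp
      also have "2 * (30 / (s * h x)) ^ DIM('a) / unit_ball_vol (real DIM('a)) = c1 * (s powr (- d) * h x powr (- d))"
        using s hx by (simp add: c1_def d_def powr_minus powr_realpow power_divide power_mult_distrib divide_simps)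
      also have "ennreal ?a * (ennreal (c1 * (s powr (- d) * h x powr (- d))) * (\<Phi> x + \<Phi> y)) = ennreal (?a * (c1 * (s powr (- d) * h x powr (- d)))) * (\<Phi> x + \<Phi> y)"
        using c1 by (simp add: ennreal_mult mult.assoc)
      also have "?a * (c1 * (s powr (- d) * h x powr (- d))) = k x y"
      proof -
        have "h x powr (\<gamma> - 2 * d - 2) = h x powr (\<gamma> - d - 2) * h x powr (- d)" by (simp add: powr_add[symmetric] algebra_simps)
        then show ?thesis using True by (simp add: k_def)
      qed
      finally show ?thesis using True by (simp add: d_def distrib_left)
    qed simp
  qed
  also have "\<dots> = (\<integral>\<^sup>+x. \<integral>\<^sup>+y. ennreal (k x y) * \<Phi> x \<partial>M \<partial>M) + (\<integral>\<^sup>+x. \<integral>\<^sup>+y. ennreal (k x y) * \<Phi> y \<partial>M \<partial>M)"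
  proof -
    have "(\<integral>\<^sup>+y. ennreal (k x y) * \<Phi> x + ennreal (k x y) * \<Phi> y \<partial>M) = (\<integral>\<^sup>+y. ennreal (k x y) * \<Phi> x \<partial>M) + (\<integral>\<^sup>+y. ennreal (k x y) * \<Phi> y \<partial>M)" for x
      by (rule nn_integral_add) measurable
    moreover have "(\<lambda>p. ennreal (k (fst p) (snd p)) * \<Phi> (fst p)) \<in> borel_measurable (M \<Otimes>\<^sub>M M)"
      "(\<lambda>p. ennreal (k (fst p) (snd p)) * \<Phi> (snd p)) \<in> borel_measurable (M \<Otimes>\<^sub>M M)" by measurable
    from borel_measurable_nn_integral_fst[OF this(1)] borel_measurable_nn_integral_fst[OF this(2)]
    have "(\<lambda>x. \<integral>\<^sup>+y. ennreal (k x y) * \<Phi> x \<partial>M) \<in> borel_measurable M" "(\<lambda>x. \<integral>\<^sup>+y. ennreal (k x y) * \<Phi> y \<partial>M) \<in> borel_measurable M"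
      by simp_all
    ultimately show ?thesis by (simp add: nn_integral_add)
  qed
  also have "(\<integral>\<^sup>+x. \<integral>\<^sup>+y. ennreal (k x y) * \<Phi> x \<partial>M \<partial>M) \<le> (\<integral>\<^sup>+x. ennreal (c1 * C0 * s powr (- \<gamma>)) * (ennreal (h x powr (- d - 2)) * \<Phi> x) \<partial>M)"
  proof (rule nn_integral_mono)
    fix x assume "x \<in> space M"
    then have x: "x \<in> \<Omega>" by simp
    note hx = h_pos[OF x]
    have "(\<integral>\<^sup>+y. ennreal (k x y) \<partial>M) = (\<integral>\<^sup>+y. ennreal (c1 * s powr (- d) * h x powr (\<gamma> - 2 * d - 2)) *
        ennreal (if norm (x - y) < s * h x then norm (x - y) powr (- \<gamma>) else 0) \<partial>M)"
      unfolding k_def using c1 by (intro nn_integral_cong) (auto simp: ennreal_mult[symmetric])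
    also have "\<dots> = ennreal (c1 * s powr (- d) * h x powr (\<gamma> - 2 * d - 2)) * (\<integral>\<^sup>+y. ennreal (if norm (x - y) < s * h x then norm (x - y) powr (- \<gamma>) else 0) \<partial>M)"
      by (rule nn_integral_cmult) measurable
    also have "\<dots> \<le> ennreal (c1 * s powr (- d) * h x powr (\<gamma> - 2 * d - 2)) * ennreal (C0 * (s * h x) powr (real DIM('a) - \<gamma>))"
      using s hx by (intro mult_left_mono riesz_M[OF C0(2)]) auto
    also have "\<dots> = ennreal ((c1 * s powr (- d) * h x powr (\<gamma> - 2 * d - 2)) * (C0 * (s * h x) powr (d - \<gamma>)))"
      using c1 C0(1) by (simp add: ennreal_mult d_def)
    also have "(c1 * s powr (- d) * h x powr (\<gamma> - 2 * d - 2)) * (C0 * (s * h x) powr (d - \<gamma>)) = c1 * C0 * (s powr (- d) * s powr (d - \<gamma>)) * (h x powr (\<gamma> - 2 * d - 2) * h x powr (d - \<gamma>))"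
      using s hx by (simp add: powr_mult)
    also have "\<dots> = c1 * C0 * s powr (- \<gamma>) * h x powr (- d - 2)" by (simp add: powr_add[symmetric])
    finally have "(\<integral>\<^sup>+y. ennreal (k x y) \<partial>M) \<le> ennreal (c1 * C0 * s powr (- \<gamma>) * h x powr (- d - 2))" .
    then have "(\<integral>\<^sup>+y. ennreal (k x y) \<partial>M) * \<Phi> x \<le> ennreal (c1 * C0 * s powr (- \<gamma>) * h x powr (- d - 2)) * \<Phi> x" by (rule mult_right_mono) simp
    then show "(\<integral>\<^sup>+y. ennreal (k x y) * \<Phi> x \<partial>M) \<le> ennreal (c1 * C0 * s powr (- \<gamma>)) * (ennreal (h x powr (- d - 2)) * \<Phi> x)"
      using c1 C0(1) by (simp add: nn_integral_multc ennreal_mult mult.assoc)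
  qed
  also have "(\<integral>\<^sup>+x. \<integral>\<^sup>+y. ennreal (k x y) * \<Phi> y \<partial>M \<partial>M) = (\<integral>\<^sup>+y. \<integral>\<^sup>+x. ennreal (k x y) * \<Phi> y \<partial>M \<partial>M)"
    by (rule MM.Fubini'[symmetric]) (use km \<Phi>m in \<open>simp add: split_beta'\<close>)
  also have "\<dots> \<le> (\<integral>\<^sup>+x. ennreal (c1 * C0 * ((4 / 3) powr (2 * d + 2 - \<gamma>) * (3 / 2) powr (d - \<gamma>)) * s powr (- \<gamma>)) * (ennreal (h x powr (- d - 2)) * \<Phi> x) \<partial>M)"
  proof (rule nn_integral_mono)
    fix y assume "y \<in> space M"
    then have y: "y \<in> \<Omega>" by simp
    note hy = h_pos[OF y]
    \<comment> \<open>The integration variable is now \<open>x\<close>, but the horizon in the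
      weight is h(x). Comparability gives h(x) \<ge> 3/4 h(y) inside a negative power, hence the
      factor with 4/3, and enlarges the ball of integration to 3/2 s h(y).\<close>
    define A where "A = c1 * s powr (- d) * ((4 / 3) powr (2 * d + 2 - \<gamma>) * h y powr (\<gamma> - 2 * d - 2))"
    have A: "0 \<le> A" using c1 by (simp add: A_def)
    have "(\<integral>\<^sup>+x. ennreal (k x y) \<partial>M) \<le> (\<integral>\<^sup>+x. ennreal A *
        ennreal (if norm (y - x) < 3 / 2 * s * h y then norm (y - x) powr (- \<gamma>) else 0) \<partial>M)"
    proof (rule nn_integral_mono)
      fix x assume "x \<in> space M"
      then have x: "x \<in> \<Omega>" by simp
      show "ennreal (k x y) \<le> ennreal A * ennreal (if norm (y - x) < 3 / 2 * s * h y then norm (y - x) powr (- \<gamma>) else 0)"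
      proof (cases "norm (x - y) < s * h x")
        case True
        note cmp = comparable[OF x y s(2) True]
        have "s * h x \<le> 3 / 2 * s * h y" using mult_left_mono[OF cmp(1), of s] s(1) by simp
        then have n: "norm (y - x) < 3 / 2 * s * h y" using True by (simp add: norm_minus_commute)
        have "h x powr (\<gamma> - 2 * d - 2) \<le> (3 / 4 * h y) powr (\<gamma> - 2 * d - 2)"
          using cmp(2) hy \<gamma> by (intro powr_mono2') (auto simp: d_def)
        also have "\<dots> = (4 / 3) powr (2 * d + 2 - \<gamma>) * h y powr (\<gamma> - 2 * d - 2)"
        proof -
          have "(3 / 4 :: real) powr (\<gamma> - 2 * d - 2) = (4 / 3) powr (2 * d + 2 - \<gamma>)"
            using powr_minus_divide[of "4 / 3" "2 * d + 2 - \<gamma>"] powr_divide[of 1 "4 / 3" "2 * d + 2 - \<gamma>"] powr_minus[of "3/4" "2 * d + 2 - \<gamma>"]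
            by (simp add: powr_divide field_simps)
          then show ?thesis using hy powr_mult[of "3 / 4" "h y" "\<gamma> - 2 * d - 2"] by metis
        qed
        finally have hp: "h x powr (\<gamma> - 2 * d - 2) \<le> (4 / 3) powr (2 * d + 2 - \<gamma>) * h y powr (\<gamma> - 2 * d - 2)" .
        have "k x y \<le> A * norm (y - x) powr (- \<gamma>)"
          unfolding k_def A_def using True c1 mult_right_mono[OF hp, of "norm (x - y) powr (- \<gamma>)"]
          by (auto simp: norm_minus_commute mult.assoc intro!: mult_left_mono)
        then show ?thesis using n A by (simp add: ennreal_mult[symmetric] ennreal_leI)
      qed (simp add: k_def)
    qed
    also have "\<dots> = ennreal A * (\<integral>\<^sup>+x. ennreal (if norm (y - x) < 3 / 2 * s * h y then norm (y - x) powr (- \<gamma>) else 0) \<partial>M)"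
      by (rule nn_integral_cmult) measurable
    also have "\<dots> \<le> ennreal A * ennreal (C0 * (3 / 2 * s * h y) powr (real DIM('a) - \<gamma>))"
      using s hy by (intro mult_left_mono riesz_M[OF C0(2)]) auto
    also have "\<dots> = ennreal (A * (C0 * (3 / 2 * s * h y) powr (d - \<gamma>)))"
      using A C0(1) by (simp add: ennreal_mult d_def)
    also have "A * (C0 * (3 / 2 * s * h y) powr (d - \<gamma>)) = c1 * C0 * ((4 / 3) powr (2 * d + 2 - \<gamma>) * (3 / 2) powr (d - \<gamma>)) * (s powr (- d) * s powr (d - \<gamma>)) * (h y powr (\<gamma> - 2 * d - 2) * h y powr (d - \<gamma>))"
    proof -
      have "(3 / 2 * s * h y) powr (d - \<gamma>) = (3 / 2) powr (d - \<gamma>) * s powr (d - \<gamma>) * h y powr (d - \<gamma>)"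
        by (simp only: powr_mult)
      then show ?thesis unfolding A_def by (simp only: mult_ac)
    qed
    also have "\<dots> = c1 * C0 * ((4 / 3) powr (2 * d + 2 - \<gamma>) * (3 / 2) powr (d - \<gamma>)) * s powr (- \<gamma>) * h y powr (- d - 2)"
      by (simp add: powr_add[symmetric])
    finally have "(\<integral>\<^sup>+x. ennreal (k x y) \<partial>M) * \<Phi> y \<le> ennreal (c1 * C0 * ((4 / 3) powr (2 * d + 2 - \<gamma>) * (3 / 2) powr (d - \<gamma>)) * s powr (- \<gamma>) * h y powr (- d - 2)) * \<Phi> y" by (rule mult_right_mono) simp
    then show "(\<integral>\<^sup>+x. ennreal (k x y) * \<Phi> y \<partial>M) \<le> ennreal (c1 * C0 * ((4 / 3) powr (2 * d + 2 - \<gamma>) * (3 / 2) powr (d - \<gamma>)) * s powr (- \<gamma>)) * (ennreal (h y powr (- d - 2)) * \<Phi> y)"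
      using c1 C0(1) by (simp add: nn_integral_multc ennreal_mult mult.assoc)
  qed
  finally have "energy \<Omega> h s \<gamma> u \<le> ennreal (c1 * C0 * s powr (- \<gamma>)) * energy \<Omega> h (4 / 5 * s) 0 u
     + ennreal (c1 * C0 * ((4 / 3) powr (2 * d + 2 - \<gamma>) * (3 / 2) powr (d - \<gamma>)) * s powr (- \<gamma>)) * energy \<Omega> h (4 / 5 * s) 0 u"
    unfolding energy_0[OF u] by (simp add: nn_integral_cmult d_def \<Phi>_def add_mono)
  also have "\<dots> = ennreal (c1 * C0 * s powr (- \<gamma>) + c1 * C0 * ((4 / 3) powr (2 * d + 2 - \<gamma>) * (3 / 2) powr (d - \<gamma>)) * s powr (- \<gamma>)) * energy \<Omega> h (4 / 5 * s) 0 u"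
    using c1 C0(1) by (subst ennreal_plus) (auto simp: distrib_right)
  finally show ?thesis unfolding c1_def d_def by (simp add: algebra_simps)
qed

end

text \<open>One step removes the singularity; further steps, now with \<gamma> = 0, multiply the
  factor by 4/5 until it is at most 1. Their number is determined by \<open>K\<close> alone, so the
  constant is uniform over domains, horizons and functions.\<close>

lemma energy_comparison:
  fixes \<gamma> K :: real
  assumes \<gamma>: "0 \<le> \<gamma>" "\<gamma> < real DIM('a::euclidean_space)"
  shows "\<exists>C>0. \<forall>(\<Omega>::'a set) h L u s. horizon \<Omega> h L \<longrightarrow> u \<in> borel_measurable (lebesgue_on \<Omega>) \<longrightarrow>
    1 \<le> s \<longrightarrow> s \<le> K \<longrightarrow> L * s \<le> 1 / 3 \<longrightarrow> energy \<Omega> h s \<gamma> u \<le> ennreal C * energy \<Omega> h 1 0 u"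
proof -
  define d where "d = real DIM('a)"
  have one: "\<exists>C>0. \<forall>(\<Omega>::'a set) h L u s. horizon \<Omega> h L \<longrightarrow> u \<in> borel_measurable (lebesgue_on \<Omega>) \<longrightarrow>
    0 < s \<longrightarrow> L * s \<le> 1 / 3 \<longrightarrow> energy \<Omega> h s \<gamma> u \<le> ennreal (C * s powr (- \<gamma>)) * energy \<Omega> h (4 / 5 * s) 0 u"
    if \<gamma>: "0 \<le> \<gamma>" "\<gamma> < real DIM('a)" for \<gamma>
  proof -
    obtain C0 where C0: "0 < C0" "\<forall>(x::'a) R. 0 < R \<longrightarrow>
      (\<integral>\<^sup>+z. ennreal (norm (x - z) powr (- \<gamma>)) * indicator (ball x R) z \<partial>lborel) \<le> ennreal (C0 * R powr (real DIM('a) - \<gamma>))"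
      using riesz_kernel_nn_integral[OF \<gamma>] by auto
    let ?C = "2 * 30 ^ DIM('a) / unit_ball_vol (real DIM('a)) * C0 *
     (1 + (4 / 3) powr (2 * real DIM('a) + 2 - \<gamma>) * (3 / 2) powr (real DIM('a) - \<gamma>))"
    have "?C > 0" using C0(1) by (intro mult_pos_pos divide_pos_pos add_pos_nonneg) auto
    then show ?thesis
      using horizon.energy_chain_step[OF _ C0 \<gamma>] by (intro exI[of _ ?C]) blast
  qed
  obtain C1 where C1: "C1 > 0" "\<And>(\<Omega>::'a set) h L u s. horizon \<Omega> h L \<Longrightarrow> u \<in> borel_measurable (lebesgue_on \<Omega>) \<Longrightarrow>
    0 < s \<Longrightarrow> L * s \<le> 1 / 3 \<Longrightarrow> energy \<Omega> h s \<gamma> u \<le> ennreal (C1 * s powr (- \<gamma>)) * energy \<Omega> h (4 / 5 * s) 0 u"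
    using one[OF \<gamma>] by blast
  have zero: "(0::real) \<le> 0" "0 < real DIM('a)" by auto
  obtain C2 where C2: "C2 > 0" "\<And>(\<Omega>::'a set) h L u s. horizon \<Omega> h L \<Longrightarrow> u \<in> borel_measurable (lebesgue_on \<Omega>) \<Longrightarrow>
    0 < s \<Longrightarrow> L * s \<le> 1 / 3 \<Longrightarrow> energy \<Omega> h s 0 u \<le> ennreal (C2 * s powr (- 0)) * energy \<Omega> h (4 / 5 * s) 0 u"
    using one[OF zero] by blast
  have iter: "energy \<Omega> h s 0 u \<le> ennreal (max 1 C2 ^ n) * energy \<Omega> h 1 0 u"
    if H: "horizon \<Omega> h L" "u \<in> borel_measurable (lebesgue_on \<Omega>)" "0 < s" "L * s \<le> 1 / 3" "s * (4 / 5) ^ n \<le> 1"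
    for \<Omega> :: "'a set" and h L u s n
    using H(3-)
  proof (induction n arbitrary: s)
    case 0
    then show ?case using horizon.energy_mono[OF H(1), of s 1 0 u] by simp
  next
    case (Suc n)
    have "L * (4 / 5 * s) \<le> 1 / 3" using Suc.prems(2) Suc.prems(1) horizon.L_pos[OF H(1)]
      using mult_pos_pos[of L s] by simp
    then have IH: "energy \<Omega> h (4 / 5 * s) 0 u \<le> ennreal (max 1 C2 ^ n) * energy \<Omega> h 1 0 u"
      using Suc.prems by (intro Suc.IH) auto
    have "energy \<Omega> h s 0 u \<le> ennreal (C2 * s powr (- 0)) * energy \<Omega> h (4 / 5 * s) 0 u"
      by (rule C2(2)[OF H(1,2) Suc.prems(1,2)])
    also have "\<dots> \<le> ennreal (max 1 C2) * (ennreal (max 1 C2 ^ n) * energy \<Omega> h 1 0 u)"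
      using Suc.prems(1) by (intro mult_mono IH ennreal_leI) auto
    also have "\<dots> = ennreal (max 1 C2 ^ Suc n) * energy \<Omega> h 1 0 u"
      by (simp add: ennreal_mult mult.assoc)
    finally show ?case .
  qed
  have "0 < 1 / (\<bar>K\<bar> + 1)" by simp
  then obtain n where n: "(4 / 5 :: real) ^ n < 1 / (\<bar>K\<bar> + 1)"
    using real_arch_pow_inv[of "1 / (\<bar>K\<bar> + 1)" "4 / 5"] by auto
  have "energy \<Omega> h s \<gamma> u \<le> ennreal (C1 * max 1 C2 ^ n) * energy \<Omega> h 1 0 u"
    if H: "horizon \<Omega> h L" "u \<in> borel_measurable (lebesgue_on \<Omega>)" "1 \<le> s" "s \<le> K" "L * s \<le> 1 / 3"
    for \<Omega> :: "'a set" and h L u s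
  proof -
    have L: "0 < L" by (rule horizon.L_pos[OF H(1)])
    have "energy \<Omega> h s \<gamma> u \<le> ennreal (C1 * s powr (- \<gamma>)) * energy \<Omega> h (4 / 5 * s) 0 u"
      using H by (intro C1(2)) auto
    also have "\<dots> \<le> ennreal C1 * (ennreal (max 1 C2 ^ n) * energy \<Omega> h 1 0 u)"
    proof (intro mult_mono iter[OF H(1,2)] ennreal_leI)
      have "s powr (- \<gamma>) \<le> 1" using H(3) \<gamma> powr_mono2'[of "- \<gamma>" 1 s] by simp
      then show "C1 * s powr (- \<gamma>) \<le> C1" using C1(1) by simp
      show "L * (4 / 5 * s) \<le> 1 / 3" using mult_left_mono[of "4 / 5 * s" s L] H(3,5) L by linarith
      have "4 / 5 * s * (4 / 5) ^ n \<le> (\<bar>K\<bar> + 1) * (1 / (\<bar>K\<bar> + 1))"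
        using H(3,4) n by (intro mult_mono) auto
      also have "\<dots> = 1" by simp
      finally show "4 / 5 * s * (4 / 5) ^ n \<le> 1" .
    qed (use H in auto)
    finally show ?thesis using C1(1) by (simp add: ennreal_mult mult.assoc)
  qed
  moreover have "C1 * max 1 C2 ^ n > 0" using C1(1) by simp
  ultimately show ?thesis by blast
qed

section \<open>Integration by parts against a singular kernel\<close>

text \<open>A directional derivative is a pointwise limit of difference quotients of a continuous
  function, so its measurability requires no continuity of the gradient.\<close>

lemma borel_measurable_directional_derivative:
  fixes F :: "'a::euclidean_space \<Rightarrow> real"
  assumes F: "\<And>x. (F has_derivative (\<lambda>h. D x \<bullet> h)) (at x)"
  shows "(\<lambda>x. D x \<bullet> b) \<in> borel_measurable borel"
proof -
  define t where "t n = inverse (real (Suc n))" for n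
  have Fc: "continuous_on UNIV F" by (rule has_derivative_continuous_on, rule has_derivative_at_withinI, rule F)
  have Fm [measurable]: "F \<in> borel_measurable borel" by (rule borel_measurable_continuous_onI[OF Fc])
  have "(\<lambda>n. (F (x + t n *\<^sub>R b) - F x) / t n) \<longlonglongrightarrow> D x \<bullet> b" for x
  proof -
    have "((\<lambda>s. F (x + s *\<^sub>R b)) has_derivative (\<lambda>h. D (x + 0 *\<^sub>R b) \<bullet> (h *\<^sub>R b))) (at 0)"
      by (rule has_derivative_compose[OF _ F]) (auto intro!: derivative_eq_intros)
    then have "((\<lambda>s. F (x + s *\<^sub>R b)) has_real_derivative (D x \<bullet> b)) (at 0)"
      by (simp add: has_field_derivative_def mult_commute_abs)
    then have "((\<lambda>h. (F (x + h *\<^sub>R b) - F x) / h) \<longlongrightarrow> D x \<bullet> b) (at 0)"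
      by (simp add: has_field_derivative_iff)
    moreover have "t \<longlonglongrightarrow> 0" unfolding t_def by (rule LIMSEQ_inverse_real_of_nat)
    moreover have "t n \<noteq> 0" for n by (simp add: t_def)
    ultimately show ?thesis unfolding tendsto_at_iff_sequentially by (auto simp: o_def)
  qed
  then show ?thesis
    by (rule borel_measurable_LIMSEQ_real) measurable
qed

lemma riesz_kernel_integrable:
  fixes y :: "'a::euclidean_space"
  assumes "0 \<le> \<gamma>" "\<gamma> < real DIM('a)"
  shows "integrable lborel (\<lambda>x. norm (x - y) powr (- \<gamma>) * indicator (cball 0 R) x)"
proof (rule integrableI_bounded)
  obtain C where C: "\<And>(x::'a) R. 0 < R \<Longrightarrow>
    (\<integral>\<^sup>+z. ennreal (norm (x - z) powr (- \<gamma>)) * indicator (ball x R) z \<partial>lborel) \<le> ennreal (C * R powr (real DIM('a) - \<gamma>))"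
    using riesz_kernel_nn_integral[OF assms] by blast
  define S where "S = \<bar>R\<bar> + norm y + 1"
  have S: "S > 0" by (simp add: S_def add_nonneg_pos)
  have "(\<integral>\<^sup>+x. ennreal (norm (norm (x - y) powr (- \<gamma>) * indicator (cball 0 R) x)) \<partial>lborel)
    \<le> (\<integral>\<^sup>+z. ennreal (norm (y - z) powr (- \<gamma>)) * indicator (ball y S) z \<partial>lborel)"
  proof (rule nn_integral_mono)
    fix z
    have "z \<in> ball y S" if "norm z \<le> R"
      using that norm_triangle_ineq4[of y z] by (simp add: dist_norm S_def)
    then show "ennreal (norm (norm (z - y) powr (- \<gamma>) * indicator (cball 0 R) z)) \<le> ennreal (norm (y - z) powr (- \<gamma>)) * indicator (ball y S) z"
      by (cases "norm z \<le> R") (simp_all add: norm_minus_commute)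
  qed
  also have "\<dots> \<le> ennreal (C * S powr (real DIM('a) - \<gamma>))" by (rule C[OF S])
  finally show "(\<integral>\<^sup>+x. ennreal (norm (norm (x - y) powr (- \<gamma>) * indicator (cball 0 R) x)) \<partial>lborel) < \<infinity>"
    by (simp add: order_le_less_trans)
next
  have [measurable]: "cball (0::'a) R \<in> sets borel" by simp
  show "(\<lambda>x. norm (x - y) powr (- \<gamma>) * indicator (cball 0 R) x) \<in> borel_measurable lborel" by measurable
qed

text \<open>The singularity is removed by the factor \<open>(s\<^sup>2 / (s\<^sup>2 + \<epsilon>\<^sup>2))\<^sup>m\<close> with \<open>s = |x - y|\<close>, whose gradient is at
  most \<open>2m / s\<close> uniformly in \<open>\<epsilon>\<close> and tends to zero away from \<open>y\<close>.\<close>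

lemma integral_partial_singular:
  fixes F :: "'a::euclidean_space \<Rightarrow> real"
  assumes F: "\<And>x. x \<noteq> y \<Longrightarrow> (F has_derivative (\<lambda>v. G x \<bullet> v)) (at x)"
    and \<beta>: "0 \<le> \<beta>" "\<beta> + 1 < real DIM('a)"
    and bF: "\<And>x. x \<noteq> y \<Longrightarrow> \<bar>F x\<bar> \<le> A * norm (x - y) powr (- \<beta>)"
    and bG: "\<And>x. x \<noteq> y \<Longrightarrow> norm (G x) \<le> A * norm (x - y) powr (- \<beta> - 1)"
    and R: "\<And>x. R < norm x \<Longrightarrow> F x = 0" and Gy: "G y = 0" and b: "norm b = 1"
  shows "(\<integral>x. G x \<bullet> b \<partial>lborel) = 0" and "(\<lambda>x. G x \<bullet> b) \<in> borel_measurable borel"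
proof -
  define \<epsilon> where "\<epsilon> n = inverse (real (Suc n))" for n
  have \<epsilon>: "0 < \<epsilon> n" "\<epsilon> n \<le> 1" for n by (auto simp: \<epsilon>_def divide_simps)
  \<comment> \<open>With m \<ge> \<beta> + 2 the product of F with the m-th power of q is of order
    |x - y|^(2 m - \<beta>), an exponent of at least 2. The regularised function is therefore
    differentiable at the pole, with derivative 0.\<close>
  define m where "m = nat \<lceil>\<beta>\<rceil> + 2"
  have m: "\<beta> + 2 \<le> real m" using \<beta>(1) by (simp add: m_def)
  have m0: "m \<ge> 2" by (simp add: m_def)
  define q where "q n x = (norm (x - y))\<^sup>2 / ((norm (x - y))\<^sup>2 + (\<epsilon> n)\<^sup>2)" for n x
  have den: "0 < (norm (x - y))\<^sup>2 + (\<epsilon> n)\<^sup>2" for n x using \<epsilon>[of n] by (simp add: add_nonneg_pos)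
  have q: "0 \<le> q n x" "q n x \<le> 1" for n x using den[of x n] by (auto simp: q_def divide_simps)
  define X where "X n x = (real m * q n x ^ (m - 1) * (2 * (\<epsilon> n)\<^sup>2 / ((norm (x - y))\<^sup>2 + (\<epsilon> n)\<^sup>2)\<^sup>2)) *\<^sub>R (x - y)" for n x
  have Xder: "((\<lambda>x. q n x ^ m) has_derivative (\<lambda>v. X n x \<bullet> v)) (at x)" for n x
  proof -
    have n2: "((\<lambda>x. (norm (x - y))\<^sup>2) has_derivative (\<lambda>v. 2 * ((x - y) \<bullet> v))) (at x)"
      unfolding power2_norm_eq_inner by (auto intro!: derivative_eq_intros simp: inner_commute)
    have "(q n has_derivative (\<lambda>v. (2 * (\<epsilon> n)\<^sup>2 / ((norm (x - y))\<^sup>2 + (\<epsilon> n)\<^sup>2)\<^sup>2) * ((x - y) \<bullet> v))) (at x)"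
    proof -
      have "((\<lambda>t. t / (t + (\<epsilon> n)\<^sup>2)) has_real_derivative (\<epsilon> n)\<^sup>2 / (t + (\<epsilon> n)\<^sup>2)\<^sup>2) (at t)" if "t + (\<epsilon> n)\<^sup>2 > 0" for t
        using that by (auto intro!: derivative_eq_intros simp: power2_eq_square)
      from has_derivative_compose[OF n2 this[OF den[of x n], unfolded has_field_derivative_def]]
      show ?thesis unfolding q_def[abs_def] by (rule has_derivative_eq_rhs) (simp add: fun_eq_iff)
    qed
    from has_derivative_power[OF this, of m] show ?thesis
      by (rule has_derivative_eq_rhs) (simp add: X_def fun_eq_iff mult_ac)
  qed
  have Xbound: "norm (X n x) * norm (x - y) \<le> 2 * real m * q n x ^ m" for n x
  proof -
    define N where "N = (norm (x - y))\<^sup>2 + (\<epsilon> n)\<^sup>2"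
    have N: "N > 0" "(\<epsilon> n)\<^sup>2 \<le> N" using den[of x n] by (auto simp: N_def)
    have "norm (X n x) * norm (x - y) = real m * q n x ^ (m - 1) * (2 * (\<epsilon> n)\<^sup>2 / N\<^sup>2) * (norm (x - y))\<^sup>2"
      using q(1)[of n x] by (simp add: X_def N_def power2_eq_square)
    also have "\<dots> = 2 * real m * (q n x ^ (m - 1) * q n x) * ((\<epsilon> n)\<^sup>2 / N)"
    proof -
      have "2 * (\<epsilon> n)\<^sup>2 / N\<^sup>2 * (norm (x - y))\<^sup>2 = 2 * q n x * ((\<epsilon> n)\<^sup>2 / N)"
        unfolding q_def N_def[symmetric] by (simp add: power2_eq_square[of N])
      then have "c * (2 * (\<epsilon> n)\<^sup>2 / N\<^sup>2 * (norm (x - y))\<^sup>2) = c * (2 * q n x * ((\<epsilon> n)\<^sup>2 / N))" for c by (simp only:)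
      from this[of "real m * q n x ^ (m - 1)"] show ?thesis by (simp add: mult_ac)
    qed
    also have "q n x ^ (m - 1) * q n x = q n x ^ m" using m0 by (cases m) auto
    also have "2 * real m * q n x ^ m * ((\<epsilon> n)\<^sup>2 / N) \<le> 2 * real m * q n x ^ m * 1"
      using N q(1)[of n x] by (intro mult_left_mono) auto
    finally show ?thesis by simp
  qed
  have qsmall: "q n x ^ m \<le> (norm (x - y))\<^sup>2 ^ m / (\<epsilon> n)\<^sup>2 ^ m" for n x
  proof -
    have "q n x \<le> (norm (x - y))\<^sup>2 / (\<epsilon> n)\<^sup>2"
      unfolding q_def using \<epsilon>(1)[of n] using den[of x n] by (intro divide_left_mono mult_pos_pos) auto
    then have "q n x ^ m \<le> ((norm (x - y))\<^sup>2 / (\<epsilon> n)\<^sup>2) ^ m" using q(1) by (rule power_mono)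
    then show ?thesis by (simp add: power_divide)
  qed
  have A: "0 \<le> A"
  proof -
    obtain z :: 'a where "norm z = 1" using vector_choose_size[of 1] by auto
    then have "y + z \<noteq> y" by auto
    from bF[OF this] have "\<bar>F (y + z)\<bar> \<le> A" using \<open>norm z = 1\<close> by simp
    then show ?thesis by linarith
  qed
  have pm: "(norm (x - y))\<^sup>2 ^ m = norm (x - y) powr (2 * real m)" if "x \<noteq> y" for x
    using powr_realpow[of "norm (x - y)" "2 * m"] that by (simp add: power_mult)
  define Fn where "Fn n x = F x * q n x ^ m" for n x
  define Gn where "Gn n x = q n x ^ m *\<^sub>R G x + F x *\<^sub>R X n x" for n x
  have qy: "q n y = 0" for n by (simp add: q_def)
  have Gny: "Gn n y = 0" for n using m0 qy by (simp add: Gn_def Gy X_def)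
  have sing: "\<bar>F x\<bar> * q n x ^ m \<le> A / (\<epsilon> n)\<^sup>2 ^ m * (norm (x - y))\<^sup>2" if "norm (x - y) \<le> 1" "x \<noteq> y" for n x
  proof -
    have s: "0 < norm (x - y)" using that by simp
    have "\<bar>F x\<bar> * q n x ^ m \<le> (A * norm (x - y) powr (- \<beta>)) * ((norm (x - y))\<^sup>2 ^ m / (\<epsilon> n)\<^sup>2 ^ m)"
      by (intro mult_mono bF that qsmall mult_nonneg_nonneg A) (use q in auto)
    also have "\<dots> = A / (\<epsilon> n)\<^sup>2 ^ m * (norm (x - y) powr (2 * real m - \<beta>))"
    proof -
      have "norm (x - y) powr (- \<beta>) * norm (x - y) powr (2 * real m) = norm (x - y) powr (2 * real m - \<beta>)"
        by (simp flip: powr_add)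
      then show ?thesis unfolding pm[OF that(2)] by (simp add: mult_ac)
    qed
    also have "\<dots> \<le> A / (\<epsilon> n)\<^sup>2 ^ m * (norm (x - y) powr 2)"
      using that(1) s m \<beta>(1) A \<epsilon>(1)[of n] by (intro mult_left_mono powr_mono') auto
    finally show ?thesis using s by (simp add: powr_numeral)
  qed
  have FnD: "(Fn n has_derivative (\<lambda>v. Gn n x \<bullet> v)) (at x)" for n x
  proof (cases "x = y")
    case False
    from has_derivative_mult[OF F[OF False] Xder[of n x]] show ?thesis
      unfolding Fn_def[abs_def] by (rule has_derivative_eq_rhs) (simp add: Gn_def fun_eq_iff inner_add_left algebra_simps)
  next
    case True
    \<comment> \<open>Whatever value F has at the pole, the regularised function is 0 there because
      \<open>q n y = 0\<close>, and near the pole it is bounded by B |x - y|^2.\<close>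
    have "(Fn n has_derivative (\<lambda>v. 0)) (at y)"
      unfolding has_derivative_within
    proof (intro conjI bounded_linear_zero)
      define B where "B = A / (\<epsilon> n)\<^sup>2 ^ m"
      show "((\<lambda>x. (1 / norm (x - y)) *\<^sub>R (Fn n x - (Fn n y + 0))) \<longlongrightarrow> 0) (at y)"
      proof (rule Lim_null_comparison)
        show "\<forall>\<^sub>F x in at y. norm ((1 / norm (x - y)) *\<^sub>R (Fn n x - (Fn n y + 0))) \<le> B * norm (x - y)"
          unfolding eventually_at
        proof (intro exI[of _ 1] conjI ballI impI)
          fix x assume x: "x \<noteq> y \<and> dist x y < 1"
          then have "\<bar>Fn n x\<bar> \<le> B * (norm (x - y))\<^sup>2"
            using sing[of x n] q(1)[of n x] by (simp add: Fn_def abs_mult B_def dist_norm)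
          then show "norm ((1 / norm (x - y)) *\<^sub>R (Fn n x - (Fn n y + 0))) \<le> B * norm (x - y)"
            using x m0 by (simp add: Fn_def[of n y] qy power2_eq_square field_simps power_0_left)
        qed simp
        show "((\<lambda>x. B * norm (x - y)) \<longlongrightarrow> 0) (at y)"
          by (auto intro!: tendsto_eq_intros)
      qed
    qed
    then show ?thesis using True Gny by simp
  qed
  have Gn_le: "norm (Gn n x) \<le> (1 + 2 * real m) * A * norm (x - y) powr (- \<beta> - 1) * q n x ^ m" if xy: "x \<noteq> y" for n x
  proof -
    have s: "0 < norm (x - y)" using xy by simp
    have "norm (X n x) \<le> 2 * real m * q n x ^ m / norm (x - y)" using Xbound[of n x] s by (simp add: field_simps)
    then have "norm (F x *\<^sub>R X n x) \<le> (A * norm (x - y) powr (- \<beta>)) * (2 * real m * q n x ^ m / norm (x - y))"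
      unfolding norm_scaleR by (intro mult_mono bF[OF xy]) (use A in auto)
    also have "\<dots> = 2 * real m * A * norm (x - y) powr (- \<beta> - 1) * q n x ^ m"
      using s by (simp add: powr_diff)
    finally have "norm (F x *\<^sub>R X n x) \<le> 2 * real m * A * norm (x - y) powr (- \<beta> - 1) * q n x ^ m" .
    moreover have "norm (q n x ^ m *\<^sub>R G x) \<le> A * norm (x - y) powr (- \<beta> - 1) * q n x ^ m"
      using mult_right_mono[OF bG[OF xy], of "q n x ^ m"] q(1)[of n x] by (simp add: mult.commute)
    ultimately show ?thesis unfolding Gn_def
      using norm_triangle_ineq[of "q n x ^ m *\<^sub>R G x" "F x *\<^sub>R X n x"] by (simp add: algebra_simps)
  qed
  have Gn_bounded: "\<bar>Gn n x \<bullet> b\<bar> \<le> (1 + 2 * real m) * A * (1 + 1 / (\<epsilon> n)\<^sup>2 ^ m)" for n x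
  proof (cases "x = y")
    case True
    then show ?thesis using A \<epsilon>(1)[of n] by (simp add: Gny)
  next
    case False
    have s: "0 < norm (x - y)" using False by simp
    have "norm (x - y) powr (- \<beta> - 1) * q n x ^ m \<le> 1 + 1 / (\<epsilon> n)\<^sup>2 ^ m"
    proof (cases "norm (x - y) \<le> 1")
      case True
      have "norm (x - y) powr (- \<beta> - 1) * q n x ^ m \<le> norm (x - y) powr (- \<beta> - 1) * (norm (x - y) powr (2 * real m) / (\<epsilon> n)\<^sup>2 ^ m)"
        using qsmall[of n x] unfolding pm[OF False] by (intro mult_left_mono) auto
      also have "\<dots> = norm (x - y) powr (2 * real m - \<beta> - 1) / (\<epsilon> n)\<^sup>2 ^ m" by (simp flip: powr_add add: algebra_simps)
      also have "\<dots> \<le> 1 / (\<epsilon> n)\<^sup>2 ^ m"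
        using True s m \<beta>(1) \<epsilon>(1)[of n] powr_mono'[of 0 "2 * real m - \<beta> - 1" "norm (x - y)"] by (intro divide_right_mono) auto
      finally show ?thesis by simp
    next
      case large: False
      have "norm (x - y) powr (- \<beta> - 1) \<le> 1" using large \<beta>(1) powr_mono2'[of "- \<beta> - 1" 1 "norm (x - y)"] by simp
      moreover have "q n x ^ m \<le> 1" using q by (simp add: power_le_one)
      ultimately have "norm (x - y) powr (- \<beta> - 1) * q n x ^ m \<le> 1" using q(1)[of n x] by (simp add: mult_le_one)
      then show ?thesis using \<epsilon>(1)[of n] by (smt (verit) divide_nonneg_nonneg zero_le_power zero_le_power2)
    qed
    then have "(1 + 2 * real m) * A * (norm (x - y) powr (- \<beta> - 1) * q n x ^ m) \<le> (1 + 2 * real m) * A * (1 + 1 / (\<epsilon> n)\<^sup>2 ^ m)"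
      using A by (intro mult_left_mono) auto
    then have "norm (Gn n x) \<le> (1 + 2 * real m) * A * (1 + 1 / (\<epsilon> n)\<^sup>2 ^ m)"
      using Gn_le[OF False, of n] by (simp only: mult.assoc)
    then show ?thesis using Cauchy_Schwarz_ineq2[of "Gn n x" b] b by simp
  qed
  have lim: "(\<lambda>n. Gn n x \<bullet> b) \<longlonglongrightarrow> G x \<bullet> b" for x
  proof (cases "x = y")
    case True
    then show ?thesis by (simp add: Gny Gy)
  next
    case False
    then have s: "0 < norm (x - y)" by simp
    have e0: "\<epsilon> \<longlonglongrightarrow> 0" unfolding \<epsilon>_def by (rule LIMSEQ_inverse_real_of_nat)
    have q1: "(\<lambda>n. q n x) \<longlonglongrightarrow> 1"
      unfolding q_def using s by (auto intro!: tendsto_eq_intros e0)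
    have "(\<lambda>n. X n x) \<longlonglongrightarrow> (real m * 1 ^ (m - 1) * (2 * 0\<^sup>2 / ((norm (x - y))\<^sup>2 + 0\<^sup>2)\<^sup>2)) *\<^sub>R (x - y)"
      unfolding X_def using s by (intro tendsto_intros q1 e0) auto
    then have X0: "(\<lambda>n. X n x) \<longlonglongrightarrow> 0" by simp
    have "(\<lambda>n. Gn n x \<bullet> b) \<longlonglongrightarrow> (1 ^ m *\<^sub>R G x + F x *\<^sub>R 0) \<bullet> b"
      unfolding Gn_def by (intro tendsto_intros q1 X0)
    then show ?thesis by simp
  qed
  have Gnm: "(\<lambda>x. Gn n x \<bullet> b) \<in> borel_measurable borel" for n
    by (rule borel_measurable_directional_derivative[OF FnD])
  show Gm: "(\<lambda>x. G x \<bullet> b) \<in> borel_measurable borel"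
    by (rule borel_measurable_LIMSEQ_real[OF lim Gnm])
  have G0: "G x = 0" if "R < norm x" for x
  proof (cases "x = y")
    case False
    have "(F has_derivative (\<lambda>h. 0)) (at x)"
    proof (rule has_derivative_transform_within_open[where f="\<lambda>x. 0" and s="- cball 0 R"])
      show "open (- cball (0::'a) R)" by (rule open_Compl[OF closed_cball])
    qed (use that R in auto)
    then have "(\<bullet>) (G x) = (\<lambda>h. 0)" using has_derivative_unique[OF F[OF False]] by blast
    then show ?thesis by (metis inner_eq_zero_iff)
  qed (simp add: Gy)
  have "(\<lambda>n. \<integral>x. Gn n x \<bullet> b \<partial>lborel) \<longlonglongrightarrow> (\<integral>x. G x \<bullet> b \<partial>lborel)"
  \<comment> \<open>The gradient of the regularising factor costs only one further power of |x - y|,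
    uniformly in n, so a Riesz kernel of order \<beta> + 1 < d on a ball dominates.\<close>
  proof (rule integral_dominated_convergence[where w="\<lambda>x. (1 + 2 * real m) * A * (norm (x - y) powr (- (\<beta> + 1)) * indicator (cball 0 R) x)"])
    show "integrable lborel (\<lambda>x. (1 + 2 * real m) * A * (norm (x - y) powr (- (\<beta> + 1)) * indicator (cball 0 R) x))"
      by (intro integrable_mult_right riesz_kernel_integrable) (use \<beta> in auto)
    show "AE x in lborel. norm (Gn n x \<bullet> b) \<le> (1 + 2 * real m) * A * (norm (x - y) powr (- (\<beta> + 1)) * indicator (cball 0 R) x)" for n
    proof (rule AE_I2)
      fix x
      show "norm (Gn n x \<bullet> b) \<le> (1 + 2 * real m) * A * (norm (x - y) powr (- (\<beta> + 1)) * indicator (cball 0 R) x)"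
      proof (cases "x = y \<or> R < norm x")
        case True
        then have "Gn n x = 0" using Gny G0 R by (auto simp: Gn_def)
        then show ?thesis using A by simp
      next
        case False
        then have "norm (Gn n x) \<le> (1 + 2 * real m) * A * norm (x - y) powr (- \<beta> - 1) * q n x ^ m" using Gn_le by simp
        also have "\<dots> \<le> (1 + 2 * real m) * A * norm (x - y) powr (- \<beta> - 1) * 1"
          using A q by (intro mult_left_mono power_le_one) auto
        finally show ?thesis using False Cauchy_Schwarz_ineq2[of "Gn n x" b] b by simp
      qed
    qed
  qed (use lim Gm Gnm in auto)
  moreover have "(\<lambda>n. \<integral>x. Gn n x \<bullet> b \<partial>lborel) = (\<lambda>n. 0)"
  proof
    fix n
    show "(\<integral>x. Gn n x \<bullet> b \<partial>lborel) = 0"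
      by (rule integral_partial_eq_0[OF FnD Gn_bounded _ b, of R]) (simp add: Fn_def R)
  qed
  ultimately have "(\<lambda>n. 0 :: real) \<longlonglongrightarrow> (\<integral>x. G x \<bullet> b \<partial>lborel)" by (simp only:)
  from LIMSEQ_unique[OF this tendsto_const] show "(\<integral>x. G x \<bullet> b \<partial>lborel) = 0" .
qed

section \<open>The symmetrized kernel and its gradient\<close>

lemma gradient_norm_le:
  fixes f :: "'a::euclidean_space \<Rightarrow> real"
  assumes f: "(f has_derivative (\<lambda>v. g \<bullet> v)) (at x)" and S: "open S" "x \<in> S"
    and lip: "\<And>y. y \<in> S \<Longrightarrow> \<bar>f y - f x\<bar> \<le> L * norm (y - x)"
  shows "norm g \<le> L"
proof (cases "g = 0")
  case True
  obtain e where e: "0 < e" "cball x e \<subseteq> S" using S open_contains_cball by metis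
  obtain z :: 'a where z: "norm z = e" using vector_choose_size[of e] e by auto
  then have "x + z \<in> S" using e by (auto simp: dist_norm)
  then have "0 \<le> L * norm z" using lip[of "x + z"] by (metis abs_ge_zero add_diff_cancel_left' order_trans)
  then show ?thesis using z e True by (simp add: zero_le_mult_iff)
next
  case False
  have "((\<lambda>t. f (x + t *\<^sub>R g)) has_derivative (\<lambda>h. g \<bullet> (h *\<^sub>R g))) (at 0)"
    by (rule has_derivative_compose[where f="\<lambda>t. x + t *\<^sub>R g" and g=f and g'="\<lambda>v. g \<bullet> v"]) (use f in \<open>auto intro!: derivative_eq_intros\<close>)
  then have "((\<lambda>t. f (x + t *\<^sub>R g)) has_real_derivative (g \<bullet> g)) (at 0)"
    by (simp add: has_field_derivative_def mult_commute_abs)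
  then have "((\<lambda>t. (f (x + t *\<^sub>R g) - f x) / t) \<longlongrightarrow> g \<bullet> g) (at 0)"
    by (simp add: has_field_derivative_iff)
  moreover have "\<forall>\<^sub>F t in at 0. (f (x + t *\<^sub>R g) - f x) / t \<le> L * norm g"
  proof -
    have "((\<lambda>t. x + t *\<^sub>R g) \<longlongrightarrow> x + 0 *\<^sub>R g) (at 0)" by (intro tendsto_intros)
    then have "\<forall>\<^sub>F t in at 0. x + t *\<^sub>R g \<in> S" using S by (intro topological_tendstoD) auto
    moreover have "\<forall>\<^sub>F t in at (0::real). t \<noteq> 0" by (simp add: eventually_at_filter)
    ultimately show ?thesis
    proof eventually_elim
      case (elim t)
      have "\<bar>(f (x + t *\<^sub>R g) - f x) / t\<bar> \<le> L * norm g"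
        using lip[OF elim(1)] elim(2) by (simp add: abs_divide field_simps)
      then show ?case by linarith
    qed
  qed
  ultimately have "g \<bullet> g \<le> L * norm g"
    by (rule tendsto_upperbound) simp
  then show ?thesis using False by (simp add: dot_square_norm power2_eq_square)
qed

text \<open>The bounds \<open>R0\<close> of the profile and \<open>C0\<close> of the Riesz kernel
  are parameters, so that the constants derived from them are visibly independent of the horizon and
  hence of \<delta>. The balls of three times the horizon give room for translating the kernel when
  P is differentiated.\<close>

locale nonlocal_kernel = horizon \<Omega> h "1/3" for \<Omega> :: "'a::euclidean_space set" and h +
  fixes \<beta> :: real and \<rho> \<rho>' :: "real \<Rightarrow> real" and H :: "'a \<Rightarrow> 'a" and R0 C0 :: real
  assumes \<beta>: "0 \<le> \<beta>" "\<beta> + 1 < real DIM('a)"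
    and \<rho>_nonneg: "\<And>r. 0 \<le> \<rho> r" and \<rho>_supp: "\<And>r. 1 \<le> r \<Longrightarrow> \<rho> r = 0" "\<And>r. 1 \<le> r \<Longrightarrow> \<rho>' r = 0"
    and \<rho>_der: "\<And>r. (\<rho> has_real_derivative \<rho>' r) (at r)" and \<rho>'_cont: "continuous_on UNIV \<rho>'"
    and \<rho>_le: "\<And>r. \<rho> r \<le> R0" "\<And>r. \<bar>\<rho>' r\<bar> \<le> R0"
    and ball3: "\<And>x. x \<in> \<Omega> \<Longrightarrow> ball x (3 * h x) \<subseteq> \<Omega>"
    and h_der: "\<And>x. x \<in> \<Omega> \<Longrightarrow> (h has_derivative (\<lambda>v. H x \<bullet> v)) (at x)" and H_cont: "continuous_on \<Omega> H"
    and C0: "0 < C0" "\<forall>(x::'a) R. 0 < R \<longrightarrow>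
      (\<integral>\<^sup>+z. ennreal (norm (x - z) powr (- (\<beta> + 1))) * indicator (ball x R) z \<partial>lborel) \<le> ennreal (C0 * R powr (real DIM('a) - (\<beta> + 1)))"
begin

text \<open>The kernel is written in terms of the distance s and the horizon t as two independent
  variables; \<open>\<psi>s\<close> and \<open>\<psi>t\<close> are the two partial derivatives of
  \<open>\<psi>\<close>. The symmetric kernel k is then the singular factor times
  \<open>\<psi>\<close> at h(x) plus \<open>\<psi>\<close> at h(y).\<close>

definition \<psi> where "\<psi> s t = t powr (\<beta> - real DIM('a) - 2) * \<rho> (s / t)"
definition \<psi>s where "\<psi>s s t = t powr (\<beta> - real DIM('a) - 3) * \<rho>' (s / t)"
definition \<psi>t where "\<psi>t s t = (\<beta> - real DIM('a) - 2) * t powr (\<beta> - real DIM('a) - 3) * \<rho> (s / t) - s * t powr (\<beta> - real DIM('a) - 4) * \<rho>' (s / t)"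
definition "ker" where "ker x y = norm (x - y) powr (- \<beta>) * (\<psi> (norm (x - y)) (h x) + \<psi> (norm (x - y)) (h y))"
text \<open>The gradient of k in \<open>x\<close>: both summands depend on \<open>x\<close> through
  the distance, and only the first through the horizon, with \<open>H\<close> the gradient of
  \<open>h\<close>. On the diagonal the value is 0, since 0 raised to any real power is 0.\<close>

definition Dker where "Dker x y =
  ((- \<beta> * norm (x - y) powr (- \<beta> - 1) * (\<psi> (norm (x - y)) (h x) + \<psi> (norm (x - y)) (h y))
     + norm (x - y) powr (- \<beta>) * (\<psi>s (norm (x - y)) (h x) + \<psi>s (norm (x - y)) (h y))) / norm (x - y)) *\<^sub>R (x - y)
   + (norm (x - y) powr (- \<beta>) * \<psi>t (norm (x - y)) (h x)) *\<^sub>R H x"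
text \<open>The weight of \<open>energy\<close> with s = 1 and \<gamma> = \<beta> + 1. Its
  symmetrisation \<open>S\<close> dominates, up to constants, both k and h times the gradient of
  k.\<close>

definition E where "E x y = (if norm (x - y) < h x then h x powr (\<beta> - real DIM('a) - 1) * norm (x - y) powr (- (\<beta> + 1)) else 0)"
definition S where "S x y = E x y + E y x"

section \<open>Pointwise bounds for the kernel and its gradient\<close>

lemma \<rho>_cont: "continuous_on UNIV \<rho>"
  using \<rho>_der by (meson DERIV_isCont continuous_at_imp_continuous_on)

lemma \<rho>_measurable [measurable]: "\<rho> \<in> borel_measurable borel" "\<rho>' \<in> borel_measurable borel"
  using \<rho>_cont \<rho>'_cont by (auto intro: borel_measurable_continuous_onI)

lemma H_M [measurable]: "H \<in> borel_measurable M"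
  by (rule continuous_imp_measurable_on_sets_lebesgue[OF H_cont]) simp

lemma R0: "0 \<le> R0" using \<rho>_nonneg \<rho>_le(1) order_trans by blast

lemma H_le: "x \<in> \<Omega> \<Longrightarrow> norm (H x) \<le> 1 / 3"
  by (rule gradient_norm_le[OF h_der open_\<Omega>]) (use h_lip in blast)+

lemma ker_measurable [measurable]:
  "(\<lambda>p. ker (fst p) (snd p)) \<in> borel_measurable (M \<Otimes>\<^sub>M M)"
  "(\<lambda>p. Dker (fst p) (snd p)) \<in> borel_measurable (M \<Otimes>\<^sub>M M)"
  "(\<lambda>p. S (fst p) (snd p)) \<in> borel_measurable (M \<Otimes>\<^sub>M M)"
  "(\<lambda>y. ker x y) \<in> borel_measurable M" "(\<lambda>x. ker x y) \<in> borel_measurable M"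
  "(\<lambda>y. Dker x y) \<in> borel_measurable M" "(\<lambda>x. Dker x y) \<in> borel_measurable M"
  "(\<lambda>y. S x y) \<in> borel_measurable M" "(\<lambda>x. S x y) \<in> borel_measurable M"
  unfolding ker_def Dker_def S_def E_def \<psi>_def \<psi>s_def \<psi>t_def by measurable

lemma E_nonneg: "0 \<le> E x y" by (simp add: E_def)

lemma S_nonneg: "0 \<le> S x y" by (simp add: S_def E_nonneg)

lemma psi_eq_0: "0 < t \<Longrightarrow> t \<le> s \<Longrightarrow> \<psi> s t = 0" "0 < t \<Longrightarrow> t \<le> s \<Longrightarrow> \<psi>s s t = 0" "0 < t \<Longrightarrow> t \<le> s \<Longrightarrow> \<psi>t s t = 0"
  by (simp_all add: \<psi>_def \<psi>s_def \<psi>t_def \<rho>_supp)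

lemma psi_nonneg: "0 \<le> \<psi> s t" by (simp add: \<psi>_def \<rho>_nonneg)

lemma psi_le: "\<psi> s t \<le> R0 * t powr (\<beta> - real DIM('a) - 2)"
  unfolding \<psi>_def using mult_left_mono[OF \<rho>_le(1), of "t powr (\<beta> - real DIM('a) - 2)"] by (simp add: mult.commute)

lemma psi_s_le: "\<bar>\<psi>s s t\<bar> \<le> R0 * t powr (\<beta> - real DIM('a) - 3)"
  unfolding \<psi>s_def using mult_left_mono[OF \<rho>_le(2), of "t powr (\<beta> - real DIM('a) - 3)"] by (simp add: mult.commute abs_mult)

lemma psi_t_le:
  assumes "0 < t" "0 \<le> s"
  shows "\<bar>\<psi>t s t\<bar> \<le> (real DIM('a) + 3) * R0 * t powr (\<beta> - real DIM('a) - 3)"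
proof (cases "s < t")
  case True
  have e: "t powr (\<beta> - real DIM('a) - 4) = t powr (\<beta> - real DIM('a) - 3) / t"
    using assms powr_diff[of t "\<beta> - real DIM('a) - 3" 1] by (simp add: algebra_simps)
  have 1: "\<bar>(\<beta> - real DIM('a) - 2) * t powr (\<beta> - real DIM('a) - 3) * \<rho> (s / t)\<bar> \<le> (real DIM('a) + 2) * t powr (\<beta> - real DIM('a) - 3) * R0"
    unfolding abs_mult using \<beta> \<rho>_nonneg \<rho>_le by (intro mult_mono) auto
  have "\<bar>s * t powr (\<beta> - real DIM('a) - 4) * \<rho>' (s / t)\<bar> = (s / t) * t powr (\<beta> - real DIM('a) - 3) * \<bar>\<rho>' (s / t)\<bar>"
    unfolding e using assms by (simp add: abs_mult)
  also have "\<dots> \<le> 1 * t powr (\<beta> - real DIM('a) - 3) * R0"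
    using True assms \<rho>_le R0 by (intro mult_mono) auto
  finally show ?thesis using 1 unfolding \<psi>t_def by (simp add: algebra_simps)
next
  case False
  then show ?thesis using psi_eq_0(3)[of t s] assms R0 by simp
qed

text \<open>Inside the horizon n / t < 1, so surplus powers of the distance may be traded for powers
  of the horizon. This brings all terms of k and of its gradient to the common form of the weight
  \<open>E\<close>, divided by the horizon in the case of the gradient.\<close>

lemma powr_split: "0 < n \<Longrightarrow> n < t \<Longrightarrow> n powr (- \<beta>) * t powr (\<beta> - real DIM('a) - 2) \<le> t powr (\<beta> - real DIM('a) - 1) * n powr (- (\<beta> + 1))"
  "0 < n \<Longrightarrow> n < t \<Longrightarrow> n powr (- \<beta>) * t powr (\<beta> - real DIM('a) - 3) \<le> t powr (\<beta> - real DIM('a) - 1) * n powr (- (\<beta> + 1)) / t"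
  "0 < n \<Longrightarrow> n < t \<Longrightarrow> n powr (- \<beta> - 1) * t powr (\<beta> - real DIM('a) - 2) = t powr (\<beta> - real DIM('a) - 1) * n powr (- (\<beta> + 1)) / t"
proof -
  assume n: "0 < n" "n < t"
  define T where "T = t powr (\<beta> - real DIM('a) - 1)"
  define N where "N = n powr (- (\<beta> + 1))"
  have T: "t powr (\<beta> - real DIM('a) - 2) = T / t" "t powr (\<beta> - real DIM('a) - 3) = T / t / t"
    using n powr_diff[of t "\<beta> - real DIM('a) - 1" 1] powr_diff[of t "\<beta> - real DIM('a) - 2" 1] by (simp_all add: T_def algebra_simps)
  have N: "n powr (- \<beta>) = N * n" "n powr (- \<beta> - 1) = N"
  proof -
    have "- \<beta> = - (\<beta> + 1) + 1" by simp
    then have "n powr (- \<beta>) = n powr (- (\<beta> + 1)) * n powr 1" using powr_add[of n "- (\<beta> + 1)" 1] by metis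
    then show "n powr (- \<beta>) = N * n" using n by (simp add: N_def)
    have "- \<beta> - 1 = - (\<beta> + 1)" by simp
    then show "n powr (- \<beta> - 1) = N" unfolding N_def by metis
  qed
  have p: "0 \<le> T * N" by (simp add: T_def N_def)
  have q: "T * N * (n / t) \<le> T * N * 1" using n p by (intro mult_left_mono) auto
  show "n powr (- \<beta>) * t powr (\<beta> - real DIM('a) - 2) \<le> t powr (\<beta> - real DIM('a) - 1) * n powr (- (\<beta> + 1))"
    unfolding T N T_def[symmetric] N_def[symmetric] using q by (simp add: mult_ac)
  show "n powr (- \<beta>) * t powr (\<beta> - real DIM('a) - 3) \<le> t powr (\<beta> - real DIM('a) - 1) * n powr (- (\<beta> + 1)) / t"
    unfolding T N T_def[symmetric] N_def[symmetric] using divide_right_mono[OF q, of t] n by (simp add: mult_ac)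
  show "n powr (- \<beta> - 1) * t powr (\<beta> - real DIM('a) - 2) = t powr (\<beta> - real DIM('a) - 1) * n powr (- (\<beta> + 1)) / t"
    unfolding T N T_def[symmetric] N_def[symmetric] by simp
qed

lemma ker_nonneg: "0 \<le> ker x y"
  by (simp add: ker_def psi_nonneg)

lemma psi_E:
  assumes z: "z \<in> \<Omega>" and xy: "x \<noteq> y"
  defines "e \<equiv> (if norm (x - y) < h z then h z powr (\<beta> - real DIM('a) - 1) * norm (x - y) powr (- (\<beta> + 1)) else 0)"
  shows "norm (x - y) powr (- \<beta>) * \<psi> (norm (x - y)) (h z) \<le> R0 * e"
    "norm (x - y) powr (- \<beta> - 1) * \<psi> (norm (x - y)) (h z) \<le> R0 * (e / h z)"
    "norm (x - y) powr (- \<beta>) * \<bar>\<psi>s (norm (x - y)) (h z)\<bar> \<le> R0 * (e / h z)"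
    "norm (x - y) powr (- \<beta>) * \<bar>\<psi>t (norm (x - y)) (h z)\<bar> \<le> (real DIM('a) + 3) * R0 * (e / h z)"
proof -
  define n where "n = norm (x - y)"
  have n: "0 < n" using xy by (simp add: n_def)
  note t = h_pos[OF z]
  have "n powr (- \<beta>) * \<psi> n (h z) \<le> R0 * e \<and> n powr (- \<beta> - 1) * \<psi> n (h z) \<le> R0 * (e / h z)
    \<and> n powr (- \<beta>) * \<bar>\<psi>s n (h z)\<bar> \<le> R0 * (e / h z) \<and> n powr (- \<beta>) * \<bar>\<psi>t n (h z)\<bar> \<le> (real DIM('a) + 3) * R0 * (e / h z)"
  proof (cases "n < h z")
    case True
    then have e: "e = h z powr (\<beta> - real DIM('a) - 1) * n powr (- (\<beta> + 1))" by (simp add: e_def n_def)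
    have dd: "0 \<le> (real DIM('a) + 3) * R0" using R0 by simp
    have "n powr (- \<beta>) * \<psi> n (h z) \<le> n powr (- \<beta>) * (R0 * h z powr (\<beta> - real DIM('a) - 2))"
      by (rule mult_left_mono[OF psi_le]) simp
    moreover have "n powr (- \<beta> - 1) * \<psi> n (h z) \<le> n powr (- \<beta> - 1) * (R0 * h z powr (\<beta> - real DIM('a) - 2))"
      by (rule mult_left_mono[OF psi_le]) simp
    moreover have "n powr (- \<beta>) * \<bar>\<psi>s n (h z)\<bar> \<le> n powr (- \<beta>) * (R0 * h z powr (\<beta> - real DIM('a) - 3))"
      by (rule mult_left_mono[OF psi_s_le]) simp
    moreover have "n powr (- \<beta>) * \<bar>\<psi>t n (h z)\<bar> \<le> n powr (- \<beta>) * ((real DIM('a) + 3) * R0 * h z powr (\<beta> - real DIM('a) - 3))"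
      using n t by (intro mult_left_mono[OF psi_t_le]) auto
    ultimately show ?thesis
      using mult_left_mono[OF powr_split(1)[OF n True] R0] mult_left_mono[OF powr_split(2)[OF n True] R0]
        mult_left_mono[OF powr_split(2)[OF n True] dd] arg_cong[OF powr_split(3)[OF n True], of "\<lambda>u. R0 * u"]
      unfolding e by (simp add: mult_ac)
  next
    case False
    then show ?thesis using psi_eq_0[OF t, of n] by (simp add: e_def n_def)
  qed
  then show "norm (x - y) powr (- \<beta>) * \<psi> (norm (x - y)) (h z) \<le> R0 * e"
    "norm (x - y) powr (- \<beta> - 1) * \<psi> (norm (x - y)) (h z) \<le> R0 * (e / h z)"
    "norm (x - y) powr (- \<beta>) * \<bar>\<psi>s (norm (x - y)) (h z)\<bar> \<le> R0 * (e / h z)"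
    "norm (x - y) powr (- \<beta>) * \<bar>\<psi>t (norm (x - y)) (h z)\<bar> \<le> (real DIM('a) + 3) * R0 * (e / h z)"
    by (auto simp: n_def)
qed

lemma E_h: "x \<in> \<Omega> \<Longrightarrow> y \<in> \<Omega> \<Longrightarrow> E y x / h y \<le> 4 / 3 * (E y x / h x)"
proof -
  assume x: "x \<in> \<Omega>" and y: "y \<in> \<Omega>"
  show ?thesis
  proof (cases "norm (y - x) < h y")
    case True
    have "3 / 4 * h x \<le> h y" by (rule comparable(2)[OF y x, of 1]) (use True in auto)
    then have "1 / h y \<le> 4 / 3 / h x" using h_pos[OF x] h_pos[OF y] by (simp add: field_simps)
    then show ?thesis using mult_left_mono[of "1 / h y" "4 / 3 / h x" "E y x"] E_nonneg[of y x] by simp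
  qed (simp add: E_def)
qed

lemma ker_le_S:
  assumes x: "x \<in> \<Omega>" and y: "y \<in> \<Omega>"
  shows "ker x y \<le> R0 * S x y"
proof (cases "x = y")
  case False
  show ?thesis
    using psi_E(1)[OF x False] psi_E(1)[OF y False] 
    unfolding ker_def S_def E_def norm_minus_commute[of y x] by (simp add: algebra_simps split: if_splits)
qed (simp add: ker_def S_nonneg R0)

text \<open>The derivative of the singular factor contributes \<beta>, that of the distance in
  \<open>\<psi>\<close> contributes 1, and that of the horizon d + 3, since |H| \<le> 1/3. The terms
  carrying h(y) are divided by h(y); comparability replaces it by h(x) at the cost of the factor
  4/3.\<close>

lemma Dker_le_S:
  assumes x: "x \<in> \<Omega>" and y: "y \<in> \<Omega>"
  shows "norm (Dker x y) \<le> 4 * (\<beta> + real DIM('a) + 3) * R0 * (S x y / h x)"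
proof (cases "x = y")
  case True
  then show ?thesis using R0 S_nonneg[of x y] h_pos[OF x] \<beta> by (simp add: Dker_def)
next
  case False
  define n where "n = norm (x - y)"
  have n: "0 < n" using False by (simp add: n_def)
  define e1 where "e1 = E x y / h x"
  define e2 where "e2 = E y x / h y"
  have e: "0 \<le> e1" "0 \<le> e2" using E_nonneg h_pos x y by (auto simp: e1_def e2_def intro!: divide_nonneg_pos)
  note P = psi_E[OF x False, folded E_def, folded e1_def n_def]
  have Ey: "E y x = (if norm (x - y) < h y then h y powr (\<beta> - real DIM('a) - 1) * norm (x - y) powr (- (\<beta> + 1)) else 0)"
    by (simp add: E_def norm_minus_commute)
  note Q = psi_E[OF y False, folded Ey, folded e2_def n_def]
  define A where "A = - \<beta> * n powr (- \<beta> - 1) * (\<psi> n (h x) + \<psi> n (h y)) + n powr (- \<beta>) * (\<psi>s n (h x) + \<psi>s n (h y))"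
  have t1: "\<bar>- \<beta> * n powr (- \<beta> - 1) * (\<psi> n (h x) + \<psi> n (h y))\<bar> \<le> \<beta> * (R0 * e1 + R0 * e2)"
  proof -
    have "\<bar>- \<beta> * n powr (- \<beta> - 1) * (\<psi> n (h x) + \<psi> n (h y))\<bar> = \<beta> * (n powr (- \<beta> - 1) * \<psi> n (h x) + n powr (- \<beta> - 1) * \<psi> n (h y))"
      unfolding abs_mult abs_minus_cancel using \<beta> psi_nonneg[of n "h x"] psi_nonneg[of n "h y"] by (simp add: distrib_left mult_ac)
    also have "\<dots> \<le> \<beta> * (R0 * e1 + R0 * e2)" using \<beta> P(2) Q(2) by (intro mult_left_mono add_mono) auto
    finally show ?thesis .
  qed
  have t2: "\<bar>n powr (- \<beta>) * (\<psi>s n (h x) + \<psi>s n (h y))\<bar> \<le> R0 * e1 + R0 * e2"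
  proof -
    have "\<bar>n powr (- \<beta>) * (\<psi>s n (h x) + \<psi>s n (h y))\<bar> \<le> n powr (- \<beta>) * \<bar>\<psi>s n (h x)\<bar> + n powr (- \<beta>) * \<bar>\<psi>s n (h y)\<bar>"
      unfolding abs_mult distrib_left[symmetric] by (intro mult_mono) auto
    then show ?thesis using P(3) Q(3) by linarith
  qed
  have "norm (Dker x y) \<le> \<bar>A\<bar> + \<bar>n powr (- \<beta>) * \<psi>t n (h x)\<bar> * norm (H x)"
    unfolding Dker_def n_def[symmetric] A_def[symmetric]
    using norm_triangle_ineq[of "(A / n) *\<^sub>R (x - y)" "(n powr (- \<beta>) * \<psi>t n (h x)) *\<^sub>R H x"] n by (simp add: n_def)
  also have "\<bar>n powr (- \<beta>) * \<psi>t n (h x)\<bar> * norm (H x) \<le> (real DIM('a) + 3) * R0 * e1 * 1"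
    using P(4) H_le[OF x] R0 e by (intro mult_mono) (auto simp: abs_mult)
  also have "\<bar>A\<bar> \<le> \<beta> * (R0 * e1 + R0 * e2) + (R0 * e1 + R0 * e2)"
    unfolding A_def using t1 t2 by linarith
  finally have "norm (Dker x y) \<le> \<beta> * (R0 * e1 + R0 * e2) + (R0 * e1 + R0 * e2) + (real DIM('a) + 3) * R0 * e1 * 1" by simp
  also have "\<dots> \<le> (\<beta> + real DIM('a) + 3) * R0 * (2 * (e1 + e2))"
  proof -
    have "0 \<le> \<beta> * (R0 * e1)" "0 \<le> \<beta> * (R0 * e2)" "0 \<le> R0 * e1" "0 \<le> R0 * e2" "0 \<le> real DIM('a) * (R0 * e1)" "0 \<le> real DIM('a) * (R0 * e2)"
      using \<beta> R0 e by simp_all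
    then show ?thesis by (simp add: algebra_simps)
  qed
  also have "\<dots> \<le> (\<beta> + real DIM('a) + 3) * R0 * (2 * (2 * (S x y / h x)))"
  proof (intro mult_left_mono)
    have "0 \<le> E x y / h x" "0 \<le> E y x / h x" using E_nonneg h_pos[OF x] by (auto intro!: divide_nonneg_pos)
    then show "e1 + e2 \<le> 2 * (S x y / h x)"
    proof -
      have "a + c \<le> 2 * (a + b)" if "0 \<le> a" "0 \<le> b" "c \<le> 4 / 3 * b" for a b c :: real
        using that mult_right_mono[of "4 / 3" 2 b] by simp
      from this[OF \<open>0 \<le> E x y / h x\<close> \<open>0 \<le> E y x / h x\<close> E_h[OF x y]] show ?thesis
        unfolding e1_def e2_def S_def add_divide_distrib .
    qed
  qed (use \<beta> R0 in auto)
  also have "(\<beta> + real DIM('a) + 3) * R0 * (2 * (2 * t)) = 4 * (\<beta> + real DIM('a) + 3) * R0 * t" for t by simp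
  finally show ?thesis .
qed

lemma psi_has_derivative:
  fixes N t :: "'a \<Rightarrow> real"
  assumes N: "(N has_derivative (\<lambda>v. a \<bullet> v)) (at x)" and t: "(t has_derivative (\<lambda>v. b \<bullet> v)) (at x)" and pos: "0 < t x"
  shows "((\<lambda>x. \<psi> (N x) (t x)) has_derivative (\<lambda>v. \<psi>s (N x) (t x) * (a \<bullet> v) + \<psi>t (N x) (t x) * (b \<bullet> v))) (at x)"
proof -
  define p where "p = \<beta> - real DIM('a) - 2"
  define T where "T = t x powr p"
  have T: "t x powr (\<beta> - real DIM('a) - 3) = T / t x" "t x powr (\<beta> - real DIM('a) - 4) = T / t x / t x" "t x powr (p - 1) = T / t x"
    using pos powr_diff[of "t x" p 1] powr_diff[of "t x" "p - 1" 1] by (simp_all add: T_def p_def algebra_simps)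
  have d1: "((\<lambda>x. t x powr p) has_derivative (\<lambda>v. p * (T / t x) * (b \<bullet> v))) (at x)"
    using has_derivative_compose[OF t has_real_derivative_powr[OF pos, of p, unfolded has_field_derivative_def]]
    by (simp add: T)
  have "((\<lambda>x. N x / t x) has_derivative (\<lambda>v. (a \<bullet> v) / t x - N x * (b \<bullet> v) / (t x * t x))) (at x)"
    using pos by (auto intro!: derivative_eq_intros N t simp: field_simps)
  then have d2: "((\<lambda>x. \<rho> (N x / t x)) has_derivative (\<lambda>v. \<rho>' (N x / t x) * ((a \<bullet> v) / t x - N x * (b \<bullet> v) / (t x * t x)))) (at x)"
    by (rule has_derivative_compose[OF _ \<rho>_der[unfolded has_field_derivative_def]])
  have s: "\<psi>s (N x) (t x) = T / t x * \<rho>' (N x / t x)" by (simp add: \<psi>s_def T)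
  have t: "\<psi>t (N x) (t x) = p * (T / t x) * \<rho> (N x / t x) - N x * (T / t x / t x) * \<rho>' (N x / t x)"
    unfolding \<psi>t_def T p_def by simp
  show ?thesis
    unfolding \<psi>_def p_def[symmetric]
    by (rule has_derivative_eq_rhs[OF has_derivative_mult[OF d1 d2]])
      (use pos in \<open>simp add: fun_eq_iff s t T_def[symmetric] field_simps\<close>)
qed

lemma ker_has_derivative:
  assumes x: "x \<in> \<Omega>" and y: "y \<in> \<Omega>" and xy: "x \<noteq> y"
  shows "((\<lambda>x. ker x y) has_derivative (\<lambda>v. Dker x y \<bullet> v)) (at x)"
proof -
  define n where "n = norm (x - y)"
  have n: "0 < n" using xy by (simp add: n_def)
  define w where "w = (x - y) /\<^sub>R n"
  have N: "((\<lambda>x. norm (x - y)) has_derivative (\<lambda>v. w \<bullet> v)) (at x)"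
  proof -
    have "(norm has_derivative (\<lambda>v. v \<bullet> sgn (x - y))) (at (x - y))" using xy by (intro has_derivative_norm) simp
    moreover have "((\<lambda>x. x - y) has_derivative (\<lambda>v. v)) (at x)" by (auto intro!: derivative_eq_intros)
    ultimately have "((\<lambda>x. norm (x - y)) has_derivative (\<lambda>v. v \<bullet> sgn (x - y))) (at x)"
      by (rule has_derivative_compose[rotated])
    then show ?thesis by (simp add: w_def n_def sgn_div_norm inner_commute)
  qed
  have hy: "((\<lambda>x. h y) has_derivative (\<lambda>v. 0 \<bullet> v)) (at x)" by simp
  note p1 = psi_has_derivative[OF N h_der[OF x] h_pos[OF x]]
  note p2 = psi_has_derivative[OF N hy h_pos[OF y]]
  have d0: "((\<lambda>x. norm (x - y) powr (- \<beta>)) has_derivative (\<lambda>v. (- \<beta> * n powr (- \<beta> - 1)) * (w \<bullet> v))) (at x)"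
    using has_derivative_compose[OF N has_real_derivative_powr[of "norm (x - y)" "- \<beta>", unfolded has_field_derivative_def]] n
    by (simp add: n_def)
  show ?thesis unfolding ker_def
  proof (rule has_derivative_eq_rhs[OF has_derivative_mult[OF d0 has_derivative_add[OF p1 p2]]], rule ext)
    fix v
    define c where "c = (x - y) \<bullet> v"
    have wv: "w \<bullet> v = c / n" by (simp add: w_def c_def divide_inverse mult.commute)
    have D: "Dker x y \<bullet> v = (- \<beta> * n powr (- \<beta> - 1) * (\<psi> n (h x) + \<psi> n (h y)) + n powr (- \<beta>) * (\<psi>s n (h x) + \<psi>s n (h y))) / n * c
       + n powr (- \<beta>) * \<psi>t n (h x) * (H x \<bullet> v)"
      unfolding Dker_def n_def[symmetric] c_def by (simp only: inner_add_left inner_scaleR_left)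
    show "norm (x - y) powr - \<beta> * (\<psi>s (norm (x - y)) (h x) * (w \<bullet> v) + \<psi>t (norm (x - y)) (h x) * (H x \<bullet> v) + (\<psi>s (norm (x - y)) (h y) * (w \<bullet> v) + \<psi>t (norm (x - y)) (h y) * (0 \<bullet> v)))
      + - \<beta> * n powr (- \<beta> - 1) * (w \<bullet> v) * (\<psi> (norm (x - y)) (h x) + \<psi> (norm (x - y)) (h y)) = Dker x y \<bullet> v"
      unfolding D wv n_def[symmetric] inner_zero_left using n by (simp add: field_simps)
  qed
qed


section \<open>Integral bounds for the kernel and its gradient\<close>

lemma M_eq_lborel:
  fixes f :: "'a \<Rightarrow> 'b::{banach, second_countable_topology}"
  assumes f: "f \<in> borel_measurable borel" and 0: "\<And>x. x \<notin> \<Omega> \<Longrightarrow> f x = 0"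
  shows "integrable M f \<longleftrightarrow> integrable lborel f" "(\<integral>x. f x \<partial>M) = (\<integral>x. f x \<partial>lborel)"
proof -
  have eq: "(\<lambda>x. indicator \<Omega> x *\<^sub>R f x) = f" using 0 by (auto simp: indicator_def fun_eq_iff)
  show "integrable M f \<longleftrightarrow> integrable lborel f" "(\<integral>x. f x \<partial>M) = (\<integral>x. f x \<partial>lborel)"
    using f by (simp_all add: integrable_restrict_space integral_restrict_space eq integrable_completion integral_completion)
qed

lemma \<Omega>_norm_le: "\<exists>R>0. \<forall>x\<in>\<Omega>. norm x \<le> R"
  using bounded_\<Omega> bounded_pos by blast

lemma riesz_integrable_M:
  assumes "0 \<le> \<gamma>" "\<gamma> < real DIM('a)"
  shows "integrable M (\<lambda>x. norm (x - y) powr (- \<gamma>))"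
proof -
  obtain R where R: "\<forall>x\<in>\<Omega>. norm x \<le> R" using \<Omega>_norm_le by blast
  let ?f = "\<lambda>x. norm (x - y) powr (- \<gamma>) * indicator (cball 0 R) x"
  have [measurable]: "cball (0::'a) R \<in> sets borel" "\<Omega> \<in> sets borel" using open_\<Omega> by auto
  have f: "integrable lborel (\<lambda>x. indicator \<Omega> x *\<^sub>R ?f x)"
    by (rule integrable_mult_indicator[OF _ riesz_kernel_integrable[OF assms]]) simp
  have "integrable M (\<lambda>x. indicator \<Omega> x *\<^sub>R ?f x)"
    using f by (subst M_eq_lborel(1)) (auto simp: indicator_def)
  then show ?thesis
    by (rule Bochner_Integration.integrable_cong[THEN iffD1, rotated 2]) (use R in \<open>auto simp: indicator_def\<close>)
qed

lemma riesz_M_uniform: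
  "\<exists>C\<ge>0. \<forall>x\<in>\<Omega>. (\<integral>\<^sup>+y. ennreal (norm (x - y) powr (- (\<beta> + 1))) \<partial>M) \<le> ennreal C"
proof -
  obtain R where R: "R > 0" "\<forall>x\<in>\<Omega>. norm x \<le> R" using \<Omega>_norm_le by blast
  have "(\<integral>\<^sup>+y. ennreal (norm (x - y) powr (- (\<beta> + 1))) \<partial>M) \<le> ennreal (C0 * (3 * R) powr (real DIM('a) - (\<beta> + 1)))" if x: "x \<in> \<Omega>" for x
  proof -
    have "norm (x - y) < 3 * R" if "y \<in> \<Omega>" for y
      using norm_triangle_ineq4[of x y] R x that by (smt (verit, best))
    then have "(\<integral>\<^sup>+y. ennreal (norm (x - y) powr (- (\<beta> + 1))) \<partial>M) = (\<integral>\<^sup>+y. ennreal (if norm (x - y) < 3 * R then norm (x - y) powr (- (\<beta> + 1)) else 0) \<partial>M)"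
      by (intro nn_integral_cong) auto
    also have "\<dots> \<le> ennreal (C0 * (3 * R) powr (real DIM('a) - (\<beta> + 1)))"
      by (rule riesz_M[OF C0(2)]) (use R in auto)
    finally show ?thesis .
  qed
  then show ?thesis using C0(1) by (intro exI[of _ "C0 * (3 * R) powr (real DIM('a) - (\<beta> + 1))"]) auto
qed

text \<open>The constant in the bound CS h(x)^(-2) for the integral of S(x, y) over y. The 1 comes
  from E(x, y); the product comes from E(y, x), where h(y) \<ge> 3/4 h(x) enters in a negative power
  and the ball grows to radius 3/2 h(x).\<close>

definition "CS = C0 * (1 + (4 / 3) powr (real DIM('a) + 1 - \<beta>) * (3 / 2) powr (real DIM('a) - (\<beta> + 1)))"

lemma CS_pos: "0 < CS" unfolding CS_def using C0(1) by (intro mult_pos_pos add_pos_nonneg) auto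

lemma S_nn_integral:
  assumes x: "x \<in> \<Omega>"
  shows "(\<integral>\<^sup>+y. ennreal (S x y) \<partial>M) \<le> ennreal (CS * h x powr (- 2))"
proof -
  define d where "d = real DIM('a)"
  define c where "c = (4 / 3) powr (d + 1 - \<beta>)"
  define p where "p = \<beta> - d - 1"
  note hx = h_pos[OF x]
  let ?I = "\<lambda>s y. ennreal (if norm (x - y) < s * h x then norm (x - y) powr (- (\<beta> + 1)) else 0)"
  have "(\<integral>\<^sup>+y. ennreal (S x y) \<partial>M) \<le> (\<integral>\<^sup>+y. ennreal (h x powr p) * ?I 1 y + ennreal (c * h x powr p) * ?I (3 / 2) y \<partial>M)"
  proof (rule nn_integral_mono)
    fix y assume "y \<in> space M"
    then have y: "y \<in> \<Omega>" by simp
    have 1: "ennreal (E x y) \<le> ennreal (h x powr p) * ?I 1 y"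
      by (simp add: E_def p_def d_def ennreal_mult[symmetric])
    have 2: "ennreal (E y x) \<le> ennreal (c * h x powr p) * ?I (3 / 2) y"
    proof (cases "norm (y - x) < h y")
      case True
      note cmp = comparable[OF y x, of 1]
      have le: "h y \<le> 3 / 2 * h x" "3 / 4 * h x \<le> h y" using cmp True by auto
      then have n: "norm (x - y) < 3 / 2 * h x" using True by (simp add: norm_minus_commute)
      have "h y powr p \<le> (3 / 4 * h x) powr p" using le hx \<beta> by (intro powr_mono2') (auto simp: p_def d_def)
      also have "\<dots> = (3 / 4) powr p * h x powr p" by (simp only: powr_mult)
      also have "(3 / 4 :: real) powr p = c"
      proof -
        have "(3 / 4 :: real) powr p = inverse (4 / 3) powr p" by simp
        also have "\<dots> = (4 / 3) powr (- p)" by (simp only: powr_minus inverse_powr[symmetric])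
        finally show ?thesis by (simp add: c_def p_def algebra_simps)
      qed
      finally have "E y x \<le> (c * h x powr p) * norm (x - y) powr (- (\<beta> + 1))"
        using True unfolding E_def by (simp add: norm_minus_commute p_def d_def mult_right_mono)
      then show ?thesis using n by (simp add: ennreal_mult'[symmetric] ennreal_mult''[symmetric] ennreal_leI c_def)
    qed (simp add: E_def)
    show "ennreal (S x y) \<le> ennreal (h x powr p) * ?I 1 y + ennreal (c * h x powr p) * ?I (3 / 2) y"
      unfolding S_def using add_mono[OF 1 2] by (simp add: E_nonneg ennreal_plus)
  qed
  also have "\<dots> = ennreal (h x powr p) * (\<integral>\<^sup>+y. ?I 1 y \<partial>M) + ennreal (c * h x powr p) * (\<integral>\<^sup>+y. ?I (3 / 2) y \<partial>M)"
    by (subst nn_integral_add, measurable, subst (1 2) nn_integral_cmult, measurable)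
  also have "\<dots> \<le> ennreal (h x powr p) * ennreal (C0 * (1 * h x) powr (real DIM('a) - (\<beta> + 1))) + ennreal (c * h x powr p) * ennreal (C0 * (3 / 2 * h x) powr (real DIM('a) - (\<beta> + 1)))"
    using hx by (intro add_mono mult_left_mono riesz_M[OF C0(2)]) auto
  also have "\<dots> = ennreal (h x powr p * (C0 * (1 * h x) powr (d - (\<beta> + 1))) + c * h x powr p * (C0 * (3 / 2 * h x) powr (d - (\<beta> + 1))))"
    using C0(1) by (simp add: ennreal_mult[symmetric] ennreal_plus[symmetric] c_def d_def del: ennreal_plus)
  also have "h x powr p * (C0 * (1 * h x) powr (d - (\<beta> + 1))) + c * h x powr p * (C0 * (3 / 2 * h x) powr (d - (\<beta> + 1)))
      = CS * (h x powr p * h x powr (d - (\<beta> + 1)))"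
    unfolding powr_mult CS_def c_def d_def by (simp add: algebra_simps)
  also have "h x powr p * h x powr (d - (\<beta> + 1)) = h x powr (- 2)"
    by (simp add: p_def powr_add[symmetric])
  finally show ?thesis .
qed

text \<open>On a compact set the horizon has a positive lower bound, which comparability passes on
  to the points that interact with the set. The scaled bounds thus become plain Riesz bounds. Their
  constants depend on K, which is harmless because they only serve integrability and Fubini.\<close>

lemma local_bounds:
  assumes K: "compact K" "K \<subseteq> \<Omega>"
  shows "\<exists>C\<ge>0. \<forall>x\<in>K. \<forall>y\<in>\<Omega>. S x y \<le> C * norm (x - y) powr (- (\<beta> + 1)) \<and> ker x y \<le> C * norm (x - y) powr (- \<beta>)
     \<and> norm (Dker x y) \<le> C * norm (x - y) powr (- (\<beta> + 1))"
proof -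
  obtain m where m: "0 < m" "\<And>x. x \<in> K \<Longrightarrow> m \<le> h x"
  proof (cases "K = {}")
    case False
    then obtain z where "z \<in> K" "\<And>x. x \<in> K \<Longrightarrow> h z \<le> h x"
      using continuous_attains_inf[OF K(1) False continuous_on_subset[OF continuous_h K(2)]] by blast
    then show ?thesis using that[of "h z"] h_pos K(2) by blast
  qed (use that[of 1] in auto)
  define p where "p = \<beta> - real DIM('a) - 1"
  define C1 where "C1 = 2 * (3 / 4 * m) powr p"
  define C2 where "C2 = 2 * R0 * (3 / 4 * m) powr (p - 1)"
  define C3 where "C3 = 4 * (\<beta> + real DIM('a) + 3) * R0 * (C1 / m)"
  have Cs: "0 \<le> C1" "0 \<le> C2" "0 \<le> C3" using R0 m \<beta> by (auto simp: C1_def C2_def C3_def)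
  show ?thesis
  proof (intro exI[of _ "C1 + C2 + C3"] conjI ballI)
    fix x y assume x: "x \<in> K" and y: "y \<in> \<Omega>"
    have x': "x \<in> \<Omega>" using x K by auto
    define n where "n = norm (x - y)"
    have hy: "3 / 4 * m \<le> h y" if "n < h y"
      using comparable(2)[OF y x', of 1] that m(2)[OF x] by (simp add: n_def norm_minus_commute)
    have hx: "3 / 4 * m \<le> h x" using m(1) m(2)[OF x] by linarith
    have pl: "t powr p \<le> (3 / 4 * m) powr p" "t powr (p - 1) \<le> (3 / 4 * m) powr (p - 1)" if "3 / 4 * m \<le> t" for t
      using that m \<beta> by (auto intro!: powr_mono2' simp: p_def)
    have "E x y \<le> (3 / 4 * m) powr p * n powr (- (\<beta> + 1))"
      using pl(1)[OF hx] by (simp add: E_def n_def p_def mult_right_mono)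
    moreover have "E y x \<le> (3 / 4 * m) powr p * n powr (- (\<beta> + 1))"
      using pl(1)[OF hy] by (auto simp: E_def n_def p_def norm_minus_commute mult_right_mono)
    ultimately have S: "S x y \<le> C1 * n powr (- (\<beta> + 1))" by (simp add: S_def C1_def)
    have "\<psi> n (h x) \<le> R0 * (3 / 4 * m) powr (p - 1)"
      using psi_le[of n "h x"] mult_left_mono[OF pl(2)[OF hx] R0] by (simp add: p_def)
    moreover have "\<psi> n (h y) \<le> R0 * (3 / 4 * m) powr (p - 1)"
    proof (cases "n < h y")
      case True
      then show ?thesis using psi_le[of n "h y"] mult_left_mono[OF pl(2)[OF hy[OF True]] R0] by (simp add: p_def)
    next
      case False
      then show ?thesis using psi_eq_0(1)[OF h_pos[OF y], of n] R0 by simp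
    qed
    ultimately have "\<psi> n (h x) + \<psi> n (h y) \<le> C2" by (simp add: C2_def)
    then have k: "ker x y \<le> C2 * n powr (- \<beta>)"
      unfolding ker_def n_def[symmetric] using mult_left_mono[of "\<psi> n (h x) + \<psi> n (h y)" C2 "n powr (- \<beta>)"] by (simp add: mult.commute)
    have "S x y / h x \<le> C1 * n powr (- (\<beta> + 1)) / m"
      using S m(2)[OF x] m(1) S_nonneg Cs by (intro frac_le) auto
    then have "4 * (\<beta> + real DIM('a) + 3) * R0 * (S x y / h x) \<le> 4 * (\<beta> + real DIM('a) + 3) * R0 * (C1 * n powr (- (\<beta> + 1)) / m)"
      using R0 \<beta> by (intro mult_left_mono) auto
    then have D: "norm (Dker x y) \<le> C3 * n powr (- (\<beta> + 1))"
      using Dker_le_S[OF x' y] by (simp add: C3_def)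
    have w: "c * t \<le> (C1 + C2 + C3) * t" if "c \<le> C1 + C2 + C3" "0 \<le> t" for c t :: real
      using that by (rule mult_right_mono)
    show "S x y \<le> (C1 + C2 + C3) * norm (x - y) powr (- (\<beta> + 1))"
      by (rule order_trans[OF S[unfolded n_def] w]) (use Cs in auto)
    show "ker x y \<le> (C1 + C2 + C3) * norm (x - y) powr (- \<beta>)"
      by (rule order_trans[OF k[unfolded n_def] w]) (use Cs in auto)
    show "norm (Dker x y) \<le> (C1 + C2 + C3) * norm (x - y) powr (- (\<beta> + 1))"
      by (rule order_trans[OF D[unfolded n_def] w]) (use Cs in auto)
  qed (use Cs in simp)
qed

text \<open>Tonelli: the Riesz kernel of order \<beta> + 1 has an integral bounded uniformly in the
  other variable, so a kernel below it may be multiplied by an integrable function of either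
  variable.\<close>

lemma integrable_MM:
  fixes q :: "'a \<times> 'a \<Rightarrow> real"
  assumes q [measurable]: "q \<in> borel_measurable (M \<Otimes>\<^sub>M M)" and f: "integrable M f"
    and le: "\<And>x y. x \<in> \<Omega> \<Longrightarrow> y \<in> \<Omega> \<Longrightarrow> \<bar>q (x, y)\<bar> \<le> B * norm (x - y) powr (- (\<beta> + 1))" and B: "0 \<le> B"
  shows "integrable (M \<Otimes>\<^sub>M M) (\<lambda>p. q p * f (snd p))" "integrable (M \<Otimes>\<^sub>M M) (\<lambda>p. q p * f (fst p))"
proof -
  have fm [measurable]: "f \<in> borel_measurable M" using f by simp
  obtain C where C: "0 \<le> C" "\<And>x. x \<in> \<Omega> \<Longrightarrow> (\<integral>\<^sup>+y. ennreal (norm (x - y) powr (- (\<beta> + 1))) \<partial>M) \<le> ennreal C"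
    using riesz_M_uniform by blast
  have fin: "(\<integral>\<^sup>+x. ennreal \<bar>f x\<bar> * ennreal (B * C) \<partial>M) < \<infinity>"
  proof -
    have "(\<integral>\<^sup>+x. ennreal \<bar>f x\<bar> \<partial>M) < \<infinity>" using f unfolding integrable_iff_bounded by simp
    then show ?thesis by (simp add: nn_integral_multc ennreal_mult_less_top)
  qed
  have key: "(\<integral>\<^sup>+y. ennreal (norm (g x y * f x)) \<partial>M) \<le> ennreal \<bar>f x\<bar> * ennreal (B * C)"
    if g: "\<And>y. y \<in> \<Omega> \<Longrightarrow> \<bar>g x y\<bar> \<le> B * norm (x - y) powr (- (\<beta> + 1))" and x: "x \<in> \<Omega>" for g x
  proof -
    have "(\<integral>\<^sup>+y. ennreal (norm (g x y * f x)) \<partial>M) \<le> (\<integral>\<^sup>+y. ennreal (\<bar>f x\<bar> * B) * ennreal (norm (x - y) powr (- (\<beta> + 1))) \<partial>M)"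
    proof (rule nn_integral_mono)
      fix y assume "y \<in> space M"
      then have "\<bar>g x y\<bar> \<le> B * norm (x - y) powr (- (\<beta> + 1))" using g by simp
      from mult_left_mono[OF this, of "\<bar>f x\<bar>"]
      show "ennreal (norm (g x y * f x)) \<le> ennreal (\<bar>f x\<bar> * B) * ennreal (norm (x - y) powr (- (\<beta> + 1)))"
        using B by (simp add: ennreal_mult'[symmetric] ennreal_mult''[symmetric] abs_mult mult_ac ennreal_leI)
    qed
    also have "\<dots> = ennreal (\<bar>f x\<bar> * B) * (\<integral>\<^sup>+y. ennreal (norm (x - y) powr (- (\<beta> + 1))) \<partial>M)"
      by (rule nn_integral_cmult) measurable
    also have "\<dots> \<le> ennreal (\<bar>f x\<bar> * B) * ennreal C" by (rule mult_left_mono[OF C(2)[OF x]]) simp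
    finally show ?thesis using B C(1) by (simp add: ennreal_mult mult.assoc)
  qed
  show "integrable (M \<Otimes>\<^sub>M M) (\<lambda>p. q p * f (fst p))"
  proof (rule integrableI_bounded)
    have "(\<integral>\<^sup>+p. ennreal (norm (q p * f (fst p))) \<partial>(M \<Otimes>\<^sub>M M)) = (\<integral>\<^sup>+x. \<integral>\<^sup>+y. ennreal (norm (q (x, y) * f x)) \<partial>M \<partial>M)"
      by (subst nn_integral_fst[symmetric]) auto
    also have "\<dots> \<le> (\<integral>\<^sup>+x. ennreal \<bar>f x\<bar> * ennreal (B * C) \<partial>M)"
      by (intro nn_integral_mono key) (use le in auto)
    finally show "(\<integral>\<^sup>+p. ennreal (norm (q p * f (fst p))) \<partial>(M \<Otimes>\<^sub>M M)) < \<infinity>" using fin by (rule order_le_less_trans)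
  qed measurable
  show "integrable (M \<Otimes>\<^sub>M M) (\<lambda>p. q p * f (snd p))"
  proof (rule integrableI_bounded)
    have "(\<integral>\<^sup>+p. ennreal (norm (q p * f (snd p))) \<partial>(M \<Otimes>\<^sub>M M)) = (\<integral>\<^sup>+y. \<integral>\<^sup>+x. ennreal (norm (q (x, y) * f y)) \<partial>M \<partial>M)"
      by (subst MM.nn_integral_snd[symmetric]) (auto simp: split_beta')
    also have "\<dots> \<le> (\<integral>\<^sup>+x. ennreal \<bar>f x\<bar> * ennreal (B * C) \<partial>M)"
    proof (intro nn_integral_mono key)
      fix y x assume "y \<in> space M" "x \<in> \<Omega>"
      then show "\<bar>q (x, y)\<bar> \<le> B * norm (y - x) powr (- (\<beta> + 1))"
        unfolding norm_minus_commute[of y x] by (intro le) auto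
    qed simp
    finally show "(\<integral>\<^sup>+p. ennreal (norm (q p * f (snd p))) \<partial>(M \<Otimes>\<^sub>M M)) < \<infinity>" using fin by (rule order_le_less_trans)
  qed measurable
qed

lemma integrable_S: "x \<in> \<Omega> \<Longrightarrow> integrable M (S x)"
  using S_nn_integral[of x] S_nonneg by (intro integrableI_nonneg) (auto intro: order_le_less_trans)

lemma integrable_ker:
  assumes x: "x \<in> \<Omega>" shows "integrable M (ker x)"
proof (rule Bochner_Integration.integrable_bound)
  show "integrable M (\<lambda>y. R0 * S x y)" using integrable_S[OF x] by simp
  show "AE y in M. norm (ker x y) \<le> norm (R0 * S x y)"
    using ker_le_S[OF x] ker_nonneg S_nonneg R0 by (intro AE_I2) (simp add: abs_mult)
qed measurable

lemma integrable_Dker: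
  assumes x: "x \<in> \<Omega>" shows "integrable M (Dker x)"
proof (rule Bochner_Integration.integrable_bound)
  show "integrable M (\<lambda>y. 4 * (\<beta> + real DIM('a) + 3) * R0 * (S x y / h x))" using integrable_S[OF x] by simp
  show "AE y in M. norm (Dker x y) \<le> norm (4 * (\<beta> + real DIM('a) + 3) * R0 * (S x y / h x))"
  proof (rule AE_I2)
    fix y assume "y \<in> space M"
    then have "y \<in> \<Omega>" by simp
    from order_trans[OF Dker_le_S[OF x this] abs_ge_self]
    show "norm (Dker x y) \<le> norm (4 * (\<beta> + real DIM('a) + 3) * R0 * (S x y / h x))" unfolding real_norm_def .
  qed
qed measurable

end

section \<open>The total mass P and integration by parts in the kernel\<close>

context nonlocal_kernel begin

definition "P x = (\<integral>y. ker x y \<partial>M)"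

text \<open>The set \<open>A\<close> is a ball of radius \<epsilon> h(x) centred at distance r0 h(x)
  from \<open>x\<close>; there the rescaled distance is within \<epsilon> of r0 and the profile is
  at least m. On \<open>A\<close> the singular factor is at least h(x)^(-\<beta>), and the summand
  of k with the horizon at \<open>x\<close> already gives the bound.\<close>

lemma P_ge:
  assumes \<rho>: "0 < \<epsilon>" "\<epsilon> \<le> r0" "r0 + \<epsilon> \<le> 1" "0 \<le> m" "\<And>r. \<bar>r - r0\<bar> < \<epsilon> \<Longrightarrow> m \<le> \<rho> r" and x: "x \<in> \<Omega>"
  shows "m * unit_ball_vol (real DIM('a)) * \<epsilon> ^ DIM('a) * h x powr (- 2) \<le> P x"
proof -
  define d where "d = real DIM('a)"
  define V where "V = unit_ball_vol (real DIM('a))"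
  note hx = h_pos[OF x]
  obtain e :: 'a where e: "norm e = 1" using vector_choose_size[of 1] by auto
  define A where "A = ball (x + (r0 * h x) *\<^sub>R e) (\<epsilon> * h x)"
  have A: "\<bar>norm (x - y) / h x - r0\<bar> < \<epsilon>" if "y \<in> A" for y
  proof -
    have "\<bar>norm (y - x) - norm ((r0 * h x) *\<^sub>R e)\<bar> \<le> norm (y - x - (r0 * h x) *\<^sub>R e)" by (rule norm_triangle_ineq3)
    also have "\<dots> < \<epsilon> * h x" using that by (simp add: A_def dist_norm norm_minus_commute algebra_simps)
    finally have "\<bar>norm (x - y) - r0 * h x\<bar> < \<epsilon> * h x" using e \<rho> hx by (simp add: norm_minus_commute)
    moreover have "norm (x - y) / h x - r0 = (norm (x - y) - r0 * h x) / h x" using hx by (simp add: field_simps)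
    ultimately show ?thesis using hx by (simp add: abs_divide pos_divide_less_eq)
  qed
  have n: "0 < norm (x - y)" "norm (x - y) < h x" if "y \<in> A" for y
  proof -
    have "0 < norm (x - y) / h x" "norm (x - y) / h x < 1" using A[OF that] \<rho> by linarith+
    then show "0 < norm (x - y)" "norm (x - y) < h x" using hx by (simp_all add: field_simps zero_less_divide_iff)
  qed
  have sub: "A \<subseteq> \<Omega>"
  proof
    fix y assume "y \<in> A"
    then have "y \<in> ball x (3 * h x)" using n(2)[of y] hx by (simp add: dist_norm)
    then show "y \<in> \<Omega>" using ball3[OF x] by blast
  qed
  have low: "m * h x powr (- d - 2) \<le> ker x y" if y: "y \<in> A" for y
  proof -
    have "h x powr (- d - 2) = h x powr (- \<beta>) * h x powr (\<beta> - d - 2)" by (simp add: powr_add[symmetric])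
    also have "m * \<dots> = h x powr (- \<beta>) * (h x powr (\<beta> - d - 2) * m)" by simp
    also have "\<dots> \<le> norm (x - y) powr (- \<beta>) * (h x powr (\<beta> - d - 2) * \<rho> (norm (x - y) / h x))"
      using n[OF y] \<beta> \<rho>(4) \<rho>(5)[OF A[OF y]] by (intro mult_mono powr_mono2' mult_left_mono) auto
    also have "\<dots> \<le> ker x y"
      unfolding ker_def \<psi>_def d_def using psi_nonneg[of "norm (x - y)" "h y"] by (intro mult_left_mono) (auto simp: \<psi>_def)
    finally show ?thesis .
  qed
  have Am: "A \<in> sets M" using sub by (auto simp: sets_restrict_space_iff A_def)
  have iA: "integrable M (\<lambda>y. m * h x powr (- d - 2) * indicator A y)"
    using Am by (intro integrable_mult_right integrable_real_indicator) (auto simp: less_top[symmetric] emeasure_finite)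
  have "measure M A = measure lebesgue A"
    using sub by (subst measure_restrict_space) (auto simp: A_def)
  also have "\<dots> = V * (\<epsilon> * h x) ^ DIM('a)"
    unfolding A_def V_def using \<rho>(1) hx by (simp add: content_ball)
  finally have "m * V * \<epsilon> ^ DIM('a) * h x powr (- 2) = (\<integral>y. m * h x powr (- d - 2) * indicator A y \<partial>M)"
  proof -
    assume "measure M A = V * (\<epsilon> * h x) ^ DIM('a)"
    moreover have "(\<epsilon> * h x) ^ DIM('a) * h x powr (- d - 2) = \<epsilon> ^ DIM('a) * h x powr (- 2)"
    proof -
      have "h x ^ DIM('a) = h x powr d" using powr_realpow[OF hx, of "DIM('a)"] by (simp add: d_def)
      moreover have "h x powr d * h x powr (- d - 2) = h x powr (- 2)" by (simp flip: powr_add)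
      ultimately show ?thesis by (simp add: power_mult_distrib mult.assoc)
    qed
    ultimately have "m * (h x powr (- d - 2) * measure M A) = m * (V * (\<epsilon> ^ DIM('a) * h x powr (- 2)))"
      by (metis mult.assoc mult.commute)
    moreover have "A \<inter> \<Omega> = A" using sub by blast
    ultimately show ?thesis by (auto simp: mult.assoc)
  qed
  also have "\<dots> \<le> P x"
    unfolding P_def
  proof (rule Bochner_Integration.integral_mono[OF iA integrable_ker[OF x]])
    fix y show "m * h x powr (- d - 2) * indicator A y \<le> ker x y"
      using low[of y] ker_nonneg[of x y] by (cases "y \<in> A") auto
  qed
  finally show ?thesis unfolding V_def .
qed

text \<open>For fixed \<open>y\<close> the product of the kernel with \<open>w\<close>, extended by
  zero, has a pole of order \<beta> at \<open>y\<close> and a gradient of order \<beta> + 1. The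
  integral of its derivative vanishes by the singular version of the divergence argument.\<close>

lemma ibp_point:
  fixes w :: "'a \<Rightarrow> real"
  assumes y: "y \<in> \<Omega>" and b: "norm b = 1"
    and w: "\<And>x. (w has_derivative (\<lambda>v. D x \<bullet> v)) (at x)" and D: "continuous_on UNIV D"
    and K: "compact K" "K \<subseteq> \<Omega>" "\<And>x. x \<notin> K \<Longrightarrow> w x = 0"
  shows "(\<integral>x. ker x y * (D x \<bullet> b) \<partial>M) = - (\<integral>x. (Dker x y \<bullet> b) * w x \<partial>M)"
proof -
  have D0: "D x = 0" if "x \<notin> K" for x
  proof -
    have "(w has_derivative (\<lambda>h. 0)) (at x)"
      by (rule has_derivative_transform_within_open[where f="\<lambda>x. 0" and s="- K"])
        (use K that in \<open>auto simp: compact_imp_closed\<close>)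
    then have "(\<bullet>) (D x) = (\<lambda>h. 0)" using has_derivative_unique[OF w[of x]] by blast
    then show ?thesis by (metis inner_eq_zero_iff)
  qed
  have wc: "continuous_on UNIV w" by (rule has_derivative_continuous_on, rule has_derivative_at_withinI, rule w)
  obtain B0 where B0: "0 \<le> B0" "\<And>x. norm (w x) \<le> B0"
    using continuous_compact_support(1)[OF wc K(1,3)] by blast
  obtain B1 where B1: "0 \<le> B1" "\<And>x. norm (D x) \<le> B1"
    using continuous_compact_support(1)[OF D K(1) D0] by blast
  obtain C where C: "0 \<le> C" "\<And>x y. x \<in> K \<Longrightarrow> y \<in> \<Omega> \<Longrightarrow> ker x y \<le> C * norm (x - y) powr (- \<beta>) \<and> norm (Dker x y) \<le> C * norm (x - y) powr (- (\<beta> + 1))"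
    using local_bounds[OF K(1,2)] by blast
  obtain R where R: "0 < R" "\<forall>x\<in>\<Omega>. norm x \<le> R" using \<Omega>_norm_le by blast
  have nR: "norm (x - y) \<le> 2 * R" if "x \<in> \<Omega>" for x
    using norm_triangle_ineq4[of x y] R(2)[rule_format, OF that] R(2)[rule_format, OF y] by linarith
  define F where "F x = (if x \<in> \<Omega> then ker x y * w x else 0)" for x
  define G where "G x = (if x \<in> \<Omega> \<and> x \<noteq> y then w x *\<^sub>R Dker x y + ker x y *\<^sub>R D x else 0)" for x
  \<comment> \<open>The last summand pays for raising the order in the term k \<nabla>w from \<beta>
    to \<beta> + 1: distances inside \<Omega> are at most 2 R.\<close>
  define A where "A = C * B0 + C * B0 + C * B1 * (2 * R)"
  have A: "C * B0 \<le> A" using C B0 B1 R by (simp add: A_def)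
  have Fder: "(F has_derivative (\<lambda>v. G x \<bullet> v)) (at x)" if xy: "x \<noteq> y" for x
  proof (cases "x \<in> \<Omega>")
    case True
    have "((\<lambda>x. ker x y * w x) has_derivative (\<lambda>v. G x \<bullet> v)) (at x)"
      by (rule has_derivative_eq_rhs[OF has_derivative_mult[OF ker_has_derivative[OF True y xy] w]])
        (use True xy in \<open>simp add: G_def fun_eq_iff inner_add_left\<close>)
    then show ?thesis
      by (rule has_derivative_transform_within_open[where s=\<Omega>]) (use True open_\<Omega> in \<open>auto simp: F_def\<close>)
  next
    case False
    then have "x \<notin> K" using K by auto
    have "(F has_derivative (\<lambda>v. 0)) (at x)"
      by (rule has_derivative_transform_within_open[where f="\<lambda>x. 0" and s="- K"])
        (use K \<open>x \<notin> K\<close> in \<open>auto simp: F_def compact_imp_closed\<close>)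
    then show ?thesis using False by (simp add: G_def)
  qed
  have sing: "(\<integral>x. G x \<bullet> b \<partial>lborel) = 0" "(\<lambda>x. G x \<bullet> b) \<in> borel_measurable borel"
  proof -
    have bF: "\<bar>F x\<bar> \<le> A * norm (x - y) powr (- \<beta>)" if xy: "x \<noteq> y" for x
    proof (cases "x \<in> K")
      case True
      have "\<bar>F x\<bar> \<le> ker x y * B0"
        using B0 ker_nonneg[of x y] by (simp add: F_def abs_mult mult_left_mono)
      also have "\<dots> \<le> C * norm (x - y) powr (- \<beta>) * B0" using C(2)[OF True y] B0(1) by (intro mult_right_mono) auto
      also have "\<dots> \<le> A * norm (x - y) powr (- \<beta>)" using mult_right_mono[OF A, of "norm (x - y) powr (- \<beta>)"] by (simp add: mult_ac)
      finally show ?thesis .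
    next
      case False
      then have "F x = 0" by (simp add: F_def K(3))
      moreover have "0 \<le> A" using A C(1) B0(1) by (metis mult_nonneg_nonneg order_trans)
      ultimately show ?thesis by simp
    qed
    have bG: "norm (G x) \<le> A * norm (x - y) powr (- \<beta> - 1)" if xy: "x \<noteq> y" for x
    proof (cases "x \<in> K")
      case True
      have n: "0 < norm (x - y)" using xy by simp
      define q where "q = norm (x - y) powr (- (\<beta> + 1))"
      have q: "0 \<le> q" by (simp add: q_def)
      have q': "norm (x - y) powr (- \<beta> - 1) = q" unfolding q_def by (rule arg_cong[where f="\<lambda>u. norm (x - y) powr u"]) simp
      have "norm (x - y) powr (- \<beta>) = q * norm (x - y)"
        using powr_add[of "norm (x - y)" "- (\<beta> + 1)" 1] n by (simp add: q_def)
      also have "\<dots> \<le> q * (2 * R)" using nR[of x] True K q by (intro mult_left_mono) auto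
      finally have nb: "norm (x - y) powr (- \<beta>) \<le> q * (2 * R)" .
      have "norm (G x) \<le> \<bar>w x\<bar> * norm (Dker x y) + ker x y * norm (D x)"
        using norm_triangle_ineq[of "w x *\<^sub>R Dker x y" "ker x y *\<^sub>R D x"] ker_nonneg[of x y] q B0 B1 by (auto simp: G_def intro!: add_nonneg_nonneg)
      also have "\<dots> \<le> B0 * (C * q) + (C * (q * (2 * R))) * B1"
      proof (intro add_mono mult_mono)
        show "norm (Dker x y) \<le> C * q" using C(2)[OF True y] by (simp add: q_def)
        show "ker x y \<le> C * (q * (2 * R))" using C(2)[OF True y] mult_left_mono[OF nb C(1)] by linarith
      qed (use B0 B1 C q R ker_nonneg in auto)
      also have "\<dots> \<le> A * q" using C B0 q by (simp add: A_def algebra_simps)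
      finally show ?thesis unfolding q' .
    next
      case False
      then have "G x = 0" by (auto simp: G_def K(3) D0)
      moreover have "0 \<le> A" using A C(1) B0(1) by (metis mult_nonneg_nonneg order_trans)
      ultimately show ?thesis by simp
    qed
    have RF: "F x = 0" if "R < norm x" for x using R that by (force simp: F_def)
    have Gy: "G y = 0" by (simp add: G_def)
    show "(\<integral>x. G x \<bullet> b \<partial>lborel) = 0" "(\<lambda>x. G x \<bullet> b) \<in> borel_measurable borel"
      using integral_partial_singular[OF Fder \<beta> bF bG RF Gy b] by auto
  qed
  have M0: "(\<integral>x. G x \<bullet> b \<partial>M) = 0"
    using M_eq_lborel(2)[OF sing(2)] sing(1) by (simp add: G_def)
  have wm: "w \<in> borel_measurable M" and Dm: "(\<lambda>x. D x \<bullet> b) \<in> borel_measurable M"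
    using borel_measurable_continuous_onI[OF wc] borel_measurable_continuous_onI[OF D]
    by (auto intro!: measurable_lebesgue_on_borel)
  have ri: "integrable M (\<lambda>x. norm (x - y) powr (- (\<beta> + 1)))" using \<beta> by (intro riesz_integrable_M) auto
  have rj: "integrable M (\<lambda>x. norm (x - y) powr (- \<beta>))" using \<beta> by (intro riesz_integrable_M) auto
  have i1: "integrable M (\<lambda>x. (Dker x y \<bullet> b) * w x)"
  proof (rule Bochner_Integration.integrable_bound[OF integrable_mult_right[OF ri, of "C * B0"]])
    show "AE x in M. norm ((Dker x y \<bullet> b) * w x) \<le> norm (C * B0 * norm (x - y) powr (- (\<beta> + 1)))"
    proof (rule AE_I2)
      fix x
      show "norm ((Dker x y \<bullet> b) * w x) \<le> norm (C * B0 * norm (x - y) powr (- (\<beta> + 1)))"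
      proof (cases "x \<in> K")
        case True
        have "\<bar>Dker x y \<bullet> b\<bar> \<le> C * norm (x - y) powr (- (\<beta> + 1))"
          using Cauchy_Schwarz_ineq2[of "Dker x y" b] b C(2)[OF True y] by simp
        then have "\<bar>Dker x y \<bullet> b\<bar> * \<bar>w x\<bar> \<le> C * norm (x - y) powr (- (\<beta> + 1)) * B0"
          using B0 C(1) by (intro mult_mono) auto
        then show ?thesis using C(1) B0(1) by (simp add: abs_mult mult_ac)
      qed (simp add: K(3))
    qed
  qed (use wm in measurable)
  have i2: "integrable M (\<lambda>x. ker x y * (D x \<bullet> b))"
  proof (rule Bochner_Integration.integrable_bound[OF integrable_mult_right[OF rj, of "C * B1"]])
    show "AE x in M. norm (ker x y * (D x \<bullet> b)) \<le> norm (C * B1 * norm (x - y) powr (- \<beta>))"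
    proof (rule AE_I2)
      fix x
      show "norm (ker x y * (D x \<bullet> b)) \<le> norm (C * B1 * norm (x - y) powr (- \<beta>))"
      proof (cases "x \<in> K")
        case True
        have "\<bar>D x \<bullet> b\<bar> \<le> B1" using Cauchy_Schwarz_ineq2[of "D x" b] b B1(2)[of x] by simp
        then have "ker x y * \<bar>D x \<bullet> b\<bar> \<le> C * norm (x - y) powr (- \<beta>) * B1"
          using C(2)[OF True y] C(1) by (intro mult_mono) auto
        then show ?thesis using C(1) B1(1) ker_nonneg[of x y] by (simp add: abs_mult mult_ac)
      qed (simp add: D0)
    qed
  qed (use Dm in measurable)
  have "0 = (\<integral>x. G x \<bullet> b \<partial>M)" using M0 by simp
  also have "\<dots> = (\<integral>x. (Dker x y \<bullet> b) * w x + ker x y * (D x \<bullet> b) \<partial>M)"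
  proof (rule Bochner_Integration.integral_cong)
    fix x assume "x \<in> space M"
    then show "G x \<bullet> b = (Dker x y \<bullet> b) * w x + ker x y * (D x \<bullet> b)"
      by (cases "x = y") (simp_all add: G_def inner_add_left Dker_def ker_def)
  qed simp
  also have "\<dots> = (\<integral>x. (Dker x y \<bullet> b) * w x \<partial>M) + (\<integral>x. ker x y * (D x \<bullet> b) \<partial>M)"
    using i1 i2 by (rule Bochner_Integration.integral_add)
  finally show ?thesis by linarith
qed

text \<open>Superposition of the pointwise formulas over \<open>y\<close> with the density
  \<open>f\<close>. As the kernel takes the derivative, integrability is all that \<open>f\<close>
  has to provide; compact support of \<open>w\<close> keeps the kernel bounds uniform for
  Fubini.\<close>

lemma ibp:
  fixes w f :: "'a \<Rightarrow> real"
  assumes f: "integrable M f" and b: "norm b = 1"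
    and w: "\<And>x. (w has_derivative (\<lambda>v. D x \<bullet> v)) (at x)" and D: "continuous_on UNIV D"
    and K: "compact K" "K \<subseteq> \<Omega>" "\<And>x. x \<notin> K \<Longrightarrow> w x = 0"
  shows "integrable M (\<lambda>x. (\<integral>y. ker x y * f y \<partial>M) * (D x \<bullet> b))"
    and "integrable M (\<lambda>x. (\<integral>y. (Dker x y \<bullet> b) * f y \<partial>M) * w x)"
    and "(\<integral>x. (\<integral>y. ker x y * f y \<partial>M) * (D x \<bullet> b) \<partial>M) = - (\<integral>x. (\<integral>y. (Dker x y \<bullet> b) * f y \<partial>M) * w x \<partial>M)"
proof -
  have D0: "D x = 0" if "x \<notin> K" for x
  proof -
    have "(w has_derivative (\<lambda>h. 0)) (at x)"
      by (rule has_derivative_transform_within_open[where f="\<lambda>x. 0" and s="- K"])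
        (use K that in \<open>auto simp: compact_imp_closed\<close>)
    then have "(\<bullet>) (D x) = (\<lambda>h. 0)" using has_derivative_unique[OF w[of x]] by blast
    then show ?thesis by (metis inner_eq_zero_iff)
  qed
  have wc: "continuous_on UNIV w" by (rule has_derivative_continuous_on, rule has_derivative_at_withinI, rule w)
  obtain B0 where B0: "0 \<le> B0" "\<And>x. norm (w x) \<le> B0"
    using continuous_compact_support(1)[OF wc K(1,3)] by blast
  obtain B1 where B1: "0 \<le> B1" "\<And>x. norm (D x) \<le> B1"
    using continuous_compact_support(1)[OF D K(1) D0] by blast
  obtain C where C: "0 \<le> C" "\<And>x y. x \<in> K \<Longrightarrow> y \<in> \<Omega> \<Longrightarrow> S x y \<le> C * norm (x - y) powr (- (\<beta> + 1)) \<and> norm (Dker x y) \<le> C * norm (x - y) powr (- (\<beta> + 1))"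
    using local_bounds[OF K(1,2)] by blast
  have wm [measurable]: "w \<in> borel_measurable M" and Dm [measurable]: "(\<lambda>x. D x \<bullet> b) \<in> borel_measurable M"
    using borel_measurable_continuous_onI[OF wc] borel_measurable_continuous_onI[OF D]
    by (auto intro!: measurable_lebesgue_on_borel)
  define q1 where "q1 p = ker (fst p) (snd p) * (D (fst p) \<bullet> b)" for p
  define q2 where "q2 p = (Dker (fst p) (snd p) \<bullet> b) * w (fst p)" for p
  have q1m: "q1 \<in> borel_measurable (M \<Otimes>\<^sub>M M)" unfolding q1_def by measurable
  have q2m: "q2 \<in> borel_measurable (M \<Otimes>\<^sub>M M)" unfolding q2_def by measurable
  have b1: "\<bar>q1 (x, y)\<bar> \<le> (R0 * C * B1) * norm (x - y) powr (- (\<beta> + 1))" if x: "x \<in> \<Omega>" and y: "y \<in> \<Omega>" for x y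
  proof (cases "x \<in> K")
    case True
    have Db: "\<bar>D x \<bullet> b\<bar> \<le> B1" using Cauchy_Schwarz_ineq2[of "D x" b] b B1(2)[of x] by simp
    have "ker x y \<le> R0 * (C * norm (x - y) powr (- (\<beta> + 1)))"
      using ker_le_S[OF x y] mult_left_mono[of "S x y" "C * norm (x - y) powr (- (\<beta> + 1))" R0] C(2)[OF True y] R0 by linarith
    then have "ker x y * \<bar>D x \<bullet> b\<bar> \<le> R0 * (C * norm (x - y) powr (- (\<beta> + 1))) * B1"
      using Db C(1) R0 by (intro mult_mono) auto
    then show ?thesis using ker_nonneg[of x y] by (simp add: q1_def abs_mult mult_ac)
  qed (use C B1 R0 in \<open>simp add: q1_def D0\<close>)
  have b2: "\<bar>q2 (x, y)\<bar> \<le> (C * B0) * norm (x - y) powr (- (\<beta> + 1))" if x: "x \<in> \<Omega>" and y: "y \<in> \<Omega>" for x y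
  proof (cases "x \<in> K")
    case True
    have "\<bar>Dker x y \<bullet> b\<bar> \<le> C * norm (x - y) powr (- (\<beta> + 1))"
      using Cauchy_Schwarz_ineq2[of "Dker x y" b] b C(2)[OF True y] by simp
    then have "\<bar>Dker x y \<bullet> b\<bar> * \<bar>w x\<bar> \<le> C * norm (x - y) powr (- (\<beta> + 1)) * B0"
      using B0 C(1) by (intro mult_mono) auto
    then show ?thesis by (simp add: q2_def abs_mult mult_ac)
  qed (use C B0 in \<open>simp add: q2_def K(3)\<close>)
  have I1: "integrable (M \<Otimes>\<^sub>M M) (\<lambda>p. q1 p * f (snd p))"
    by (rule integrable_MM(1)[OF q1m f b1]) (use R0 C B1 in auto)
  have I2: "integrable (M \<Otimes>\<^sub>M M) (\<lambda>p. q2 p * f (snd p))"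
    by (rule integrable_MM(1)[OF q2m f b2]) (use C B0 in auto)
  have J1: "integrable (M \<Otimes>\<^sub>M M) (\<lambda>(x, y). q1 (x, y) * f y)" and J2: "integrable (M \<Otimes>\<^sub>M M) (\<lambda>(x, y). q2 (x, y) * f y)"
    using I1 I2 by (simp_all add: split_beta')
  have e1: "(\<integral>y. q1 (x, y) * f y \<partial>M) = (\<integral>y. ker x y * f y \<partial>M) * (D x \<bullet> b)" for x
    by (subst integral_mult_left_zero[symmetric]) (simp add: q1_def mult_ac)
  have e2: "(\<integral>y. q2 (x, y) * f y \<partial>M) = (\<integral>y. (Dker x y \<bullet> b) * f y \<partial>M) * w x" for x
    by (subst integral_mult_left_zero[symmetric]) (simp add: q2_def mult_ac)
  show "integrable M (\<lambda>x. (\<integral>y. ker x y * f y \<partial>M) * (D x \<bullet> b))" using MM.integrable_fst[OF J1] by (simp add: e1)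
  show "integrable M (\<lambda>x. (\<integral>y. (Dker x y \<bullet> b) * f y \<partial>M) * w x)" using MM.integrable_fst[OF J2] by (simp add: e2)
  have "(\<integral>x. (\<integral>y. ker x y * f y \<partial>M) * (D x \<bullet> b) \<partial>M) = (\<integral>y. \<integral>x. q1 (x, y) * f y \<partial>M \<partial>M)"
    using MM.Fubini_integral[OF J1] by (simp add: e1)
  also have "\<dots> = (\<integral>y. - (\<integral>x. q2 (x, y) * f y \<partial>M) \<partial>M)"
  proof (rule Bochner_Integration.integral_cong)
    fix y assume "y \<in> space M"
    then have y: "y \<in> \<Omega>" by simp
    show "(\<integral>x. q1 (x, y) * f y \<partial>M) = - (\<integral>x. q2 (x, y) * f y \<partial>M)"
      using ibp_point[OF y b w D K] by (simp add: q1_def q2_def)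
  qed simp
  also have "\<dots> = - (\<integral>x. (\<integral>y. (Dker x y \<bullet> b) * f y \<partial>M) * w x \<partial>M)"
    using MM.Fubini_integral[OF J2] by (simp add: e2)
  finally show "(\<integral>x. (\<integral>y. ker x y * f y \<partial>M) * (D x \<bullet> b) \<partial>M) = - (\<integral>x. (\<integral>y. (Dker x y \<bullet> b) * f y \<partial>M) * w x \<partial>M)" .
qed


text \<open>Substituting \<open>y = x - z\<close> moves the derivative from the singular factor to the horizon function.\<close>

lemma P_C1:
  obtains PD where "\<And>x. x \<in> \<Omega> \<Longrightarrow> (P has_derivative (\<lambda>v. PD x \<bullet> v)) (at x)" "continuous_on \<Omega> PD"
proof -
  \<comment> \<open>Extending the horizon by 0 removes the contribution of points off \<Omega>,
    because powers of 0 are 0. The integral over \<Omega> becomes one over the whole space, where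
    translation is possible.\<close>
  define hh where "hh x = indicator \<Omega> x *\<^sub>R h x" for x
  define HH where "HH x = indicator \<Omega> x *\<^sub>R H x" for x
  have \<Omega>b [measurable]: "\<Omega> \<in> sets borel" using open_\<Omega> by simp
  have [measurable]: "hh \<in> borel_measurable borel" "HH \<in> borel_measurable borel"
    unfolding hh_def[abs_def] HH_def[abs_def]
    by (intro borel_measurable_continuous_on_indicator continuous_h H_cont \<Omega>b)+
  define f where "f x z = norm z powr (- \<beta>) * (\<psi> (norm z) (h x) + \<psi> (norm z) (hh (x - z)))" for x z
  define Df where "Df x z = (norm z powr (- \<beta>) * \<psi>t (norm z) (h x)) *\<^sub>R H x + (norm z powr (- \<beta>) * \<psi>t (norm z) (hh (x - z))) *\<^sub>R HH (x - z)" for x z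
  have [measurable]: "(\<lambda>z. norm z powr (- \<beta>)) \<in> borel_measurable borel" by measurable
  have fm [measurable]: "f x \<in> borel_measurable borel" for x unfolding f_def[abs_def] \<psi>_def by measurable
  have Dfm [measurable]: "Df x \<in> borel_measurable borel" for x unfolding Df_def[abs_def] \<psi>t_def by measurable
  have Pf: "P x = (\<integral>z. f x z \<partial>lborel)" "integrable lborel (f x)" if x: "x \<in> \<Omega>" for x
  proof -
    define g where "g y = norm (x - y) powr (- \<beta>) * (\<psi> (norm (x - y)) (h x) + \<psi> (norm (x - y)) (hh y))" for y
    have gm: "g \<in> borel_measurable borel" unfolding g_def[abs_def] \<psi>_def by measurable
    have g0: "g y = 0" if y: "y \<notin> \<Omega>" for y
    proof -
      have "h x \<le> norm (x - y)"
      proof (rule ccontr)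
        assume "\<not> ?thesis"
        then have "y \<in> ball x (3 * h x)" using h_pos[OF x] by (simp add: dist_norm)
        then show False using ball3[OF x] y by blast
      qed
      then show ?thesis using psi_eq_0(1)[OF h_pos[OF x]] y by (simp add: g_def hh_def \<psi>_def)
    qed
    have gk: "g y = ker x y" if "y \<in> \<Omega>" for y using that by (simp add: g_def ker_def hh_def)
    have "integrable M g" using integrable_ker[OF x] by (rule Bochner_Integration.integrable_cong[THEN iffD1, rotated 2]) (simp_all add: gk)
    then have gi: "integrable lborel g" using M_eq_lborel(1)[OF gm g0] by simp
    have fg: "f x = (\<lambda>z. g (x - z))" by (simp add: f_def g_def fun_eq_iff)
    show "integrable lborel (f x)" unfolding fg by (rule integrable_lborel_diff[OF gi])
    have "P x = (\<integral>y. g y \<partial>M)" unfolding P_def by (rule Bochner_Integration.integral_cong) (simp_all add: gk)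
    also have "\<dots> = (\<integral>y. g y \<partial>lborel)" by (rule M_eq_lborel(2)[OF gm g0])
    also have "\<dots> = (\<integral>z. f x z \<partial>lborel)" unfolding fg by (rule integral_lborel_diff[OF gm, symmetric])
    finally show "P x = (\<integral>z. f x z \<partial>lborel)" .
  qed
  define PD where "PD x = (\<integral>z. Df x z \<partial>lborel)" for x
  have local: "(P has_derivative (\<lambda>v. PD x0 \<bullet> v)) (at x0) \<and> isCont PD x0" if x0: "x0 \<in> \<Omega>" for x0
  proof -
    define h0 where "h0 = h x0"
    have h0: "0 < h0" using h_pos[OF x0] by (simp add: h0_def)
    \<comment> \<open>For |z| < 2 h0 the point x - z is within 9/4 h0 of x0, hence in the ball of
      radius 3 h0 inside \<Omega>. For |z| \<ge> 2 h0 both summands vanish: h(x) \<le> 13/12 h0, and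
      h(x - z) \<le> h(x) + |z| / 3 \<le> |z|.\<close>
    define r where "r = h0 / 4"
    have r: "0 < r" using h0 by (simp add: r_def)
    have far: "x - z \<in> \<Omega>" if "x \<in> ball x0 r" "norm z < 2 * h0" for x z
    proof -
      have "norm (x0 - (x - z)) \<le> norm (x0 - x) + norm z" using norm_triangle_ineq[of "x0 - x" z] by (simp add: algebra_simps)
      then have "x - z \<in> ball x0 (3 * h x0)" using that h0 by (simp add: dist_norm r_def h0_def)
      then show ?thesis using ball3[OF x0] by blast
    qed
    have x\<Omega>: "x \<in> \<Omega>" if "x \<in> ball x0 r" for x using far[OF that, of 0] h0 by simp
    have hx: "h0 / 2 \<le> 3 / 4 * h x" "h x \<le> 13 / 12 * h0" if x: "x \<in> ball x0 r" for x
    proof -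
      have "norm (x0 - x) < h0 / 4" using x by (simp add: dist_norm r_def)
      then have "\<bar>h x0 - h x\<bar> \<le> h0 / 12" using h_lip[OF x0 x\<Omega>[OF x]] by linarith
      then show "h0 / 2 \<le> 3 / 4 * h x" "h x \<le> 13 / 12 * h0" using h0 unfolding h0_def by linarith+
    qed
    have out: "\<psi> (norm z) (h x) = 0" "\<psi>t (norm z) (h x) = 0" "\<psi> (norm z) (hh (x - z)) = 0" "\<psi>t (norm z) (hh (x - z)) = 0"
      if x: "x \<in> ball x0 r" and z: "2 * h0 \<le> norm z" for x z
    proof -
      have "h x \<le> norm z" using hx(2)[OF x] z h0 by linarith
      then show "\<psi> (norm z) (h x) = 0" "\<psi>t (norm z) (h x) = 0" using psi_eq_0[OF h_pos[OF x\<Omega>[OF x]]] by auto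
      have "\<psi> (norm z) (hh (x - z)) = 0 \<and> \<psi>t (norm z) (hh (x - z)) = 0"
      proof (cases "x - z \<in> \<Omega>")
        case True
        have "\<bar>h (x - z) - h x\<bar> \<le> 1 / 3 * norm z" using h_lip[OF True x\<Omega>[OF x]] by simp
        then have "h (x - z) \<le> norm z" using hx(2)[OF x] z by linarith
        then show ?thesis using psi_eq_0[OF h_pos[OF True]] True by (simp add: hh_def)
      qed (simp add: hh_def \<psi>_def \<psi>t_def)
      then show "\<psi> (norm z) (hh (x - z)) = 0" "\<psi>t (norm z) (hh (x - z)) = 0" by auto
    qed
    have der: "((\<lambda>x. f x z) has_derivative (\<lambda>v. Df x z \<bullet> v)) (at x)" if x: "x \<in> ball x0 r" for x z
    proof (cases "norm z < 2 * h0")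
      case True
      note xz = far[OF x True]
      have N: "((\<lambda>x. norm z) has_derivative (\<lambda>v. 0 \<bullet> v)) (at x)" by simp
      have hz: "((\<lambda>x. h (x - z)) has_derivative (\<lambda>v. H (x - z) \<bullet> v)) (at x)"
        by (rule has_derivative_compose[where f="\<lambda>x. x - z" and f'="\<lambda>v. v" and g=h and g'="\<lambda>v. H (x - z) \<bullet> v"])
          (use h_der[OF xz] in \<open>auto intro!: derivative_eq_intros\<close>)
      have "((\<lambda>x. norm z powr (- \<beta>) * (\<psi> (norm z) (h x) + \<psi> (norm z) (h (x - z)))) has_derivative (\<lambda>v. Df x z \<bullet> v)) (at x)"
        by (rule has_derivative_eq_rhs[OF has_derivative_mult_right[OF has_derivative_add[OF psi_has_derivative[OF N h_der[OF x\<Omega>[OF x]] h_pos[OF x\<Omega>[OF x]]]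
            psi_has_derivative[OF N hz h_pos[OF xz]]]]])
          (use xz in \<open>simp add: fun_eq_iff Df_def hh_def HH_def inner_add_left distrib_left\<close>)
      then show ?thesis
        by (rule has_derivative_transform_within_open[where s="ball x0 r"])
          (use x far[OF _ True] in \<open>auto simp: f_def hh_def simp del: mem_ball\<close>)
    next
      case False
      have "((\<lambda>x. f x z) has_derivative (\<lambda>v. 0)) (at x)"
        by (rule has_derivative_transform_within_open[where f="\<lambda>x. 0" and s="ball x0 r"])
          (use x False out in \<open>auto simp: f_def not_less simp del: mem_ball\<close>)
      moreover have "Df x z = 0" using out[OF x, of z] False by (simp add: Df_def)
      ultimately show ?thesis by simp
    qed
    define B where "B = (real DIM('a) + 3) * R0 * (h0 / 2) powr (\<beta> - real DIM('a) - 3)"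
    have B: "0 \<le> B" using R0 by (simp add: B_def)
    define g where "g z = 2 * B * (norm (z - 0) powr (- \<beta>) * indicator (cball (0::'a) (2 * h0)) z)" for z
    have gi: "integrable lborel g" unfolding g_def[abs_def]
      by (intro integrable_mult_right riesz_kernel_integrable) (use \<beta> in auto)
    have tle: "\<bar>\<psi>t s t\<bar> \<le> B" if "h0 / 2 \<le> t" "0 \<le> s" for s t
    proof -
      have "\<bar>\<psi>t s t\<bar> \<le> (real DIM('a) + 3) * R0 * t powr (\<beta> - real DIM('a) - 3)" using that h0 by (intro psi_t_le) auto
      also have "\<dots> \<le> B" unfolding B_def using that h0 R0 \<beta> by (intro mult_left_mono powr_mono2') auto
      finally show ?thesis .
    qed
    have bound: "norm (Df x z) \<le> g z" if x: "x \<in> ball x0 r" for x z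
    proof (cases "norm z < 2 * h0")
      case True
      note xz = far[OF x True]
      have 1: "\<bar>\<psi>t (norm z) (h x)\<bar> \<le> B" using hx(1)[OF x] h0 by (intro tle) auto
      have 2: "\<bar>\<psi>t (norm z) (hh (x - z))\<bar> \<le> B"
      proof (cases "norm z < h (x - z)")
        case less: True
        have "3 / 4 * h x \<le> h (x - z)" by (rule comparable(2)[OF xz x\<Omega>[OF x], of 1]) (use less in auto)
        then show ?thesis using hx(1)[OF x] xz by (intro tle) (auto simp: hh_def)
      next
        case False
        then show ?thesis using psi_eq_0(3)[OF h_pos[OF xz], of "norm z"] xz B by (simp add: hh_def)
      qed
      have "norm (Df x z) \<le> norm z powr (- \<beta>) * \<bar>\<psi>t (norm z) (h x)\<bar> * norm (H x) + norm z powr (- \<beta>) * \<bar>\<psi>t (norm z) (hh (x - z))\<bar> * norm (HH (x - z))"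
        unfolding Df_def by (rule order_trans[OF norm_triangle_ineq]) (simp add: abs_mult)
      also have "\<dots> \<le> norm z powr (- \<beta>) * B * 1 + norm z powr (- \<beta>) * B * 1"
        using 1 2 H_le[OF x\<Omega>[OF x]] H_le[OF xz] B xz by (intro add_mono mult_mono) (auto simp: HH_def)
      also have "\<dots> = g z" using True by (simp add: g_def)
      finally show ?thesis .
    next
      case False
      then have "Df x z = 0" using out[OF x, of z] by (simp add: Df_def)
      then show ?thesis using B by (simp add: g_def)
    qed
    have "((\<lambda>x. \<integral>z. f x z \<partial>lborel) has_derivative (\<lambda>v. (\<integral>z. Df x0 z \<partial>lborel) \<bullet> v)) (at x0)"
      by (rule has_derivative_integral(1)[OF r der Pf(2)[OF x\<Omega>] _ bound gi]) auto
    then have "(P has_derivative (\<lambda>v. PD x0 \<bullet> v)) (at x0)"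
      unfolding PD_def
      by (rule has_derivative_transform_within_open[where s="ball x0 r"]) (use r Pf(1) x\<Omega> in \<open>auto simp del: mem_ball\<close>)
    moreover have "isCont PD x0"
      unfolding continuous_at_sequentially
    proof (intro allI impI)
      fix X assume lim: "X \<longlonglongrightarrow> x0"
      have "x0 \<in> ball x0 r" using r by simp
      from topological_tendstoD[OF lim open_ball this] obtain n where n: "\<And>i. i \<ge> n \<Longrightarrow> X i \<in> ball x0 r"
        by (auto simp: eventually_sequentially simp del: mem_ball)
      have "(\<lambda>i. \<integral>z. Df (X (i + n)) z \<partial>lborel) \<longlonglongrightarrow> (\<integral>z. Df x0 z \<partial>lborel)"
      proof (rule integral_dominated_convergence[OF _ _ gi])
        show "AE z in lborel. (\<lambda>i. Df (X (i + n)) z) \<longlonglongrightarrow> Df x0 z"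
        proof (rule AE_I2)
          fix z
          have limn: "(\<lambda>i. X (i + n)) \<longlonglongrightarrow> x0" by (rule LIMSEQ_ignore_initial_segment[OF lim])
          show "(\<lambda>i. Df (X (i + n)) z) \<longlonglongrightarrow> Df x0 z"
          proof (cases "norm z < 2 * h0")
            case True
            have xz: "x0 - z \<in> \<Omega>" using far[OF \<open>x0 \<in> ball x0 r\<close> True] .
            have xnz: "X (i + n) - z \<in> \<Omega>" "X (i + n) \<in> \<Omega>" for i using far[OF n True] x\<Omega>[OF n] by auto
            have c: "(\<lambda>i. F (Y i)) \<longlonglongrightarrow> F y" if "continuous_on \<Omega> F" "y \<in> \<Omega>" "\<And>i. Y i \<in> \<Omega>" "Y \<longlonglongrightarrow> y" for F :: "'a \<Rightarrow> 'c::topological_space" and Y y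
              using continuous_on_tendsto_compose[OF that(1,4,2)] that(3) by simp
            have l2: "(\<lambda>i. X (i + n) - z) \<longlonglongrightarrow> x0 - z" by (intro tendsto_intros limn)
            have t: "(\<lambda>i. \<psi>t s (T i)) \<longlonglongrightarrow> \<psi>t s t" if "T \<longlonglongrightarrow> t" "0 < t" for s T t
              unfolding \<psi>t_def
              by (intro tendsto_intros that(1) continuous_on_tendsto_compose[OF \<rho>_cont] continuous_on_tendsto_compose[OF \<rho>'_cont]) (use that(2) in auto)
            have "(\<lambda>i. (norm z powr (- \<beta>) * \<psi>t (norm z) (h (X (i + n)))) *\<^sub>R H (X (i + n)) + (norm z powr (- \<beta>) * \<psi>t (norm z) (h (X (i + n) - z))) *\<^sub>R H (X (i + n) - z))
              \<longlonglongrightarrow> (norm z powr (- \<beta>) * \<psi>t (norm z) (h x0)) *\<^sub>R H x0 + (norm z powr (- \<beta>) * \<psi>t (norm z) (h (x0 - z))) *\<^sub>R H (x0 - z)"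
              by (intro tendsto_intros t c[OF continuous_h] c[OF H_cont] limn l2 xz x0 xnz h_pos)
            then show ?thesis using xz xnz by (simp add: Df_def hh_def HH_def)
          next
            case False
            then have "Df x z = 0" if "x \<in> ball x0 r" for x using out[OF that, of z] by (simp add: Df_def)
            then show ?thesis using n \<open>x0 \<in> ball x0 r\<close> by simp
          qed
        qed
        show "AE z in lborel. norm (Df (X (i + n)) z) \<le> g z" for i using bound[OF n] by simp
      qed auto
      then have "(\<lambda>i. PD (X (i + n))) \<longlonglongrightarrow> PD x0" by (simp add: PD_def)
      from LIMSEQ_offset[where f="\<lambda>i. PD (X i)", OF this] show "(PD \<circ> X) \<longlonglongrightarrow> PD x0" by (simp add: o_def)
    qed
    ultimately show ?thesis by blast
  qed
  show thesis
    by (rule that[of PD]) (use local in \<open>auto intro: continuous_at_imp_continuous_on\<close>)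
qed

end

section \<open>The pointwise nonlocal equation\<close>

lemma extend_C1:
  fixes f :: "'a::euclidean_space \<Rightarrow> real"
  assumes \<Omega>: "open \<Omega>" and K: "compact K" "K \<subseteq> \<Omega>"
    and der: "\<And>x. x \<in> \<Omega> \<Longrightarrow> (f has_derivative (\<lambda>v. Df x \<bullet> v)) (at x)" and cont: "continuous_on \<Omega> Df"
    and zero: "\<And>x. x \<in> \<Omega> \<Longrightarrow> x \<notin> K \<Longrightarrow> f x = 0"
  shows "((\<lambda>x. if x \<in> \<Omega> then f x else 0) has_derivative (\<lambda>v. (if x \<in> \<Omega> then Df x else 0) \<bullet> v)) (at x)"
    and "continuous_on UNIV (\<lambda>x. if x \<in> \<Omega> then Df x else 0)"
proof -
  let ?F = "\<lambda>x. if x \<in> \<Omega> then f x else 0" and ?D = "\<lambda>x. if x \<in> \<Omega> then Df x else 0"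
  have oK: "open (- K)" using K(1) by (simp add: compact_imp_closed open_Compl)
  have inside: "(?F has_derivative (\<lambda>v. ?D x \<bullet> v)) (at x)" if "x \<in> \<Omega>" for x
    by (rule has_derivative_transform_within_open[where f=f and s=\<Omega>]) (use der that \<Omega> in auto)
  have outside: "(?F has_derivative (\<lambda>v. 0)) (at x)" if "x \<notin> K" for x
    by (rule has_derivative_transform_within_open[where f="\<lambda>x. 0" and s="- K"]) (use zero that oK in auto)
  have D0: "?D x = 0" if "x \<notin> K" for x
  proof (cases "x \<in> \<Omega>")
    case True
    then have "(\<bullet>) (?D x) = (\<lambda>v. 0)" using has_derivative_unique[OF inside outside[OF that]] by blast
    then show ?thesis by (metis inner_eq_zero_iff)
  qed simp
  show "(?F has_derivative (\<lambda>v. ?D x \<bullet> v)) (at x)"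
  proof (cases "x \<in> K")
    case True
    then show ?thesis using inside K by blast
  next
    case False
    then show ?thesis using outside[OF False] D0[OF False] by simp
  qed
  have "continuous_on (\<Omega> \<union> - K) ?D"
  proof (rule continuous_on_open_Un[OF \<Omega> oK])
    show "continuous_on \<Omega> ?D" using cont by (rule continuous_on_eq) simp
    show "continuous_on (- K) ?D" by (rule continuous_on_eq[OF continuous_on_const[of _ 0]]) (use D0 in auto)
  qed
  moreover have "\<Omega> \<union> - K = UNIV" using K by auto
  ultimately show "continuous_on UNIV ?D" by simp
qed

context nonlocal_kernel begin

text \<open>The one-sided kernel of the bilinear form, whose horizon is taken at the first argument
  only; adding its transpose gives the symmetric kernel.\<close>

definition "a x y = norm (x - y) powr (- \<beta>) * \<psi> (norm (x - y)) (h x)"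

lemma ker_a: "ker x y = a x y + a y x"
  by (simp add: ker_def a_def norm_minus_commute distrib_left)

lemma a_nonneg: "0 \<le> a x y" by (simp add: a_def psi_nonneg)

lemma a_measurable [measurable]: "(\<lambda>p. a (fst p) (snd p)) \<in> borel_measurable (M \<Otimes>\<^sub>M M)" "(\<lambda>p. a (snd p) (fst p)) \<in> borel_measurable (M \<Otimes>\<^sub>M M)"
  unfolding a_def \<psi>_def by measurable

lemma sym_ker_eq:
  assumes x: "x \<in> \<Omega>" and y: "y \<in> \<Omega>" shows "sym_ker \<beta> \<rho> h x y = ker x y"
proof -
  have "rho_ker \<beta> \<rho> h x y / (h x)\<^sup>2 = a x y" if x: "x \<in> \<Omega>" for x y
  proof -
    note hx = h_pos[OF x]
    have "(norm (y - x) / h x) powr (- \<beta>) = norm (x - y) powr (- \<beta>) * h x powr \<beta>"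
      using hx by (simp add: powr_divide powr_minus_divide norm_minus_commute)
    moreover have "h x powr (\<beta> - real DIM('a) - 2) = h x powr \<beta> / (h x ^ DIM('a) * (h x)\<^sup>2)"
      using hx powr_realpow[OF hx, of "DIM('a)"] powr_realpow[OF hx, of 2] by (simp add: powr_diff)
    ultimately show ?thesis by (simp add: rho_ker_def a_def \<psi>_def norm_minus_commute)
  qed
  from this[OF x, of y] this[OF y, of x] show ?thesis by (simp add: sym_ker_def ker_a)
qed

lemma nl_form_integrand:
  assumes x: "x \<in> \<Omega>"
  shows "\<rho> (norm (y - x) / h x) / h x powr (real DIM('a) + 2 - \<beta>) * (t / norm (x - y) powr \<beta>) = a x y * t"
proof -
  have "h x powr (\<beta> - real DIM('a) - 2) = inverse (h x powr (real DIM('a) + 2 - \<beta>))"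
    using powr_minus[of "h x" "real DIM('a) + 2 - \<beta>"] by (simp add: algebra_simps)
  then show ?thesis by (simp add: a_def \<psi>_def powr_minus norm_minus_commute divide_inverse mult_ac)
qed

text \<open>Split the increment of \<open>v\<close> and exchange the variables in the part with
  v(y); the two one-sided kernels add up to k. The compact support of \<open>v\<close> makes each
  part absolutely integrable on the product, with \<open>u\<close> merely integrable.\<close>

lemma nl_form_eq:
  assumes u: "integrable M u" and v: "test_fun \<Omega> v"
  shows "nl_form \<beta> \<rho> \<Omega> h u v = (\<integral>x. (\<integral>y. ker x y * (u x - u y) \<partial>M) * v x \<partial>M)"
proof -
  define K where "K = closure {x. v x \<noteq> 0}"
  have K: "compact K" "K \<subseteq> \<Omega>" "\<And>x. x \<notin> K \<Longrightarrow> v x = 0"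
    using v closure_subset[of "{x. v x \<noteq> 0}"] by (auto simp: test_fun_def K_def)
  have vU: "test_fun UNIV v" using v by (auto simp: test_fun_def)
  have vc: "continuous_on UNIV v" using test_fun_bounded_derivatives(1)[OF vU, of "[]"] by simp
  obtain B where B: "0 \<le> B" "\<And>x. norm (v x) \<le> B" using continuous_compact_support(1)[OF vc K(1,3)] by blast
  have [measurable]: "v \<in> borel_measurable M" by (rule measurable_lebesgue_on_borel[OF borel_measurable_continuous_onI[OF vc]])
  obtain C where C: "0 \<le> C" "\<And>x y. x \<in> K \<Longrightarrow> y \<in> \<Omega> \<Longrightarrow> S x y \<le> C * norm (x - y) powr (- (\<beta> + 1))"
    using local_bounds[OF K(1,2)] by blast
  define q1 where "q1 p = a (fst p) (snd p) * v (fst p)" for p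
  define q2 where "q2 p = a (fst p) (snd p) * v (snd p)" for p
  have q1m: "q1 \<in> borel_measurable (M \<Otimes>\<^sub>M M)" and q2m: "q2 \<in> borel_measurable (M \<Otimes>\<^sub>M M)" unfolding q1_def q2_def by measurable
  have S_sym: "S x y = S y x" for x y by (simp add: S_def)
  have aS: "a x y \<le> R0 * S x y" if "x \<in> \<Omega>" "y \<in> \<Omega>" for x y
    using ker_le_S[OF that] a_nonneg[of y x] by (simp add: ker_a)
  have b1: "\<bar>q1 (x, y)\<bar> \<le> R0 * C * B * norm (x - y) powr (- (\<beta> + 1))" if x: "x \<in> \<Omega>" and y: "y \<in> \<Omega>" for x y
  proof (cases "x \<in> K")
    case True
    have "a x y \<le> R0 * (C * norm (x - y) powr (- (\<beta> + 1)))"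
      using aS[OF x y] mult_left_mono[OF C(2)[OF True y] R0] by linarith
    then have "a x y * \<bar>v x\<bar> \<le> R0 * (C * norm (x - y) powr (- (\<beta> + 1))) * B"
      using B C(1) R0 by (intro mult_mono) auto
    then show ?thesis using a_nonneg[of x y] by (simp add: q1_def abs_mult mult_ac)
  qed (use C B R0 in \<open>simp add: q1_def K(3)\<close>)
  have b2: "\<bar>q2 (x, y)\<bar> \<le> R0 * C * B * norm (x - y) powr (- (\<beta> + 1))" if x: "x \<in> \<Omega>" and y: "y \<in> \<Omega>" for x y
  proof (cases "y \<in> K")
    case True
    have "a x y \<le> R0 * (C * norm (y - x) powr (- (\<beta> + 1)))"
      using aS[OF x y] mult_left_mono[OF C(2)[OF True x] R0] by (simp add: S_sym[of x y])
    then have "a x y * \<bar>v y\<bar> \<le> R0 * (C * norm (y - x) powr (- (\<beta> + 1))) * B"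
      using B C(1) R0 by (intro mult_mono) auto
    then show ?thesis using a_nonneg[of x y] by (simp add: q2_def abs_mult mult_ac norm_minus_commute[of x y])
  qed (use C B R0 in \<open>simp add: q2_def K(3)\<close>)
  have B': "0 \<le> R0 * C * B" using R0 C B by simp
  define f1 where "f1 p = q1 p * u (fst p) - q1 p * u (snd p)" for p
  define f2 where "f2 p = q2 p * u (fst p) - q2 p * u (snd p)" for p
  have i1: "integrable (M \<Otimes>\<^sub>M M) f1" unfolding f1_def
    by (intro Bochner_Integration.integrable_diff integrable_MM[OF q1m u b1 B'])
  have i2: "integrable (M \<Otimes>\<^sub>M M) f2" unfolding f2_def
    by (intro Bochner_Integration.integrable_diff integrable_MM[OF q2m u b2 B'])
  have i2': "integrable (M \<Otimes>\<^sub>M M) (\<lambda>(x, y). f2 (y, x))" by (rule MM.integrable_product_swap[OF i2])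
  have "nl_form \<beta> \<rho> \<Omega> h u v = (\<integral>x. \<integral>y. f1 (x, y) - f2 (x, y) \<partial>M \<partial>M)"
    unfolding nl_form_def
  proof (intro Bochner_Integration.integral_cong refl)
    fix x y assume "x \<in> space M"
    then have x: "x \<in> \<Omega>" by simp
    show "\<rho> (norm (y - x) / h x) / h x powr (real DIM('a) + 2 - \<beta>) * ((u x - u y) * (v x - v y) / norm (x - y) powr \<beta>) = f1 (x, y) - f2 (x, y)"
      unfolding nl_form_integrand[OF x] by (simp add: f1_def f2_def q1_def q2_def algebra_simps)
  qed
  also have "\<dots> = (\<integral>p. f1 p - f2 p \<partial>(M \<Otimes>\<^sub>M M))"
    using MM.integral_fst'[of "\<lambda>p. f1 p - f2 p"] i1 i2 by simp
  also have "\<dots> = (\<integral>p. f1 p \<partial>(M \<Otimes>\<^sub>M M)) - (\<integral>p. f2 p \<partial>(M \<Otimes>\<^sub>M M))"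
    using i1 i2 by simp
  also have "(\<integral>p. f2 p \<partial>(M \<Otimes>\<^sub>M M)) = (\<integral>p. f2 (snd p, fst p) \<partial>(M \<Otimes>\<^sub>M M))"
    using MM.integral_product_swap[of f2] i2 by (simp add: split_beta')
  also have "(\<integral>p. f1 p \<partial>(M \<Otimes>\<^sub>M M)) - (\<integral>p. f2 (snd p, fst p) \<partial>(M \<Otimes>\<^sub>M M)) = (\<integral>p. f1 p - f2 (snd p, fst p) \<partial>(M \<Otimes>\<^sub>M M))"
    using i1 i2' by (simp add: split_beta')
  also have "\<dots> = (\<integral>x. \<integral>y. f1 (x, y) - f2 (y, x) \<partial>M \<partial>M)"
    using MM.integral_fst'[of "\<lambda>p. f1 p - f2 (snd p, fst p)"] i1 i2' by (simp add: split_beta')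
  also have "\<dots> = (\<integral>x. (\<integral>y. ker x y * (u x - u y) \<partial>M) * v x \<partial>M)"
  proof (intro Bochner_Integration.integral_cong refl)
    fix x
    have "(\<integral>y. f1 (x, y) - f2 (y, x) \<partial>M) = (\<integral>y. ker x y * (u x - u y) * v x \<partial>M)"
      by (intro Bochner_Integration.integral_cong refl) (simp add: f1_def f2_def q1_def q2_def ker_a algebra_simps)
    then show "(\<integral>y. f1 (x, y) - f2 (y, x) \<partial>M) = (\<integral>y. ker x y * (u x - u y) \<partial>M) * v x" by simp
  qed
  finally show ?thesis .
qed

text \<open>The kernel bounds hold only for x in K, so the indicator of K is built into the kernel
  before Fubini is applied on the product.\<close>

lemma L1_loc_nonlocal:
  fixes q :: "'a \<Rightarrow> 'a \<Rightarrow> real"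
  assumes q [measurable]: "(\<lambda>p. q (fst p) (snd p)) \<in> borel_measurable (M \<Otimes>\<^sub>M M)" and f: "integrable M f"
    and K: "compact K" "K \<subseteq> \<Omega>" and C: "0 \<le> C" "\<And>x y. x \<in> K \<Longrightarrow> y \<in> \<Omega> \<Longrightarrow> \<bar>q x y\<bar> \<le> C * norm (x - y) powr (- (\<beta> + 1))"
  shows "AE x in M. x \<in> K \<longrightarrow> integrable M (\<lambda>y. q x y * f y)"
    and "integrable M (\<lambda>x. indicator K x * (\<integral>y. q x y * f y \<partial>M))"
    and "integrable M (\<lambda>x. indicator K x * (\<integral>y. q x y * (f x - f y) \<partial>M))"
proof -
  have Km [measurable]: "indicator K \<in> borel_measurable M"
    by (rule measurable_lebesgue_on_borel, rule borel_measurable_indicator) (simp add: K(1) compact_imp_closed)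
  define Q where "Q p = indicator K (fst p) * q (fst p) (snd p)" for p :: "'a \<times> 'a"
  have Qm: "Q \<in> borel_measurable (M \<Otimes>\<^sub>M M)" unfolding Q_def by measurable
  have Qb: "\<bar>Q (x, y)\<bar> \<le> C * norm (x - y) powr (- (\<beta> + 1))" if "x \<in> \<Omega>" "y \<in> \<Omega>" for x y
    using C(2)[of x y] C(1) that by (cases "x \<in> K") (simp_all add: Q_def)
  have i1: "integrable (M \<Otimes>\<^sub>M M) (\<lambda>(x, y). Q (x, y) * f y)" and i2: "integrable (M \<Otimes>\<^sub>M M) (\<lambda>(x, y). Q (x, y) * f x)"
    using integrable_MM[OF Qm f Qb C(1)] by (simp_all add: split_beta')
  have "AE x in M. integrable M (\<lambda>y. Q (x, y) * f y)" by (rule MM.AE_integrable_fst[OF i1])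
  then show "AE x in M. x \<in> K \<longrightarrow> integrable M (\<lambda>y. q x y * f y)" 
  proof eventually_elim
    case (elim x)
    show ?case
    proof
      assume "x \<in> K"
      with elim show "integrable M (\<lambda>y. q x y * f y)" by (simp add: Q_def)
    qed
  qed
  show "integrable M (\<lambda>x. indicator K x * (\<integral>y. q x y * f y \<partial>M))"
    using MM.integrable_fst[OF i1] by (simp add: Q_def mult.assoc)
  have "integrable (M \<Otimes>\<^sub>M M) (\<lambda>(x, y). Q (x, y) * f x - Q (x, y) * f y)"
    using Bochner_Integration.integrable_diff[OF i2 i1] by (simp add: split_beta')
  from MM.integrable_fst[OF this] show "integrable M (\<lambda>x. indicator K x * (\<integral>y. q x y * (f x - f y) \<partial>M))"
    by (simp add: Q_def mult.assoc right_diff_distrib[symmetric])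
qed

lemma AE_of_compact:
  assumes "\<And>K. compact K \<Longrightarrow> K \<subseteq> \<Omega> \<Longrightarrow> AE x in M. x \<in> K \<longrightarrow> Q x"
  shows "AE x in M. Q x"
proof -
  obtain \<D> where D: "countable \<D>" "\<D> \<subseteq> Pow \<Omega>" "\<And>X. X \<in> \<D> \<Longrightarrow> \<exists>a b. X = cbox a b" "\<Union>\<D> = \<Omega>"
    using open_countable_Union_open_cbox[OF open_\<Omega>] by blast
  have "AE x in M. \<forall>X\<in>\<D>. x \<in> X \<longrightarrow> Q x"
    unfolding AE_ball_countable[OF D(1)]
  proof
    fix X assume X: "X \<in> \<D>"
    then obtain a b where "X = cbox a b" using D(3) by blast
    then show "AE x in M. x \<in> X \<longrightarrow> Q x" using assms[of X] X D(2) by auto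
  qed
  moreover have "AE x in M. x \<in> \<Omega>" by (rule AE_I2) simp
  ultimately show ?thesis by eventually_elim (use D(4) in blast)
qed

lemma L1_locI:
  fixes f :: "'a \<Rightarrow> real"
  assumes "\<And>K. compact K \<Longrightarrow> K \<subseteq> \<Omega> \<Longrightarrow> integrable M (\<lambda>x. indicator K x * f x)"
  shows "L1_loc \<Omega> f"
  unfolding L1_loc_def
proof (intro allI impI)
  fix K assume K: "compact K \<and> K \<subseteq> \<Omega>"
  then have "K \<in> sets lebesgue" by (simp add: compact_imp_closed)
  then show "integrable (lebesgue_on K) f" using assms[of K] K by (subst integrable_lebesgue_on_iff(1)[of K \<Omega>]) auto
qed

lemma L1_loc_integrable: "integrable M f \<Longrightarrow> L1_loc \<Omega> (f :: 'a \<Rightarrow> real)"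
proof (rule L1_locI)
  fix K :: "'a set" assume f: "integrable M f" and "compact K" "K \<subseteq> \<Omega>"
  then have "K \<in> sets M" by (auto simp: sets_restrict_space_iff compact_imp_closed)
  from integrable_mult_indicator[OF this f] show "integrable M (\<lambda>x. indicator K x * f x)" by simp
qed

lemma ker_local_bound:
  assumes K: "compact K" "K \<subseteq> \<Omega>"
  shows "\<exists>C\<ge>0. \<forall>x\<in>K. \<forall>y\<in>\<Omega>. \<bar>ker x y\<bar> \<le> C * norm (x - y) powr (- (\<beta> + 1)) \<and> norm (Dker x y) \<le> C * norm (x - y) powr (- (\<beta> + 1))"
proof -
  obtain C where C: "0 \<le> C" "\<And>x y. x \<in> K \<Longrightarrow> y \<in> \<Omega> \<Longrightarrow> S x y \<le> C * norm (x - y) powr (- (\<beta> + 1)) \<and> norm (Dker x y) \<le> C * norm (x - y) powr (- (\<beta> + 1))"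
    using local_bounds[OF K] by blast
  show ?thesis
  proof (intro exI[of _ "R0 * C + C"] conjI ballI)
    fix x y assume xy: "x \<in> K" "y \<in> \<Omega>"
    let ?n = "norm (x - y) powr (- (\<beta> + 1))"
    have "0 \<le> R0 * C * ?n" "0 \<le> C * ?n" using R0 C(1) by simp_all
    moreover have "ker x y \<le> R0 * (C * ?n)"
    proof (rule order_trans)
      show "ker x y \<le> R0 * S x y" by (rule ker_le_S) (use xy K in auto)
      show "R0 * S x y \<le> R0 * (C * ?n)" using C(2)[OF xy] by (intro mult_left_mono R0) simp
    qed
    moreover have "(R0 * C + C) * ?n = R0 * C * ?n + C * ?n" "R0 * (C * ?n) = R0 * C * ?n" by (simp_all only: distrib_right mult.assoc)
    moreover have "norm (Dker x y) \<le> C * ?n" using C(2)[OF xy] by simp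
    ultimately show "\<bar>ker x y\<bar> \<le> (R0 * C + C) * ?n" "norm (Dker x y) \<le> (R0 * C + C) * ?n"
      using ker_nonneg[of x y] by linarith+
  qed (use R0 C in simp)
qed

text \<open>Local integrability of the nonlocal operator allows the fundamental lemma to compare it
  with \<open>G\<close>. The separate integrability of k(x, y) u(y) is recorded because it allows
  the integral to be split into P u and the averaging part.\<close>

lemma nonlocal_equation_AE:
  assumes u: "integrable M u" and G: "L1_loc \<Omega> G"
    and eq: "\<And>v. test_fun \<Omega> v \<Longrightarrow> nl_form \<beta> \<rho> \<Omega> h u v = (\<integral>x. G x * v x \<partial>M)"
  shows "AE x in M. integrable M (\<lambda>y. ker x y * u y) \<and> integrable M (\<lambda>y. ker x y * (u x - u y)) \<and> (\<integral>y. ker x y * (u x - u y) \<partial>M) = G x"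
proof -
  have i1: "AE x in M. integrable M (\<lambda>y. ker x y * u y)"
  proof (rule AE_of_compact)
    fix K assume K: "compact K" "K \<subseteq> \<Omega>"
    obtain C where C: "0 \<le> C" "\<And>x y. x \<in> K \<Longrightarrow> y \<in> \<Omega> \<Longrightarrow> \<bar>ker x y\<bar> \<le> C * norm (x - y) powr (- (\<beta> + 1))"
      using ker_local_bound[OF K] by blast
    show "AE x in M. x \<in> K \<longrightarrow> integrable M (\<lambda>y. ker x y * u y)"
      by (rule L1_loc_nonlocal(1)[OF _ u K C]) measurable
  qed
  define Lu where "Lu x = (\<integral>y. ker x y * (u x - u y) \<partial>M)" for x
  have L: "L1_loc \<Omega> Lu"
  proof (rule L1_locI)
    fix K assume K: "compact K" "K \<subseteq> \<Omega>"
    obtain C where C: "0 \<le> C" "\<And>x y. x \<in> K \<Longrightarrow> y \<in> \<Omega> \<Longrightarrow> \<bar>ker x y\<bar> \<le> C * norm (x - y) powr (- (\<beta> + 1))"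
      using ker_local_bound[OF K] by blast
    show "integrable M (\<lambda>x. indicator K x * Lu x)"
      unfolding Lu_def by (rule L1_loc_nonlocal(3)[OF _ u K C]) measurable
  qed
  have "AE x in M. Lu x - G x = 0"
  proof (rule fundamental_lemma[OF open_\<Omega>])
    show "L1_loc \<Omega> (\<lambda>x. Lu x - G x)" using L G by (auto simp: L1_loc_def)
    fix v assume v: "test_fun \<Omega> v"
    have vU: "test_fun UNIV v" using v by (auto simp: test_fun_def)
    have vm: "v \<in> borel_measurable borel"
      using test_fun_bounded_derivatives(1)[OF vU, of "[]"] by (intro borel_measurable_continuous_onI) simp
    obtain B where B: "\<And>x. \<bar>v x\<bar> \<le> B" using test_fun_bounded_derivatives(3)[OF vU, of "[]"] by auto
    have K: "compact (closure {x. v x \<noteq> 0})" "closure {x. v x \<noteq> 0} \<subseteq> \<Omega>" using v by (auto simp: test_fun_def)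
    have v0: "v x = 0" if "x \<notin> closure {x. v x \<noteq> 0}" for x using that closure_subset[of "{x. v x \<noteq> 0}"] by auto
    have "integrable M (\<lambda>x. Lu x * v x)" "integrable M (\<lambda>x. G x * v x)"
      by (rule L1_loc_integrable_mult[OF L \<Omega>_sets K vm B v0], assumption, rule L1_loc_integrable_mult[OF G \<Omega>_sets K vm B v0])
    moreover have "(\<integral>x. Lu x * v x \<partial>M) = (\<integral>x. G x * v x \<partial>M)"
      using nl_form_eq[OF u v] eq[OF v] by (simp add: Lu_def)
    ultimately show "(\<integral>x. (Lu x - G x) * v x \<partial>M) = 0" by (simp add: left_diff_distrib)
  qed
  moreover have "AE x in M. x \<in> \<Omega>" by (rule AE_I2) simp
  ultimately show ?thesis using i1
  proof eventually_elim
    case (elim x)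
    have "integrable M (\<lambda>y. ker x y * (u x - u y))"
      using elim integrable_ker[of x] by (simp add: right_diff_distrib)
    then show ?case using elim by (simp add: Lu_def)
  qed
qed

end

section \<open>The weak gradient of the solution\<close>

context nonlocal_kernel begin

lemma integrable_compact_support:
  fixes f g :: "'a \<Rightarrow> real"
  assumes f: "L1_loc \<Omega> f" and g: "continuous_on UNIV g" and K: "compact K" "K \<subseteq> \<Omega>" "\<And>x. x \<notin> K \<Longrightarrow> g x = 0"
  shows "integrable M (\<lambda>x. f x * g x)"
proof -
  obtain B where B: "\<And>x. norm (g x) \<le> B" using continuous_compact_support(1)[OF g K(1,3)] by blast
  show ?thesis
    by (rule L1_loc_integrable_mult[OF f \<Omega>_sets K(1,2) borel_measurable_continuous_onI[OF g], where B=B]) (use B K(3) in auto)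
qed

lemma gradient_zero_outside:
  fixes w :: "'a \<Rightarrow> real"
  assumes w: "\<And>x. (w has_derivative (\<lambda>v. D x \<bullet> v)) (at x)" and K: "compact K" "\<And>x. x \<notin> K \<Longrightarrow> w x = 0" and x: "x \<notin> K"
  shows "D x = 0"
proof -
  have "(w has_derivative (\<lambda>h. 0)) (at x)"
    by (rule has_derivative_transform_within_open[where f="\<lambda>x. 0" and s="- K"])
      (use K x in \<open>auto simp: compact_imp_closed\<close>)
  then have "(\<bullet>) (D x) = (\<lambda>h. 0)" using has_derivative_unique[OF w[of x]] by blast
  then show ?thesis by (metis inner_eq_zero_iff)
qed

lemma L1_loc_Dker:
  assumes f: "integrable M f" and b: "norm b = 1"
  shows "L1_loc \<Omega> (\<lambda>x. \<integral>y. (Dker x y \<bullet> b) * f y \<partial>M)" "L1_loc \<Omega> (\<lambda>x. \<integral>y. (Dker x y \<bullet> b) * (f x - f y) \<partial>M)"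
    "AE x in M. integrable M (\<lambda>y. (Dker x y \<bullet> b) * f y)"
proof -
  have m: "(\<lambda>p. Dker (fst p) (snd p) \<bullet> b) \<in> borel_measurable (M \<Otimes>\<^sub>M M)" by measurable
  have C: "\<exists>C\<ge>0. \<forall>x\<in>K. \<forall>y\<in>\<Omega>. \<bar>Dker x y \<bullet> b\<bar> \<le> C * norm (x - y) powr (- (\<beta> + 1))" if K: "compact K" "K \<subseteq> \<Omega>" for K
  proof -
    obtain C where C: "0 \<le> C" "\<And>x y. x \<in> K \<Longrightarrow> y \<in> \<Omega> \<Longrightarrow> norm (Dker x y) \<le> C * norm (x - y) powr (- (\<beta> + 1))"
      using ker_local_bound[OF K] by blast
    have "\<bar>Dker x y \<bullet> b\<bar> \<le> norm (Dker x y)" for x y using Cauchy_Schwarz_ineq2[of "Dker x y" b] b by simp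
    then show ?thesis by (intro exI[of _ C] conjI C(1) ballI order_trans[OF _ C(2)])
  qed
  show "L1_loc \<Omega> (\<lambda>x. \<integral>y. (Dker x y \<bullet> b) * f y \<partial>M)"
  proof (rule L1_locI)
    fix K assume K: "compact K" "K \<subseteq> \<Omega>"
    obtain C where C: "0 \<le> C" "\<And>x y. x \<in> K \<Longrightarrow> y \<in> \<Omega> \<Longrightarrow> \<bar>Dker x y \<bullet> b\<bar> \<le> C * norm (x - y) powr (- (\<beta> + 1))" using C[OF K] by blast
    show "integrable M (\<lambda>x. indicator K x * (\<integral>y. (Dker x y \<bullet> b) * f y \<partial>M))" by (rule L1_loc_nonlocal(2)[OF m f K C])
  qed
  show "L1_loc \<Omega> (\<lambda>x. \<integral>y. (Dker x y \<bullet> b) * (f x - f y) \<partial>M)"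
  proof (rule L1_locI)
    fix K assume K: "compact K" "K \<subseteq> \<Omega>"
    obtain C where C: "0 \<le> C" "\<And>x y. x \<in> K \<Longrightarrow> y \<in> \<Omega> \<Longrightarrow> \<bar>Dker x y \<bullet> b\<bar> \<le> C * norm (x - y) powr (- (\<beta> + 1))" using C[OF K] by blast
    show "integrable M (\<lambda>x. indicator K x * (\<integral>y. (Dker x y \<bullet> b) * (f x - f y) \<partial>M))" by (rule L1_loc_nonlocal(3)[OF m f K C])
  qed
  show "AE x in M. integrable M (\<lambda>y. (Dker x y \<bullet> b) * f y)"
  proof (rule AE_of_compact)
    fix K assume K: "compact K" "K \<subseteq> \<Omega>"
    obtain C where C: "0 \<le> C" "\<And>x y. x \<in> K \<Longrightarrow> y \<in> \<Omega> \<Longrightarrow> \<bar>Dker x y \<bullet> b\<bar> \<le> C * norm (x - y) powr (- (\<beta> + 1))" using C[OF K] by blast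
    show "AE x in M. x \<in> K \<longrightarrow> integrable M (\<lambda>y. (Dker x y \<bullet> b) * f y)" by (rule L1_loc_nonlocal(1)[OF m f K C])
  qed
qed

text \<open>\<open>PD\<close> was obtained after the substitution y = x - z and does not look like
  the integral of the kernel gradient. The two are identified weakly: the integral of the derivative
  of P v vanishes, and integration by parts with density 1 treats the part where \<open>v\<close> is
  differentiated.\<close>

lemma P_gradient_AE:
  assumes PD: "\<And>x. x \<in> \<Omega> \<Longrightarrow> (P has_derivative (\<lambda>v. PD x \<bullet> v)) (at x)" "continuous_on \<Omega> PD" and b: "b \<in> Basis"
  shows "AE x in M. PD x \<bullet> b = (\<integral>y. Dker x y \<bullet> b \<partial>M)"
proof -
  have nb: "norm b = 1" using b by simp
  have one: "integrable M (\<lambda>x. 1 :: real)" by simp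
  define Q where "Q x = (\<integral>y. Dker x y \<bullet> b \<partial>M)" for x
  have Q: "L1_loc \<Omega> Q" unfolding Q_def[abs_def] using L1_loc_Dker(1)[OF one nb] by simp
  have PDl: "L1_loc \<Omega> (\<lambda>x. PD x \<bullet> b)"
    unfolding L1_loc_def
  proof (intro allI impI)
    fix K assume K: "compact K \<and> K \<subseteq> \<Omega>"
    have c: "continuous_on K (\<lambda>x. PD x \<bullet> b)" using continuous_on_subset[OF PD(2)] K by (intro continuous_intros) auto
    have Km: "K \<in> sets lebesgue" "emeasure lebesgue K < \<infinity>"
      using K lmeasurable_compact[of K] by (auto simp: compact_imp_closed fmeasurable_def)
    obtain B where B: "\<And>x. x \<in> K \<Longrightarrow> \<bar>PD x \<bullet> b\<bar> \<le> B"
      using compact_imp_bounded[OF compact_continuous_image[OF c]] K by (auto simp: bounded_iff)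
    show "integrable (lebesgue_on K) (\<lambda>x. PD x \<bullet> b)"
    proof (rule finite_measure.integrable_const_bound)
      show "finite_measure (lebesgue_on K)" using K lmeasurable_compact finite_measure_lebesgue_on by blast
      show "AE x in lebesgue_on K. norm (PD x \<bullet> b) \<le> B" using B by (intro AE_I2) auto
      show "(\<lambda>x. PD x \<bullet> b) \<in> borel_measurable (lebesgue_on K)"
        by (rule continuous_imp_measurable_on_sets_lebesgue[OF c Km(1)])
    qed
  qed
  have "AE x in M. PD x \<bullet> b - Q x = 0"
  proof (rule fundamental_lemma[OF open_\<Omega>])
    show "L1_loc \<Omega> (\<lambda>x. PD x \<bullet> b - Q x)" using PDl Q by (auto simp: L1_loc_def)
    fix v assume v: "test_fun \<Omega> v"
    define K where "K = closure {x. v x \<noteq> 0}"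
    have K: "compact K" "K \<subseteq> \<Omega>" "\<And>x. x \<notin> K \<Longrightarrow> v x = 0"
      using v closure_subset[of "{x. v x \<noteq> 0}"] by (auto simp: test_fun_def K_def)
    have vU: "test_fun UNIV v" using v by (auto simp: test_fun_def)
    obtain D where D: "\<And>x. (v has_derivative (\<lambda>h. D x \<bullet> h)) (at x)" "continuous_on UNIV D"
      using test_fun_has_derivative[OF vU] by metis
    have vc: "continuous_on UNIV v" by (rule has_derivative_continuous_on, rule has_derivative_at_withinI, rule D)
    have Pc: "continuous_on \<Omega> P" by (rule has_derivative_continuous_on, rule has_derivative_at_withinI, rule PD(1))
    let ?Df = "\<lambda>x. v x *\<^sub>R PD x + P x *\<^sub>R D x"
    have fd: "((\<lambda>x. P x * v x) has_derivative (\<lambda>h. ?Df x \<bullet> h)) (at x)" if "x \<in> \<Omega>" for x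
      by (rule has_derivative_eq_rhs[OF has_derivative_mult[OF PD(1)[OF that] D(1)]]) (simp add: fun_eq_iff inner_add_left)
    have fc: "continuous_on \<Omega> ?Df"
      by (intro continuous_intros PD(2) Pc continuous_on_subset[OF vc subset_UNIV] continuous_on_subset[OF D(2) subset_UNIV])
    have zero: "P x * v x = 0" if "x \<in> \<Omega>" "x \<notin> K" for x using K(3)[OF that(2)] by simp
    note ext = extend_C1[OF open_\<Omega> K(1,2) fd fc zero]
    define F where "F x = (if x \<in> \<Omega> then P x * v x else 0)" for x
    define DF where "DF x = (if x \<in> \<Omega> then ?Df x else 0)" for x
    have F: "\<And>x. (F has_derivative (\<lambda>v. DF x \<bullet> v)) (at x)" "continuous_on UNIV DF"
      using ext unfolding F_def DF_def by auto
    have F0: "F x = 0" if "x \<notin> K" for x using K(3)[OF that] by (simp add: F_def)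
    have DF0: "DF x = 0" if "x \<notin> K" for x by (rule gradient_zero_outside[OF F(1) K(1) F0 that])
    obtain B where B: "\<And>x. norm (DF x) \<le> B" using continuous_compact_support(1)[OF F(2) K(1) DF0] by blast
    obtain R where R: "\<forall>x\<in>\<Omega>. norm x \<le> R" using \<Omega>_norm_le by blast
    have "(\<integral>x. DF x \<bullet> b \<partial>lborel) = 0"
    proof (rule integral_partial_eq_0[OF F(1) _ _ nb])
      show "\<bar>DF x \<bullet> b\<bar> \<le> B" for x using Cauchy_Schwarz_ineq2[of "DF x" b] nb B[of x] by simp
      show "F x = 0" if "R < norm x" for x using R that by (force simp: F_def)
    qed
    moreover have "(\<integral>x. DF x \<bullet> b \<partial>M) = (\<integral>x. DF x \<bullet> b \<partial>lborel)"
      using F(2) by (intro M_eq_lborel(2) borel_measurable_continuous_onI continuous_intros) (auto simp: DF_def)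
    moreover have "(\<integral>x. DF x \<bullet> b \<partial>M) = (\<integral>x. (PD x \<bullet> b) * v x + (\<integral>y. ker x y * 1 \<partial>M) * (D x \<bullet> b) \<partial>M)"
      by (intro Bochner_Integration.integral_cong refl) (simp add: DF_def inner_add_left P_def mult.commute)
    moreover have i: "integrable M (\<lambda>x. (PD x \<bullet> b) * v x)" by (rule integrable_compact_support[OF PDl vc K])
    note I = ibp[OF one nb D K]
    ultimately have "0 = (\<integral>x. (PD x \<bullet> b) * v x \<partial>M) - (\<integral>x. (\<integral>y. (Dker x y \<bullet> b) * 1 \<partial>M) * v x \<partial>M)"
      using I(1,3) i by (simp add: Bochner_Integration.integral_add)
    also have "\<dots> = (\<integral>x. (PD x \<bullet> b - Q x) * v x \<partial>M)"
      using i I(2) by (simp add: Q_def left_diff_distrib)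
    finally show "(\<integral>x. (PD x \<bullet> b - Q x) * v x \<partial>M) = 0" ..
  qed
  then show ?thesis by (simp add: Q_def)
qed

definition T where "T u x = (\<Sum>b\<in>Basis. (\<integral>y. (Dker x y \<bullet> b) * (u y - u x) \<partial>M) *\<^sub>R b)"

lemma T_inner: "b \<in> Basis \<Longrightarrow> T u x \<bullet> b = (\<integral>y. (Dker x y \<bullet> b) * (u y - u x) \<partial>M)"
  by (simp add: T_def inner_sum_left inner_Basis if_distrib cong: if_cong)

lemma L1_loc_T:
  assumes u: "integrable M u" and b: "b \<in> Basis"
  shows "L1_loc \<Omega> (\<lambda>x. T u x \<bullet> b)"
proof -
  have "(\<lambda>x. T u x \<bullet> b) = (\<lambda>x. - (\<integral>y. (Dker x y \<bullet> b) * (u x - u y) \<partial>M))"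
    unfolding T_inner[OF b] by (subst Bochner_Integration.integral_minus[symmetric]) (simp add: algebra_simps)
  then show ?thesis using L1_loc_Dker(2)[OF u, of b] b by (auto simp: L1_loc_def)
qed

text \<open>Formally \<open>P \<nabla>u = \<nabla>G + \<integral>\<nabla>\<^sub>xk(x, y) (u(y) - u(x)) dy\<close>, by differentiating the equation
  \<open>P u = \<integral>k(x, y) u(y) dy + G\<close>; weakly, it is tested against \<open>v / P\<close>.\<close>

lemma weak_gradient:
  assumes u: "integrable M u" and P_pos: "\<And>x. x \<in> \<Omega> \<Longrightarrow> 0 < P x"
    and eq: "AE x in M. integrable M (\<lambda>y. ker x y * u y) \<and> integrable M (\<lambda>y. ker x y * (u x - u y)) \<and> (\<integral>y. ker x y * (u x - u y) \<partial>M) = G x"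
    and g: "is_weak_grad \<Omega> G g"
  shows "is_weak_grad \<Omega> u (\<lambda>x. (1 / P x) *\<^sub>R (g x + T u x))"
  unfolding is_weak_grad_def
proof
  fix b :: 'a assume b: "b \<in> Basis"
  have nb: "norm b = 1" using b by simp
  have wp: "weak_partial \<Omega> [b] G (\<lambda>x. g x \<bullet> b)" using g b by (simp add: is_weak_grad_def)
  have Gl: "L1_loc \<Omega> G" and gl: "L1_loc \<Omega> (\<lambda>x. g x \<bullet> b)" using wp by (auto simp: weak_partial_def)
  have ul: "L1_loc \<Omega> u" by (rule L1_loc_integrable[OF u])
  obtain PD where PD: "\<And>x. x \<in> \<Omega> \<Longrightarrow> (P has_derivative (\<lambda>v. PD x \<bullet> v)) (at x)" "continuous_on \<Omega> PD"
    using P_C1 by blast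
  have Pc: "continuous_on \<Omega> P" by (rule has_derivative_continuous_on, rule has_derivative_at_withinI, rule PD(1))
  have Pinv: "continuous_on \<Omega> (\<lambda>x. 1 / P x)" using P_pos by (intro continuous_intros Pc) force
  have sl: "L1_loc \<Omega> (\<lambda>x. g x \<bullet> b + T u x \<bullet> b)" using gl L1_loc_T[OF u b] by (auto simp: L1_loc_def)
  have rl: "L1_loc \<Omega> (\<lambda>x. ((1 / P x) *\<^sub>R (g x + T u x)) \<bullet> b)"
    unfolding L1_loc_def
  proof (intro allI impI)
    fix K assume K: "compact K \<and> K \<subseteq> \<Omega>"
    have c: "continuous_on K (\<lambda>x. 1 / P x)" using continuous_on_subset[OF Pinv] K by blast
    obtain B where B: "\<And>x. x \<in> K \<Longrightarrow> \<bar>1 / P x\<bar> \<le> B"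
      using compact_imp_bounded[OF compact_continuous_image[OF c]] K by (auto simp: bounded_iff)
    have "integrable (lebesgue_on K) (\<lambda>x. (g x \<bullet> b + T u x \<bullet> b) * (1 / P x))"
    proof (rule integrable_on_mult_bounded)
      show "integrable (lebesgue_on K) (\<lambda>x. g x \<bullet> b + T u x \<bullet> b)" using sl K by (auto simp: L1_loc_def)
      show "(\<lambda>x. 1 / P x) \<in> borel_measurable (lebesgue_on K)"
        using K by (intro continuous_imp_measurable_on_sets_lebesgue[OF c]) (auto simp: compact_imp_closed)
    qed (use B in simp)
    then show "integrable (lebesgue_on K) (\<lambda>x. ((1 / P x) *\<^sub>R (g x + T u x)) \<bullet> b)"
      by (simp add: inner_add_left)
  qed
  show "weak_partial \<Omega> [b] u (\<lambda>x. ((1 / P x) *\<^sub>R (g x + T u x)) \<bullet> b)"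
    unfolding weak_partial_def
  proof (intro conjI ul rl allI impI)
    fix v assume v: "test_fun \<Omega> v"
    define K where "K = closure {x. v x \<noteq> 0}"
    have K: "compact K" "K \<subseteq> \<Omega>" "\<And>x. x \<notin> K \<Longrightarrow> v x = 0"
      using v closure_subset[of "{x. v x \<noteq> 0}"] by (auto simp: test_fun_def K_def)
    have vU: "test_fun UNIV v" using v by (auto simp: test_fun_def)
    obtain D where D: "\<And>x. (v has_derivative (\<lambda>h. D x \<bullet> h)) (at x)" "\<And>x b. b \<in> Basis \<Longrightarrow> D x \<bullet> b = iter_partial [b] v x" "continuous_on UNIV D"
      using test_fun_has_derivative[OF vU] by metis
    have vc: "continuous_on UNIV v" by (rule has_derivative_continuous_on, rule has_derivative_at_withinI, rule D)
    let ?Dw = "\<lambda>x. (1 / P x) *\<^sub>R D x - (v x / (P x)\<^sup>2) *\<^sub>R PD x"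
    have wd: "((\<lambda>x. v x / P x) has_derivative (\<lambda>h. ?Dw x \<bullet> h)) (at x)" if x: "x \<in> \<Omega>" for x
    proof -
      have "P x \<noteq> 0" using P_pos[OF x] by simp
      from has_derivative_divide'[OF D(1) PD(1)[OF x] this] show ?thesis
        by (rule has_derivative_eq_rhs) (use \<open>P x \<noteq> 0\<close> in \<open>simp add: fun_eq_iff inner_diff_left field_simps power2_eq_square\<close>)
    qed
    have wcont: "continuous_on \<Omega> ?Dw"
      using P_pos by (intro continuous_intros PD(2) Pc continuous_on_subset[OF vc subset_UNIV] continuous_on_subset[OF D(3) subset_UNIV]) force+
    have zero: "v x / P x = 0" if "x \<in> \<Omega>" "x \<notin> K" for x using K(3)[OF that(2)] by simp
    note ext = extend_C1[OF open_\<Omega> K(1,2) wd wcont zero]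
    define w where "w x = (if x \<in> \<Omega> then v x / P x else 0)" for x
    define Dw where "Dw x = (if x \<in> \<Omega> then ?Dw x else 0)" for x
    have w: "\<And>x. (w has_derivative (\<lambda>v. Dw x \<bullet> v)) (at x)" "continuous_on UNIV Dw"
      using ext unfolding w_def Dw_def by auto
    have w0: "w x = 0" if "x \<notin> K" for x using K(3)[OF that] by (simp add: w_def)
    have Dw0: "Dw x = 0" if "x \<notin> K" for x by (rule gradient_zero_outside[OF w(1) K(1) w0 that])
    have wc: "continuous_on UNIV w" by (rule has_derivative_continuous_on, rule has_derivative_at_withinI, rule w)
    have Dwc: "continuous_on UNIV (\<lambda>x. Dw x \<bullet> b)" by (intro continuous_intros w(2))
    \<comment> \<open>The product rule for v = P w: what remains of the derivative of
      \<open>v\<close> after P times the derivative of \<open>w\<close> is \<open>w\<close> times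
      the derivative of P. Written as a difference, it is visibly continuous on the whole
      space.\<close>
    define z where "z x = D x \<bullet> b - (if x \<in> \<Omega> then P x * (Dw x \<bullet> b) else 0)" for x
    have z: "z x = w x * (PD x \<bullet> b)" if x: "x \<in> \<Omega>" for x
      using P_pos[OF x] x by (simp add: z_def w_def Dw_def inner_diff_left field_simps power2_eq_square)
    have zi: "integrable M (\<lambda>x. u x * z x)"
    proof -
      have Pw: "continuous_on UNIV (\<lambda>x. if x \<in> \<Omega> then P x * (Dw x \<bullet> b) else 0)"
      proof -
        have oK: "open (- K)" using K(1) by (simp add: compact_imp_closed open_Compl)
        have "continuous_on (\<Omega> \<union> - K) (\<lambda>x. if x \<in> \<Omega> then P x * (Dw x \<bullet> b) else 0)"
        proof (rule continuous_on_open_Un[OF open_\<Omega> oK])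
          show "continuous_on \<Omega> (\<lambda>x. if x \<in> \<Omega> then P x * (Dw x \<bullet> b) else 0)"
            by (rule continuous_on_eq[where f="\<lambda>x. P x * (Dw x \<bullet> b)"]) (auto intro!: continuous_intros Pc continuous_on_subset[OF Dwc subset_UNIV])
          show "continuous_on (- K) (\<lambda>x. if x \<in> \<Omega> then P x * (Dw x \<bullet> b) else 0)"
            by (rule continuous_on_eq[OF continuous_on_const[of _ 0]]) (use Dw0 in auto)
        qed
        moreover have "\<Omega> \<union> - K = UNIV" using K by auto
        ultimately show ?thesis by simp
      qed
      show ?thesis
      proof (rule integrable_compact_support[OF ul _ K(1,2)])
        show "continuous_on UNIV z" unfolding z_def[abs_def] by (intro continuous_intros Pw D(3))
        show "z x = 0" if "x \<notin> K" for x
          using gradient_zero_outside[OF D(1) K(1,3) that] Dw0[OF that] by (simp add: z_def)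
      qed
    qed
    have Gw: "(\<integral>x. G x * (Dw x \<bullet> b) \<partial>M) = - (\<integral>x. (g x \<bullet> b) * w x \<partial>M)"
      by (rule weak_partial_C1_test[OF open_\<Omega> b wp w K(1,2) w0])
    note I = ibp[OF u nb w K(1,2) w0]
    have Gi: "integrable M (\<lambda>x. G x * (Dw x \<bullet> b))"
      by (rule integrable_compact_support[OF Gl Dwc K(1,2)]) (simp add: Dw0)
    have gi: "integrable M (\<lambda>x. (g x \<bullet> b) * w x)" by (rule integrable_compact_support[OF gl wc K(1,2) w0])
    have in\<Omega>: "AE x in M. x \<in> \<Omega>" by (rule AE_I2) simp
    have PG: "AE x in M. PD x \<bullet> b = (\<integral>y. Dker x y \<bullet> b \<partial>M)" by (rule P_gradient_AE) (use PD b in auto)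
    have uD: "integrable M (\<lambda>x. u x * (D x \<bullet> b))"
    proof (rule integrable_compact_support[OF ul _ K(1,2)])
      show "continuous_on UNIV (\<lambda>x. D x \<bullet> b)" by (intro continuous_intros D(3))
      show "D x \<bullet> b = 0" if "x \<notin> K" for x using gradient_zero_outside[OF D(1) K(1,3) that] by simp
    qed
    \<comment> \<open>Here the equation is inserted in the form u P = G + \<integral>k(x, y) u(y)
      dy, multiplied by the derivative of w = v / P. This replaces \<open>u\<close> by terms that
      can be integrated by parts.\<close>
    have "(\<integral>x. u x * (D x \<bullet> b) \<partial>M) = (\<integral>x. G x * (Dw x \<bullet> b) + (\<integral>y. ker x y * u y \<partial>M) * (Dw x \<bullet> b) + u x * z x \<partial>M)"
    proof (rule integral_cong_AE)
      show "AE x in M. u x * (D x \<bullet> b) = G x * (Dw x \<bullet> b) + (\<integral>y. ker x y * u y \<partial>M) * (Dw x \<bullet> b) + u x * z x"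
        using eq in\<Omega>
      proof eventually_elim
        case (elim x)
        have "G x = (\<integral>y. u x * ker x y - ker x y * u y \<partial>M)" using elim by (simp add: algebra_simps)
        also have "\<dots> = u x * P x - (\<integral>y. ker x y * u y \<partial>M)"
          using elim integrable_ker[of x] by (simp add: P_def)
        finally have "u x * P x = G x + (\<integral>y. ker x y * u y \<partial>M)" by simp
        then have "u x * P x * (Dw x \<bullet> b) = (G x + (\<integral>y. ker x y * u y \<partial>M)) * (Dw x \<bullet> b)" by simp
        then show ?case using elim by (simp add: z_def algebra_simps)
      qed
    qed (use uD Gi I(1) zi in auto)
    also have "\<dots> = - (\<integral>x. (g x \<bullet> b) * w x \<partial>M) - (\<integral>x. (\<integral>y. (Dker x y \<bullet> b) * u y \<partial>M) * w x \<partial>M) + (\<integral>x. u x * z x \<partial>M)"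
      using Gi I(1,3) zi Gw by simp
    also have "\<dots> = - (\<integral>x. (g x \<bullet> b) * w x + (\<integral>y. (Dker x y \<bullet> b) * u y \<partial>M) * w x - u x * z x \<partial>M)"
      using gi I(2) zi by simp
    \<comment> \<open>Since PD is the integral of the kernel gradient almost everywhere, the term
      with \<open>z\<close> subtracts u(x) under the integral and turns the last two terms into
      \<open>T u\<close>, paired with v / P.\<close>
    also have "(\<integral>x. (g x \<bullet> b) * w x + (\<integral>y. (Dker x y \<bullet> b) * u y \<partial>M) * w x - u x * z x \<partial>M) = (\<integral>x. ((1 / P x) *\<^sub>R (g x + T u x)) \<bullet> b * v x \<partial>M)"
    proof (rule integral_cong_AE)
      show "AE x in M. (g x \<bullet> b) * w x + (\<integral>y. (Dker x y \<bullet> b) * u y \<partial>M) * w x - u x * z x = ((1 / P x) *\<^sub>R (g x + T u x)) \<bullet> b * v x"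
        using PG L1_loc_Dker(3)[OF u nb] in\<Omega>
      proof eventually_elim
        case (elim x)
        have iD: "integrable M (\<lambda>y. Dker x y \<bullet> b)" using integrable_Dker[OF elim(3)] by simp
        have "T u x \<bullet> b = (\<integral>y. (Dker x y \<bullet> b) * u y - (Dker x y \<bullet> b) * u x \<partial>M)"
          unfolding T_inner[OF b] by (simp add: algebra_simps)
        also have "\<dots> = (\<integral>y. (Dker x y \<bullet> b) * u y \<partial>M) - (PD x \<bullet> b) * u x"
          using elim iD by simp
        finally have Tb: "T u x \<bullet> b = (\<integral>y. (Dker x y \<bullet> b) * u y \<partial>M) - (PD x \<bullet> b) * u x" .
        have "((1 / P x) *\<^sub>R (g x + T u x)) \<bullet> b * v x = w x * (g x \<bullet> b + T u x \<bullet> b)"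
          using elim(3) by (simp add: w_def inner_add_left)
        then show ?case unfolding Tb z[OF elim(3)] by (simp add: algebra_simps)
      qed
      show "(\<lambda>x. ((1 / P x) *\<^sub>R (g x + T u x)) \<bullet> b * v x) \<in> borel_measurable M"
        using integrable_compact_support[OF rl vc K] by simp
    qed (use gi I(2) zi in auto)
    finally show "(\<integral>x. u x * iter_partial [b] v x \<partial>M) = (- 1) ^ length [b] * (\<integral>x. ((1 / P x) *\<^sub>R (g x + T u x)) \<bullet> b * v x \<partial>M)"
      using D(2)[OF b] by (simp del: iter_partial.simps)
  qed
qed


section \<open>The gradient is bounded by the nonlocal energy\<close>

lemma nn_integral_S_increment:
  assumes u [measurable]: "u \<in> borel_measurable M"
  shows "(\<integral>\<^sup>+x. \<integral>\<^sup>+y. ennreal (S x y * (u x - u y)\<^sup>2) \<partial>M \<partial>M) = 2 * energy \<Omega> h 1 (\<beta> + 1) u"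
proof -
  have Em [measurable]: "(\<lambda>p. E (fst p) (snd p)) \<in> borel_measurable (M \<Otimes>\<^sub>M M)" "(\<lambda>p. E (snd p) (fst p)) \<in> borel_measurable (M \<Otimes>\<^sub>M M)"
    unfolding E_def by measurable
  have e: "energy \<Omega> h 1 (\<beta> + 1) u = (\<integral>\<^sup>+x. \<integral>\<^sup>+y. ennreal (E x y * (u x - u y)\<^sup>2) \<partial>M \<partial>M)"
  proof -
    have "\<beta> + 1 - real DIM('a) - 2 = \<beta> - real DIM('a) - 1" by simp
    then show ?thesis unfolding energy_def E_def by (intro nn_integral_cong) (simp only: mult_1 if_distrib[of "\<lambda>t. t * _"] mult_zero_left)
  qed
  have m1: "(\<lambda>(x, y). ennreal (E x y * (u x - u y)\<^sup>2)) \<in> borel_measurable (M \<Otimes>\<^sub>M M)"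
    and m2: "(\<lambda>(x, y). ennreal (E y x * (u x - u y)\<^sup>2)) \<in> borel_measurable (M \<Otimes>\<^sub>M M)"
    unfolding split_beta' by measurable
  have "(\<integral>\<^sup>+x. \<integral>\<^sup>+y. ennreal (S x y * (u x - u y)\<^sup>2) \<partial>M \<partial>M)
    = (\<integral>\<^sup>+x. \<integral>\<^sup>+y. ennreal (E x y * (u x - u y)\<^sup>2) + ennreal (E y x * (u x - u y)\<^sup>2) \<partial>M \<partial>M)"
    by (intro nn_integral_cong) (simp add: S_def distrib_right ennreal_plus E_nonneg)
  also have "\<dots> = (\<integral>\<^sup>+p. (case p of (x, y) \<Rightarrow> ennreal (E x y * (u x - u y)\<^sup>2)) + (case p of (x, y) \<Rightarrow> ennreal (E y x * (u x - u y)\<^sup>2)) \<partial>(M \<Otimes>\<^sub>M M))"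
    using m1 m2 by (subst nn_integral_fst[symmetric]) auto
  also have "\<dots> = (\<integral>\<^sup>+x. \<integral>\<^sup>+y. ennreal (E x y * (u x - u y)\<^sup>2) \<partial>M \<partial>M) + (\<integral>\<^sup>+x. \<integral>\<^sup>+y. ennreal (E y x * (u x - u y)\<^sup>2) \<partial>M \<partial>M)"
    using m1 m2 nn_integral_fst[OF m1] nn_integral_fst[OF m2] by (simp add: nn_integral_add)
  also have "(\<integral>\<^sup>+x. \<integral>\<^sup>+y. ennreal (E y x * (u x - u y)\<^sup>2) \<partial>M \<partial>M) = (\<integral>\<^sup>+y. \<integral>\<^sup>+x. ennreal (E y x * (u x - u y)\<^sup>2) \<partial>M \<partial>M)"
    using MM.Fubini'[OF m2] by simp
  also have "\<dots> = (\<integral>\<^sup>+x. \<integral>\<^sup>+y. ennreal (E x y * (u x - u y)\<^sup>2) \<partial>M \<partial>M)"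
    by (simp add: power2_commute)
  finally show ?thesis unfolding e by (simp add: mult_2)
qed

text \<open>The dimension comes from summing over the coordinates of \<open>T\<close>, the other
  factor from \<open>Dker_le_S\<close>.\<close>

definition "CD = real DIM('a) * (4 * (\<beta> + real DIM('a) + 3) * R0)"

text \<open>The kernel gradient is at most a constant times S / h. Cauchy-Schwarz with the weight S
  splits off its integral, at most CS h^(-2); together with the square of 1 / h this gives
  h^(-4).\<close>

lemma T_le:
  assumes u [measurable]: "u \<in> borel_measurable M" and x: "x \<in> \<Omega>"
  shows "ennreal ((norm (T u x))\<^sup>2) \<le> ennreal (CD\<^sup>2 * CS * h x powr (- 4)) * (\<integral>\<^sup>+y. ennreal (S x y * (u x - u y)\<^sup>2) \<partial>M)"
proof -
  note hx = h_pos[OF x]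
  define k where "k = 4 * (\<beta> + real DIM('a) + 3) * R0"
  have k: "0 \<le> k" using \<beta> R0 by (simp add: k_def)
  have CDk: "CD = real DIM('a) * k" by (simp only: CD_def k_def)
  have CD0: "0 \<le> CD" using k by (simp add: CDk)
  define J where "J = (\<integral>\<^sup>+y. ennreal (S x y * \<bar>u y - u x\<bar>) \<partial>M)"
  have comp: "ennreal \<bar>T u x \<bullet> b\<bar> \<le> ennreal (k / h x) * J" if b: "b \<in> Basis" for b
  proof -
    have "ennreal \<bar>T u x \<bullet> b\<bar> \<le> (\<integral>\<^sup>+y. ennreal (norm ((Dker x y \<bullet> b) * (u y - u x))) \<partial>M)"
    proof (cases "integrable M (\<lambda>y. (Dker x y \<bullet> b) * (u y - u x))")
      case True
      then show ?thesis unfolding T_inner[OF b] using integral_norm_bound_ennreal[OF True] by simp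
    next
      \<comment> \<open>An integral that does not exist is 0 by convention, so the bound is trivial
        in this case.\<close>
      case False
      then show ?thesis unfolding T_inner[OF b] by (simp add: not_integrable_integral_eq)
    qed
    also have "\<dots> \<le> (\<integral>\<^sup>+y. ennreal (k / h x) * ennreal (S x y * \<bar>u y - u x\<bar>) \<partial>M)"
    proof (rule nn_integral_mono)
      fix y assume "y \<in> space M"
      then have y: "y \<in> \<Omega>" by simp
      have "\<bar>Dker x y \<bullet> b\<bar> \<le> norm (Dker x y)" using Cauchy_Schwarz_ineq2[of "Dker x y" b] b by simp
      also have "\<dots> \<le> k * (S x y / h x)" using Dker_le_S[OF x y] by (simp add: k_def)
      finally have "\<bar>Dker x y \<bullet> b\<bar> * \<bar>u y - u x\<bar> \<le> k * (S x y / h x) * \<bar>u y - u x\<bar>" by (rule mult_right_mono) simp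
      then have "norm ((Dker x y \<bullet> b) * (u y - u x)) \<le> (k / h x) * (S x y * \<bar>u y - u x\<bar>)" by (simp add: abs_mult)
      then show "ennreal (norm ((Dker x y \<bullet> b) * (u y - u x))) \<le> ennreal (k / h x) * ennreal (S x y * \<bar>u y - u x\<bar>)"
        using k hx S_nonneg by (subst ennreal_mult[symmetric]) (auto intro: ennreal_leI)
    qed
    also have "\<dots> = ennreal (k / h x) * J" unfolding J_def by (rule nn_integral_cmult) measurable
    finally show ?thesis .
  qed
  have "ennreal (norm (T u x)) \<le> ennreal (\<Sum>b\<in>Basis. \<bar>T u x \<bullet> b\<bar>)" by (rule ennreal_leI[OF norm_le_l1])
  also have "\<dots> = (\<Sum>b\<in>Basis. ennreal \<bar>T u x \<bullet> b\<bar>)" by (simp add: sum_ennreal)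
  also have "\<dots> \<le> (\<Sum>b\<in>(Basis :: 'a set). ennreal (k / h x) * J)" by (rule sum_mono[OF comp])
  also have "\<dots> = ennreal (CD / h x) * J"
  proof -
    have "of_nat DIM('a) * ennreal (k / h x) = ennreal (CD / h x)"
      using k hx by (simp add: CDk ennreal_of_nat_eq_real_of_nat ennreal_mult'[symmetric])
    then show ?thesis by (simp add: mult.assoc[symmetric])
  qed
  finally have le: "ennreal (norm (T u x)) \<le> ennreal (CD / h x) * J" .
  have *: "ennreal (norm (T u x)) * ennreal (norm (T u x)) \<le> (ennreal (CD / h x) * J) * (ennreal (CD / h x) * J)"
    by (rule mult_mono[OF le le]) auto
  have "ennreal ((norm (T u x))\<^sup>2) \<le> ennreal ((CD / h x)\<^sup>2) * J\<^sup>2"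
  proof -
    have "ennreal ((CD / h x)\<^sup>2) = ennreal (CD / h x) * ennreal (CD / h x)"
      unfolding power2_eq_square by (rule ennreal_mult) (use CD0 hx in auto)
    moreover have "ennreal ((norm (T u x))\<^sup>2) = ennreal (norm (T u x)) * ennreal (norm (T u x))"
      unfolding power2_eq_square by (rule ennreal_mult) auto
    ultimately show "ennreal ((norm (T u x))\<^sup>2) \<le> ennreal ((CD / h x)\<^sup>2) * J\<^sup>2"
      using * by (simp only: power2_eq_square mult_ac)
  qed
  also have "J\<^sup>2 \<le> ennreal (CS * h x powr (- 2)) * (\<integral>\<^sup>+y. ennreal (S x y * (u x - u y)\<^sup>2) \<partial>M)"
  proof -
    let ?f = "\<lambda>y. ennreal (sqrt (S x y))" and ?g = "\<lambda>y. ennreal (sqrt (S x y) * \<bar>u y - u x\<bar>)"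
    have "J = (\<integral>\<^sup>+y. ?f y * ?g y \<partial>M)"
      unfolding J_def by (intro nn_integral_cong) (simp add: ennreal_mult[symmetric] S_nonneg mult.assoc[symmetric])
    then have "J\<^sup>2 \<le> (\<integral>\<^sup>+y. (?f y)\<^sup>2 \<partial>M) * (\<integral>\<^sup>+y. (?g y)\<^sup>2 \<partial>M)"
      using Cauchy_Schwarz_nn_integral[of ?f M ?g] by simp
    also have "(\<integral>\<^sup>+y. (?f y)\<^sup>2 \<partial>M) = (\<integral>\<^sup>+y. ennreal (S x y) \<partial>M)"
      by (intro nn_integral_cong) (simp add: ennreal_power S_nonneg)
    also have "(\<integral>\<^sup>+y. (?g y)\<^sup>2 \<partial>M) = (\<integral>\<^sup>+y. ennreal (S x y * (u x - u y)\<^sup>2) \<partial>M)"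
      by (intro nn_integral_cong) (simp add: ennreal_power S_nonneg power_mult_distrib power2_commute)
    also have "(\<integral>\<^sup>+y. ennreal (S x y) \<partial>M) * (\<integral>\<^sup>+y. ennreal (S x y * (u x - u y)\<^sup>2) \<partial>M) \<le> ennreal (CS * h x powr (- 2)) * (\<integral>\<^sup>+y. ennreal (S x y * (u x - u y)\<^sup>2) \<partial>M)"
      by (rule mult_right_mono[OF S_nn_integral[OF x]]) simp
    finally show ?thesis .
  qed
  then have "ennreal ((CD / h x)\<^sup>2) * J\<^sup>2 \<le> ennreal ((CD / h x)\<^sup>2) * (ennreal (CS * h x powr (- 2)) * (\<integral>\<^sup>+y. ennreal (S x y * (u x - u y)\<^sup>2) \<partial>M))"
    by (rule mult_left_mono) simp
  also have "\<dots> = ennreal ((CD / h x)\<^sup>2 * (CS * h x powr (- 2))) * (\<integral>\<^sup>+y. ennreal (S x y * (u x - u y)\<^sup>2) \<partial>M)"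
    using CS_pos by (simp add: ennreal_mult mult.assoc)
  also have "(CD / h x)\<^sup>2 * (CS * h x powr (- 2)) = CD\<^sup>2 * CS * h x powr (- 4)"
  proof -
    have "h x powr (- 4) = h x powr (- 2) * h x powr (- 2)" by (simp flip: powr_add)
    moreover have "h x powr (- 2) = 1 / (h x)\<^sup>2" using hx by (simp add: powr_minus powr_numeral divide_inverse)
    ultimately show ?thesis by (simp add: power_divide)
  qed
  finally show ?thesis .
qed

text \<open>The bound 1 / P \<le> h^2 / c contributes h^4 after squaring, which cancels the h^(-4)
  in the estimate of \<open>T\<close> and leaves h^2 on the gradient of G. The doubling of the
  coefficient from 2 to 4 is due to the two halves of S, which carry the same energy.\<close>

lemma gradient_bound:
  assumes u [measurable]: "u \<in> borel_measurable M" and c: "0 < c" and P: "\<And>x. x \<in> \<Omega> \<Longrightarrow> c * h x powr (- 2) \<le> P x"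
    and g [measurable]: "g \<in> borel_measurable M"
  shows "(\<integral>\<^sup>+x. ennreal ((norm ((1 / P x) *\<^sub>R (g x + T u x)))\<^sup>2) \<partial>M)
    \<le> ennreal (2 / c\<^sup>2) * (\<integral>\<^sup>+x. ennreal ((norm ((h x)\<^sup>2 *\<^sub>R g x))\<^sup>2) \<partial>M) + ennreal (4 / c\<^sup>2 * (CD\<^sup>2 * CS)) * energy \<Omega> h 1 (\<beta> + 1) u"
proof -
  define I where "I x = (\<integral>\<^sup>+y. ennreal (S x y * (u x - u y)\<^sup>2) \<partial>M)" for x
  have Im [measurable]: "I \<in> borel_measurable M"
  proof -
    have "(\<lambda>p. ennreal (S (fst p) (snd p) * (u (fst p) - u (snd p))\<^sup>2)) \<in> borel_measurable (M \<Otimes>\<^sub>M M)" by measurable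
    from borel_measurable_nn_integral_fst[OF this] show ?thesis by (simp add: I_def[abs_def])
  qed
  have "(\<integral>\<^sup>+x. ennreal ((norm ((1 / P x) *\<^sub>R (g x + T u x)))\<^sup>2) \<partial>M)
    \<le> (\<integral>\<^sup>+x. ennreal (2 / c\<^sup>2) * ennreal ((norm ((h x)\<^sup>2 *\<^sub>R g x))\<^sup>2) + ennreal (2 / c\<^sup>2 * (CD\<^sup>2 * CS)) * I x \<partial>M)"
  proof (rule nn_integral_mono)
    fix x assume "x \<in> space M"
    then have x: "x \<in> \<Omega>" by simp
    note hx = h_pos[OF x]
    have h2: "h x powr (- 2) = 1 / (h x)\<^sup>2" using hx by (simp add: powr_minus powr_numeral divide_inverse)
    have Pp: "0 < P x" using P[OF x] c hx by (smt (verit) mult_pos_pos powr_gt_zero)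
    have "1 / P x \<le> (h x)\<^sup>2 / c" using P[OF x] Pp c hx unfolding h2 by (simp add: field_simps)
    then have "norm ((1 / P x) *\<^sub>R (g x + T u x)) \<le> (h x)\<^sup>2 / c * (norm (g x) + norm (T u x))"
      using Pp c unfolding norm_scaleR by (intro mult_mono norm_triangle_ineq) auto
    then have "(norm ((1 / P x) *\<^sub>R (g x + T u x)))\<^sup>2 \<le> ((h x)\<^sup>2 / c * (norm (g x) + norm (T u x)))\<^sup>2" by (rule power_mono) simp
    also have "\<dots> = (h x) ^ 4 / c\<^sup>2 * (norm (g x) + norm (T u x))\<^sup>2" by (simp add: power_mult_distrib power_divide)
    also have "\<dots> \<le> (h x) ^ 4 / c\<^sup>2 * (2 * (norm (g x))\<^sup>2 + 2 * (norm (T u x))\<^sup>2)"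
    proof (rule mult_left_mono)
      show "(norm (g x) + norm (T u x))\<^sup>2 \<le> 2 * (norm (g x))\<^sup>2 + 2 * (norm (T u x))\<^sup>2"
        using zero_le_power2[of "norm (g x) - norm (T u x)"] by (simp add: power2_eq_square algebra_simps)
    qed simp
    also have "\<dots> = 2 / c\<^sup>2 * (norm ((h x)\<^sup>2 *\<^sub>R g x))\<^sup>2 + 2 / c\<^sup>2 * (h x) ^ 4 * (norm (T u x))\<^sup>2"
      by (simp add: power_mult_distrib algebra_simps)
    finally have "ennreal ((norm ((1 / P x) *\<^sub>R (g x + T u x)))\<^sup>2) \<le> ennreal (2 / c\<^sup>2 * (norm ((h x)\<^sup>2 *\<^sub>R g x))\<^sup>2 + 2 / c\<^sup>2 * (h x) ^ 4 * (norm (T u x))\<^sup>2)"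
      by (rule ennreal_leI)
    also have "\<dots> = ennreal (2 / c\<^sup>2) * ennreal ((norm ((h x)\<^sup>2 *\<^sub>R g x))\<^sup>2) + ennreal (2 / c\<^sup>2 * (h x) ^ 4) * ennreal ((norm (T u x))\<^sup>2)"
      using c hx by (subst ennreal_plus) (auto simp: ennreal_mult[symmetric])
    also have "\<dots> \<le> ennreal (2 / c\<^sup>2) * ennreal ((norm ((h x)\<^sup>2 *\<^sub>R g x))\<^sup>2) + ennreal (2 / c\<^sup>2 * (h x) ^ 4) * (ennreal (CD\<^sup>2 * CS * h x powr (- 4)) * I x)"
      unfolding I_def by (intro add_left_mono mult_left_mono T_le[OF u x]) simp
    also have "ennreal (2 / c\<^sup>2 * (h x) ^ 4) * (ennreal (CD\<^sup>2 * CS * h x powr (- 4)) * I x) = ennreal (2 / c\<^sup>2 * (CD\<^sup>2 * CS)) * I x"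
    proof -
      have "h x powr (- 4) = 1 / (h x) ^ 4" using hx by (simp add: powr_minus powr_numeral divide_inverse)
      then have e: "2 / c\<^sup>2 * (h x) ^ 4 * (CD\<^sup>2 * CS * h x powr (- 4)) = 2 / c\<^sup>2 * (CD\<^sup>2 * CS)" using hx by simp
      have "ennreal A * (ennreal B * I x) = ennreal (A * B) * I x" if "0 \<le> A" "0 \<le> B" for A B
        using that by (simp add: ennreal_mult mult.assoc)
      from this[of "2 / c\<^sup>2 * (h x) ^ 4" "CD\<^sup>2 * CS * h x powr (- 4)", unfolded e] show ?thesis
        using c hx CS_pos by simp
    qed
    finally show "ennreal ((norm ((1 / P x) *\<^sub>R (g x + T u x)))\<^sup>2) \<le> ennreal (2 / c\<^sup>2) * ennreal ((norm ((h x)\<^sup>2 *\<^sub>R g x))\<^sup>2) + ennreal (2 / c\<^sup>2 * (CD\<^sup>2 * CS)) * I x" .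
  qed
  also have "\<dots> = ennreal (2 / c\<^sup>2) * (\<integral>\<^sup>+x. ennreal ((norm ((h x)\<^sup>2 *\<^sub>R g x))\<^sup>2) \<partial>M) + ennreal (2 / c\<^sup>2 * (CD\<^sup>2 * CS)) * (\<integral>\<^sup>+x. I x \<partial>M)"
    by (simp add: nn_integral_add nn_integral_cmult)
  also have "(\<integral>\<^sup>+x. I x \<partial>M) = 2 * energy \<Omega> h 1 (\<beta> + 1) u" unfolding I_def by (rule nn_integral_S_increment[OF u])
  also have "ennreal (2 / c\<^sup>2 * (CD\<^sup>2 * CS)) * (2 * energy \<Omega> h 1 (\<beta> + 1) u) = ennreal (4 / c\<^sup>2 * (CD\<^sup>2 * CS)) * energy \<Omega> h 1 (\<beta> + 1) u"
  proof -
    have "ennreal (2 / c\<^sup>2 * (CD\<^sup>2 * CS)) * ennreal 2 = ennreal (4 / c\<^sup>2 * (CD\<^sup>2 * CS))"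
      using CS_pos by (subst ennreal_mult[symmetric]) auto
    then show ?thesis by (simp add: mult.assoc[symmetric])
  qed
  finally show ?thesis .
qed

end

section \<open>The horizon of the nonlocal space\<close>

text \<open>The last claim iterates the doubling condition about log2 \<kappa> times. Rounding that
  number up costs the single extra factor \<open>Cq\<close>.\<close>

lemma admissible_q_facts:
  assumes "admissible_q k cq Cq N q"
  shows "\<And>r. 0 < r \<Longrightarrow> 0 < q r \<and> q r \<le> r" "1 \<le> Cq" "\<And>r s. 0 \<le> s \<Longrightarrow> s \<le> r \<Longrightarrow> 0 \<le> q r - q s \<and> q r - q s \<le> r - s"
    "\<And>\<kappa> r. 1 \<le> \<kappa> \<Longrightarrow> 0 < r \<Longrightarrow> q (\<kappa> * r) \<le> Cq * \<kappa> powr log 2 Cq * q r"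
proof -
  have q: "2 \<le> k" "1 \<le> Cq" "\<And>r. 0 < r \<Longrightarrow> 0 < q r \<and> q r \<le> r" "\<And>r. 0 < r \<Longrightarrow> q (2 * r) \<le> Cq * q r"
    using assms unfolding admissible_q_def by blast+
  obtain D where D: "Ck_halfline k q D" "\<And>r. 0 \<le> r \<Longrightarrow> 0 \<le> D 1 r \<and> D 1 r \<le> 1"
    using assms unfolding admissible_q_def by blast
  show "\<And>r. 0 < r \<Longrightarrow> 0 < q r \<and> q r \<le> r" "1 \<le> Cq" by (fact q)+
  have "enat 0 < k" using q(1) by (cases k) (auto simp: numeral_eq_enat)
  then have der: "(D 0 has_real_derivative D 1 r) (at r within {0..})" if "0 \<le> r" for r
    using D(1) that unfolding Ck_halfline_def by auto
  have D0: "D 0 r = q r" if "0 \<le> r" for r using D(1) that unfolding Ck_halfline_def by auto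
  show inc: "0 \<le> q r - q s \<and> q r - q s \<le> r - s" if rs: "0 \<le> s" "s \<le> r" for r s
  proof -
    \<comment> \<open>Subtracting r / 2 centres the derivative in the interval from -1/2 to 1/2, so
      that one mean value estimate gives both inequalities.\<close>
    have "norm ((D 0 r - r / 2) - (D 0 s - s / 2)) \<le> 1 / 2 * norm (r - s)"
    proof (rule field_differentiable_bound[where S="{0..}" and f="\<lambda>r. D 0 r - r / 2" and f'="\<lambda>r. D 1 r - 1 / 2"])
      fix z :: real assume z: "z \<in> {0..}"
      show "((\<lambda>r. D 0 r - r / 2) has_real_derivative D 1 z - 1 / 2) (at z within {0..})"
        using der[of z] z by (auto intro!: derivative_eq_intros)
      have "0 \<le> D 1 z \<and> D 1 z \<le> 1" using D(2)[of z] z by simp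
      then show "norm (D 1 z - 1 / 2) \<le> 1 / 2" unfolding real_norm_def by linarith
    qed (use rs in auto)
    then have "\<bar>(q r - r / 2) - (q s - s / 2)\<bar> \<le> (r - s) / 2" using rs by (simp add: D0)
    then show ?thesis unfolding abs_le_iff by (simp add: field_simps)
  qed
  have pow: "q (2 ^ n * r) \<le> Cq ^ n * q r" if "0 < r" for n r
  proof (induction n)
    case (Suc n)
    have "q (2 ^ Suc n * r) \<le> Cq * q (2 ^ n * r)" using q(4)[of "2 ^ n * r"] that by (simp add: mult.assoc)
    also have "\<dots> \<le> Cq * (Cq ^ n * q r)" using Suc q(2) by (intro mult_left_mono) auto
    finally show ?case by (simp add: mult.assoc)
  qed simp
  show "q (\<kappa> * r) \<le> Cq * \<kappa> powr log 2 Cq * q r" if \<kappa>: "1 \<le> \<kappa>" and r: "0 < r" for \<kappa> r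
  proof -
    define n where "n = nat \<lceil>log 2 \<kappa>\<rceil>"
    have l0: "0 \<le> log 2 \<kappa>" using \<kappa> by simp
    have n: "log 2 \<kappa> \<le> real n" "real n \<le> log 2 \<kappa> + 1"
    proof -
      have "real n = of_int \<lceil>log 2 \<kappa>\<rceil>" using l0 by (simp add: n_def)
      then show "log 2 \<kappa> \<le> real n" "real n \<le> log 2 \<kappa> + 1" using ceiling_correct[of "log 2 \<kappa>"] by linarith+
    qed
    have "\<kappa> = 2 powr log 2 \<kappa>" using \<kappa> by simp
    also have "\<dots> \<le> 2 powr real n" using n by simp
    finally have "\<kappa> \<le> 2 ^ n" by (simp add: powr_realpow)
    then have "\<kappa> * r \<le> 2 ^ n * r" using r by simp
    then have "q (\<kappa> * r) \<le> q (2 ^ n * r)" using inc[of "\<kappa> * r" "2 ^ n * r"] \<kappa> r by simp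
    also have "\<dots> \<le> Cq ^ n * q r" by (rule pow[OF r])
    also have "\<dots> \<le> (Cq * \<kappa> powr log 2 Cq) * q r"
    proof (rule mult_right_mono)
      have "Cq ^ n = Cq powr real n" using q(2) by (simp add: powr_realpow)
      also have "\<dots> \<le> Cq powr (log 2 \<kappa> + 1)" using n q(2) by (intro powr_mono) auto
      also have "\<dots> = Cq * Cq powr log 2 \<kappa>" using q(2) by (simp add: powr_add)
      \<comment> \<open>Both powers are 2 to the product of the two logarithms.\<close>
      also have "Cq powr log 2 \<kappa> = \<kappa> powr log 2 Cq" using q(2) \<kappa> by (simp add: powr_def log_def)
      finally show "Cq ^ n \<le> Cq * \<kappa> powr log 2 Cq" .
    qed (use q(3)[OF r] in simp)
    finally show ?thesis .
  qed
qed

lemma infdist_frontier_facts: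
  fixes \<Omega> :: "'a::euclidean_space set"
  assumes \<Omega>: "open \<Omega>" "bounded \<Omega>" and x: "x \<in> \<Omega>"
  shows "0 < infdist x (frontier \<Omega>)" "ball x (infdist x (frontier \<Omega>)) \<subseteq> \<Omega>"
proof -
  \<comment> \<open>The distance to the empty set is 0 by convention, so positivity requires a
    nonempty frontier; boundedness of \<Omega> provides it.\<close>
  have ne: "frontier \<Omega> \<noteq> {}" using x \<Omega>(2) frontier_eq_empty[of \<Omega>] not_bounded_UNIV by auto
  have "x \<notin> frontier \<Omega>" using x \<Omega>(1) by (simp add: frontier_def interior_open)
  then show "0 < infdist x (frontier \<Omega>)" by (intro infdist_pos_not_in_closed[OF frontier_closed ne])
  show "ball x (infdist x (frontier \<Omega>)) \<subseteq> \<Omega>"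
  proof (rule ccontr)
    assume "\<not> ?thesis"
    then have "ball x (infdist x (frontier \<Omega>)) - \<Omega> \<noteq> {}" by blast
    moreover have "ball x (infdist x (frontier \<Omega>)) \<inter> \<Omega> \<noteq> {}" using x \<open>0 < infdist x (frontier \<Omega>)\<close> by (metis IntI centre_in_ball empty_iff)
    ultimately have "ball x (infdist x (frontier \<Omega>)) \<inter> frontier \<Omega> \<noteq> {}"
      by (intro connected_Int_frontier[OF connected_ball])
    then obtain z where "z \<in> frontier \<Omega>" "dist x z < infdist x (frontier \<Omega>)" by auto
    then show False using infdist_le[of z "frontier \<Omega>" x] by simp
  qed
qed

text \<open>Besides bounds for the profile and its derivative, this extracts an interval around r0,
  inside the positive unit interval, on which the profile is bounded below. Containment in (0, 1) is
  what lets the lower bound of P use points off \<open>x\<close> and inside the horizon.\<close>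

lemma rho_facts:
  assumes "admissible_rho TYPE('a::euclidean_space) \<beta> \<rho>"
  obtains \<rho>' R0 \<epsilon> r0 m where "\<And>r. 0 \<le> \<rho> r" "\<And>r. 1 \<le> r \<Longrightarrow> \<rho> r = 0" "\<And>r. 1 \<le> r \<Longrightarrow> \<rho>' r = 0"
    "\<And>r. (\<rho> has_real_derivative \<rho>' r) (at r)" "continuous_on UNIV \<rho>'" "\<And>r. \<rho> r \<le> R0" "\<And>r. \<bar>\<rho>' r\<bar> \<le> R0"
    "0 < \<epsilon>" "\<epsilon> \<le> r0" "r0 + \<epsilon> \<le> 1" "0 < m" "\<And>r. \<bar>r - r0\<bar> < \<epsilon> \<Longrightarrow> m \<le> \<rho> r"
proof -
  let ?S = "closure {r. \<rho> r \<noteq> 0}"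
  have \<rho>: "\<And>r. 0 \<le> \<rho> r" "\<rho> C1_differentiable_on UNIV" "?S \<subseteq> {-1<..<1}"
    using assms unfolding admissible_rho_def by auto
  obtain c where c: "c > 0" "{-c..c} \<subseteq> ?S" using assms unfolding admissible_rho_def by blast
  obtain \<rho>' where d: "\<And>r. (\<rho> has_vector_derivative \<rho>' r) (at r)" "continuous_on UNIV \<rho>'"
    using \<rho>(2) unfolding C1_differentiable_on_def by auto
  have der: "(\<rho> has_real_derivative \<rho>' r) (at r)" for r using d(1) by (simp add: has_real_derivative_iff_has_vector_derivative)
  have z: "\<rho> r = 0" "\<rho>' r = 0" if "r \<notin> ?S" for r
  proof -
    show "\<rho> r = 0" using that closure_subset[of "{r. \<rho> r \<noteq> 0}"] by auto
    have "(\<rho> has_real_derivative 0) (at r)"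
      by (rule has_field_derivative_transform_within_open[where f="\<lambda>x. 0" and S="- ?S"])
        (use that closure_subset[of "{r. \<rho> r \<noteq> 0}"] in \<open>auto simp: subset_iff\<close>)
    then show "\<rho>' r = 0" using DERIV_unique der by blast
  qed
  have cont: "continuous_on UNIV \<rho>" using der by (meson DERIV_isCont continuous_at_imp_continuous_on)
  have comp: "compact ?S" using \<rho>(3) 
    using bounded_subset[OF bounded_box[of "-1::real" 1]] by (auto simp: compact_eq_bounded_closed)
  obtain A where A: "0 \<le> A" "\<And>r. norm (\<rho> r) \<le> A" using continuous_compact_support(1)[OF cont comp z(1)] by blast
  obtain B where B: "0 \<le> B" "\<And>r. norm (\<rho>' r) \<le> B" using continuous_compact_support(1)[OF d(2) comp z(2)] by blast
  \<comment> \<open>The support is a closure, so the profile may vanish at c / 2 itself. Some nearby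
    point has a nonzero value, and the distance c / 4 keeps it positive.\<close>
  have "c / 2 \<in> ?S" using c by auto
  then obtain r0 where r0: "\<rho> r0 \<noteq> 0" "dist r0 (c / 2) < c / 4"
    using c(1) unfolding closure_approachable by (metis (mono_tags, lifting) mem_Collect_eq divide_pos_pos zero_less_numeral)
  have r0p: "0 < r0" using r0(2) c(1) unfolding dist_real_def by linarith
  have r01: "r0 < 1" using r0(1) \<rho>(3) closure_subset[of "{r. \<rho> r \<noteq> 0}"] by auto
  have pos: "0 < \<rho> r0" using r0(1) \<rho>(1)[of r0] by simp
  obtain e where e: "e > 0" "\<And>r. dist r r0 < e \<Longrightarrow> dist (\<rho> r) (\<rho> r0) < \<rho> r0 / 2"
    using cont pos unfolding continuous_on_iff by (metis UNIV_I half_gt_zero)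
  show thesis
  proof (rule that[of \<rho>' "max A B" "min e (min r0 (1 - r0))" r0 "\<rho> r0 / 2"])
    show "\<rho> r \<le> max A B" for r using A(2)[of r] by simp
    show "\<bar>\<rho>' r\<bar> \<le> max A B" for r using B(2)[of r] by simp
    show "\<rho> r = 0" "\<rho>' r = 0" if "1 \<le> r" for r using z[of r] \<rho>(3) that by fastforce+
    show "\<rho> r0 / 2 \<le> \<rho> r" if "\<bar>r - r0\<bar> < min e (min r0 (1 - r0))" for r
    proof -
      have "dist r r0 < e" using that by (simp add: dist_real_def)
      then have "\<bar>\<rho> r - \<rho> r0\<bar> < \<rho> r0 / 2" using e(2)[of r] by (simp add: dist_real_def)
      then show ?thesis by linarith
    qed
  qed (use \<rho>(1) der d(2) e(1) r0p r01 pos in auto)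
qed

section \<open>Norms and uniqueness of weak gradients\<close>

lemma ennsqrt_mono_sum:
  assumes "A \<le> ennreal c * (X + Y)" "0 < c"
  shows "ennsqrt A \<le> ennreal (sqrt c) * (ennsqrt X + ennsqrt Y)"
proof (cases "X = \<infinity> \<or> Y = \<infinity>")
  case True
  then have "ennsqrt X + ennsqrt Y = \<infinity>" by (auto simp: ennsqrt_def)
  then show ?thesis unfolding \<open>ennsqrt X + ennsqrt Y = \<infinity>\<close> using assms(2) by (simp add: ennreal_mult_top)
next
  case False
  then obtain x y where xy: "X = ennreal x" "Y = ennreal y" "0 \<le> x" "0 \<le> y"
    by (cases X; cases Y) auto
  have "A \<le> ennreal (c * (x + y))" using assms xy by (simp add: ennreal_plus[symmetric] ennreal_mult'[symmetric] del: ennreal_plus)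
  then obtain a where a: "A = ennreal a" "0 \<le> a" "a \<le> c * (x + y)"
    using assms(2) xy by (cases A) (auto simp: top_unique)
  have "sqrt a \<le> sqrt (c * (x + y))" using a by simp
  also have "\<dots> = sqrt c * sqrt (x + y)" by (rule real_sqrt_mult)
  also have "\<dots> \<le> sqrt c * (sqrt x + sqrt y)" using xy assms(2) by (intro mult_left_mono sqrt_add_le_add_sqrt) auto
  finally have "ennreal (sqrt a) \<le> ennreal (sqrt c * (sqrt x + sqrt y))" by (rule ennreal_leI)
  also have "\<dots> = ennreal (sqrt c) * (ennreal (sqrt x) + ennreal (sqrt y))"
    using xy assms(2) by (simp add: ennreal_mult ennreal_plus)
  finally show ?thesis using a xy by (simp add: ennsqrt_def)
qed

lemma L1_loc_measurable:
  fixes f :: "'a::euclidean_space \<Rightarrow> real"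
  assumes \<Omega>: "open \<Omega>" and f: "L1_loc \<Omega> f"
  shows "f \<in> borel_measurable (lebesgue_on \<Omega>)"
proof -
  obtain \<D> where D: "countable \<D>" "\<D> \<subseteq> Pow \<Omega>" "\<And>X. X \<in> \<D> \<Longrightarrow> \<exists>a b. X = cbox a b" "\<Union>\<D> = \<Omega>"
    using open_countable_Union_open_cbox[OF \<Omega>] by blast
  show ?thesis
  proof (rule measurable_piecewise_restrict[OF D(1)])
    fix X assume X: "X \<in> \<D>"
    then obtain a b where ab: "X = cbox a b" using D(3) by blast
    have sub: "X \<subseteq> \<Omega>" using X D(2) by auto
    then have "X \<inter> space (lebesgue_on \<Omega>) = X" by auto
    then show "X \<inter> space (lebesgue_on \<Omega>) \<in> sets (lebesgue_on \<Omega>)"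
      using \<Omega> ab sub by (auto simp: sets_restrict_space_iff)
    have "restrict_space (lebesgue_on \<Omega>) X = lebesgue_on X"
      using \<Omega> ab sub by (subst restrict_restrict_space) (auto simp: Int_absorb1)
    then show "f \<in> borel_measurable (restrict_space (lebesgue_on \<Omega>) X)"
      using f sub ab by (auto simp: L1_loc_def intro: borel_measurable_integrable)
  qed (use D(4) in simp)
qed

lemma weak_grad_measurable:
  assumes "open \<Omega>" "is_weak_grad \<Omega> f g"
  shows "g \<in> borel_measurable (lebesgue_on (\<Omega> :: 'a::euclidean_space set))"
proof -
  have "(\<lambda>x. \<Sum>b\<in>Basis. (g x \<bullet> b) *\<^sub>R b) \<in> borel_measurable (lebesgue_on \<Omega>)"
    by (intro borel_measurable_sum borel_measurable_scaleR borel_measurable_const L1_loc_measurable[OF assms(1)])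
      (use assms(2) in \<open>auto simp: is_weak_grad_def weak_partial_def\<close>)
  then show ?thesis by (simp add: euclidean_representation)
qed

lemma weak_grad_unique:
  fixes \<Omega> :: "'a::euclidean_space set"
  assumes \<Omega>: "open \<Omega>" and g: "is_weak_grad \<Omega> f g" "is_weak_grad \<Omega> f g'"
  shows "AE x in lebesgue_on \<Omega>. g x = g' x"
proof -
  have \<Omega>m: "\<Omega> \<in> sets lebesgue" using \<Omega> by simp
  have "AE x in lebesgue_on \<Omega>. \<forall>b\<in>Basis. g x \<bullet> b - g' x \<bullet> b = 0"
  proof (subst AE_ball_countable, simp add: countable_finite, rule ballI)
    fix b :: 'a assume b: "b \<in> Basis"
    have 1: "weak_partial \<Omega> [b] f (\<lambda>x. g x \<bullet> b)" "weak_partial \<Omega> [b] f (\<lambda>x. g' x \<bullet> b)" using g b by (auto simp: is_weak_grad_def)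
    have L: "L1_loc \<Omega> (\<lambda>x. g x \<bullet> b)" "L1_loc \<Omega> (\<lambda>x. g' x \<bullet> b)" using 1 by (auto simp: weak_partial_def)
    show "AE x in lebesgue_on \<Omega>. g x \<bullet> b - g' x \<bullet> b = 0"
    proof (rule fundamental_lemma[OF \<Omega>])
      show "L1_loc \<Omega> (\<lambda>x. g x \<bullet> b - g' x \<bullet> b)" using L by (auto simp: L1_loc_def)
      fix v assume v: "test_fun \<Omega> v"
      have vU: "test_fun UNIV v" using v by (auto simp: test_fun_def)
      have vm: "v \<in> borel_measurable borel"
        using test_fun_bounded_derivatives(1)[OF vU, of "[]"] by (intro borel_measurable_continuous_onI) simp
      obtain B where B: "\<And>x. \<bar>v x\<bar> \<le> B" using test_fun_bounded_derivatives(3)[OF vU, of "[]"] by auto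
      have K: "compact (closure {x. v x \<noteq> 0})" "closure {x. v x \<noteq> 0} \<subseteq> \<Omega>" using v by (auto simp: test_fun_def)
      have v0: "v x = 0" if "x \<notin> closure {x. v x \<noteq> 0}" for x using that closure_subset[of "{x. v x \<noteq> 0}"] by auto
      have i: "integrable (lebesgue_on \<Omega>) (\<lambda>x. (g x \<bullet> b) * v x)" "integrable (lebesgue_on \<Omega>) (\<lambda>x. (g' x \<bullet> b) * v x)"
        by (rule L1_loc_integrable_mult[OF L(1) \<Omega>m K vm B v0], assumption, rule L1_loc_integrable_mult[OF L(2) \<Omega>m K vm B v0])
      have "(\<integral>x. (g x \<bullet> b) * v x \<partial>lebesgue_on \<Omega>) = (\<integral>x. (g' x \<bullet> b) * v x \<partial>lebesgue_on \<Omega>)"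
        using 1 v by (simp add: weak_partial_def del: iter_partial.simps)
      then show "(\<integral>x. (g x \<bullet> b - g' x \<bullet> b) * v x \<partial>lebesgue_on \<Omega>) = 0" using i by (simp add: left_diff_distrib)
    qed
  qed
  then show ?thesis by eventually_elim (auto intro: euclidean_eqI)
qed

text \<open>\<open>weak_grad\<close> is an arbitrary choice among the weak gradients; uniqueness
  almost everywhere allows the explicit one to be used in the norm.\<close>

lemma L2_norm_grad_eq:
  fixes \<Omega> :: "'a::euclidean_space set"
  assumes \<Omega>: "open \<Omega>" and g: "is_weak_grad \<Omega> f g"
  shows "L2_norm_grad \<Omega> w f = L2_norm \<Omega> (\<lambda>x. w x *\<^sub>R g x)"
proof -
  have wg: "is_weak_grad \<Omega> f (weak_grad \<Omega> f)" unfolding weak_grad_def by (rule someI[of _ g]) (rule g)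
  have "L2_norm \<Omega> (\<lambda>x. w x *\<^sub>R weak_grad \<Omega> f x) = L2_norm \<Omega> (\<lambda>x. w x *\<^sub>R g x)"
    unfolding L2_norm_def using weak_grad_unique[OF \<Omega> wg g]
    by (intro arg_cong[where f=ennsqrt] nn_integral_cong_AE) (auto elim: eventually_mono)
  then show ?thesis using g by (auto simp: L2_norm_grad_def)
qed

lemma Cbar_pos: "0 < d \<Longrightarrow> 0 < Cbar d"
  by (simp add: Cbar_def Gamma_real_pos)

lemma q_lam_constant_ge_1:
  assumes q: "admissible_q kq cq Cq N q" and lam: "generalized_distance \<Omega> kl \<kappa>0 \<kappa>1 lam"
  shows "1 \<le> Cq * \<kappa>0 powr log 2 Cq"
proof -
  have "1 \<le> Cq" "1 \<le> \<kappa>0" using admissible_q_facts(2)[OF q] lam by (auto simp: generalized_distance_def)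
  then have "1 \<le> \<kappa>0 powr log 2 Cq" by (intro ge_one_powr_ge_zero) auto
  then show ?thesis using \<open>1 \<le> Cq\<close> mult_mono[of 1 Cq 1 "\<kappa>0 powr log 2 Cq"] by simp
qed

text \<open>\<lambda> and the distance are comparable with factor \<kappa>0, and iterated doubling
  transfers this through \<open>q\<close>. The resulting constant K is the last entry of the maximum
  in \<open>delta0\<close>.\<close>

lemma q_lam_comparison:
  fixes \<Omega> :: "'a::euclidean_space set"
  assumes q: "admissible_q kq cq Cq N q" and lam: "generalized_distance \<Omega> kl \<kappa>0 \<kappa>1 lam"
    and \<Omega>: "open \<Omega>" "bounded \<Omega>" and x: "x \<in> \<Omega>"
  defines "K \<equiv> Cq * \<kappa>0 powr log 2 Cq"
  shows "0 < lam x" "q (lam x) \<le> K * q (infdist x (frontier \<Omega>))" "q (infdist x (frontier \<Omega>)) \<le> K * q (lam x)"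
proof -
  define d where "d = infdist x (frontier \<Omega>)"
  have d: "0 < d" unfolding d_def by (rule infdist_frontier_facts(1)[OF \<Omega> x])
  have \<kappa>: "1 \<le> \<kappa>0" using lam by (simp add: generalized_distance_def)
  have xc: "x \<in> closure \<Omega>" using x closure_subset by blast
  have l: "d / \<kappa>0 \<le> lam x" "lam x \<le> \<kappa>0 * d" using lam xc unfolding generalized_distance_def d_def by blast+
  show l0: "0 < lam x" using l(1) d \<kappa> by (meson divide_pos_pos less_le_trans zero_less_one)
  have l1: "d \<le> \<kappa>0 * lam x" using l(1) \<kappa> by (simp add: field_simps)
  note qf = admissible_q_facts[OF q]
  have "q (lam x) \<le> q (\<kappa>0 * d)" using qf(3)[of "lam x" "\<kappa>0 * d"] l l0 by simp
  also have "\<dots> \<le> K * q d" unfolding K_def by (rule qf(4)[OF \<kappa> d])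
  finally show "q (lam x) \<le> K * q (infdist x (frontier \<Omega>))" by (simp add: d_def)
  have "q d \<le> q (\<kappa>0 * lam x)" using qf(3)[of d "\<kappa>0 * lam x"] l1 d by simp
  also have "\<dots> \<le> K * q (lam x)" unfolding K_def by (rule qf(4)[OF \<kappa> l0])
  finally show "q (infdist x (frontier \<Omega>)) \<le> K * q (lam x)" by (simp add: d_def)
qed

section \<open>Passage between the two horizons\<close>

context horizon
begin

lemma nn_integral2_cmult_le:
  assumes g: "(\<lambda>p. g (fst p) (snd p)) \<in> borel_measurable (M \<Otimes>\<^sub>M M)" and c: "0 \<le> c"
    and le: "\<And>x y. x \<in> \<Omega> \<Longrightarrow> y \<in> \<Omega> \<Longrightarrow> f x y \<le> c * g x y"
  shows "(\<integral>\<^sup>+x. (\<integral>\<^sup>+y. ennreal (f x y) \<partial>M) \<partial>M) \<le> ennreal c * (\<integral>\<^sup>+x. (\<integral>\<^sup>+y. ennreal (g x y) \<partial>M) \<partial>M)"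
proof -
  have gm: "(\<lambda>p. ennreal (g (fst p) (snd p))) \<in> borel_measurable (M \<Otimes>\<^sub>M M)" using g by measurable
  have inner: "(\<integral>\<^sup>+y. ennreal (f x y) \<partial>M) \<le> ennreal c * (\<integral>\<^sup>+y. ennreal (g x y) \<partial>M)" if x: "x \<in> \<Omega>" for x
  proof -
    have "(\<integral>\<^sup>+y. ennreal (f x y) \<partial>M) \<le> (\<integral>\<^sup>+y. ennreal c * ennreal (g x y) \<partial>M)"
      using le[OF x] c by (intro nn_integral_mono) (auto simp: ennreal_mult'[symmetric] intro!: ennreal_leI)
    also have "\<dots> = ennreal c * (\<integral>\<^sup>+y. ennreal (g x y) \<partial>M)"
    proof (rule nn_integral_cmult)
      have "(\<lambda>y. (x, y)) \<in> measurable M (M \<Otimes>\<^sub>M M)" using x by simp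
      from measurable_compose[OF this gm] show "(\<lambda>y. ennreal (g x y)) \<in> borel_measurable M" by simp
    qed
    finally show ?thesis .
  qed
  have "(\<integral>\<^sup>+x. (\<integral>\<^sup>+y. ennreal (f x y) \<partial>M) \<partial>M) \<le> (\<integral>\<^sup>+x. ennreal c * (\<integral>\<^sup>+y. ennreal (g x y) \<partial>M) \<partial>M)"
    using inner by (intro nn_integral_mono) auto
  also have "\<dots> = ennreal c * (\<integral>\<^sup>+x. (\<integral>\<^sup>+y. ennreal (g x y) \<partial>M) \<partial>M)"
    using borel_measurable_nn_integral_fst[OF gm] by (intro nn_integral_cmult) simp
  finally show ?thesis .
qed

lemma energy_change_horizon:
  assumes u [measurable]: "u \<in> borel_measurable M" and \<gamma>: "\<gamma> \<le> real DIM('a) + 2" and K: "1 \<le> K"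
    and \<eta>: "\<And>x. x \<in> \<Omega> \<Longrightarrow> 0 < \<eta> x \<and> h x \<le> K * \<eta> x \<and> \<eta> x \<le> s * h x"
  shows "energy \<Omega> \<eta> 1 \<gamma> u \<le> ennreal (K powr (real DIM('a) + 2 - \<gamma>)) * energy \<Omega> h s \<gamma> u"
  unfolding energy_def
proof (rule nn_integral2_cmult_le)
  show "(\<lambda>p. if norm (fst p - snd p) < s * h (fst p) then h (fst p) powr (\<gamma> - real DIM('a) - 2) * norm (fst p - snd p) powr (- \<gamma>) *
      (u (fst p) - u (snd p))\<^sup>2 else 0) \<in> borel_measurable (M \<Otimes>\<^sub>M M)" by measurable
  fix x y assume x: "x \<in> \<Omega>" and "y \<in> \<Omega>"
  let ?e = "\<gamma> - real DIM('a) - 2"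
  have e: "\<eta> x powr ?e \<le> K powr (real DIM('a) + 2 - \<gamma>) * h x powr ?e"
  proof -
    have "\<eta> x powr ?e \<le> (h x / K) powr ?e"
      using \<eta>[OF x] h_pos[OF x] K \<gamma> by (intro powr_mono2') (auto simp: field_simps)
    also have "\<dots> = h x powr ?e * K powr (- ?e)" 
      using powr_divide[of "h x" K ?e] powr_minus_divide[of K ?e] h_pos[OF x] K by simp
    also have "- ?e = real DIM('a) + 2 - \<gamma>" by simp
    finally show ?thesis by (simp add: mult.commute)
  qed
  have "\<eta> x powr ?e * (norm (x - y) powr - \<gamma> * (u x - u y)\<^sup>2) \<le> (K powr (real DIM('a) + 2 - \<gamma>) * h x powr ?e) * (norm (x - y) powr - \<gamma> * (u x - u y)\<^sup>2)"
    by (rule mult_right_mono[OF e]) simp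
  then show "(if norm (x - y) < 1 * \<eta> x then \<eta> x powr ?e * norm (x - y) powr - \<gamma> * (u x - u y)\<^sup>2 else 0)
    \<le> K powr (real DIM('a) + 2 - \<gamma>) * (if norm (x - y) < s * h x then h x powr ?e * norm (x - y) powr - \<gamma> * (u x - u y)\<^sup>2 else 0)"
    using \<eta>[OF x] by (auto simp: mult_ac)
qed simp

text \<open>Within the horizon |x - y|^\<beta> is at most h(x)^\<beta>, so the weight of the
  seminorm dominates the one without singularity. The constant \<open>c\<close> is the normalisation
  of the seminorm.\<close>

lemma energy_le_seminorm:
  assumes u [measurable]: "u \<in> borel_measurable M" and \<beta>: "0 \<le> \<beta>" and c: "0 < c"
  shows "energy \<Omega> h 1 0 u \<le> ennreal (1 / c) * (\<integral>\<^sup>+x. (\<integral>\<^sup>+y. ennreal (if norm (y - x) < h x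
      then c * \<bar>u x - u y\<bar>\<^sup>2 / (norm (x - y) powr \<beta> * h x powr (real DIM('a) + 2 - \<beta>)) else 0) \<partial>M) \<partial>M)"
  unfolding energy_def
proof (rule nn_integral2_cmult_le)
  show "(\<lambda>p. if norm (snd p - fst p) < h (fst p) then c * \<bar>u (fst p) - u (snd p)\<bar>\<^sup>2 /
      (norm (fst p - snd p) powr \<beta> * h (fst p) powr (real DIM('a) + 2 - \<beta>)) else 0) \<in> borel_measurable (M \<Otimes>\<^sub>M M)" by measurable
  fix x y assume x: "x \<in> \<Omega>" and "y \<in> \<Omega>"
  let ?D = "real DIM('a)" and ?n = "norm (x - y)"
  note hx = h_pos[OF x]
  show "(if ?n < 1 * h x then h x powr (0 - ?D - 2) * ?n powr - 0 * (u x - u y)\<^sup>2 else 0)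
    \<le> 1 / c * (if norm (y - x) < h x then c * \<bar>u x - u y\<bar>\<^sup>2 / (?n powr \<beta> * h x powr (?D + 2 - \<beta>)) else 0)"
  proof (cases "?n < h x \<and> x \<noteq> y")
    case True
    then have n: "0 < ?n" "?n < h x" by auto
    have "?n powr \<beta> * h x powr (?D + 2 - \<beta>) \<le> h x powr \<beta> * h x powr (?D + 2 - \<beta>)"
      using n \<beta> by (intro mult_right_mono powr_mono2) auto
    also have "\<dots> = h x powr (?D + 2)" by (simp flip: powr_add)
    finally have "1 / h x powr (?D + 2) \<le> 1 / (?n powr \<beta> * h x powr (?D + 2 - \<beta>))"
      using n hx by (intro divide_left_mono mult_pos_pos) auto
    then have "1 / h x powr (?D + 2) * (u x - u y)\<^sup>2 \<le> 1 / (?n powr \<beta> * h x powr (?D + 2 - \<beta>)) * (u x - u y)\<^sup>2"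
      by (rule mult_right_mono) simp
    moreover have "h x powr (0 - ?D - 2) = 1 / h x powr (?D + 2)"
      using powr_minus_divide[of "h x" "?D + 2"] by (simp add: algebra_simps)
    ultimately show ?thesis using n c by (simp add: norm_minus_commute)
  next
    case False
    then show ?thesis using hx by (auto simp: norm_minus_commute)
  qed
qed (use c in simp)

end

text \<open>\<open>X\<close> stands for the squared seminorm and \<open>B\<close> for the cost of
  the change of horizon. The final constant is displayed through \<open>c\<close>,
  \<open>CD\<close>, \<open>CS\<close> and \<open>B\<close>, so that its independence of \<delta>, u
  and G can be read off when it is fixed in advance.\<close>

lemma (in nonlocal_kernel) regularity:
  assumes u: "L2_on \<Omega> u" and G: "W12_loc \<Omega> G"
    and eq: "\<forall>v. test_fun \<Omega> v \<longrightarrow> nl_form \<beta> \<rho> \<Omega> h u v = (\<integral>x. G x * v x \<partial>M)"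
    and c: "0 < c" "\<forall>x\<in>\<Omega>. c * h x powr (- 2) \<le> P x"
    and B: "0 \<le> B" "energy \<Omega> h 1 (\<beta> + 1) u \<le> ennreal B * X"
  defines "R \<equiv> ennsqrt X + L2_norm_grad \<Omega> (\<lambda>x. (h x)\<^sup>2) G"
  shows "AE x in M. integrable M (\<lambda>y. sym_ker \<beta> \<rho> h x y * (u x - u y)) \<and> nl_op \<beta> \<rho> \<Omega> h u x = G x" (is ?a)
    and "AE x in M. u x = nl_J \<beta> \<rho> \<Omega> h u x + G x / nl_P \<beta> \<rho> \<Omega> h x" (is ?b)
    and "L2_norm_grad \<Omega> (\<lambda>_. 1) u \<le> ennreal (sqrt (2 / c\<^sup>2 + 4 / c\<^sup>2 * (CD\<^sup>2 * CS) * B)) * R" (is ?c)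
    and "R < \<infinity> \<Longrightarrow> W12 \<Omega> u"
proof -
  obtain g where g: "is_weak_grad \<Omega> G g" using G by (auto simp: W12_loc_def)
  have gm: "g \<in> borel_measurable M" by (rule weak_grad_measurable[OF open_\<Omega> g])
  obtain b :: 'a where b: "b \<in> Basis" using nonempty_Basis by blast
  have GL: "L1_loc \<Omega> G" using g b by (auto simp: is_weak_grad_def weak_partial_def)
  have um: "u \<in> borel_measurable M" using u by (simp add: L2_on_def)
  have u2: "integrable M (\<lambda>x. (u x)\<^sup>2)"
  proof (rule integrableI_bounded)
    show "(\<integral>\<^sup>+x. ennreal (norm ((u x)\<^sup>2)) \<partial>M) < \<infinity>"
      using u by (auto simp: L2_on_def L2_norm_def ennsqrt_def less_top split: if_splits)
  qed (use um in measurable)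
  \<comment> \<open>\<Omega> has finite measure, so |u| \<le> 1 + u^2 makes the square integrable
    \<open>u\<close> integrable.\<close>
  have iu: "integrable M u"
  proof (rule Bochner_Integration.integrable_bound[OF Bochner_Integration.integrable_add[OF integrable_const[of 1] u2]])
    show "AE x in M. norm (u x) \<le> norm (1 + (u x)\<^sup>2)"
    proof (rule AE_I2)
      fix x
      have "0 \<le> (\<bar>u x\<bar> - 1 / 2)\<^sup>2" by simp
      then have "\<bar>u x\<bar> \<le> 1 + (u x)\<^sup>2" by (simp add: power2_eq_square algebra_simps)
      then show "norm (u x) \<le> norm (1 + (u x)\<^sup>2)" by simp
    qed
  qed (rule um)
  have E: "AE x in M. integrable M (\<lambda>y. ker x y * u y) \<and> integrable M (\<lambda>y. ker x y * (u x - u y)) \<and> (\<integral>y. ker x y * (u x - u y) \<partial>M) = G x"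
    by (rule nonlocal_equation_AE[OF iu GL]) (use eq in blast)
  have P0: "0 < P x" if x: "x \<in> \<Omega>" for x
    using c(2)[rule_format, OF x] mult_pos_pos[OF c(1), of "h x powr (- 2)"] h_pos[OF x] by simp
  have conv: "integrable M (\<lambda>y. sym_ker \<beta> \<rho> h x y * f y) \<longleftrightarrow> integrable M (\<lambda>y. ker x y * f y)"
    "(\<integral>y. sym_ker \<beta> \<rho> h x y * f y \<partial>M) = (\<integral>y. ker x y * f y \<partial>M)" if x: "x \<in> \<Omega>" for x and f :: "'a \<Rightarrow> real"
    by (rule Bochner_Integration.integrable_cong Bochner_Integration.integral_cong; use x in \<open>simp add: sym_ker_eq\<close>)+
  have PP: "nl_P \<beta> \<rho> \<Omega> h x = P x" if x: "x \<in> \<Omega>" for x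
    using conv(2)[OF x, of "\<lambda>_. 1"] by (simp add: nl_P_def P_def)
  show ?a using E AE_space
    by eventually_elim (simp add: conv nl_op_def)
  show ?b using E AE_space
  proof eventually_elim
    case (elim x)
    then have x: "x \<in> \<Omega>" by simp
    have "G x = (\<integral>y. ker x y * u x - ker x y * u y \<partial>M)" using elim by (simp add: right_diff_distrib)
    also have "\<dots> = P x * u x - (\<integral>y. ker x y * u y \<partial>M)"
      using elim integrable_ker[OF x] by (subst Bochner_Integration.integral_diff) (auto simp: P_def)
    finally have "P x * u x = (\<integral>y. ker x y * u y \<partial>M) + G x" by simp
    then have "u x = ((\<integral>y. ker x y * u y \<partial>M) + G x) / P x" using P0[OF x] by (simp add: field_simps)
    then show ?case by (simp add: nl_J_def PP[OF x] conv(2)[OF x] add_divide_distrib)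
  qed
  define gu where "gu x = (1 / P x) *\<^sub>R (g x + T u x)" for x
  have wg: "is_weak_grad \<Omega> u gu" unfolding gu_def by (rule weak_gradient[OF iu P0 E g])
  define Y where "Y = (\<integral>\<^sup>+x. ennreal ((norm ((h x)\<^sup>2 *\<^sub>R g x))\<^sup>2) \<partial>M)"
  have R: "R = ennsqrt X + ennsqrt Y"
    unfolding R_def Y_def L2_norm_grad_eq[OF open_\<Omega> g] L2_norm_def ..
  define k where "k = 4 / c\<^sup>2 * (CD\<^sup>2 * CS) * B"
  have k: "0 \<le> k" using CS_pos B(1) by (simp add: k_def)
  have k0: "0 < 2 / c\<^sup>2 + k" using k c(1) by (intro add_pos_nonneg) auto
  have "(\<integral>\<^sup>+x. ennreal ((norm (gu x))\<^sup>2) \<partial>M) \<le> ennreal (2 / c\<^sup>2) * Y + ennreal (4 / c\<^sup>2 * (CD\<^sup>2 * CS)) * energy \<Omega> h 1 (\<beta> + 1) u"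
    unfolding gu_def Y_def by (rule gradient_bound[OF um c(1) c(2)[rule_format] gm])
  also have "\<dots> \<le> ennreal (2 / c\<^sup>2) * Y + ennreal (4 / c\<^sup>2 * (CD\<^sup>2 * CS)) * (ennreal B * X)"
    by (intro add_left_mono mult_left_mono B(2)) simp
  also have "\<dots> = ennreal (2 / c\<^sup>2) * Y + ennreal k * X"
  proof -
    have "ennreal k = ennreal (4 / c\<^sup>2 * (CD\<^sup>2 * CS)) * ennreal B" unfolding k_def by (rule ennreal_mult'' [OF B(1)])
    then show ?thesis by (simp only: mult.assoc)
  qed
  also have "\<dots> \<le> ennreal (2 / c\<^sup>2 + k) * Y + ennreal (2 / c\<^sup>2 + k) * X"
    using k by (intro add_mono mult_right_mono ennreal_leI) auto
  also have "\<dots> = ennreal (2 / c\<^sup>2 + k) * (X + Y)" by (simp add: distrib_left add.commute)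
  finally have bd: "ennsqrt (\<integral>\<^sup>+x. ennreal ((norm (gu x))\<^sup>2) \<partial>M) \<le> ennreal (sqrt (2 / c\<^sup>2 + k)) * R"
    unfolding R by (rule ennsqrt_mono_sum[OF _ k0])
  then show ?c unfolding L2_norm_grad_eq[OF open_\<Omega> wg] L2_norm_def k_def by simp
  assume "R < \<infinity>"
  then have "ennreal (sqrt (2 / c\<^sup>2 + k)) * R < \<infinity>" by (simp add: ennreal_mult_less_top less_top)
  with bd have "L2_norm \<Omega> gu < \<infinity>" unfolding L2_norm_def by (rule le_less_trans)
  then have "L2_on \<Omega> gu" using weak_grad_measurable[OF open_\<Omega> wg] by (simp add: L2_on_def)
  then show "W12 \<Omega> u" using u wg by (auto simp: W12_def)
qed

theorem theorem7p1:
  fixes \<Omega> :: "'a::euclidean_space set"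
    and lam :: "'a \<Rightarrow> real" and q \<rho> :: "real \<Rightarrow> real" and \<beta> \<kappa>1 :: real
  assumes "lipschitz_domain \<Omega>"
    and "0 \<le> \<beta>" and "\<beta> < real DIM('a) - 1"
    and "admissible_rho TYPE('a) \<beta> \<rho>"
    and "W2inf \<Omega> (\<lambda>x. q (lam x))"
  shows "\<exists>C::real. 0 < C \<and>
    (\<forall>kq cq Cq N kl \<kappa>0 \<delta> u G.
      admissible_q kq cq Cq N q \<longrightarrow>
      generalized_distance \<Omega> kl \<kappa>0 \<kappa>1 lam \<longrightarrow>
      0 < \<delta> \<longrightarrow> \<delta> < delta0 \<kappa>0 \<kappa>1 Cq \<longrightarrow>
      nl_space \<beta> \<delta> q \<Omega> u \<longrightarrow>
      W12_loc \<Omega> G \<longrightarrow>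
      (let h = (\<lambda>x. \<delta> * q (lam x));
           R = nl_seminorm \<beta> \<delta> q \<Omega> u + L2_norm \<Omega> (\<lambda>x. h x * G x)
                 + L2_norm_grad \<Omega> (\<lambda>x. (h x)\<^sup>2) G
       in (\<forall>v. test_fun \<Omega> v \<longrightarrow>
             nl_form \<beta> \<rho> \<Omega> h u v = (\<integral>x. G x * v x \<partial>(lebesgue_on \<Omega>))) \<longrightarrow>
          (AE x in lebesgue_on \<Omega>.
             integrable (lebesgue_on \<Omega>) (\<lambda>y. sym_ker \<beta> \<rho> h x y * (u x - u y)) \<and>
             nl_op \<beta> \<rho> \<Omega> h u x = G x) \<and>
          (AE x in lebesgue_on \<Omega>.
             u x = nl_J \<beta> \<rho> \<Omega> h u x + G x / nl_P \<beta> \<rho> \<Omega> h x) \<and>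
          L2_norm_grad \<Omega> (\<lambda>_. 1) u \<le> ennreal C * R \<and>
          (R < \<infinity> \<longrightarrow> W12 \<Omega> u)))"
proof -
  have \<Omega>: "open \<Omega>" "bounded \<Omega>" using assms(1) by (auto simp: lipschitz_domain_def)
  \<comment> \<open>The range of \<beta> is nonempty only for d \<ge> 2, which is what positivity of
    the sphere area requires.\<close>
  have d2: "2 \<le> DIM('a)" using assms(2,3) by linarith
  define D where "D x = infdist x (frontier \<Omega>)" for x
  have D_lip: "\<bar>D x - D y\<bar> \<le> norm (x - y)" for x y unfolding D_def by (metis infdist_triangle_abs dist_norm)
  show ?thesis
  \<comment> \<open>The constant has to be chosen before the admissibility parameters. If no
    admissible choice exists, any constant will do; otherwise one fixed choice determines a
    comparison constant K, depending only on the domain, on q, \<lambda> and \<kappa>1.\<close>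
  proof (cases "\<exists>kq cq Cq N kl \<kappa>0. admissible_q kq cq Cq N q \<and> generalized_distance \<Omega> kl \<kappa>0 \<kappa>1 lam")
    case False
    then show ?thesis by (intro exI[of _ 1]) auto
  next
    case True
    then obtain kq0 cq0 Cq0 N0 kl0 \<kappa>00 where w: "admissible_q kq0 cq0 Cq0 N0 q" "generalized_distance \<Omega> kl0 \<kappa>00 \<kappa>1 lam" by blast
    define K where "K = Cq0 * \<kappa>00 powr log 2 Cq0"
    note cmp0 = q_lam_comparison[OF w \<Omega>, folded K_def D_def]
    have K1: "1 \<le> K" unfolding K_def by (rule q_lam_constant_ge_1[OF w])
    note qf = admissible_q_facts[OF w(1)]
    have q_lip: "\<bar>q r - q s\<bar> \<le> \<bar>r - s\<bar>" if "0 < r" "0 < s" for r s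
      using qf(3)[of r s] qf(3)[of s r] that by (cases "r \<le> s") auto
    have lip: "\<bar>q (lam x) - q (lam y)\<bar> \<le> \<kappa>1 * norm (x - y)" if "x \<in> \<Omega>" "y \<in> \<Omega>" for x y
    proof -
      have "\<kappa>1-lipschitz_on (closure \<Omega>) lam" using w(2) by (simp add: generalized_distance_def)
      then have "dist (lam x) (lam y) \<le> \<kappa>1 * dist x y"
        by (rule lipschitz_onD) (use that closure_subset[of \<Omega>] in auto)
      then show ?thesis using q_lip[OF cmp0(1)[OF that(1)] cmp0(1)[OF that(2)]] by (simp add: dist_norm)
    qed
    have \<kappa>1: "0 \<le> \<kappa>1" using w(2) by (auto simp: generalized_distance_def lipschitz_on_def)
    have "\<kappa>1-lipschitz_on \<Omega> (\<lambda>x. q (lam x))" using lip \<kappa>1 by (intro lipschitz_onI) (auto simp: dist_norm)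
    \<comment> \<open>Differentiability of the horizon is taken from q(\<lambda>), since the order
      of smoothness of \<lambda> itself may be 0. The Lipschitz bound supplies the continuity that
      fixes the representative.\<close>
    from W2inf_C1[OF \<Omega>(1) assms(5) lipschitz_on_continuous_on[OF this]]
    obtain H where H: "\<And>x. x \<in> \<Omega> \<Longrightarrow> ((\<lambda>x. q (lam x)) has_derivative (\<lambda>v. H x \<bullet> v)) (at x)" "continuous_on \<Omega> H" by blast
    obtain \<rho>' R0 \<epsilon> r0 m where \<rho>: "\<And>r. 0 \<le> \<rho> r" "\<And>r. 1 \<le> r \<Longrightarrow> \<rho> r = 0" "\<And>r. 1 \<le> r \<Longrightarrow> \<rho>' r = 0"
      "\<And>r. (\<rho> has_real_derivative \<rho>' r) (at r)" "continuous_on UNIV \<rho>'" "\<And>r. \<rho> r \<le> R0" "\<And>r. \<bar>\<rho>' r\<bar> \<le> R0"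
      "0 < \<epsilon>" "\<epsilon> \<le> r0" "r0 + \<epsilon> \<le> 1" "0 < m" "\<And>r. \<bar>r - r0\<bar> < \<epsilon> \<Longrightarrow> m \<le> \<rho> r"
      using rho_facts[OF assms(4)] by blast
    have \<gamma>: "0 \<le> \<beta> + 1" "\<beta> + 1 < real DIM('a)" using assms(2,3) by auto
    obtain C0 where C0: "0 < C0" "\<forall>(x::'a) R. 0 < R \<longrightarrow>
      (\<integral>\<^sup>+z. ennreal (norm (x - z) powr (- (\<beta> + 1))) * indicator (ball x R) z \<partial>lborel) \<le> ennreal (C0 * R powr (real DIM('a) - (\<beta> + 1)))"
      using riesz_kernel_nn_integral[OF \<gamma>] by blast
    obtain Cc where Cc: "0 < Cc" "\<forall>(\<Omega>::'a set) h L u s. horizon \<Omega> h L \<longrightarrow> u \<in> borel_measurable (lebesgue_on \<Omega>) \<longrightarrow>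
      1 \<le> s \<longrightarrow> s \<le> K \<longrightarrow> L * s \<le> 1 / 3 \<longrightarrow> energy \<Omega> h s (\<beta> + 1) u \<le> ennreal Cc * energy \<Omega> h 1 0 u"
      using energy_comparison[OF \<gamma>, of K] by blast
    define Cd where "Cd = Cbar (real DIM('a)) * (real DIM('a) + 2 - \<beta>) / sphere_area TYPE('a)"
    have Cd: "0 < Cd" unfolding Cd_def using Cbar_pos[of "real DIM('a)"] sphere_area_pos[OF d2] assms(3) by simp
    define c where "c = m * unit_ball_vol (real DIM('a)) * \<epsilon> ^ DIM('a)"
    have c: "0 < c" unfolding c_def using \<rho>(8,11) by simp
    define B where "B = K powr (real DIM('a) + 2 - (\<beta> + 1)) * (Cc * (1 / Cd))"
    have B: "0 \<le> B" unfolding B_def using Cc(1) Cd by simp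
    define S where "S = C0 * (1 + (4 / 3) powr (real DIM('a) + 1 - \<beta>) * (3 / 2) powr (real DIM('a) - (\<beta> + 1)))"
    have S: "0 < S" unfolding S_def using C0(1) by (intro mult_pos_pos add_pos_nonneg) auto
    define T where "T = real DIM('a) * (4 * (\<beta> + real DIM('a) + 3) * R0)"
    define C where "C = sqrt (2 / c\<^sup>2 + 4 / c\<^sup>2 * (T\<^sup>2 * S) * B)"
    have C: "0 < C" unfolding C_def real_sqrt_gt_0_iff using c S B by (intro add_pos_nonneg) auto
    show ?thesis unfolding Let_def
    proof (intro exI[of _ C] conjI[OF C] allI impI, goal_cases)
      case (1 kq cq Cq N kl \<kappa>0 \<delta> u G)
      note qa = 1(1) and ga = 1(2) and \<delta>0 = 1(3) and \<delta>1 = 1(4) and uS = 1(5) and GW = 1(6)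
      define K' where "K' = Cq * \<kappa>0 powr log 2 Cq"
      note cmp = q_lam_comparison[OF qa ga \<Omega>, folded K'_def D_def]
      have K'1: "1 \<le> K'" unfolding K'_def by (rule q_lam_constant_ge_1[OF qa ga])
      have \<delta>: "\<delta> * \<kappa>1 \<le> 1 / 3" "\<delta> * K' \<le> 1 / 3"
      proof -
        have "\<delta> * max 1 (max \<kappa>1 K') \<le> 1 / 3"
          using \<delta>1 unfolding delta0_def K'_def[symmetric] by (simp add: pos_less_divide_eq mult.commute)
        moreover have "\<delta> * \<kappa>1 \<le> \<delta> * max 1 (max \<kappa>1 K')" "\<delta> * K' \<le> \<delta> * max 1 (max \<kappa>1 K')"
          using \<delta>0 by (auto intro: mult_left_mono)
        ultimately show "\<delta> * \<kappa>1 \<le> 1 / 3" "\<delta> * K' \<le> 1 / 3" by linarith+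
      qed
      define h where "h = (\<lambda>x. \<delta> * q (lam x))"
      define h0 where "h0 = (\<lambda>x. \<delta> * q (D x))"
      have Dp: "0 < D x" "ball x (D x) \<subseteq> \<Omega>" if "x \<in> \<Omega>" for x using infdist_frontier_facts[OF \<Omega> that] by (simp_all add: D_def)
      \<comment> \<open>The bound of \<delta> by \<open>delta0\<close> gives \<delta> K' \<le> 1/3
        for the given parameters; with q(r) \<le> r, three horizons fit into the distance to the
        boundary.\<close>
      have hD: "3 * h x \<le> D x" if x: "x \<in> \<Omega>" for x
      proof -
        have "h x \<le> \<delta> * (K' * q (D x))" unfolding h_def using cmp(2)[OF x] \<delta>0 by (intro mult_left_mono) auto
        also have "\<dots> = (\<delta> * K') * q (D x)" by simp
        also have "\<dots> \<le> 1 / 3 * D x" using qf(1)[OF Dp(1)[OF x]] \<delta>(2) by (intro mult_mono) auto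
        finally show ?thesis by simp
      qed
      have h_sub: "ball x (3 * h x) \<subseteq> \<Omega>" if "x \<in> \<Omega>" for x
        using subset_ball[OF hD[OF that]] Dp(2)[OF that] by blast
      have h_pos: "0 < h x" if "x \<in> \<Omega>" for x unfolding h_def using qf(1)[OF cmp(1)[OF that]] \<delta>0 by simp
      have hz: "horizon \<Omega> h (1 / 3)"
      proof
        fix x y assume xy: "x \<in> \<Omega>" "y \<in> \<Omega>"
        have "\<bar>h x - h y\<bar> = \<delta> * \<bar>q (lam x) - q (lam y)\<bar>" unfolding h_def using \<delta>0 by (simp add: abs_mult right_diff_distrib[symmetric])
        also have "\<dots> \<le> \<delta> * (\<kappa>1 * norm (x - y))" using lip[OF xy] \<delta>0 by (intro mult_left_mono) auto
        also have "\<dots> = (\<delta> * \<kappa>1) * norm (x - y)" by simp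
        also have "\<dots> \<le> 1 / 3 * norm (x - y)" by (rule mult_right_mono[OF \<delta>(1)]) simp
        finally show "\<bar>h x - h y\<bar> \<le> 1 / 3 * norm (x - y)" .
      next
        fix x assume x: "x \<in> \<Omega>"
        have "ball x (h x) \<subseteq> ball x (3 * h x)" using h_pos[OF x] by (intro subset_ball) simp
        then show "ball x (h x / (3 * (1 / 3))) \<subseteq> \<Omega>" using h_sub[OF x] by simp
      qed (use \<Omega> h_pos in auto)
      \<comment> \<open>The Lipschitz constant is \<delta> because both \<open>q\<close> and the
        distance are 1-Lipschitz. The radius in \<open>ball_sub\<close> is then q(D x) / 3, below
        the distance to the boundary.\<close>
      have hz0: "horizon \<Omega> h0 \<delta>"
      proof
        fix x y assume xy: "x \<in> \<Omega>" "y \<in> \<Omega>"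
        have "\<bar>h0 x - h0 y\<bar> = \<delta> * \<bar>q (D x) - q (D y)\<bar>" unfolding h0_def using \<delta>0 by (simp add: abs_mult right_diff_distrib[symmetric])
        also have "\<dots> \<le> \<delta> * norm (x - y)"
          using q_lip[OF Dp(1)[OF xy(1)] Dp(1)[OF xy(2)]] D_lip[of x y] \<delta>0 by (intro mult_left_mono) auto
        finally show "\<bar>h0 x - h0 y\<bar> \<le> \<delta> * norm (x - y)" .
      next
        fix x assume x: "x \<in> \<Omega>"
        show "0 < h0 x" unfolding h0_def using qf(1)[OF Dp(1)[OF x]] \<delta>0 by simp
        have "h0 x / (3 * \<delta>) \<le> D x" unfolding h0_def using qf(1)[OF Dp(1)[OF x]] \<delta>0 Dp(1)[OF x] by simp
        then show "ball x (h0 x / (3 * \<delta>)) \<subseteq> \<Omega>" using subset_ball[of _ "D x" x] Dp(2)[OF x] by blast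
      qed (use \<Omega> \<delta>0 in auto)
      have nk: "nonlocal_kernel \<Omega> h \<beta> \<rho> \<rho>' (\<lambda>x. \<delta> *\<^sub>R H x) R0 C0"
      proof (rule nonlocal_kernel.intro[OF hz], rule nonlocal_kernel_axioms.intro)
        show "(h has_derivative (\<lambda>v. \<delta> *\<^sub>R H x \<bullet> v)) (at x)" if "x \<in> \<Omega>" for x
          unfolding h_def using has_derivative_mult_right[OF H(1)[OF that], of \<delta>] by simp
        show "continuous_on \<Omega> (\<lambda>x. \<delta> *\<^sub>R H x)" by (intro continuous_intros H(2))
      qed (use assms(2) \<gamma> \<rho>(1-7) h_sub C0 in auto)
      have uL: "L2_on \<Omega> u" using uS by (simp add: nl_space_def)
      have um: "u \<in> borel_measurable (lebesgue_on \<Omega>)" using uL by (simp add: L2_on_def)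
      define X where "X = (\<integral>\<^sup>+x. (\<integral>\<^sup>+y. ennreal (if norm (y - x) < h0 x
        then Cd * \<bar>u x - u y\<bar>\<^sup>2 / (norm (x - y) powr \<beta> * h0 x powr (real DIM('a) + 2 - \<beta>)) else 0) \<partial>lebesgue_on \<Omega>) \<partial>lebesgue_on \<Omega>)"
      have sX: "nl_seminorm \<beta> \<delta> q \<Omega> u = ennsqrt X"
        by (simp only: nl_seminorm_def Let_def X_def Cd_def h0_def D_def)
      \<comment> \<open>The factor between the horizons is min K K'. The fixed K bounds it
        independently of the given parameters, as the constant must be; the given K' makes it
        admissible, since \<delta> K' \<le> 1/3. Both comparisons hold pointwise, so their minimum
        does too.\<close>
      have "energy \<Omega> h 1 (\<beta> + 1) u \<le> ennreal (K powr (real DIM('a) + 2 - (\<beta> + 1))) * energy \<Omega> h0 (min K K') (\<beta> + 1) u"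
      proof (rule horizon.energy_change_horizon[OF hz0 um _ K1])
        fix x assume x: "x \<in> \<Omega>"
        have "q (lam x) \<le> min K K' * q (D x)" using cmp0(2)[OF x] cmp(2)[OF x] by (auto simp: min_def)
        then have "\<delta> * q (lam x) \<le> \<delta> * (min K K' * q (D x))" "\<delta> * q (D x) \<le> \<delta> * (K * q (lam x))"
          using cmp0(3)[OF x] \<delta>0 by (auto intro: mult_left_mono)
        then show "0 < h x \<and> h0 x \<le> K * h x \<and> h x \<le> min K K' * h0 x"
          using h_pos[OF x] by (simp add: h_def h0_def mult.left_commute)
      qed (use \<gamma> in simp)
      also have "\<dots> \<le> ennreal (K powr (real DIM('a) + 2 - (\<beta> + 1))) * (ennreal Cc * (ennreal (1 / Cd) * X))"
      proof (intro mult_left_mono)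
        have "energy \<Omega> h0 (min K K') (\<beta> + 1) u \<le> ennreal Cc * energy \<Omega> h0 1 0 u"
        proof (rule Cc(2)[rule_format, OF hz0 um])
          have "\<delta> * min K K' \<le> \<delta> * K'" using \<delta>0 by simp
          then show "\<delta> * min K K' \<le> 1 / 3" using \<delta>(2) by linarith
        qed (use K1 K'1 in auto)
        also have "\<dots> \<le> ennreal Cc * (ennreal (1 / Cd) * X)"
          unfolding X_def by (intro mult_left_mono horizon.energy_le_seminorm[OF hz0 um assms(2) Cd]) simp
        finally show "energy \<Omega> h0 (min K K') (\<beta> + 1) u \<le> ennreal Cc * (ennreal (1 / Cd) * X)" .
      qed simp
      also have "\<dots> = ennreal B * X" 
      proof -
        have "ennreal B = ennreal (K powr (real DIM('a) + 2 - (\<beta> + 1))) * (ennreal Cc * ennreal (1 / Cd))"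
          unfolding B_def using Cc(1) Cd by (simp only: ennreal_mult less_imp_le powr_ge_zero mult_nonneg_nonneg zero_le_divide_1_iff)
        then show ?thesis by (simp only: mult.assoc)
      qed
      finally have eB: "energy \<Omega> h 1 (\<beta> + 1) u \<le> ennreal B * X" .
      have "c * h x powr (- 2) \<le> nonlocal_kernel.P \<Omega> h \<beta> \<rho> x" if "x \<in> \<Omega>" for x
        unfolding c_def by (rule nonlocal_kernel.P_ge[OF nk \<rho>(8,9,10) less_imp_le[OF \<rho>(11)] \<rho>(12) that])
      then have Pc: "\<forall>x\<in>\<Omega>. c * h x powr (- 2) \<le> nonlocal_kernel.P \<Omega> h \<beta> \<rho> x" by blast
      note reg = nonlocal_kernel.regularity[OF nk uL GW 1(7)[folded h_def] c Pc B eB,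
          unfolded nonlocal_kernel.CD_def[OF nk] nonlocal_kernel.CS_def[OF nk], folded S_def T_def, folded C_def sX]
      have le: "nl_seminorm \<beta> \<delta> q \<Omega> u + L2_norm_grad \<Omega> (\<lambda>x. (h x)\<^sup>2) G
        \<le> nl_seminorm \<beta> \<delta> q \<Omega> u + L2_norm \<Omega> (\<lambda>x. h x * G x) + L2_norm_grad \<Omega> (\<lambda>x. (h x)\<^sup>2) G"
        by (intro add_right_mono) (simp add: add_increasing2)
      have "L2_norm_grad \<Omega> (\<lambda>_. 1) u \<le> ennreal C *
          (nl_seminorm \<beta> \<delta> q \<Omega> u + L2_norm \<Omega> (\<lambda>x. h x * G x) + L2_norm_grad \<Omega> (\<lambda>x. (h x)\<^sup>2) G)"
        by (rule order_trans[OF reg(3) mult_left_mono[OF le]]) simp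
      then show ?case
        unfolding fun_cong[OF h_def, symmetric]
        by (intro conjI impI reg(1,2) reg(4)[OF le_less_trans[OF le]])
    qed
  qed
qed

end
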